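(* Let $K$ be a field, let $\mathcal{P}=(G,X)$ be a group pair with $\mathrm{cd}_K(G,X)\le 2$ and let $KG\hookrightarrow\mathcal{D}$ be an embedding into an Artinian ring. Suppose that $\mathcal{D}\otimes_K\omega_K(X)^{op}$ is flat as a right $KG$-module. Assume that $KG_x$ is coherent for all $x\in X$. Then $KG$ is coherent.
   Context: A group pair $(G,X)$ is a group $G$ together with a non-empty left $G$-set $X$; $G_x$ is the stabiliser of $x$. The augmentation module $\omega_K(X)$ is the kernel of the $KG$-homomorphism $K[X]\to K$ sending every $x\in X$ to $1$, and $\mathrm{cd}_K(G,X)=\mathrm{pd}_{KG}(\omega_K(X))+1$ (projective dimension plus one). For a left $KG$-module $M$, $M^{op}$ is the right $KG$-module with the same underlying set and action $m\cdot g:=g^{-1}m$ for $g\in G$. The ring $\mathcal{D}$ is a right $KG$-module via the embedding, and $\mathcal{D}\otimes_K\omega_K(X)^{op}$ is a right $KG$-module via the diagonal action $(d\otimes m)\cdot g=(dg)\otimes(m\cdot g)$. A ring is coherent if all its finitely generated left ideals are finitely presented. *)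

theory Defs
  imports "HOL-Algebra.Group_Action" "HOL-Algebra.Module" "HOL-Algebra.RingHom"
    "HOL-Algebra.Free_Abelian_Groups" "HOL-Library.Extended_Nat"
begin

section \<open>Modules over rings that need not be commutative\<close>

text \<open>
  The library locale \<open>module\<close> requires a commutative scalar ring.  The record type and the
  locale \<open>submodule\<close> do not, and both are reused.  Fields \<open>mult\<close> and \<open>one\<close> of a module record
  carry no information.
\<close>

locale left_module = R?: ring R + M?: abelian_group M
  for R :: "('a, 'r) ring_scheme" (structure) and M :: "('a, 'b, 'm) module_scheme" (structure) +
  assumes smult_closed:
      "\<lbrakk>a \<in> carrier R; x \<in> carrier M\<rbrakk> \<Longrightarrow> a \<odot>\<^bsub>M\<^esub> x \<in> carrier M"
    and smult_l_distr:
      "\<lbrakk>a \<in> carrier R; b \<in> carrier R; x \<in> carrier M\<rbrakk> \<Longrightarrow>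
       (a \<oplus>\<^bsub>R\<^esub> b) \<odot>\<^bsub>M\<^esub> x = a \<odot>\<^bsub>M\<^esub> x \<oplus>\<^bsub>M\<^esub> b \<odot>\<^bsub>M\<^esub> x"
    and smult_r_distr:
      "\<lbrakk>a \<in> carrier R; x \<in> carrier M; y \<in> carrier M\<rbrakk> \<Longrightarrow>
       a \<odot>\<^bsub>M\<^esub> (x \<oplus>\<^bsub>M\<^esub> y) = a \<odot>\<^bsub>M\<^esub> x \<oplus>\<^bsub>M\<^esub> a \<odot>\<^bsub>M\<^esub> y"
    and smult_assoc:
      "\<lbrakk>a \<in> carrier R; b \<in> carrier R; x \<in> carrier M\<rbrakk> \<Longrightarrow>
       (a \<otimes>\<^bsub>R\<^esub> b) \<odot>\<^bsub>M\<^esub> x = a \<odot>\<^bsub>M\<^esub> (b \<odot>\<^bsub>M\<^esub> x)"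
    and smult_one:
      "x \<in> carrier M \<Longrightarrow> \<one>\<^bsub>R\<^esub> \<odot>\<^bsub>M\<^esub> x = x"

text \<open>
  Right modules use the same record: \<open>a \<odot>\<^bsub>M\<^esub> x\<close> then stands for \<open>x \<cdot> a\<close>, which shows in
  the associativity law.
\<close>

locale right_module = R?: ring R + M?: abelian_group M
  for R :: "('a, 'r) ring_scheme" (structure) and M :: "('a, 'b, 'm) module_scheme" (structure) +
  assumes smult_closed:
      "\<lbrakk>a \<in> carrier R; x \<in> carrier M\<rbrakk> \<Longrightarrow> a \<odot>\<^bsub>M\<^esub> x \<in> carrier M"
    and smult_l_distr:
      "\<lbrakk>a \<in> carrier R; b \<in> carrier R; x \<in> carrier M\<rbrakk> \<Longrightarrow>
       (a \<oplus>\<^bsub>R\<^esub> b) \<odot>\<^bsub>M\<^esub> x = a \<odot>\<^bsub>M\<^esub> x \<oplus>\<^bsub>M\<^esub> b \<odot>\<^bsub>M\<^esub> x"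
    and smult_r_distr:
      "\<lbrakk>a \<in> carrier R; x \<in> carrier M; y \<in> carrier M\<rbrakk> \<Longrightarrow>
       a \<odot>\<^bsub>M\<^esub> (x \<oplus>\<^bsub>M\<^esub> y) = a \<odot>\<^bsub>M\<^esub> x \<oplus>\<^bsub>M\<^esub> a \<odot>\<^bsub>M\<^esub> y"
    and smult_assoc:
      "\<lbrakk>a \<in> carrier R; b \<in> carrier R; x \<in> carrier M\<rbrakk> \<Longrightarrow>
       (a \<otimes>\<^bsub>R\<^esub> b) \<odot>\<^bsub>M\<^esub> x = b \<odot>\<^bsub>M\<^esub> (a \<odot>\<^bsub>M\<^esub> x)"
    and smult_one:
      "x \<in> carrier M \<Longrightarrow> \<one>\<^bsub>R\<^esub> \<odot>\<^bsub>M\<^esub> x = x"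

definition lmod_hom ::
  "('a, 'r) ring_scheme \<Rightarrow> ('a, 'b, 'm) module_scheme \<Rightarrow> ('a, 'c, 'n) module_scheme \<Rightarrow> ('b \<Rightarrow> 'c) set"
  where "lmod_hom R M N = {f \<in> carrier M \<rightarrow> carrier N.
     (\<forall>x\<in>carrier M. \<forall>y\<in>carrier M. f (x \<oplus>\<^bsub>M\<^esub> y) = f x \<oplus>\<^bsub>N\<^esub> f y) \<and>
     (\<forall>a\<in>carrier R. \<forall>x\<in>carrier M. f (a \<odot>\<^bsub>M\<^esub> x) = a \<odot>\<^bsub>N\<^esub> f x)}"

definition left_regular :: "('a, 'r) ring_scheme \<Rightarrow> ('a, 'a) module"
  where "left_regular R = \<lparr>carrier = carrier R, monoid.mult = monoid.mult R, monoid.one = \<one>\<^bsub>R\<^esub>,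
     ring.zero = \<zero>\<^bsub>R\<^esub>, ring.add = ring.add R, smult = (\<lambda>a x. a \<otimes>\<^bsub>R\<^esub> x)\<rparr>"

definition right_regular :: "('a, 'r) ring_scheme \<Rightarrow> ('a, 'a) module"
  where "right_regular R = \<lparr>carrier = carrier R, monoid.mult = monoid.mult R, monoid.one = \<one>\<^bsub>R\<^esub>,
     ring.zero = \<zero>\<^bsub>R\<^esub>, ring.add = ring.add R, smult = (\<lambda>a x. x \<otimes>\<^bsub>R\<^esub> a)\<rparr>"

definition restrict_scalars :: "('s \<Rightarrow> 'a) \<Rightarrow> ('a, 'b, 'm) module_scheme \<Rightarrow> ('s, 'b) module"
  where "restrict_scalars h M = \<lparr>carrier = carrier M, monoid.mult = monoid.mult M, monoid.one = \<one>\<^bsub>M\<^esub>,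
     ring.zero = \<zero>\<^bsub>M\<^esub>, ring.add = ring.add M, smult = (\<lambda>s x. h s \<odot>\<^bsub>M\<^esub> x)\<rparr>"

definition free_module :: "('a, 'r) ring_scheme \<Rightarrow> 'i set \<Rightarrow> ('a, 'i \<Rightarrow> 'a) module"
  where "free_module R B = \<lparr>
     carrier = {v. (\<forall>i\<in>B. v i \<in> carrier R) \<and> (\<forall>i. i \<notin> B \<longrightarrow> v i = \<zero>\<^bsub>R\<^esub>) \<and>
                   finite {i. v i \<noteq> \<zero>\<^bsub>R\<^esub>}},
     monoid.mult = undefined, monoid.one = undefined,
     ring.zero = (\<lambda>i. \<zero>\<^bsub>R\<^esub>), ring.add = (\<lambda>v w i. v i \<oplus>\<^bsub>R\<^esub> w i),
     smult = (\<lambda>a v i. a \<otimes>\<^bsub>R\<^esub> v i)\<rparr>"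


section \<open>Finiteness conditions\<close>

definition finitely_generated :: "('a, 'r) ring_scheme \<Rightarrow> ('a, 'b, 'm) module_scheme \<Rightarrow> bool"
  where "finitely_generated R M \<longleftrightarrow>
     (\<exists>S. finite S \<and> S \<subseteq> carrier M \<and> \<Inter>{H. submodule H R M \<and> S \<subseteq> H} = carrier M)"

definition finitely_presented :: "('a, 'r) ring_scheme \<Rightarrow> ('a, 'b, 'm) module_scheme \<Rightarrow> bool"
  where "finitely_presented R M \<longleftrightarrow>
     (\<exists>n::nat. \<exists>p \<in> lmod_hom R (free_module R {..<n}) M.
        p ` carrier (free_module R {..<n}) = carrier M \<and>
        finitely_generated R ((free_module R {..<n})
          \<lparr>carrier := a_kernel (free_module R {..<n}) M p\<rparr>))"

definition coherent_ring :: "('a, 'r) ring_scheme \<Rightarrow> bool"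
  where "coherent_ring R \<longleftrightarrow> ring R \<and>
     (\<forall>I. submodule I R (left_regular R) \<longrightarrow>
          finitely_generated R ((left_regular R)\<lparr>carrier := I\<rparr>) \<longrightarrow>
          finitely_presented R ((left_regular R)\<lparr>carrier := I\<rparr>))"

text \<open>As for coherence, the one-sided notion meant is the left one.\<close>

locale left_artinian_ring = ring +
  assumes descending_chain_condition:
    "\<And>I :: nat \<Rightarrow> _ set.
      (\<And>n. submodule (I n) R (left_regular R)) \<Longrightarrow> (\<And>n. I (Suc n) \<subseteq> I n) \<Longrightarrow>
      \<exists>n. \<forall>m\<ge>n. I m = I n"


section \<open>Projective dimension\<close>

text \<open>
  A projective module is a direct summand of a free module.  It is then a direct summand of the
  free module on its own underlying set, so bases inside the type of the module suffice.
\<close>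

definition projective_module :: "('a, 'r) ring_scheme \<Rightarrow> ('a, 'b, 'm) module_scheme \<Rightarrow> bool"
  where "projective_module R P \<longleftrightarrow> left_module R P \<and>
     (\<exists>B :: 'b set. \<exists>s \<in> lmod_hom R P (free_module R B). \<exists>p \<in> lmod_hom R (free_module R B) P.
        \<forall>x\<in>carrier P. p (s x) = x)"

text \<open>
  HOL cannot quantify over all modules, only over those on a fixed type.  The type
  \<open>('a + 'b) list\<close> has the cardinality \<open>max (|'a|, |'b|, \<aleph>\<^sub>0)\<close>, so up to isomorphism it carries all
  modules of at most this size.  Below \<open>'a\<close> is the type of the ring and \<open>'b\<close> that of a given module.
\<close>

type_synonym ('a, 'b) ambient = "('a + 'b) list"

text \<open>
  A projective resolution of \<open>M\<close> of length at most \<open>n\<close>, where \<open>d i\<close> maps \<open>P (Suc i)\<close> to \<open>P i\<close>.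
  Restricting to modules on the ambient type loses nothing: if \<open>M\<close> has any projective resolution
  \<open>P\<^sub>n \<rightarrow> \<dots> \<rightarrow> P\<^sub>0\<close>, then building one from free modules on the underlying sets of
  the successive kernels gives, by Schanuel's lemma, a projective \<open>n\<close>-th kernel, and all modules
  involved have cardinality at most \<open>max (|'a|, |'b|, \<aleph>\<^sub>0)\<close>.
\<close>

definition projective_resolution ::
  "('a, 'r) ring_scheme \<Rightarrow> ('a, 'b, 'm) module_scheme \<Rightarrow> nat \<Rightarrow>
   (nat \<Rightarrow> ('a, ('a, 'b) ambient) module) \<Rightarrow>
   (nat \<Rightarrow> ('a, 'b) ambient \<Rightarrow> ('a, 'b) ambient) \<Rightarrow> (('a, 'b) ambient \<Rightarrow> 'b) \<Rightarrow> bool"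
  where "projective_resolution R M n P d \<epsilon> \<longleftrightarrow>
     (\<forall>i. projective_module R (P i)) \<and>
     \<epsilon> \<in> lmod_hom R (P 0) M \<and>
     (\<forall>i. d i \<in> lmod_hom R (P (Suc i)) (P i)) \<and>
     \<epsilon> ` carrier (P 0) = carrier M \<and>
     d 0 ` carrier (P (Suc 0)) = a_kernel (P 0) M \<epsilon> \<and>
     (\<forall>i. d (Suc i) ` carrier (P (Suc (Suc i))) = a_kernel (P (Suc i)) (P i) (d i)) \<and>
     (\<forall>i>n. carrier (P i) = {\<zero>\<^bsub>P i\<^esub>})"

text \<open>The value is \<open>\<infinity>\<close> if there is no finite resolution, and \<open>0\<close> for the zero module.\<close>

definition projective_dimension :: "('a, 'r) ring_scheme \<Rightarrow> ('a, 'b, 'm) module_scheme \<Rightarrow> enat"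
  where "projective_dimension R M =
     Inf {enat n | n. \<exists>P d \<epsilon>. projective_resolution R M n P d \<epsilon>}"


section \<open>Tensor products and flatness\<close>

text \<open>
  The tensor product of a right \<open>R\<close>-module \<open>N\<close> and a left \<open>R\<close>-module \<open>A\<close>: the free abelian group on
  pairs modulo the usual relations.  Recall that \<open>a \<odot>\<^bsub>N\<^esub> x\<close> means \<open>x \<cdot> a\<close>.
\<close>

definition tensor_relations ::
  "('a, 'r) ring_scheme \<Rightarrow> ('a, 'b, 'm) module_scheme \<Rightarrow> ('a, 'c, 'n) module_scheme \<Rightarrow>
   ('b \<times> 'c \<Rightarrow>\<^sub>0 int) set"
  where "tensor_relations R N A =
     {frag_of (x \<oplus>\<^bsub>N\<^esub> y, u) - (frag_of (x, u) + frag_of (y, u)) | x y u.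
        x \<in> carrier N \<and> y \<in> carrier N \<and> u \<in> carrier A} \<union>
     {frag_of (x, u \<oplus>\<^bsub>A\<^esub> v) - (frag_of (x, u) + frag_of (x, v)) | x u v.
        x \<in> carrier N \<and> u \<in> carrier A \<and> v \<in> carrier A} \<union>
     {frag_of (a \<odot>\<^bsub>N\<^esub> x, u) - frag_of (x, a \<odot>\<^bsub>A\<^esub> u) | x a u.
        x \<in> carrier N \<and> a \<in> carrier R \<and> u \<in> carrier A}"

definition tensor_kernel ::
  "('a, 'r) ring_scheme \<Rightarrow> ('a, 'b, 'm) module_scheme \<Rightarrow> ('a, 'c, 'n) module_scheme \<Rightarrow>
   ('b \<times> 'c \<Rightarrow>\<^sub>0 int) set"
  where "tensor_kernel R N A =
     generate (free_Abelian_group (carrier N \<times> carrier A)) (tensor_relations R N A)"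

definition tensor_coset ::
  "('a, 'r) ring_scheme \<Rightarrow> ('a, 'b, 'm) module_scheme \<Rightarrow> ('a, 'c, 'n) module_scheme \<Rightarrow>
   ('b \<times> 'c \<Rightarrow>\<^sub>0 int) \<Rightarrow> ('b \<times> 'c \<Rightarrow>\<^sub>0 int) set"
  where "tensor_coset R N A c =
     tensor_kernel R N A #>\<^bsub>free_Abelian_group (carrier N \<times> carrier A)\<^esub> c"

definition tensor_group ::
  "('a, 'r) ring_scheme \<Rightarrow> ('a, 'b, 'm) module_scheme \<Rightarrow> ('a, 'c, 'n) module_scheme \<Rightarrow>
   ('b \<times> 'c \<Rightarrow>\<^sub>0 int) set monoid"
  where "tensor_group R N A =
     free_Abelian_group (carrier N \<times> carrier A) Mod tensor_kernel R N A"

text \<open>The map \<open>id \<otimes> f : N \<otimes>\<^sub>R A \<rightarrow> N \<otimes>\<^sub>R B\<close>, computed on representatives of cosets.\<close>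

definition tensor_map ::
  "('a, 'r) ring_scheme \<Rightarrow> ('a, 'b, 'm) module_scheme \<Rightarrow> ('a, 'd, 'n) module_scheme \<Rightarrow>
   ('c \<Rightarrow> 'd) \<Rightarrow> ('b \<times> 'c \<Rightarrow>\<^sub>0 int) set \<Rightarrow> ('b \<times> 'd \<Rightarrow>\<^sub>0 int) set"
  where "tensor_map R N B f C =
     the_elem ((\<lambda>c. tensor_coset R N B (frag_extend (\<lambda>(x, u). frag_of (x, f u)) c)) ` C)"

text \<open>
  A right module is flat if tensoring with it preserves injectivity.  Testing on modules over the
  ambient type suffices: this includes, up to isomorphism, the inclusions of left ideals into \<open>R\<close>,
  which already detect flatness.
\<close>

definition flat_right_module :: "('a, 'r) ring_scheme \<Rightarrow> ('a, 'b, 'm) module_scheme \<Rightarrow> bool"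
  where "flat_right_module R N \<longleftrightarrow> right_module R N \<and>
     (\<forall>(A :: ('a, ('a, 'b) ambient) module) (B :: ('a, ('a, 'b) ambient) module) f.
        left_module R A \<longrightarrow> left_module R B \<longrightarrow>
        f \<in> lmod_hom R A B \<longrightarrow> inj_on f (carrier A) \<longrightarrow>
        inj_on (tensor_map R N B f) (carrier (tensor_group R N A)))"


section \<open>Group rings and group pairs\<close>

text \<open>The element \<open>k g\<close> of the group ring.\<close>

definition monomial :: "('k, 'r) ring_scheme \<Rightarrow> 'g \<Rightarrow> 'k \<Rightarrow> 'g \<Rightarrow> 'k"
  where "monomial K g k = (\<lambda>h. if h = g then k else \<zero>\<^bsub>K\<^esub>)"

text \<open>Elements are finitely supported functions; the product is convolution.\<close>

definition group_ring :: "('k, 'r) ring_scheme \<Rightarrow> ('g, 's) monoid_scheme \<Rightarrow> ('g \<Rightarrow> 'k) ring"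
  where "group_ring K G = \<lparr>
     carrier = carrier (free_module K (carrier G)),
     monoid.mult = (\<lambda>a b g. if g \<in> carrier G
        then \<Oplus>\<^bsub>K\<^esub>h\<in>{h \<in> carrier G. a h \<noteq> \<zero>\<^bsub>K\<^esub>}. a h \<otimes>\<^bsub>K\<^esub> b (inv\<^bsub>G\<^esub> h \<otimes>\<^bsub>G\<^esub> g) else \<zero>\<^bsub>K\<^esub>),
     monoid.one = monomial K \<one>\<^bsub>G\<^esub> \<one>\<^bsub>K\<^esub>,
     ring.zero = ring.zero (free_module K (carrier G)), ring.add = ring.add (free_module K (carrier G))\<rparr>"

locale group_pair = group_action G X \<phi> for G (structure) and X and \<phi> +
  assumes nonempty: "X \<noteq> {}"

text \<open>
  The module \<open>K[X]\<close>.  As \<open>(g \<cdot> v) x = v (g\<^sup>-\<^sup>1 \<cdot> x)\<close> for \<open>g \<in> G\<close>, the basis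
  element \<open>x\<close> is sent by \<open>g\<close> to \<open>g \<cdot> x\<close>.
\<close>

definition permutation_module ::
  "('k, 'r) ring_scheme \<Rightarrow> ('g, 's) monoid_scheme \<Rightarrow> 'x set \<Rightarrow> ('g \<Rightarrow> 'x \<Rightarrow> 'x) \<Rightarrow>
   ('g \<Rightarrow> 'k, 'x \<Rightarrow> 'k) module"
  where "permutation_module K G X \<phi> = \<lparr>
     carrier = carrier (free_module K X), monoid.mult = undefined, monoid.one = undefined,
     ring.zero = ring.zero (free_module K X), ring.add = ring.add (free_module K X),
     smult = (\<lambda>a v x. if x \<in> X
        then \<Oplus>\<^bsub>K\<^esub>g\<in>{g \<in> carrier G. a g \<noteq> \<zero>\<^bsub>K\<^esub>}. a g \<otimes>\<^bsub>K\<^esub> v (\<phi> (inv\<^bsub>G\<^esub> g) x) else \<zero>\<^bsub>K\<^esub>)\<rparr>"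

definition augmentation :: "('k, 'r) ring_scheme \<Rightarrow> 'x set \<Rightarrow> ('x \<Rightarrow> 'k) \<Rightarrow> 'k"
  where "augmentation K X v = (\<Oplus>\<^bsub>K\<^esub>x\<in>{x \<in> X. v x \<noteq> \<zero>\<^bsub>K\<^esub>}. v x)"

definition augmentation_module ::
  "('k, 'r) ring_scheme \<Rightarrow> ('g, 's) monoid_scheme \<Rightarrow> 'x set \<Rightarrow> ('g \<Rightarrow> 'x \<Rightarrow> 'x) \<Rightarrow>
   ('g \<Rightarrow> 'k, 'x \<Rightarrow> 'k) module"
  where "augmentation_module K G X \<phi> = (permutation_module K G X \<phi>)
     \<lparr>carrier := a_kernel (permutation_module K G X \<phi>) K (augmentation K X)\<rparr>"

definition cohomological_dimension ::
  "('k, 'r) ring_scheme \<Rightarrow> ('g, 's) monoid_scheme \<Rightarrow> 'x set \<Rightarrow> ('g \<Rightarrow> 'x \<Rightarrow> 'x) \<Rightarrow> enat"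
  where "cohomological_dimension K G X \<phi> =
     projective_dimension (group_ring K G) (augmentation_module K G X \<phi>) + 1"

text \<open>\<open>M\<^sup>o\<^sup>p\<close>: the action \<open>m \<cdot> g = g\<^sup>-\<^sup>1 m\<close> of \<open>G\<close>, extended linearly to the group ring.\<close>

definition opposite_module ::
  "('k, 'r) ring_scheme \<Rightarrow> ('g, 's) monoid_scheme \<Rightarrow> ('g \<Rightarrow> 'k, 'b, 'm) module_scheme \<Rightarrow>
   ('g \<Rightarrow> 'k, 'b) module"
  where "opposite_module K G M =
     restrict_scalars (\<lambda>a g. if g \<in> carrier G then a (inv\<^bsub>G\<^esub> g) else \<zero>\<^bsub>K\<^esub>) M"

definition scalar_restriction ::
  "('k, 'r) ring_scheme \<Rightarrow> ('g, 's) monoid_scheme \<Rightarrow> ('g \<Rightarrow> 'k, 'b, 'm) module_scheme \<Rightarrow>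
   ('k, 'b) module"
  where "scalar_restriction K G M = restrict_scalars (monomial K \<one>\<^bsub>G\<^esub>) M"

text \<open>
  \<open>N \<otimes>\<^sub>K M\<close> for right modules \<open>N\<close>, \<open>M\<close> over the group ring, with the diagonal action
  \<open>(n \<otimes> m) \<cdot> g = n g \<otimes> m g\<close> extended linearly:
  \<open>(n \<otimes> m) \<cdot> (\<Sum> a\<^sub>g g) = \<Sum> n (a\<^sub>g g) \<otimes> m g\<close>.  As \<open>K\<close> is commutative, the
  restriction of \<open>M\<close> to \<open>K\<close> is a left and a right module alike.
\<close>

definition diagonal_tensor ::
  "('k, 'r) ring_scheme \<Rightarrow> ('g, 's) monoid_scheme \<Rightarrow> ('g \<Rightarrow> 'k, 'b, 'm) module_scheme \<Rightarrow>
   ('g \<Rightarrow> 'k, 'c, 'n) module_scheme \<Rightarrow> ('g \<Rightarrow> 'k, ('b \<times> 'c \<Rightarrow>\<^sub>0 int) set) module"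
  where "diagonal_tensor K G N M =
     (let N' = scalar_restriction K G N; M' = scalar_restriction K G M; T = tensor_group K N' M'
      in \<lparr>carrier = carrier T, monoid.mult = undefined, monoid.one = undefined, ring.zero = monoid.one T, ring.add = monoid.mult T,
          smult = (\<lambda>a C. the_elem ((\<lambda>c. tensor_coset K N' M'
             (frag_extend (\<lambda>(n, m). \<Sum>g\<in>{g \<in> carrier G. a g \<noteq> \<zero>\<^bsub>K\<^esub>}.
                 frag_of (monomial K g (a g) \<odot>\<^bsub>N\<^esub> n, monomial K g \<one>\<^bsub>K\<^esub> \<odot>\<^bsub>M\<^esub> m)) c)) ` C))\<rparr>)"

end

theory Submission
  imports Defs
begin

text \<open>
  Let \<open>I\<close> be a left ideal of \<open>KG\<close> with finitely many generators \<open>m\<^sub>i\<close>.  Tensor products are over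
  \<open>K\<close> with the diagonal action of \<open>G\<close>, and \<open>\<omega>\<close> is the augmentation module.  The exact sequence
  \<open>0 \<rightarrow> \<omega> \<otimes> I \<rightarrow> K[X] \<otimes> I \<rightarrow> I \<rightarrow> 0\<close> reduces the presentation of \<open>I\<close> to two questions, one about its
  middle term and one about \<open>\<omega> \<otimes> I\<close>.

  The middle term is a direct sum, over the orbits of \<open>X\<close>, of modules \<open>KG \<otimes>\<^bsub>KG\<^sub>y\<^esub> I\<close> induced from the
  stabiliser algebras.  These algebras are coherent and \<open>I\<close> lies in a free \<open>KG\<^sub>y\<close>-module, so every
  finitely generated submodule of \<open>K[X] \<otimes> I\<close> is finitely presented (\<open>stabiliser_relations\<close>).
  Let \<open>V\<close> be such a submodule that contains the lifts \<open>x\<^sub>0 \<otimes> m\<^sub>i\<close> of the generators, for a fixed point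
  \<open>x\<^sub>0\<close>.  It presents \<open>I\<close> as soon as the relations between the \<open>m\<^sub>i\<close>, evaluated on these lifts, lie in a
  finitely generated submodule of \<open>\<omega> \<otimes> I\<close> that \<open>V\<close> contains (\<open>descend_relations\<close>).

  That they do is where the other hypotheses enter.  As \<open>\<omega>\<close> has projective dimension at most \<open>1\<close>
  and \<open>I\<close> is a submodule of the free module \<open>KG\<close>, the module \<open>\<omega> \<otimes> I\<close> is projective: it is the
  kernel of the map from the projective module \<open>\<omega> \<otimes> KG\<close> onto \<open>\<omega> \<otimes> KG/I\<close>, which has projective
  dimension at most \<open>1\<close>.  So it has a dual basis: coordinates \<open>s\<close> in a free module, and elements \<open>q\<^sub>c\<close>
  (\<open>equivariant_frame\<close>).  Moreover \<open>D \<otimes>\<^bsub>KG\<^esub> (\<omega> \<otimes> I) = (D \<otimes> \<omega>\<^sup>o\<^sup>p) \<otimes>\<^bsub>KG\<^esub> I\<close> embeds, by flatness,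
  into \<open>(D \<otimes> \<omega>\<^sup>o\<^sup>p) \<otimes>\<^bsub>KG\<^esub> KG = D \<otimes> \<omega>\<close> (\<open>flat_pairs\<close>).  Over \<open>D\<close>, which is Noetherian because it
  is Artinian (\<open>free_submodule_fg\<close>), finitely many relations between the \<open>m\<^sub>i\<close> span all of them.
  A coordinate \<open>s\<^sub>c\<close> that vanishes at these finitely many relations vanishes at every \<open>D\<close>-combination
  of them, hence at all relations, as \<open>KG\<close> embeds into \<open>D\<close>.  So only finitely many coordinates
  matter, and all relations are sent into the span of the corresponding \<open>q\<^sub>c\<close>
  (\<open>relations_in_finite_span\<close>).
\<close>

section \<open>Additive maps, modules and spans\<close>

text \<open>Additivity is kept apart from linearity: most maps below are linear only over \<open>K\<close>, or compatible
  with a diagonal action that is not part of a module structure.  Rings and modules are both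
  extensions of the record \<open>ring\<close>, so one notion serves both.\<close>
definition addmap :: "('a, 'm) ring_scheme \<Rightarrow> ('b, 'n) ring_scheme \<Rightarrow> ('a \<Rightarrow> 'b) \<Rightarrow> bool"
  where "addmap A B f \<longleftrightarrow> f \<in> carrier A \<rightarrow> carrier B \<and>
     (\<forall>x\<in>carrier A. \<forall>y\<in>carrier A. f (x \<oplus>\<^bsub>A\<^esub> y) = f x \<oplus>\<^bsub>B\<^esub> f y)"

lemma addmapI:
  assumes "\<And>x. x \<in> carrier A \<Longrightarrow> f x \<in> carrier B"
    and "\<And>x y. x \<in> carrier A \<Longrightarrow> y \<in> carrier A \<Longrightarrow> f (x \<oplus>\<^bsub>A\<^esub> y) = f x \<oplus>\<^bsub>B\<^esub> f y"
  shows "addmap A B f"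
  using assms by (auto simp: addmap_def)

lemma addmap_closed: "addmap A B f \<Longrightarrow> x \<in> carrier A \<Longrightarrow> f x \<in> carrier B"
  by (auto simp: addmap_def)

lemma addmap_add:
  "addmap A B f \<Longrightarrow> x \<in> carrier A \<Longrightarrow> y \<in> carrier A \<Longrightarrow> f (x \<oplus>\<^bsub>A\<^esub> y) = f x \<oplus>\<^bsub>B\<^esub> f y"
  by (auto simp: addmap_def)

lemma addmap_zero:
  assumes "addmap A B f" "abelian_group A" "abelian_group B"
  shows "f \<zero>\<^bsub>A\<^esub> = \<zero>\<^bsub>B\<^esub>"
proof -
  interpret A: abelian_group A by fact
  interpret B: abelian_group B by fact
  have c: "f \<zero>\<^bsub>A\<^esub> \<in> carrier B" using assms(1) by (auto simp: addmap_def)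
  have "f \<zero>\<^bsub>A\<^esub> = f (\<zero>\<^bsub>A\<^esub> \<oplus>\<^bsub>A\<^esub> \<zero>\<^bsub>A\<^esub>)" by simp
  also have "\<dots> = f \<zero>\<^bsub>A\<^esub> \<oplus>\<^bsub>B\<^esub> f \<zero>\<^bsub>A\<^esub>" using assms(1) by (subst addmap_add[OF assms(1)]) auto
  finally show ?thesis using c by (metis B.add.l_cancel_one')
qed

lemma addmap_uminus:
  assumes "addmap A B f" "abelian_group A" "abelian_group B" "x \<in> carrier A"
  shows "f (\<ominus>\<^bsub>A\<^esub> x) = \<ominus>\<^bsub>B\<^esub> f x"
proof -
  interpret A: abelian_group A by fact
  interpret B: abelian_group B by fact
  have "f (\<ominus>\<^bsub>A\<^esub> x) \<oplus>\<^bsub>B\<^esub> f x = \<zero>\<^bsub>B\<^esub>"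
    using assms addmap_add[OF assms(1), of "\<ominus>\<^bsub>A\<^esub> x" x] addmap_zero[OF assms(1-3)]
    by (simp add: A.l_neg)
  then show ?thesis using assms addmap_closed[OF assms(1)] by (metis A.a_inv_closed B.minus_equality)
qed

lemma addmap_minus:
  assumes "addmap A B f" "abelian_group A" "abelian_group B" "x \<in> carrier A" "y \<in> carrier A"
  shows "f (x \<ominus>\<^bsub>A\<^esub> y) = f x \<ominus>\<^bsub>B\<^esub> f y"
  using assms by (simp add: a_minus_def addmap_add addmap_uminus abelian_group.a_inv_closed)

lemma addmap_comp: "addmap A B f \<Longrightarrow> addmap B C g \<Longrightarrow> addmap A C (\<lambda>x. g (f x))"
  by (auto simp: addmap_def Pi_iff)

lemma addmap_plus:
  assumes "addmap A B f" "addmap A B g" "abelian_group B"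
  shows "addmap A B (\<lambda>x. f x \<oplus>\<^bsub>B\<^esub> g x)"
proof -
  interpret B: abelian_group B by fact
  show ?thesis
    using assms(1,2) by (intro addmapI) (auto simp: addmap_closed addmap_add B.add.m_ac)
qed

lemma addmap_diff:
  assumes "addmap A B f" "addmap A B g" "abelian_group B"
  shows "addmap A B (\<lambda>x. f x \<ominus>\<^bsub>B\<^esub> g x)"
proof -
  interpret B: abelian_group B by fact
  show ?thesis
    using assms(1,2)
    by (intro addmapI) (auto simp: addmap_closed addmap_add B.add.m_ac a_minus_def B.minus_add)
qed

lemma addmap_id: "addmap A A (\<lambda>x. x)"
  by (auto simp: addmap_def)

lemma addmap_const_zero: "abelian_group B \<Longrightarrow> addmap A B (\<lambda>_. \<zero>\<^bsub>B\<^esub>)"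
proof -
  assume "abelian_group B"
  then interpret B: abelian_group B .
  show ?thesis by (intro addmapI) auto
qed

context left_module
begin

lemmas M_group = M.abelian_group_axioms
lemmas R_ring = R.ring_axioms
lemmas R_group = R.abelian_group_axioms

lemma addmap_smult: "a \<in> carrier R \<Longrightarrow> addmap M M (\<lambda>x. a \<odot>\<^bsub>M\<^esub> x)"
  by (auto simp: addmap_def smult_closed smult_r_distr)

lemma addmap_scal: "x \<in> carrier M \<Longrightarrow> addmap R M (\<lambda>a. a \<odot>\<^bsub>M\<^esub> x)"
  by (auto simp: addmap_def smult_closed smult_l_distr)

lemma smult_zero_r: "a \<in> carrier R \<Longrightarrow> a \<odot>\<^bsub>M\<^esub> \<zero>\<^bsub>M\<^esub> = \<zero>\<^bsub>M\<^esub>"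
  using addmap_zero[OF addmap_smult M_group M_group] .

lemma smult_zero_l: "x \<in> carrier M \<Longrightarrow> \<zero>\<^bsub>R\<^esub> \<odot>\<^bsub>M\<^esub> x = \<zero>\<^bsub>M\<^esub>"
  using addmap_zero[OF addmap_scal R_group M_group] .

lemma smult_uminus_r: "a \<in> carrier R \<Longrightarrow> x \<in> carrier M \<Longrightarrow> a \<odot>\<^bsub>M\<^esub> (\<ominus>\<^bsub>M\<^esub> x) = \<ominus>\<^bsub>M\<^esub> (a \<odot>\<^bsub>M\<^esub> x)"
  using addmap_uminus[OF addmap_smult M_group M_group] .

lemma smult_uminus_l: "a \<in> carrier R \<Longrightarrow> x \<in> carrier M \<Longrightarrow> (\<ominus>\<^bsub>R\<^esub> a) \<odot>\<^bsub>M\<^esub> x = \<ominus>\<^bsub>M\<^esub> (a \<odot>\<^bsub>M\<^esub> x)"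
  using addmap_uminus[OF addmap_scal R_group M_group] .

end

definition lsub :: "('a, 'r) ring_scheme \<Rightarrow> ('a, 'b, 'm) module_scheme \<Rightarrow> 'b set \<Rightarrow> bool"
  where "lsub R M N \<longleftrightarrow> N \<subseteq> carrier M \<and> \<zero>\<^bsub>M\<^esub> \<in> N \<and>
     (\<forall>x\<in>N. \<forall>y\<in>N. x \<oplus>\<^bsub>M\<^esub> y \<in> N) \<and> (\<forall>a\<in>carrier R. \<forall>x\<in>N. a \<odot>\<^bsub>M\<^esub> x \<in> N)"

lemma lsubI:
  assumes "N \<subseteq> carrier M" "\<zero>\<^bsub>M\<^esub> \<in> N" "\<And>x y. x \<in> N \<Longrightarrow> y \<in> N \<Longrightarrow> x \<oplus>\<^bsub>M\<^esub> y \<in> N"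
    "\<And>a x. a \<in> carrier R \<Longrightarrow> x \<in> N \<Longrightarrow> a \<odot>\<^bsub>M\<^esub> x \<in> N"
  shows "lsub R M N"
  using assms by (auto simp: lsub_def)

lemma lsubD:
  assumes "lsub R M N"
  shows "N \<subseteq> carrier M" "\<zero>\<^bsub>M\<^esub> \<in> N" "\<And>x y. x \<in> N \<Longrightarrow> y \<in> N \<Longrightarrow> x \<oplus>\<^bsub>M\<^esub> y \<in> N"
    "\<And>a x. a \<in> carrier R \<Longrightarrow> x \<in> N \<Longrightarrow> a \<odot>\<^bsub>M\<^esub> x \<in> N"
  using assms by (auto simp: lsub_def)

text \<open>Linear combinations are built one summand at a time, so that membership comes with an induction
  rule.\<close>
inductive_set lspan :: "('a, 'r) ring_scheme \<Rightarrow> ('a, 'b, 'm) module_scheme \<Rightarrow> 'b set \<Rightarrow> 'b set"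
  for R M S where
    zero: "\<zero>\<^bsub>M\<^esub> \<in> lspan R M S"
  | step: "a \<in> carrier R \<Longrightarrow> s \<in> S \<Longrightarrow> v \<in> lspan R M S \<Longrightarrow> a \<odot>\<^bsub>M\<^esub> s \<oplus>\<^bsub>M\<^esub> v \<in> lspan R M S"

lemma lspan_mono: "S \<subseteq> T \<Longrightarrow> lspan R M S \<subseteq> lspan R M T"
proof
  fix x assume "S \<subseteq> T" "x \<in> lspan R M S"
  from this(2,1) show "x \<in> lspan R M T"
    by (induction rule: lspan.induct) (auto intro: lspan.intros)
qed

lemma lspan_least: "lsub R M N \<Longrightarrow> S \<subseteq> N \<Longrightarrow> lspan R M S \<subseteq> N"
proof
  fix x assume "lsub R M N" "S \<subseteq> N" "x \<in> lspan R M S"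
  from this(3,1,2) show "x \<in> N"
    by (induction rule: lspan.induct) (auto simp: lsub_def)
qed

lemma lspan_restrict: "lspan R (M\<lparr>carrier := N\<rparr>) S = lspan R M S"
proof -
  have "x \<in> lspan R (M\<lparr>carrier := N\<rparr>) S \<Longrightarrow> x \<in> lspan R M S" for x
    by (induction rule: lspan.induct) (auto intro: lspan.intros)
  moreover have "x \<in> lspan R M S \<Longrightarrow> x \<in> lspan R (M\<lparr>carrier := N\<rparr>) S" for x
    by (induction rule: lspan.induct)
      (use lspan.intros[where M = "M\<lparr>carrier := N\<rparr>"] in auto)
  ultimately show ?thesis by blast
qed

context left_module
begin

lemma lsub_carrier: "lsub R M (carrier M)"
  by (auto simp: lsub_def smult_closed)

lemma lsub_uminus: "lsub R M N \<Longrightarrow> x \<in> N \<Longrightarrow> \<ominus>\<^bsub>M\<^esub> x \<in> N"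
proof -
  assume N: "lsub R M N" and x: "x \<in> N"
  have "(\<ominus>\<^bsub>R\<^esub> \<one>\<^bsub>R\<^esub>) \<odot>\<^bsub>M\<^esub> x = \<ominus>\<^bsub>M\<^esub> x"
    using N x by (subst smult_uminus_l) (auto simp: lsub_def smult_one)
  then show ?thesis using N x by (metis R.a_inv_closed R.one_closed lsubD(4)[OF N])
qed

lemma lsub_minus: "lsub R M N \<Longrightarrow> x \<in> N \<Longrightarrow> y \<in> N \<Longrightarrow> x \<ominus>\<^bsub>M\<^esub> y \<in> N"
  by (simp add: a_minus_def lsubD(3) lsub_uminus)

lemma lspan_closed: "S \<subseteq> carrier M \<Longrightarrow> lspan R M S \<subseteq> carrier M"
  by (rule lspan_least[OF lsub_carrier])

lemma lspan_base: "S \<subseteq> carrier M \<Longrightarrow> S \<subseteq> lspan R M S"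
proof
  fix x assume "S \<subseteq> carrier M" "x \<in> S"
  then show "x \<in> lspan R M S"
    using lspan.step[of "\<one>\<^bsub>R\<^esub>" R x S "\<zero>\<^bsub>M\<^esub>" M] by (auto intro: lspan.zero simp: smult_one subsetD)
qed

lemma lspan_add:
  assumes S: "S \<subseteq> carrier M" and x: "x \<in> lspan R M S" and y: "y \<in> lspan R M S"
  shows "x \<oplus>\<^bsub>M\<^esub> y \<in> lspan R M S"
  using x
proof (induction rule: lspan.induct)
  case zero
  then show ?case using lspan_closed[OF S] y by (auto simp: subsetD)
next
  case (step a s v)
  then have "s \<in> carrier M" "v \<in> carrier M" "y \<in> carrier M"
    using S lspan_closed[OF S] y by auto
  then have "a \<odot>\<^bsub>M\<^esub> s \<oplus>\<^bsub>M\<^esub> v \<oplus>\<^bsub>M\<^esub> y = a \<odot>\<^bsub>M\<^esub> s \<oplus>\<^bsub>M\<^esub> (v \<oplus>\<^bsub>M\<^esub> y)"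
    using step by (simp add: M.a_assoc smult_closed)
  then show ?case using step by (auto intro: lspan.step)
qed

lemma lspan_smult:
  assumes S: "S \<subseteq> carrier M" and b: "b \<in> carrier R" and x: "x \<in> lspan R M S"
  shows "b \<odot>\<^bsub>M\<^esub> x \<in> lspan R M S"
  using x
proof (induction rule: lspan.induct)
  case zero
  then show ?case using b by (simp add: smult_zero_r lspan.zero)
next
  case (step a s v)
  then have "s \<in> carrier M" "v \<in> carrier M"
    using S lspan_closed[OF S] by auto
  then have "b \<odot>\<^bsub>M\<^esub> (a \<odot>\<^bsub>M\<^esub> s \<oplus>\<^bsub>M\<^esub> v) = (b \<otimes>\<^bsub>R\<^esub> a) \<odot>\<^bsub>M\<^esub> s \<oplus>\<^bsub>M\<^esub> b \<odot>\<^bsub>M\<^esub> v"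
    using step b by (simp add: smult_closed smult_r_distr smult_assoc)
  moreover have "(b \<otimes>\<^bsub>R\<^esub> a) \<odot>\<^bsub>M\<^esub> s \<oplus>\<^bsub>M\<^esub> b \<odot>\<^bsub>M\<^esub> v \<in> lspan R M S"
    using step b by (intro lspan.step R.m_closed)
  ultimately show ?case by (simp only:)
qed

lemma lsub_lspan: "S \<subseteq> carrier M \<Longrightarrow> lsub R M (lspan R M S)"
  by (intro lsubI lspan_closed lspan.zero lspan_add lspan_smult)

lemma lspan_subset_lspan: "T \<subseteq> carrier M \<Longrightarrow> S \<subseteq> lspan R M T \<Longrightarrow> lspan R M S \<subseteq> lspan R M T"
  by (intro lspan_least lsub_lspan)

lemma lspan_carrier_fixed: "lsub R M N \<Longrightarrow> lspan R M N = N"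
  using lspan_base[of N] lspan_least[of R M N N] lsubD(1)[of R M N] by blast

lemma lspan_insert:
  assumes S: "S \<subseteq> carrier M" and s: "s \<in> carrier M" and x: "x \<in> lspan R M (insert s S)"
  shows "\<exists>a\<in>carrier R. \<exists>v\<in>lspan R M S. x = a \<odot>\<^bsub>M\<^esub> s \<oplus>\<^bsub>M\<^esub> v"
  using x
proof (induction rule: lspan.induct)
  case zero
  have "\<zero>\<^bsub>M\<^esub> = \<zero>\<^bsub>R\<^esub> \<odot>\<^bsub>M\<^esub> s \<oplus>\<^bsub>M\<^esub> \<zero>\<^bsub>M\<^esub>" using s by (simp add: smult_zero_l)
  then show ?case using R.zero_closed lspan.zero by blast
next
  case (step a t v)
  then obtain b w where bw: "b \<in> carrier R" "w \<in> lspan R M S" "v = b \<odot>\<^bsub>M\<^esub> s \<oplus>\<^bsub>M\<^esub> w" by blast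
  have c: "w \<in> carrier M" "t \<in> carrier M" using bw S step s lspan_closed[OF S] by auto
  show ?case
  proof (cases "t = s")
    case True
    have "a \<odot>\<^bsub>M\<^esub> t \<oplus>\<^bsub>M\<^esub> v = (a \<oplus>\<^bsub>R\<^esub> b) \<odot>\<^bsub>M\<^esub> s \<oplus>\<^bsub>M\<^esub> w"
      using True bw c s step by (simp add: smult_l_distr smult_closed M.a_assoc)
    then show ?thesis using bw step by blast
  next
    case False
    have "a \<odot>\<^bsub>M\<^esub> t \<oplus>\<^bsub>M\<^esub> v = b \<odot>\<^bsub>M\<^esub> s \<oplus>\<^bsub>M\<^esub> (a \<odot>\<^bsub>M\<^esub> t \<oplus>\<^bsub>M\<^esub> w)"
      using bw c s step by (simp add: smult_closed M.add.m_lcomm)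
    moreover have "a \<odot>\<^bsub>M\<^esub> t \<oplus>\<^bsub>M\<^esub> w \<in> lspan R M S"
      using step False bw by (auto intro: lspan.step)
    ultimately show ?thesis using bw by blast
  qed
qed

lemma lspan_finite_support:
  assumes x: "x \<in> lspan R M S"
  shows "\<exists>T. finite T \<and> T \<subseteq> S \<and> x \<in> lspan R M T"
  using x
proof (induction rule: lspan.induct)
  case zero
  then show ?case using lspan.zero by (intro exI[of _ "{}"]) auto
next
  case (step a s v)
  then obtain T where T: "finite T" "T \<subseteq> S" "v \<in> lspan R M T" by blast
  have "v \<in> lspan R M (insert s T)" using T lspan_mono[of T "insert s T"] by blast
  then show ?case using T step by (intro exI[of _ "insert s T"]) (auto intro: lspan.step)
qed

lemma lspan_finite_choice:
  assumes S: "S \<subseteq> carrier M" and T: "finite T" "T \<subseteq> lspan R M S"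
  shows "\<exists>S0. finite S0 \<and> S0 \<subseteq> S \<and> T \<subseteq> lspan R M S0"
  using T
proof (induction T)
  case empty
  then show ?case by (intro exI[of _ "{}"]) auto
next
  case (insert t T)
  then obtain S0 where S0: "finite S0" "S0 \<subseteq> S" "T \<subseteq> lspan R M S0" by auto
  obtain S1 where S1: "finite S1" "S1 \<subseteq> S" "t \<in> lspan R M S1"
    using lspan_finite_support[of t S] insert by auto
  show ?case
    using S0 S1 lspan_mono[of S0 "S0 \<union> S1" R M] lspan_mono[of S1 "S0 \<union> S1" R M]
    by (intro exI[of _ "S0 \<union> S1"]) auto
qed

lemma submodule_iff_lsub: "submodule N R M \<longleftrightarrow> lsub R M N"
proof
  assume "submodule N R M"
  then interpret submodule N R M .
  show "lsub R M N" using subset one_closed m_closed smult_closed by (intro lsubI) auto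
next
  assume N: "lsub R M N"
  show "submodule N R M"
    using lsubD[OF N] lsub_uminus[OF N]
    by (intro submodule.intro subgroup.intro submodule_axioms.intro) (auto simp: a_inv_def)
qed

lemma finitely_generated_iff:
  "finitely_generated R M \<longleftrightarrow> (\<exists>S. finite S \<and> S \<subseteq> carrier M \<and> lspan R M S = carrier M)"
proof -
  have "\<Inter>{H. submodule H R M \<and> S \<subseteq> H} = lspan R M S" if "S \<subseteq> carrier M" for S
    unfolding submodule_iff_lsub
    using lspan_least[of R M _ S] lsub_lspan[OF that] lspan_base[OF that] by blast
  then show ?thesis unfolding finitely_generated_def by (auto cong: conj_cong)
qed

lemma left_module_restrict:
  assumes N: "lsub R M N"
  shows "left_module R (M\<lparr>carrier := N\<rparr>)"
proof -
  have sub: "\<And>x. x \<in> N \<Longrightarrow> x \<in> carrier M" using N by (auto simp: lsub_def)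
  have "abelian_group (M\<lparr>carrier := N\<rparr>)"
  proof (rule abelian_groupI)
    fix x assume "x \<in> carrier (M\<lparr>carrier := N\<rparr>)"
    then show "\<exists>y\<in>carrier (M\<lparr>carrier := N\<rparr>). y \<oplus>\<^bsub>M\<lparr>carrier := N\<rparr>\<^esub> x = \<zero>\<^bsub>M\<lparr>carrier := N\<rparr>\<^esub>"
      using lsub_uminus[OF N] sub by (intro bexI[of _ "\<ominus>\<^bsub>M\<^esub> x"]) (auto simp: M.l_neg)
  qed (use lsubD[OF N] sub in \<open>auto simp: M.a_ac\<close>)
  then show ?thesis
    using lsubD[OF N] sub R.ring_axioms
    by (intro left_module.intro left_module_axioms.intro)
      (auto simp: smult_l_distr smult_r_distr smult_assoc smult_one)
qed

lemma finitely_generated_restrict: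
  assumes N: "lsub R M N"
  shows "finitely_generated R (M\<lparr>carrier := N\<rparr>) \<longleftrightarrow> (\<exists>S. finite S \<and> S \<subseteq> N \<and> lspan R M S = N)"
  using left_module.finitely_generated_iff[OF left_module_restrict[OF N]]
  by (simp add: lspan_restrict)

end

lemma lmod_hom_closed: "f \<in> lmod_hom R M N \<Longrightarrow> x \<in> carrier M \<Longrightarrow> f x \<in> carrier N"
  by (auto simp: lmod_hom_def)

lemma lmod_hom_add: "f \<in> lmod_hom R M N \<Longrightarrow> x \<in> carrier M \<Longrightarrow> y \<in> carrier M \<Longrightarrow>
   f (x \<oplus>\<^bsub>M\<^esub> y) = f x \<oplus>\<^bsub>N\<^esub> f y"
  by (auto simp: lmod_hom_def)

lemma lmod_hom_smult: "f \<in> lmod_hom R M N \<Longrightarrow> a \<in> carrier R \<Longrightarrow> x \<in> carrier M \<Longrightarrow>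
   f (a \<odot>\<^bsub>M\<^esub> x) = a \<odot>\<^bsub>N\<^esub> f x"
  by (auto simp: lmod_hom_def)

lemma lmod_hom_addmap: "f \<in> lmod_hom R M N \<Longrightarrow> addmap M N f"
  by (auto simp: lmod_hom_def addmap_def)

lemma lmod_homI: "addmap M N f \<Longrightarrow> (\<And>a x. a \<in> carrier R \<Longrightarrow> x \<in> carrier M \<Longrightarrow> f (a \<odot>\<^bsub>M\<^esub> x) = a \<odot>\<^bsub>N\<^esub> f x)
   \<Longrightarrow> f \<in> lmod_hom R M N"
  by (auto simp: lmod_hom_def addmap_def)

lemma lmod_hom_lspan:
  assumes f: "f \<in> lmod_hom R M N" and M: "left_module R M" and N: "left_module R N"
    and S: "S \<subseteq> carrier M"
  shows "f ` lspan R M S = lspan R N (f ` S)"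
proof -
  interpret M: left_module R M by fact
  interpret N: left_module R N by fact
  have z: "f \<zero>\<^bsub>M\<^esub> = \<zero>\<^bsub>N\<^esub>"
    using addmap_zero[OF lmod_hom_addmap[OF f] M.M_group N.M_group] .
  have sc: "\<And>s. s \<in> S \<Longrightarrow> s \<in> carrier M" using S by auto
  have vc: "\<And>v. v \<in> lspan R M S \<Longrightarrow> v \<in> carrier M" using M.lspan_closed[OF S] by auto
  have "f x \<in> lspan R N (f ` S)" if "x \<in> lspan R M S" for x
    using that
  proof (induction rule: lspan.induct)
    case zero
    then show ?case by (simp add: z lspan.zero)
  next
    case (step a s v)
    then show ?case
      using f sc vc by (simp add: lmod_hom_add lmod_hom_smult M.smult_closed lspan.step)
  qed
  moreover have "x \<in> f ` lspan R M S" if "x \<in> lspan R N (f ` S)" for x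
    using that
  proof (induction rule: lspan.induct)
    case zero
    then show ?case using z lspan.zero by (metis image_eqI)
  next
    case (step a s v)
    then obtain s' v' where "s' \<in> S" "v' \<in> lspan R M S" "s = f s'" "v = f v'" by blast
    then have "a \<odot>\<^bsub>N\<^esub> s \<oplus>\<^bsub>N\<^esub> v = f (a \<odot>\<^bsub>M\<^esub> s' \<oplus>\<^bsub>M\<^esub> v')"
      using f sc vc step by (simp add: lmod_hom_add lmod_hom_smult M.smult_closed)
    then show ?case using \<open>s' \<in> S\<close> \<open>v' \<in> lspan R M S\<close> step by (auto intro: lspan.step)
  qed
  ultimately show ?thesis by blast
qed

lemma lsub_kernel:
  assumes f: "f \<in> lmod_hom R M N" and M: "left_module R M" and N: "left_module R N"
  shows "lsub R M {x \<in> carrier M. f x = \<zero>\<^bsub>N\<^esub>}"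
proof -
  interpret M: left_module R M by fact
  interpret N: left_module R N by fact
  show ?thesis
    using addmap_zero[OF lmod_hom_addmap[OF f] M.M_group N.M_group]
    by (intro lsubI) (auto simp: lmod_hom_add[OF f] lmod_hom_smult[OF f] M.smult_closed N.smult_zero_r)
qed

lemma left_regular_simps [simp]:
  "carrier (left_regular R) = carrier R" "\<zero>\<^bsub>left_regular R\<^esub> = \<zero>\<^bsub>R\<^esub>"
  "x \<oplus>\<^bsub>left_regular R\<^esub> y = x \<oplus>\<^bsub>R\<^esub> y" "a \<odot>\<^bsub>left_regular R\<^esub> x = a \<otimes>\<^bsub>R\<^esub> x"
  by (auto simp: left_regular_def)

lemma abelian_group_cong:
  assumes "abelian_group A" "carrier B = carrier A" "\<zero>\<^bsub>B\<^esub> = \<zero>\<^bsub>A\<^esub>" "\<And>x y. x \<oplus>\<^bsub>B\<^esub> y = x \<oplus>\<^bsub>A\<^esub> y"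
  shows "abelian_group B"
proof -
  interpret A: abelian_group A by fact
  show ?thesis
    by (rule abelian_groupI) (auto simp: assms(2-) A.a_ac intro: A.l_neg A.a_inv_closed)
qed

lemma left_module_left_regular: "ring R \<Longrightarrow> left_module R (left_regular R)"
proof -
  assume R: "ring R"
  then interpret R: ring R .
  have "abelian_group (left_regular R)"
    by (rule abelian_group_cong[OF R.abelian_group_axioms]) auto
  then show ?thesis
    using R by (intro left_module.intro left_module_axioms.intro)
      (auto simp: R.l_distr R.r_distr R.m_assoc)
qed

section \<open>Free modules\<close>

lemma free_module_simps [simp]:
  "\<zero>\<^bsub>free_module R B\<^esub> = (\<lambda>i. \<zero>\<^bsub>R\<^esub>)"
  "v \<oplus>\<^bsub>free_module R B\<^esub> w = (\<lambda>i. v i \<oplus>\<^bsub>R\<^esub> w i)"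
  "a \<odot>\<^bsub>free_module R B\<^esub> v = (\<lambda>i. a \<otimes>\<^bsub>R\<^esub> v i)"
  by (auto simp: free_module_def)

lemma free_module_carrier:
  "v \<in> carrier (free_module R B) \<longleftrightarrow>
     (\<forall>i\<in>B. v i \<in> carrier R) \<and> (\<forall>i. i \<notin> B \<longrightarrow> v i = \<zero>\<^bsub>R\<^esub>) \<and> finite {i. v i \<noteq> \<zero>\<^bsub>R\<^esub>}"
  by (auto simp: free_module_def)

lemma free_module_component: "ring R \<Longrightarrow> v \<in> carrier (free_module R B) \<Longrightarrow> v i \<in> carrier R"
  by (cases "i \<in> B") (auto simp: free_module_carrier ring.ring_simprules)

lemma free_module_outside: "v \<in> carrier (free_module R B) \<Longrightarrow> i \<notin> B \<Longrightarrow> v i = \<zero>\<^bsub>R\<^esub>"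
  by (auto simp: free_module_carrier)

lemma free_module_finite: "v \<in> carrier (free_module R B) \<Longrightarrow> finite {i. v i \<noteq> \<zero>\<^bsub>R\<^esub>}"
  by (auto simp: free_module_carrier)

lemma free_moduleI:
  assumes "\<And>i. i \<in> B \<Longrightarrow> v i \<in> carrier R" "\<And>i. i \<notin> B \<Longrightarrow> v i = \<zero>\<^bsub>R\<^esub>"
    "finite {i. v i \<noteq> \<zero>\<^bsub>R\<^esub>}"
  shows "v \<in> carrier (free_module R B)"
  using assms by (auto simp: free_module_carrier)

lemma monomial_closed: "ring R \<Longrightarrow> i \<in> B \<Longrightarrow> a \<in> carrier R \<Longrightarrow> monomial R i a \<in> carrier (free_module R B)"
  by (rule free_moduleI) (auto simp: monomial_def ring.ring_simprules)

lemma left_module_free: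
  assumes "ring R"
  shows "left_module R (free_module R B)"
proof -
  interpret R: ring R by fact
  have fin: "finite {i. v i \<noteq> \<zero>\<^bsub>R\<^esub>} \<Longrightarrow> finite {i. w i \<noteq> \<zero>\<^bsub>R\<^esub>} \<Longrightarrow> finite {i. v i \<oplus>\<^bsub>R\<^esub> w i \<noteq> \<zero>\<^bsub>R\<^esub>}" for v w
    by (rule finite_subset[of _ "{i. v i \<noteq> \<zero>\<^bsub>R\<^esub>} \<union> {i. w i \<noteq> \<zero>\<^bsub>R\<^esub>}"]) auto
  have fin2: "finite {i. v i \<noteq> \<zero>\<^bsub>R\<^esub>} \<Longrightarrow> a \<in> carrier R \<Longrightarrow> finite {i. a \<otimes>\<^bsub>R\<^esub> v i \<noteq> \<zero>\<^bsub>R\<^esub>}" for v a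
    by (rule finite_subset[of _ "{i. v i \<noteq> \<zero>\<^bsub>R\<^esub>}"]) auto
  note c = free_module_component[OF assms, where B = B]
  have add: "(\<lambda>i. x i \<oplus>\<^bsub>R\<^esub> y i) \<in> carrier (free_module R B)"
    if "x \<in> carrier (free_module R B)" "y \<in> carrier (free_module R B)" for x y
    using that by (auto simp: fin free_module_carrier)
  have "abelian_group (free_module R B)"
  proof (rule abelian_groupI)
    fix x assume x: "x \<in> carrier (free_module R B)"
    have "(\<lambda>i. \<ominus>\<^bsub>R\<^esub> x i) \<in> carrier (free_module R B)"
      using x c[OF x] by (intro free_moduleI finite_subset[OF _ free_module_finite[OF x]])
        (auto simp: free_module_carrier)
    then show "\<exists>y\<in>carrier (free_module R B). y \<oplus>\<^bsub>free_module R B\<^esub> x = \<zero>\<^bsub>free_module R B\<^esub>"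
      using c[OF x] by (intro bexI[of _ "\<lambda>i. \<ominus>\<^bsub>R\<^esub> x i"]) (auto simp: R.l_neg)
    show "\<zero>\<^bsub>free_module R B\<^esub> \<oplus>\<^bsub>free_module R B\<^esub> x = x"
      using c[OF x] by (auto simp: fun_eq_iff)
    fix y assume y: "y \<in> carrier (free_module R B)"
    show "x \<oplus>\<^bsub>free_module R B\<^esub> y \<in> carrier (free_module R B)" using add[OF x y] by simp
    show "x \<oplus>\<^bsub>free_module R B\<^esub> y = y \<oplus>\<^bsub>free_module R B\<^esub> x"
      using c[OF x] c[OF y] by (simp add: fun_eq_iff R.a_comm)
    fix z assume z: "z \<in> carrier (free_module R B)"
    show "x \<oplus>\<^bsub>free_module R B\<^esub> y \<oplus>\<^bsub>free_module R B\<^esub> z = x \<oplus>\<^bsub>free_module R B\<^esub> (y \<oplus>\<^bsub>free_module R B\<^esub> z)"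
      using c[OF x] c[OF y] c[OF z] by (simp add: fun_eq_iff R.a_assoc)
  next
    show "\<zero>\<^bsub>free_module R B\<^esub> \<in> carrier (free_module R B)" by (simp add: free_module_carrier)
  qed
  moreover have "a \<odot>\<^bsub>free_module R B\<^esub> v \<in> carrier (free_module R B)"
    if "a \<in> carrier R" "v \<in> carrier (free_module R B)" for a v
    using that by (auto simp: free_module_carrier fin2)
  ultimately show ?thesis
    using assms c by (intro left_module.intro left_module_axioms.intro)
      (auto simp: R.l_distr R.r_distr R.m_assoc fun_eq_iff)
qed

lemma abelian_group_free: "ring R \<Longrightarrow> abelian_group (free_module R B)"
  using left_module.M_group[OF left_module_free] .

lemma free_module_add_closed:
  assumes "ring R" "v \<in> carrier (free_module R B)" "w \<in> carrier (free_module R B)"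
  shows "v \<oplus>\<^bsub>free_module R B\<^esub> w \<in> carrier (free_module R B)"
proof -
  have "abelian_group (free_module R B)" using assms(1) by (rule abelian_group_free)
  then have "abelian_monoid (free_module R B)" by (rule abelian_group.axioms(1))
  then show ?thesis using assms(2,3) by (rule abelian_monoid.a_closed)
qed

lemma free_module_induct [consumes 2, case_names zero step]:
  assumes K: "ring K" and v: "v \<in> carrier (free_module K Y)"
    and zero: "P (\<lambda>_. \<zero>\<^bsub>K\<^esub>)"
    and step: "\<And>y k v. y \<in> Y \<Longrightarrow> k \<in> carrier K \<Longrightarrow> v \<in> carrier (free_module K Y) \<Longrightarrow> P v \<Longrightarrow>
       P (monomial K y k \<oplus>\<^bsub>free_module K Y\<^esub> v)"
  shows "P v"
proof -
  interpret K: ring K by fact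
  have "finite T \<Longrightarrow> (\<forall>v \<in> carrier (free_module K Y). {i. v i \<noteq> \<zero>\<^bsub>K\<^esub>} \<subseteq> T \<longrightarrow> P v)" for T
  proof (induction T rule: finite_induct)
    case empty
    have "v = (\<lambda>_. \<zero>\<^bsub>K\<^esub>)" if "{i. v i \<noteq> \<zero>\<^bsub>K\<^esub>} \<subseteq> {}" for v using that by auto
    then show ?case using zero by blast
  next
    case (insert y T)
    show ?case
    proof (intro ballI impI)
      fix v assume v: "v \<in> carrier (free_module K Y)" and s: "{i. v i \<noteq> \<zero>\<^bsub>K\<^esub>} \<subseteq> insert y T"
      show "P v"
      proof (cases "y \<in> Y")
        case True
        let ?v = "v(y := \<zero>\<^bsub>K\<^esub>)"
        have v': "?v \<in> carrier (free_module K Y)"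
          using v True by (intro free_moduleI finite_subset[OF _ free_module_finite[OF v]])
            (auto simp: free_module_carrier)
        have "{i. ?v i \<noteq> \<zero>\<^bsub>K\<^esub>} \<subseteq> T" using s by auto
        then have "P ?v" using insert.IH v' by blast
        moreover have "v = monomial K y (v y) \<oplus>\<^bsub>free_module K Y\<^esub> ?v"
          using free_module_component[OF K v] by (auto simp: monomial_def fun_eq_iff)
        ultimately show ?thesis
          using step[OF True free_module_component[OF K v, of y] v'] by simp
      next
        case False
        then have "v y = \<zero>\<^bsub>K\<^esub>" using v by (auto simp: free_module_carrier)
        then have "{i. v i \<noteq> \<zero>\<^bsub>K\<^esub>} \<subseteq> T" using s by auto
        then show ?thesis using insert.IH v by blast
      qed
    qed
  qed
  then show ?thesis using v free_module_finite[OF v] by blast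
qed

text \<open>The tool for nearly all identities below: two additive maps on a free module agree if they agree
  on the \<open>k b\<close> with \<open>b\<close> in the basis, without any linearity.\<close>
lemma addmap_free_eqI:
  assumes K: "ring K" and A: "abelian_group A"
    and f: "addmap (free_module K Y) A f" and g: "addmap (free_module K Y) A g"
    and eq: "\<And>y k. y \<in> Y \<Longrightarrow> k \<in> carrier K \<Longrightarrow> f (monomial K y k) = g (monomial K y k)"
    and v: "v \<in> carrier (free_module K Y)"
  shows "f v = g v"
  using K v
proof (induction rule: free_module_induct)
  case zero
  show ?case using addmap_zero[OF f abelian_group_free[OF K] A] addmap_zero[OF g abelian_group_free[OF K] A]
    by simp
next
  case (step y k v)
  then show ?case using addmap_add[OF f monomial_closed[OF K] step(3)] addmap_add[OF g monomial_closed[OF K] step(3)] eq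
    by metis
qed

lemma addmap_monomial: "ring K \<Longrightarrow> y \<in> Y \<Longrightarrow> addmap K (free_module K Y) (monomial K y)"
proof -
  assume "ring K" "y \<in> Y"
  then interpret K: ring K by simp
  show ?thesis using \<open>y \<in> Y\<close>
    by (intro addmapI) (auto simp: monomial_closed K.ring_axioms, auto simp: monomial_def)
qed

lemma addmap_component: "ring K \<Longrightarrow> addmap (free_module K Y) K (\<lambda>v. v y)"
  by (intro addmapI) (auto simp: free_module_component)

text \<open>The additive extension to a free module of a family of additive maps, one for each coordinate.\<close>
definition fext :: "('v, 'z) ring_scheme \<Rightarrow> ('k, 'r) ring_scheme \<Rightarrow> ('y \<Rightarrow> 'k \<Rightarrow> 'v) \<Rightarrow> ('y \<Rightarrow> 'k) \<Rightarrow> 'v"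
  where "fext A K c v = (\<Oplus>\<^bsub>A\<^esub>y\<in>{y. v y \<noteq> \<zero>\<^bsub>K\<^esub>}. c y (v y))"

lemma fext_superset:
  assumes K: "ring K" and A: "abelian_group A" and c: "\<And>y. y \<in> Y \<Longrightarrow> addmap K A (c y)"
    and v: "v \<in> carrier (free_module K Y)" and S: "finite S" "{y. v y \<noteq> \<zero>\<^bsub>K\<^esub>} \<subseteq> S" "S \<subseteq> Y"
  shows "fext A K c v = (\<Oplus>\<^bsub>A\<^esub>y\<in>S. c y (v y))"
proof -
  interpret K: ring K by fact
  interpret A: abelian_group A by fact
  have "c y (v y) = \<zero>\<^bsub>A\<^esub>" if "y \<in> S - {y. v y \<noteq> \<zero>\<^bsub>K\<^esub>}" for y
    using that S addmap_zero[OF c K.abelian_group_axioms A] by auto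
  moreover have "(\<lambda>y. c y (v y)) \<in> S \<rightarrow> carrier A"
  proof (rule funcsetI)
    fix y assume "y \<in> S"
    then have "y \<in> Y" using S by blast
    then show "c y (v y) \<in> carrier A" by (rule addmap_closed[OF c free_module_component[OF K v]])
  qed
  ultimately show ?thesis
    unfolding fext_def using S by (intro A.add.finprod_mono_neutral_cong_left) auto
qed

lemma addmap_fext:
  assumes K: "ring K" and A: "abelian_group A" and c: "\<And>y. y \<in> Y \<Longrightarrow> addmap K A (c y)"
  shows "addmap (free_module K Y) A (fext A K c)"
proof (rule addmapI)
  interpret K: ring K by fact
  interpret A: abelian_group A by fact
  have sub: "{y. v y \<noteq> \<zero>\<^bsub>K\<^esub>} \<subseteq> Y" if "v \<in> carrier (free_module K Y)" for v
    using that by (auto simp: free_module_carrier)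
  have cl: "c y (v y) \<in> carrier A" if "v \<in> carrier (free_module K Y)" "y \<in> Y" for v y
    using that(2) by (rule addmap_closed[OF c free_module_component[OF K that(1)]])
  show "fext A K c v \<in> carrier A" if v: "v \<in> carrier (free_module K Y)" for v
    unfolding fext_def using sub[OF v] cl[OF v] by (intro A.finsum_closed) auto
  fix v w assume v: "v \<in> carrier (free_module K Y)" and w: "w \<in> carrier (free_module K Y)"
  let ?S = "{y. v y \<noteq> \<zero>\<^bsub>K\<^esub>} \<union> {y. w y \<noteq> \<zero>\<^bsub>K\<^esub>}"
  have S: "finite ?S" "?S \<subseteq> Y"
    using sub v w free_module_finite by blast+
  have vw: "v \<oplus>\<^bsub>free_module K Y\<^esub> w \<in> carrier (free_module K Y)"
    by (rule free_module_add_closed[OF K v w])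
  have "fext A K c (v \<oplus>\<^bsub>free_module K Y\<^esub> w) = (\<Oplus>\<^bsub>A\<^esub>y\<in>?S. c y ((v \<oplus>\<^bsub>free_module K Y\<^esub> w) y))"
    using S by (intro fext_superset[OF K A c vw]) auto
  also have "\<dots> = (\<Oplus>\<^bsub>A\<^esub>y\<in>?S. c y (v y) \<oplus>\<^bsub>A\<^esub> c y (w y))"
  proof (rule A.finsum_cong')
    show "(\<lambda>y. c y (v y) \<oplus>\<^bsub>A\<^esub> c y (w y)) \<in> ?S \<rightarrow> carrier A"
      using S cl[OF v] cl[OF w] by (intro funcsetI A.a_closed) blast+
    fix y assume "y \<in> ?S"
    then have "y \<in> Y" using S by blast
    then show "c y ((v \<oplus>\<^bsub>free_module K Y\<^esub> w) y) = c y (v y) \<oplus>\<^bsub>A\<^esub> c y (w y)"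
      using addmap_add[OF c] free_module_component[OF K v] free_module_component[OF K w] by simp
  qed simp
  also have "\<dots> = (\<Oplus>\<^bsub>A\<^esub>y\<in>?S. c y (v y)) \<oplus>\<^bsub>A\<^esub> (\<Oplus>\<^bsub>A\<^esub>y\<in>?S. c y (w y))"
    using S cl[OF v] cl[OF w] by (intro A.finsum_addf) blast+
  also have "(\<Oplus>\<^bsub>A\<^esub>y\<in>?S. c y (v y)) = fext A K c v"
    using S by (intro fext_superset[OF K A c v, symmetric]) auto
  also have "(\<Oplus>\<^bsub>A\<^esub>y\<in>?S. c y (w y)) = fext A K c w"
    using S by (intro fext_superset[OF K A c w, symmetric]) auto
  finally show "fext A K c (v \<oplus>\<^bsub>free_module K Y\<^esub> w) = fext A K c v \<oplus>\<^bsub>A\<^esub> fext A K c w" .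
qed

lemma fext_monomial:
  assumes K: "ring K" and A: "abelian_group A" and c: "\<And>y. y \<in> Y \<Longrightarrow> addmap K A (c y)"
    and y: "y \<in> Y" "k \<in> carrier K"
  shows "fext A K c (monomial K y k) = c y k"
proof -
  interpret A: abelian_group A by fact
  have "fext A K c (monomial K y k) = (\<Oplus>\<^bsub>A\<^esub>z\<in>{y}. c z (monomial K y k z))"
    using y by (intro fext_superset[OF K A c monomial_closed[OF K]]) (auto simp: monomial_def)
  also have "\<dots> = c y (monomial K y k y)"
    using addmap_closed[OF c[OF y(1)] y(2)] by (subst A.finsum_insert) (auto simp: monomial_def)
  finally show ?thesis by (simp add: monomial_def)
qed

definition lin :: "('a, 'r) ring_scheme \<Rightarrow> ('a, 'b, 'm) module_scheme \<Rightarrow> ('i \<Rightarrow> 'b) \<Rightarrow> ('i \<Rightarrow> 'a) \<Rightarrow> 'b"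
  where "lin R M f = fext M R (\<lambda>i a. a \<odot>\<^bsub>M\<^esub> f i)"

lemma lmod_hom_free_eqI:
  assumes R: "ring R" and M: "left_module R M"
    and f: "f \<in> lmod_hom R (free_module R Y) M" and g: "g \<in> lmod_hom R (free_module R Y) M"
    and eq: "\<And>y. y \<in> Y \<Longrightarrow> f (monomial R y \<one>\<^bsub>R\<^esub>) = g (monomial R y \<one>\<^bsub>R\<^esub>)"
    and v: "v \<in> carrier (free_module R Y)"
  shows "f v = g v"
proof (rule addmap_free_eqI[OF R left_module.M_group[OF M] lmod_hom_addmap[OF f] lmod_hom_addmap[OF g] _ v])
  interpret R: ring R by fact
  fix y k assume y: "y \<in> Y" and k: "k \<in> carrier R"
  have "monomial R y k = k \<odot>\<^bsub>free_module R Y\<^esub> monomial R y \<one>\<^bsub>R\<^esub>"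
    using k by (auto simp: monomial_def)
  then show "f (monomial R y k) = g (monomial R y k)"
    using eq[OF y] lmod_hom_smult[OF f k] lmod_hom_smult[OF g k] monomial_closed[OF R y R.one_closed] by metis
qed

context left_module
begin

lemma lin_addmap:
  assumes "\<And>i. i \<in> I \<Longrightarrow> f i \<in> carrier M"
  shows "addmap (free_module R I) M (lin R M f)"
  unfolding lin_def using assms by (intro addmap_fext R_ring M_group addmap_scal)

lemma lin_monomial_coeff:
  assumes "\<And>i. i \<in> I \<Longrightarrow> f i \<in> carrier M" "i \<in> I" "a \<in> carrier R"
  shows "lin R M f (monomial R i a) = a \<odot>\<^bsub>M\<^esub> f i"
  unfolding lin_def using assms by (intro fext_monomial[where Y = I] R_ring M_group addmap_scal)

lemma lin_hom:
  assumes f: "\<And>i. i \<in> I \<Longrightarrow> f i \<in> carrier M"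
  shows "lin R M f \<in> lmod_hom R (free_module R I) M"
proof (rule lmod_homI[OF lin_addmap[OF f]], assumption)
  interpret F: left_module R "free_module R I" by (rule left_module_free[OF R_ring])
  fix a v assume a: "a \<in> carrier R" and v: "v \<in> carrier (free_module R I)"
  show "lin R M f (a \<odot>\<^bsub>free_module R I\<^esub> v) = a \<odot>\<^bsub>M\<^esub> lin R M f v"
  proof (rule addmap_free_eqI[OF R_ring M_group _ _ _ v])
    show "addmap (free_module R I) M (\<lambda>v. lin R M f (a \<odot>\<^bsub>free_module R I\<^esub> v))"
      by (rule addmap_comp[OF F.addmap_smult[OF a] lin_addmap[OF f]])
    show "addmap (free_module R I) M (\<lambda>v. a \<odot>\<^bsub>M\<^esub> lin R M f v)"
      by (rule addmap_comp[OF lin_addmap[OF f] addmap_smult[OF a]])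
    fix i k assume i: "i \<in> I" and k: "k \<in> carrier R"
    have "a \<odot>\<^bsub>free_module R I\<^esub> monomial R i k = monomial R i (a \<otimes>\<^bsub>R\<^esub> k)"
      using a by (auto simp: monomial_def)
    then show "lin R M f (a \<odot>\<^bsub>free_module R I\<^esub> monomial R i k) = a \<odot>\<^bsub>M\<^esub> lin R M f (monomial R i k)"
      using lin_monomial_coeff[OF f i] a k f[OF i] by (simp add: smult_assoc)
  qed
qed

lemma lin_monomial:
  assumes "\<And>i. i \<in> I \<Longrightarrow> f i \<in> carrier M" "i \<in> I"
  shows "lin R M f (monomial R i \<one>\<^bsub>R\<^esub>) = f i"
  using lin_monomial_coeff[OF assms] assms by (simp add: smult_one)

lemma lin_closed:
  "(\<And>i. i \<in> I \<Longrightarrow> f i \<in> carrier M) \<Longrightarrow> v \<in> carrier (free_module R I) \<Longrightarrow> lin R M f v \<in> carrier M"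
  by (rule lmod_hom_closed[OF lin_hom])

lemma lin_unique:
  assumes p: "p \<in> lmod_hom R (free_module R I) M" and v: "v \<in> carrier (free_module R I)"
  shows "p v = lin R M (\<lambda>i. p (monomial R i \<one>\<^bsub>R\<^esub>)) v"
proof -
  have c: "p (monomial R i \<one>\<^bsub>R\<^esub>) \<in> carrier M" if "i \<in> I" for i
    using lmod_hom_closed[OF p] monomial_closed[OF R_ring that] by blast
  show ?thesis
    by (rule lmod_hom_free_eqI[OF R_ring left_module_axioms p lin_hom _ v])
      (auto simp: c lin_monomial[where I = I])
qed

lemma lin_in_lspan:
  assumes f: "\<And>i. i \<in> I \<Longrightarrow> f i \<in> carrier M" and v: "v \<in> carrier (free_module R I)"
    and T: "T \<subseteq> carrier M" "\<And>i. i \<in> I \<Longrightarrow> v i \<noteq> \<zero>\<^bsub>R\<^esub> \<Longrightarrow> f i \<in> lspan R M T"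
  shows "lin R M f v \<in> lspan R M T"
proof -
  note c = free_module_component[OF R_ring v]
  have "finite S \<Longrightarrow> S \<subseteq> {i. v i \<noteq> \<zero>\<^bsub>R\<^esub>} \<Longrightarrow>
     (\<Oplus>\<^bsub>M\<^esub>i\<in>S. v i \<odot>\<^bsub>M\<^esub> f i) \<in> lspan R M T" for S
  proof (induction S rule: finite_induct)
    case empty
    then show ?case by (simp add: lspan.zero)
  next
    case (insert i S)
    have I: "{i. v i \<noteq> \<zero>\<^bsub>R\<^esub>} \<subseteq> I" using v by (auto simp: free_module_carrier)
    have "(\<Oplus>\<^bsub>M\<^esub>i\<in>insert i S. v i \<odot>\<^bsub>M\<^esub> f i) = v i \<odot>\<^bsub>M\<^esub> f i \<oplus>\<^bsub>M\<^esub> (\<Oplus>\<^bsub>M\<^esub>i\<in>S. v i \<odot>\<^bsub>M\<^esub> f i)"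
      using insert I f c by (intro M.finsum_insert) (auto intro!: smult_closed)
    then show ?case
      using insert I T c by (auto intro!: lspan_add lspan_smult)
  qed
  then show ?thesis
    unfolding lin_def fext_def using free_module_finite[OF v] by blast
qed

lemma lspan_image_eq:
  assumes f: "\<And>i. i \<in> I \<Longrightarrow> f i \<in> carrier M"
  shows "lspan R M (f ` I) = lin R M f ` carrier (free_module R I)"
proof
  interpret F: left_module R "free_module R I" by (rule left_module_free[OF R_ring])
  have sub: "f ` I \<subseteq> carrier M" using f by auto
  show "lin R M f ` carrier (free_module R I) \<subseteq> lspan R M (f ` I)"
  proof
    fix x assume "x \<in> lin R M f ` carrier (free_module R I)"
    then obtain v where v: "v \<in> carrier (free_module R I)" "x = lin R M f v" by (rule imageE) simp
    show "x \<in> lspan R M (f ` I)"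
      unfolding v(2) by (rule lin_in_lspan[OF f v(1) sub]) (use lspan_base[OF sub] in auto)
  qed
  have "x \<in> lin R M f ` carrier (free_module R I)" if "x \<in> lspan R M (f ` I)" for x
    using that
  proof (induction rule: lspan.induct)
    case zero
    show ?case
      using imageI[OF F.M.zero_closed, of "lin R M f"] addmap_zero[OF lin_addmap[OF f] F.M_group M_group]
      by simp
  next
    case (step a s v)
    then obtain i w where i: "i \<in> I" "s = f i" and w: "w \<in> carrier (free_module R I)" "v = lin R M f w"
      by blast
    have "a \<odot>\<^bsub>M\<^esub> s \<oplus>\<^bsub>M\<^esub> v = lin R M f (monomial R i a \<oplus>\<^bsub>free_module R I\<^esub> w)"
      using addmap_add[OF lin_addmap[OF f] monomial_closed[OF R_ring i(1) step(1)] w(1)]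
        lin_monomial_coeff[OF f i(1) step(1)] i w by simp
    then show ?case
      using imageI[OF F.M.a_closed[OF monomial_closed[OF R_ring i(1) step(1)] w(1)], of "lin R M f"] by simp
  qed
  then show "lspan R M (f ` I) \<subseteq> lin R M f ` carrier (free_module R I)" by blast
qed

end

lemma lin_comp:
  assumes M: "left_module R M" and N: "left_module R N" and h: "h \<in> lmod_hom R M N"
    and f: "\<And>i. i \<in> I \<Longrightarrow> f i \<in> carrier M" and v: "v \<in> carrier (free_module R I)"
  shows "h (lin R M f v) = lin R N (\<lambda>i. h (f i)) v"
proof -
  interpret M: left_module R M by fact
  interpret N: left_module R N by fact
  have hf: "\<And>i. i \<in> I \<Longrightarrow> h (f i) \<in> carrier N" using lmod_hom_closed[OF h] f by blast
  show ?thesis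
    unfolding lin_def
  proof (rule addmap_free_eqI[OF M.R_ring N.M_group _ _ _ v])
    show "addmap (free_module R I) N (\<lambda>v. h (fext M R (\<lambda>i a. a \<odot>\<^bsub>M\<^esub> f i) v))"
      using addmap_comp[OF M.lin_addmap[OF f] lmod_hom_addmap[OF h]] unfolding lin_def .
    show "addmap (free_module R I) N (fext N R (\<lambda>i a. a \<odot>\<^bsub>N\<^esub> h (f i)))"
      using N.lin_addmap[OF hf] unfolding lin_def .
    fix i k assume "i \<in> I" "k \<in> carrier R"
    then show "h (fext M R (\<lambda>i a. a \<odot>\<^bsub>M\<^esub> f i) (monomial R i k)) = fext N R (\<lambda>i a. a \<odot>\<^bsub>N\<^esub> h (f i)) (monomial R i k)"
      using M.lin_monomial_coeff[OF f, where I = I] N.lin_monomial_coeff[OF hf, where I = I] f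
      unfolding lin_def by (simp add: lmod_hom_smult[OF h])
  qed
qed

lemma lmod_hom_comp:
  "f \<in> lmod_hom R L M \<Longrightarrow> g \<in> lmod_hom R M N \<Longrightarrow> (\<lambda>x. g (f x)) \<in> lmod_hom R L N"
  by (auto simp: lmod_hom_def Pi_iff)

lemma lmod_hom_diff:
  assumes f: "f \<in> lmod_hom R M N" and g: "g \<in> lmod_hom R M N" and N: "left_module R N"
  shows "(\<lambda>x. f x \<ominus>\<^bsub>N\<^esub> g x) \<in> lmod_hom R M N"
proof -
  interpret N: left_module R N by fact
  show ?thesis
    using lmod_hom_closed[OF f] lmod_hom_closed[OF g]
    by (intro lmod_homI addmap_diff[OF lmod_hom_addmap[OF f] lmod_hom_addmap[OF g] N.M_group])
      (auto simp: lmod_hom_smult[OF f] lmod_hom_smult[OF g] a_minus_def N.smult_r_distr N.smult_uminus_r)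
qed

lemma free_module_eq_lspan:
  assumes "ring R"
  shows "lspan R (free_module R I) ((\<lambda>i. monomial R i \<one>\<^bsub>R\<^esub>) ` I) = carrier (free_module R I)"
proof -
  interpret F: left_module R "free_module R I" by (rule left_module_free[OF assms])
  interpret R: ring R by fact
  have m: "\<And>i. i \<in> I \<Longrightarrow> monomial R i \<one>\<^bsub>R\<^esub> \<in> carrier (free_module R I)"
    by (simp add: monomial_closed assms)
  have "(\<lambda>x. x) \<in> lmod_hom R (free_module R I) (free_module R I)"
    by (auto simp: lmod_hom_def)
  note id = F.lin_unique[OF this]
  have "v \<in> lin R (free_module R I) (\<lambda>i. monomial R i \<one>\<^bsub>R\<^esub>) ` carrier (free_module R I)"
    if "v \<in> carrier (free_module R I)" for v
    using imageI[OF that, of "lin R (free_module R I) (\<lambda>i. monomial R i \<one>\<^bsub>R\<^esub>)"] id[OF that] by simp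
  then have "carrier (free_module R I) \<subseteq> lspan R (free_module R I) ((\<lambda>i. monomial R i \<one>\<^bsub>R\<^esub>) ` I)"
    using F.lspan_image_eq[of I "\<lambda>i. monomial R i \<one>\<^bsub>R\<^esub>", OF m] by blast
  moreover have "(\<lambda>i. monomial R i \<one>\<^bsub>R\<^esub>) ` I \<subseteq> carrier (free_module R I)" using m by blast
  ultimately show ?thesis using F.lspan_closed by blast
qed

section \<open>Left Artinian rings are left Noetherian\<close>

abbreviation left_ideal :: "('a, 'r) ring_scheme \<Rightarrow> 'a set \<Rightarrow> bool"
  where "left_ideal D I \<equiv> lsub D (left_regular D) I"

abbreviation lgen :: "('a, 'r) ring_scheme \<Rightarrow> 'a set \<Rightarrow> 'a set"
  where "lgen D S \<equiv> lspan D (left_regular D) S"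

text \<open>Maximality is expressed through inverses: every \<open>y\<close> outside \<open>m\<close> has a left inverse modulo \<open>m\<close>.\<close>
definition maximal_left_ideal :: "('a, 'r) ring_scheme \<Rightarrow> 'a set \<Rightarrow> bool"
  where "maximal_left_ideal D m \<longleftrightarrow> left_ideal D m \<and> \<one>\<^bsub>D\<^esub> \<notin> m \<and>
     (\<forall>y\<in>carrier D - m. \<exists>u\<in>carrier D. \<one>\<^bsub>D\<^esub> \<ominus>\<^bsub>D\<^esub> u \<otimes>\<^bsub>D\<^esub> y \<in> m)"

definition jacobson :: "('a, 'r) ring_scheme \<Rightarrow> 'a set"
  where "jacobson D = {x \<in> carrier D. \<forall>m. maximal_left_ideal D m \<longrightarrow> x \<in> m}"

context ring
begin

interpretation L: left_module R "left_regular R"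
  by (rule left_module_left_regular) (rule ring_axioms)

lemmas left_idealD = lsubD[where M = "left_regular R" and R = R, simplified]
lemmas left_idealI = lsubI[where M = "left_regular R" and R = R, simplified]

lemma left_regular_uminus: "x \<in> carrier R \<Longrightarrow> \<ominus>\<^bsub>left_regular R\<^esub> x = \<ominus> x"
  using L.M.minus_equality[of "\<ominus> x" x] by (simp add: l_neg)

lemma left_regular_minus: "x \<in> carrier R \<Longrightarrow> y \<in> carrier R \<Longrightarrow> x \<ominus>\<^bsub>left_regular R\<^esub> y = x \<ominus> y"
  by (simp add: a_minus_def left_regular_uminus)

lemma left_ideal_minus: "left_ideal R I \<Longrightarrow> x \<in> I \<Longrightarrow> y \<in> I \<Longrightarrow> x \<ominus> y \<in> I"
  using L.lsub_minus[of I x y] left_regular_minus left_idealD(1)[of I] by (metis subsetD)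

lemma left_ideal_principal: "x \<in> carrier R \<Longrightarrow> I \<subseteq> carrier R \<Longrightarrow> left_ideal R I \<Longrightarrow> left_ideal R ((\<lambda>a. a \<otimes> x) ` I)"
proof (rule left_idealI)
  assume x: "x \<in> carrier R" and I: "I \<subseteq> carrier R" "left_ideal R I"
  note D = left_idealD[OF I(2)]
  show "(\<lambda>a. a \<otimes> x) ` I \<subseteq> carrier R" using x I by auto
  show "\<zero> \<in> (\<lambda>a. a \<otimes> x) ` I" using x D(2) by (metis image_eqI l_null)
  show "\<And>y z. y \<in> (\<lambda>a. a \<otimes> x) ` I \<Longrightarrow> z \<in> (\<lambda>a. a \<otimes> x) ` I \<Longrightarrow> y \<oplus> z \<in> (\<lambda>a. a \<otimes> x) ` I"
    using x D(1,3) by (auto simp: l_distr[symmetric] subset_iff)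
  show "\<And>a y. a \<in> carrier R \<Longrightarrow> y \<in> (\<lambda>a. a \<otimes> x) ` I \<Longrightarrow> a \<otimes> y \<in> (\<lambda>a. a \<otimes> x) ` I"
    using x D(1,4) by (auto simp: m_assoc[symmetric] subset_iff)
qed

lemma left_ideal_sum:
  assumes I: "left_ideal R I" and J: "left_ideal R J"
  shows "left_ideal R {x \<oplus> y | x y. x \<in> I \<and> y \<in> J}"
proof (rule left_idealI)
  note ID = left_idealD[OF I] and JD = left_idealD[OF J]
  have c: "\<And>x. x \<in> I \<Longrightarrow> x \<in> carrier R" "\<And>x. x \<in> J \<Longrightarrow> x \<in> carrier R" using ID(1) JD(1) by auto
  show "{x \<oplus> y | x y. x \<in> I \<and> y \<in> J} \<subseteq> carrier R" using c by auto
  show "\<zero> \<in> {x \<oplus> y | x y. x \<in> I \<and> y \<in> J}" using ID(2) JD(2) by (force intro: exI[of _ \<zero>])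
  fix u v assume "u \<in> {x \<oplus> y | x y. x \<in> I \<and> y \<in> J}"
  then obtain x y where u: "u = x \<oplus> y" "x \<in> I" "y \<in> J" by blast
  { assume "v \<in> {x \<oplus> y | x y. x \<in> I \<and> y \<in> J}"
    then obtain x' y' where v: "v = x' \<oplus> y'" "x' \<in> I" "y' \<in> J" by blast
    have "u \<oplus> v = (x \<oplus> x') \<oplus> (y \<oplus> y')" using u v c by (simp add: a_ac)
    then show "u \<oplus> v \<in> {x \<oplus> y | x y. x \<in> I \<and> y \<in> J}" using u v ID(3) JD(3) by blast }
  { assume "v \<in> carrier R"
    then have "v \<otimes> u = v \<otimes> x \<oplus> v \<otimes> y" using u c by (simp add: r_distr)
    then show "v \<otimes> u \<in> {x \<oplus> y | x y. x \<in> I \<and> y \<in> J}" using u ID(4) JD(4) \<open>v \<in> carrier R\<close> by blast }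
qed

lemma exists_maximal_left_ideal:
  assumes I: "left_ideal R I" and one: "\<one> \<notin> I"
  shows "\<exists>m. maximal_left_ideal R m \<and> I \<subseteq> m"
proof -
  let ?A = "{N. left_ideal R N \<and> I \<subseteq> N \<and> \<one> \<notin> N}"
  have ne: "?A \<noteq> {}" using I one by blast
  have "\<Union>\<C> \<in> ?A" if ch: "\<C> \<noteq> {}" "subset.chain ?A \<C>" for \<C>
  proof -
    have mem: "\<And>N. N \<in> \<C> \<Longrightarrow> left_ideal R N \<and> I \<subseteq> N \<and> \<one> \<notin> N"
      using ch(2) unfolding subset_chain_def by blast
    have "left_ideal R (\<Union>\<C>)"
    proof (rule left_idealI)
      show "\<Union>\<C> \<subseteq> carrier R" using mem left_idealD(1) by blast
      show "\<zero> \<in> \<Union>\<C>" using mem left_idealD(2) ch(1) by blast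
      fix x y assume "x \<in> \<Union>\<C>" "y \<in> \<Union>\<C>"
      then obtain N1 N2 where N12: "N1 \<in> \<C>" "N2 \<in> \<C>" "x \<in> N1" "y \<in> N2" by blast
      then have "N1 \<subseteq> N2 \<or> N2 \<subseteq> N1" using ch(2) unfolding subset_chain_def by blast
      then obtain N where "N \<in> \<C>" "x \<in> N" "y \<in> N" using N12 by blast
      then show "x \<oplus> y \<in> \<Union>\<C>" using mem left_idealD(3) by blast
    next
      fix a x assume "a \<in> carrier R" "x \<in> \<Union>\<C>"
      then show "a \<otimes> x \<in> \<Union>\<C>" using mem left_idealD(4) by blast
    qed
    then show ?thesis using mem ch(1) by blast
  qed
  then have "\<exists>m\<in>?A. \<forall>N\<in>?A. m \<subseteq> N \<longrightarrow> N = m" by (intro subset_Zorn_nonempty[OF ne])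
  then obtain m where m: "m \<in> ?A" and max: "\<forall>N\<in>?A. m \<subseteq> N \<longrightarrow> N = m" by (rule bexE)
  have mI: "left_ideal R m" using m by blast
  note mD = left_idealD[OF mI]
  have "\<exists>u\<in>carrier R. \<one> \<ominus> u \<otimes> y \<in> m" if y: "y \<in> carrier R - m" for y
  proof -
    let ?N = "{u \<oplus> v | u v. u \<in> (\<lambda>a. a \<otimes> y) ` carrier R \<and> v \<in> m}"
    have P: "left_ideal R ((\<lambda>a. a \<otimes> y) ` carrier R)"
      using y L.lsub_carrier by (intro left_ideal_principal) auto
    have N: "left_ideal R ?N" by (rule left_ideal_sum[OF P mI])
    have sub: "m \<subseteq> ?N"
    proof
      fix v assume v: "v \<in> m"
      have "v = \<zero> \<oplus> v" using v mD(1) by (auto simp: subset_iff)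
      then show "v \<in> ?N" using v left_idealD(2)[OF P] by blast
    qed
    have "y = \<one> \<otimes> y \<oplus> \<zero>" using y by simp
    then have "y \<in> ?N" using mD(2) by blast
    then have "?N \<noteq> m" using y by blast
    moreover have "I \<subseteq> ?N" using sub m by (blast intro: subset_trans)
    ultimately have "\<one> \<in> ?N" using max[rule_format, of ?N] N sub by blast
    then obtain u v where uv: "u \<in> carrier R" "v \<in> m" "\<one> = u \<otimes> y \<oplus> v" by blast
    have uv_c: "v \<in> carrier R" "u \<otimes> y \<in> carrier R" using uv(1,2) y mD(1) by auto
    have "\<one> \<ominus> u \<otimes> y = v"
      using uv_c by (simp add: a_minus_def a_assoc[symmetric] uv(3) a_comm[of "u \<otimes> y"] a_assoc r_neg)
    then show ?thesis using uv by blast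
  qed
  then show ?thesis using m by (auto simp: maximal_left_ideal_def)
qed

lemma maximal_left_idealD:
  assumes "maximal_left_ideal R m"
  shows "left_ideal R m" "\<one> \<notin> m"
    "\<And>y. y \<in> carrier R \<Longrightarrow> y \<notin> m \<Longrightarrow> \<exists>u\<in>carrier R. \<one> \<ominus> u \<otimes> y \<in> m"
  using assms by (auto simp: maximal_left_ideal_def)

lemma left_ideal_jacobson: "left_ideal R (jacobson R)"
proof (rule left_idealI)
  note D = left_idealD[OF maximal_left_idealD(1)]
  show "jacobson R \<subseteq> carrier R" by (auto simp: jacobson_def)
  show "\<zero> \<in> jacobson R" using D(2) by (simp add: jacobson_def)
  show "x \<oplus> y \<in> jacobson R" if "x \<in> jacobson R" "y \<in> jacobson R" for x y
    using that D(3) by (simp add: jacobson_def)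
  show "a \<otimes> x \<in> jacobson R" if "a \<in> carrier R" "x \<in> jacobson R" for a x
    using that D(4) by (simp add: jacobson_def)
qed

text \<open>The radical is also a right ideal: if \<open>d\<close> is not in \<open>m\<close>, then the \<open>j\<close> with \<open>j d \<in> m\<close> form
  another maximal left ideal.\<close>
lemma jacobson_right:
  assumes j: "j \<in> jacobson R" and d: "d \<in> carrier R"
  shows "j \<otimes> d \<in> jacobson R"
proof -
  have jc: "j \<in> carrier R" using j by (simp add: jacobson_def)
  have "j \<otimes> d \<in> m" if m: "maximal_left_ideal R m" for m
  proof (cases "d \<in> m")
    case True
    then show ?thesis using left_idealD(4)[OF maximal_left_idealD(1)[OF m] jc] by blast
  next
    case False
    note mD = left_idealD[OF maximal_left_idealD(1)[OF m]]
    let ?m = "{x \<in> carrier R. x \<otimes> d \<in> m}"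
    have "left_ideal R ?m"
      using mD(2-4) d by (intro left_idealI) (auto simp: l_distr m_assoc)
    moreover have "\<one> \<notin> ?m" using False d by simp
    moreover have "\<exists>u\<in>carrier R. \<one> \<ominus> u \<otimes> y \<in> ?m" if y: "y \<in> carrier R - ?m" for y
    proof -
      obtain u where u: "u \<in> carrier R" "\<one> \<ominus> u \<otimes> (y \<otimes> d) \<in> m"
        using maximal_left_idealD(3)[OF m, of "y \<otimes> d"] y d by auto
      have "d \<otimes> (\<one> \<ominus> u \<otimes> (y \<otimes> d)) \<in> m" using mD(4)[OF d u(2)] .
      moreover have "d \<otimes> (\<one> \<ominus> u \<otimes> (y \<otimes> d)) = (\<one> \<ominus> (d \<otimes> u) \<otimes> y) \<otimes> d"
        using d u(1) y by (simp add: a_minus_def l_distr r_distr m_assoc r_minus l_minus)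
      ultimately show ?thesis using d u(1) y by (intro bexI[of _ "d \<otimes> u"]) auto
    qed
    ultimately have "maximal_left_ideal R ?m" by (simp add: maximal_left_ideal_def)
    then show ?thesis using j by (auto simp: jacobson_def)
  qed
  then show ?thesis using jc d by (auto simp: jacobson_def)
qed

text \<open>For \<open>j\<close> in the radical, \<open>1 - j\<close> lies in no maximal left ideal, so it has a left inverse.\<close>
lemma jacobson_fixed_zero:
  assumes j: "j \<in> jacobson R" and a: "a \<in> carrier R" and eq: "j \<otimes> a = a"
  shows "a = \<zero>"
proof -
  have jc: "j \<in> carrier R" using j by (simp add: jacobson_def)
  let ?I = "(\<lambda>b. b \<otimes> (\<one> \<ominus> j)) ` carrier R"
  have I: "left_ideal R ?I" using jc L.lsub_carrier by (intro left_ideal_principal) auto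
  have "\<one> \<in> ?I"
  proof (rule ccontr)
    assume "\<one> \<notin> ?I"
    then obtain m where m: "maximal_left_ideal R m" "?I \<subseteq> m"
      using exists_maximal_left_ideal[OF I] by blast
    have "\<one> \<ominus> j = \<one> \<otimes> (\<one> \<ominus> j)" using jc by simp
    then have "\<one> \<ominus> j \<in> m" using m(2) by blast
    moreover have "j \<in> m" using j m(1) by (simp add: jacobson_def)
    ultimately have "(\<one> \<ominus> j) \<oplus> j \<in> m" using left_idealD(3)[OF maximal_left_idealD(1)[OF m(1)]] by blast
    then have "\<one> \<in> m" using jc by (simp add: a_minus_def a_assoc l_neg)
    then show False using maximal_left_idealD(2)[OF m(1)] by blast
  qed
  then obtain b where b: "b \<in> carrier R" "\<one> = b \<otimes> (\<one> \<ominus> j)" by blast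
  have "a = b \<otimes> (\<one> \<ominus> j) \<otimes> a" using a b(2) by simp
  also have "\<dots> = b \<otimes> (a \<ominus> j \<otimes> a)" using a b(1) jc by (simp add: m_assoc a_minus_def l_distr l_minus)
  also have "\<dots> = \<zero>" using a b(1) by (simp add: eq a_minus_def r_neg)
  finally show ?thesis .
qed

end

context left_artinian_ring
begin

interpretation L: left_module R "left_regular R"
  by (rule left_module_left_regular) (rule ring_axioms)

lemma left_ideal_minimal:
  assumes ne: "I0 \<in> \<S>" and sub: "\<And>I. I \<in> \<S> \<Longrightarrow> left_ideal R I"
  shows "\<exists>I\<in>\<S>. \<forall>I'\<in>\<S>. I' \<subseteq> I \<longrightarrow> I' = I"
proof (rule ccontr)
  assume "\<not> ?thesis"
  then have "\<forall>I\<in>\<S>. \<exists>I'\<in>\<S>. I' \<subset> I" by blast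
  then obtain f where f: "\<And>I. I \<in> \<S> \<Longrightarrow> f I \<in> \<S> \<and> f I \<subset> I" by metis
  define c where "c n = (f ^^ n) I0" for n
  have c: "c n \<in> \<S>" for n by (induction n) (auto simp: c_def ne f)
  have d: "c (Suc n) \<subset> c n" for n using f[OF c[of n]] by (simp add: c_def)
  have "\<exists>n. \<forall>m\<ge>n. c m = c n"
    using d c sub by (intro descending_chain_condition) (auto simp: L.submodule_iff_lsub)
  then obtain n where "c (Suc n) = c n" by (metis le_add2 plus_1_eq_Suc)
  then show False using d[of n] by blast
qed

text \<open>Nakayama's lemma for the radical \<open>J\<close> and \<open>A \<subseteq> F + J A\<close>.  The argument rests on descending chains
  instead of finite generation.  If \<open>A \<not>\<subseteq> F\<close>, a minimal two-sided ideal \<open>I\<close> with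
  \<open>I A \<not>\<subseteq> F\<close> satisfies \<open>I J = I\<close>, as \<open>I A \<subseteq> F + I J A\<close>; a second use of minimality then yields
  a nonzero element that is fixed by an element of \<open>J\<close>.\<close>
lemma left_ideal_nakayama:
  assumes F: "left_ideal R F" and A: "left_ideal R A"
    and AF: "\<And>a. a \<in> A \<Longrightarrow> \<exists>f\<in>F. \<exists>z\<in>lgen R {j \<otimes> a | j a. j \<in> jacobson R \<and> a \<in> A}. a = f \<oplus> z"
  shows "A \<subseteq> F"
proof (rule ccontr)
  assume nAF: "\<not> A \<subseteq> F"
  note FD = left_idealD[OF F] and AD = left_idealD[OF A]
  have Ac: "\<And>a. a \<in> A \<Longrightarrow> a \<in> carrier R" using AD(1) by blast
  have Fc: "\<And>a. a \<in> F \<Longrightarrow> a \<in> carrier R" using FD(1) by blast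
  have Jc: "\<And>j. j \<in> jacobson R \<Longrightarrow> j \<in> carrier R" by (simp add: jacobson_def)
  let ?\<S> = "{I. left_ideal R I \<and> (\<forall>i\<in>I. \<forall>d\<in>carrier R. i \<otimes> d \<in> I) \<and> (\<exists>i\<in>I. \<exists>a\<in>A. i \<otimes> a \<notin> F)}"
  obtain a0 where a0: "a0 \<in> A" "a0 \<notin> F" using nAF by blast
  have "\<one> \<otimes> a0 \<notin> F" using a0 Ac by simp
  then have "\<exists>i\<in>carrier R. \<exists>a\<in>A. i \<otimes> a \<notin> F" using a0(1) one_closed by blast
  then have "carrier R \<in> ?\<S>" using L.lsub_carrier by simp
  then have "\<exists>I\<in>?\<S>. \<forall>I'\<in>?\<S>. I' \<subseteq> I \<longrightarrow> I' = I" by (rule left_ideal_minimal) simp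
  then obtain I where I: "I \<in> ?\<S>" and min: "\<forall>I'\<in>?\<S>. I' \<subseteq> I \<longrightarrow> I' = I" by (rule bexE)
  have Il: "left_ideal R I" using I by blast
  note ID = left_idealD[OF Il]
  have Ic: "\<And>a. a \<in> I \<Longrightarrow> a \<in> carrier R" using ID(1) by blast
  have Ir: "\<And>i d. i \<in> I \<Longrightarrow> d \<in> carrier R \<Longrightarrow> i \<otimes> d \<in> I" using I by blast
  define P where "P = {i \<otimes> j | i j. i \<in> I \<and> j \<in> jacobson R}"
  have Pc: "P \<subseteq> carrier R" using Ic Jc by (auto simp: P_def)
  have Pl: "left_ideal R (lgen R P)" using L.lsub_lspan Pc by simp
  have PI: "lgen R P \<subseteq> I" by (rule lspan_least[OF Il]) (use Ir Jc in \<open>auto simp: P_def\<close>)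
  obtain i a where ia: "i \<in> I" "a \<in> A" "i \<otimes> a \<notin> F" using I by blast
  have ex: "\<exists>p\<in>P. \<exists>a\<in>A. p \<otimes> a \<notin> F"
  proof (rule ccontr)
    assume no: "\<not> ?thesis"
    have "i \<otimes> z \<in> F" if "z \<in> lgen R {j \<otimes> a | j a. j \<in> jacobson R \<and> a \<in> A}" for z
      using that
    proof (induction rule: lspan.induct)
      case zero
      then show ?case using FD(2) ia Ic by simp
    next
      case (step b s v)
      then obtain j a where ja: "s = j \<otimes> a" "j \<in> jacobson R" "a \<in> A" by blast
      have v: "v \<in> carrier R"
        using step(3) L.lspan_closed[of "{j \<otimes> a | j a. j \<in> jacobson R \<and> a \<in> A}"] Jc Ac by auto
      have "i \<otimes> (b \<otimes> s \<oplus> v) = ((i \<otimes> b) \<otimes> j) \<otimes> a \<oplus> i \<otimes> v"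
        using ja Ic[OF ia(1)] Jc Ac step(1) v by (simp add: r_distr m_assoc)
      moreover have "((i \<otimes> b) \<otimes> j) \<otimes> a \<in> F"
        using no ja Ir[OF ia(1) step(1)] unfolding P_def by blast
      ultimately show ?case using step FD(3) by simp
    qed
    moreover obtain f z where "f \<in> F" "z \<in> lgen R {j \<otimes> a | j a. j \<in> jacobson R \<and> a \<in> A}" "a = f \<oplus> z"
      using AF[OF ia(2)] by blast
    moreover have "z \<in> carrier R"
      using calculation(3) L.lspan_closed[of "{j \<otimes> a | j a. j \<in> jacobson R \<and> a \<in> A}"] Jc Ac by auto
    ultimately have "i \<otimes> a \<in> F"
      using FD(3,4) Ic[OF ia(1)] Fc by (simp add: r_distr)
    then show False using ia by blast
  qed
  have "lgen R P \<in> ?\<S>"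
  proof -
    have "x \<otimes> d \<in> lgen R P" if "x \<in> lgen R P" "d \<in> carrier R" for x d
      using that(1)
    proof (induction rule: lspan.induct)
      case zero
      then show ?case using that lspan.zero[of "left_regular R" R P] by simp
    next
      case (step b s v)
      then obtain i j where ij: "s = i \<otimes> j" "i \<in> I" "j \<in> jacobson R" by (auto simp: P_def)
      have v: "v \<in> carrier R" using step(3) L.lspan_closed[of P] Pc by auto
      have "(b \<otimes> s \<oplus> v) \<otimes> d = b \<otimes> (i \<otimes> (j \<otimes> d)) \<oplus> v \<otimes> d"
        using ij Ic Jc step(1) v that(2) by (simp add: l_distr m_assoc)
      moreover have "i \<otimes> (j \<otimes> d) \<in> P" using ij jacobson_right[OF ij(3) that(2)] by (auto simp: P_def)
      ultimately show ?case using step lspan.step[of b R "i \<otimes> (j \<otimes> d)" P "v \<otimes> d" "left_regular R"] by simp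
    qed
    then show ?thesis using Pl ex L.lspan_base[of P] Pc by (simp, blast)
  qed
  then have PI: "lgen R P = I" using min PI by blast
  have In0: "\<exists>i\<in>I. i \<noteq> \<zero>" using ia FD(2) Ac by (intro bexI[of _ i]) auto
  let ?T = "{L. left_ideal R L \<and> (\<exists>i\<in>I. \<exists>l\<in>L. i \<otimes> l \<noteq> \<zero>)}"
  obtain i1 where "i1 \<in> I" "i1 \<noteq> \<zero>" using In0 by blast
  then have "i1 \<otimes> \<one> \<noteq> \<zero>" using Ic by simp
  then have "\<exists>i\<in>I. \<exists>l\<in>carrier R. i \<otimes> l \<noteq> \<zero>" using \<open>i1 \<in> I\<close> one_closed by blast
  then have "carrier R \<in> ?T" using L.lsub_carrier by simp
  then have "\<exists>I\<in>?T. \<forall>I'\<in>?T. I' \<subseteq> I \<longrightarrow> I' = I" by (rule left_ideal_minimal) simp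
  then obtain A' where A': "A' \<in> ?T" and min': "\<forall>I'\<in>?T. I' \<subseteq> A' \<longrightarrow> I' = A'" by (rule bexE)
  obtain i0 l where il: "i0 \<in> I" "l \<in> A'" "i0 \<otimes> l \<noteq> \<zero>" using A' by blast
  have A'l: "left_ideal R A'" using A' by blast
  have lc: "l \<in> carrier R" using left_idealD(1)[OF A'l] il by blast
  let ?Q = "(\<lambda>a. a \<otimes> l) ` jacobson R"
  have "\<exists>i\<in>I. \<exists>q\<in>?Q. i \<otimes> q \<noteq> \<zero>"
  proof (rule ccontr)
    assume no: "\<not> ?thesis"
    have "x \<otimes> l = \<zero>" if "x \<in> lgen R P" for x
      using that
    proof (induction rule: lspan.induct)
      case zero
      then show ?case using lc by simp
    next
      case (step b s v)
      then obtain i j where ij: "s = i \<otimes> j" "i \<in> I" "j \<in> jacobson R" by (auto simp: P_def)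
      have v: "v \<in> carrier R" using step(3) L.lspan_closed[of P] Pc by auto
      have "i \<otimes> (j \<otimes> l) = \<zero>" using no ij by blast
      then show ?case using ij Ic Jc step(1,4) v lc by (simp add: l_distr m_assoc)
    qed
    then show False using il PI by blast
  qed
  moreover have "left_ideal R ?Q"
    by (rule left_ideal_principal[OF lc _ left_ideal_jacobson]) (use Jc in blast)
  ultimately have "?Q \<in> ?T" by simp
  moreover have "?Q \<subseteq> A'" using left_idealD(4)[OF A'l] il Jc by blast
  ultimately have "?Q = A'" using min' by simp
  then have "l \<in> ?Q" using il(2) by simp
  then obtain j where j: "j \<in> jacobson R" "l = j \<otimes> l" by (rule imageE) simp
  have "l = \<zero>" by (rule jacobson_fixed_zero[OF j(1) lc j(2)[symmetric]])
  then show False using il Ic by simp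
qed

text \<open>A minimal finite intersection of maximal left ideals lies in each maximal left ideal.\<close>
lemma jacobson_finite_intersection:
  "\<exists>\<M>. finite \<M> \<and> (\<forall>m\<in>\<M>. maximal_left_ideal R m) \<and> carrier R \<inter> \<Inter>\<M> = jacobson R"
proof -
  let ?\<S> = "{carrier R \<inter> \<Inter>\<M> | \<M>. finite \<M> \<and> (\<forall>m\<in>\<M>. maximal_left_ideal R m)}"
  have l: "left_ideal R I" if "I \<in> ?\<S>" for I
  proof -
    from that obtain \<M> where M: "I = carrier R \<inter> \<Inter>\<M>" "\<forall>m\<in>\<M>. maximal_left_ideal R m" by blast
    note D = left_idealD[OF maximal_left_idealD(1)]
    show ?thesis
      unfolding M(1) by (rule left_idealI) (use M(2) D in auto)
  qed
  have "carrier R \<inter> \<Inter>{} \<in> ?\<S>" by blast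
  then have "\<exists>I\<in>?\<S>. \<forall>I'\<in>?\<S>. I' \<subseteq> I \<longrightarrow> I' = I" using l by (rule left_ideal_minimal)
  then obtain I where I: "I \<in> ?\<S>" and min: "\<forall>I'\<in>?\<S>. I' \<subseteq> I \<longrightarrow> I' = I" by (rule bexE)
  from I obtain \<M> where M: "I = carrier R \<inter> \<Inter>\<M>" "finite \<M>" "\<forall>m\<in>\<M>. maximal_left_ideal R m" by blast
  have "I \<subseteq> m" if m: "maximal_left_ideal R m" for m
  proof -
    have "carrier R \<inter> \<Inter>(insert m \<M>) \<in> ?\<S>" using M m by blast
    moreover have "carrier R \<inter> \<Inter>(insert m \<M>) \<subseteq> I" using M(1) by auto
    ultimately have "carrier R \<inter> \<Inter>(insert m \<M>) = I" using min by blast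
    then show ?thesis by auto
  qed
  then have "I = jacobson R" using M(1,3) by (auto simp: jacobson_def)
  then show ?thesis using M by blast
qed

text \<open>The ring modulo its radical is a finite sum of simple left modules.  In an irredundant
  intersection of maximal left ideals equal to the radical, omitting one of them gives a left ideal
  that is simple modulo the radical, and modulo the radical the unit is a sum of elements of these.\<close>
lemma jacobson_socle:
  "\<exists>\<T>. (\<forall>T\<in>\<T>. left_ideal R T \<and>
        (\<forall>t\<in>T - jacobson R. \<forall>t'\<in>T. \<exists>d\<in>carrier R. t' \<ominus> d \<otimes> t \<in> jacobson R)) \<and>
     \<one> \<in> lgen R (\<Union>\<T> \<union> jacobson R)"
proof -
  let ?P = "\<lambda>\<M>. finite \<M> \<and> (\<forall>m\<in>\<M>. maximal_left_ideal R m) \<and> carrier R \<inter> \<Inter>\<M> = jacobson R"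
  obtain \<M> where P: "?P \<M>" and min: "\<forall>\<N>. ?P \<N> \<longrightarrow> card \<M> \<le> card \<N>"
    using ex_has_least_nat[of ?P _ card] jacobson_finite_intersection by metis
  have fin: "finite \<M>" and max: "\<And>m. m \<in> \<M> \<Longrightarrow> maximal_left_ideal R m"
    and int: "carrier R \<inter> \<Inter>\<M> = jacobson R" using P by auto
  define T where "T m = carrier R \<inter> \<Inter>(\<M> - {m})" for m
  note mD = left_idealD[OF maximal_left_idealD(1)[OF max]]
  have Tl: "left_ideal R (T m)" for m
    unfolding T_def by (rule left_idealI) (use mD in auto)
  note TD = left_idealD[OF Tl]
  have Tm: "T m \<inter> m = jacobson R" if "m \<in> \<M>" for m using int that by (auto simp: T_def)
  have ex: "\<exists>t\<in>T m. \<one> \<ominus> t \<in> m" if m: "m \<in> \<M>" for m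
  proof -
    have "\<not> T m \<subseteq> m"
    proof
      assume "T m \<subseteq> m"
      then have "T m = jacobson R" using Tm[OF m] by auto
      then have "?P (\<M> - {m})" using fin max by (simp add: T_def)
      then have "card \<M> \<le> card (\<M> - {m})" by (rule min[rule_format])
      then show False using card_Diff1_less[OF fin m] by simp
    qed
    then obtain y where y: "y \<in> T m" "y \<notin> m" by blast
    then have yc: "y \<in> carrier R" using TD(1) by blast
    obtain u where u: "u \<in> carrier R" "\<one> \<ominus> u \<otimes> y \<in> m"
      using maximal_left_idealD(3)[OF max[OF m] yc y(2)] by (rule bexE)
    show ?thesis using TD(4)[OF u(1) y(1)] u(2) by (rule bexI[rotated])
  qed
  let ?\<T> = "T ` \<M>"
  let ?U = "\<Union>?\<T> \<union> jacobson R"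
  have Uc: "?U \<subseteq> carrier R" by (auto simp: T_def jacobson_def)
  have Ub: "?U \<subseteq> lgen R ?U" using L.lspan_base[of ?U] Uc by simp
  have Wl: "left_ideal R (lgen R ?U)" using L.lsub_lspan[of ?U] Uc by simp
  note WD = left_idealD[OF Wl]
  have "finite \<N> \<Longrightarrow> \<N> \<subseteq> \<M> \<Longrightarrow>
     \<exists>w\<in>lgen R ?U. (\<forall>m\<in>\<N>. \<one> \<ominus> w \<in> m) \<and> (\<forall>m\<in>\<M> - \<N>. w \<in> m)" for \<N>
  proof (induction \<N> rule: finite_induct)
    case empty
    then show ?case using WD(2) mD(2) by (intro bexI[of _ \<zero>]) auto
  next
    case (insert m \<N>)
    then obtain w where w: "w \<in> lgen R ?U" "\<And>m. m \<in> \<N> \<Longrightarrow> \<one> \<ominus> w \<in> m" "\<And>m. m \<in> \<M> \<Longrightarrow> m \<notin> \<N> \<Longrightarrow> w \<in> m"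
      by auto
    have m: "m \<in> \<M>" using insert by blast
    obtain t where t: "t \<in> T m" "\<one> \<ominus> t \<in> m" using ex[OF m] by blast
    have wc: "w \<in> carrier R" and tc: "t \<in> carrier R" using w(1) WD(1) t(1) TD(1) by auto
    have tm: "t \<in> m'" if "m' \<in> \<M>" "m' \<noteq> m" for m' using that t(1) by (auto simp: T_def)
    have "t \<in> lgen R ?U" using t(1) m Ub by blast
    then have "w \<oplus> t \<in> lgen R ?U" using WD(3) w(1) by blast
    moreover have "\<one> \<ominus> (w \<oplus> t) \<in> m'" if m': "m' \<in> insert m \<N>" for m'
    proof (cases "m' = m")
      case True
      have "\<one> \<ominus> (w \<oplus> t) = (\<one> \<ominus> t) \<ominus> w" using wc tc by (simp add: a_minus_def minus_add a_assoc a_comm[of "\<ominus> w"])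
      then show ?thesis
        using True left_ideal_minus[OF maximal_left_idealD(1)[OF max[OF m]] t(2) w(3)[OF m]] insert by simp
    next
      case False
      then have "m' \<in> \<N>" "m' \<in> \<M>" using m' insert by auto
      have "\<one> \<ominus> (w \<oplus> t) = (\<one> \<ominus> w) \<ominus> t" using wc tc by (simp add: a_minus_def minus_add a_assoc)
      then show ?thesis
        using left_ideal_minus[OF maximal_left_idealD(1)[OF max[OF \<open>m' \<in> \<M>\<close>]] w(2)[OF \<open>m' \<in> \<N>\<close>] tm[OF \<open>m' \<in> \<M>\<close> False]]
        by simp
    qed
    moreover have "w \<oplus> t \<in> m'" if "m' \<in> \<M> - insert m \<N>" for m'
      using that w(3) tm mD(3)[of m'] by auto
    ultimately show ?case by blast
  qed
  from this[OF fin] obtain w where w: "w \<in> lgen R ?U" "\<And>m. m \<in> \<M> \<Longrightarrow> \<one> \<ominus> w \<in> m" by auto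
  have wc: "w \<in> carrier R" using w(1) WD(1) by auto
  have "\<one> \<ominus> w \<in> jacobson R" using w(2) wc int by auto
  then have "\<one> \<ominus> w \<in> lgen R ?U" using Ub by blast
  then have "(\<one> \<ominus> w) \<oplus> w \<in> lgen R ?U" using WD(3) w(1) by blast
  then have one: "\<one> \<in> lgen R ?U" using wc by (simp add: a_minus_def a_assoc l_neg)
  have "\<exists>d\<in>carrier R. t' \<ominus> d \<otimes> t \<in> jacobson R"
    if m: "m \<in> \<M>" and t: "t \<in> T m - jacobson R" "t' \<in> T m" for m t t'
  proof -
    have tc: "t \<in> carrier R" "t' \<in> carrier R" using t TD(1) by auto
    have "t \<notin> m" using t(1) Tm[OF m] by blast
    then obtain u where u: "u \<in> carrier R" "\<one> \<ominus> u \<otimes> t \<in> m"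
      using maximal_left_idealD(3)[OF max[OF m] tc(1)] by blast
    have e: "t' \<otimes> (\<one> \<ominus> u \<otimes> t) = t' \<ominus> (t' \<otimes> u) \<otimes> t"
      using tc u(1) by (simp add: a_minus_def r_distr r_minus m_assoc)
    have "t' \<otimes> (\<one> \<ominus> u \<otimes> t) \<in> m" using mD(4)[OF m tc(2) u(2)] .
    moreover have "(t' \<otimes> u) \<otimes> t \<in> T m" using TD(4)[of "t' \<otimes> u" t m] tc u(1) t(1) by blast
    then have "t' \<ominus> (t' \<otimes> u) \<otimes> t \<in> T m" using left_ideal_minus[OF Tl t(2)] by blast
    ultimately have "t' \<ominus> (t' \<otimes> u) \<otimes> t \<in> jacobson R" using e Tm[OF m] by auto
    then show ?thesis using tc u(1) by blast
  qed
  then show ?thesis using one Tl by (intro exI[of _ ?\<T>]) auto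
qed

lemma lgen_union:
  assumes "S \<subseteq> carrier R" "T \<subseteq> carrier R" "x \<in> lgen R (S \<union> T)"
  shows "\<exists>y\<in>lgen R S. \<exists>z\<in>lgen R T. x = y \<oplus> z"
proof -
  have l: "left_ideal R (lgen R S)" "left_ideal R (lgen R T)"
    using assms L.lsub_lspan by auto
  have b: "S \<subseteq> lgen R S" "T \<subseteq> lgen R T" using assms L.lspan_base by auto
  have "S \<union> T \<subseteq> {y \<oplus> z | y z. y \<in> lgen R S \<and> z \<in> lgen R T}"
  proof
    fix s assume "s \<in> S \<union> T"
    moreover have "s = s \<oplus> \<zero>" "s = \<zero> \<oplus> s" using \<open>s \<in> S \<union> T\<close> assms by auto
    ultimately show "s \<in> {y \<oplus> z | y z. y \<in> lgen R S \<and> z \<in> lgen R T}"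
      using b left_idealD(2)[OF l(1)] left_idealD(2)[OF l(2)] by blast
  qed
  from subsetD[OF lspan_least[OF left_ideal_sum[OF l] this] assms(3)] show ?thesis by blast
qed

text \<open>Modulo \<open>J A\<close>, the left ideal \<open>A\<close> is a sum of simple modules \<open>T x\<close>.  If finitely many elements did not
  suffice, one could choose elements \<open>y\<^sub>n\<close> from these simple modules, each outside the span of
  its predecessors; the spans of the tails \<open>y\<^sub>n, y\<^sub>n\<^sub>+\<^sub>1, \<dots>\<close> would then descend strictly.  Nakayama's lemma
  removes the term \<open>J A\<close>.\<close>
theorem left_ideal_fg:
  assumes A: "left_ideal R A"
  shows "\<exists>S. finite S \<and> S \<subseteq> A \<and> lgen R S = A"
proof -
  note AD = left_idealD[OF A]
  have Ac: "\<And>a. a \<in> A \<Longrightarrow> a \<in> carrier R" using AD(1) by blast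
  have Jc: "\<And>j. j \<in> jacobson R \<Longrightarrow> j \<in> carrier R" by (simp add: jacobson_def)
  define JA where "JA = {j \<otimes> a | j a. j \<in> jacobson R \<and> a \<in> A}"
  have JAc: "JA \<subseteq> A" using AD(4) Jc by (auto simp: JA_def)
  have sc: "S \<union> JA \<subseteq> carrier R" if "S \<subseteq> A" for S using that JAc AD(1) by blast
  have gl: "left_ideal R (lgen R (S \<union> JA))" if "S \<subseteq> A" for S using L.lsub_lspan sc[OF that] by simp
  have gb: "S \<union> JA \<subseteq> lgen R (S \<union> JA)" if "S \<subseteq> A" for S using L.lspan_base[of "S \<union> JA"] sc[OF that] by simp
  obtain \<T> where T: "\<forall>T\<in>\<T>. left_ideal R T \<and>
        (\<forall>t\<in>T - jacobson R. \<forall>t'\<in>T. \<exists>d\<in>carrier R. t' \<ominus> d \<otimes> t \<in> jacobson R)"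
    and one: "\<one> \<in> lgen R (\<Union>\<T> \<union> jacobson R)"
    using jacobson_socle by (elim exE conjE)
  have Tl: "left_ideal R T" if "T \<in> \<T>" for T using T that by simp
  have Ts: "\<exists>d\<in>carrier R. t' \<ominus> d \<otimes> t \<in> jacobson R"
    if "T \<in> \<T>" "t \<in> T" "t \<notin> jacobson R" "t' \<in> T" for T t t'
    using T that by simp
  note TD = left_idealD[OF Tl]
  have "\<exists>S. finite S \<and> S \<subseteq> A \<and> A \<subseteq> lgen R (S \<union> JA)"
  proof (rule ccontr)
    assume no: "\<not> ?thesis"
    let ?E = "\<lambda>y. \<exists>T\<in>\<T>. \<exists>t\<in>T. \<exists>x\<in>A. y = t \<otimes> x"
    have Ec: "y \<in> A" if "?E y" for y using that TD(1) AD(4) by blast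
    have ex: "\<exists>y. ?E y \<and> y \<notin> lgen R (S \<union> JA)" if S: "finite S" "S \<subseteq> A" for S
    proof (rule ccontr)
      assume n: "\<not> ?thesis"
      note VD = left_idealD[OF gl[OF S(2)]]
      obtain a where a: "a \<in> A" "a \<notin> lgen R (S \<union> JA)" using no S by blast
      let ?I = "{d \<in> carrier R. d \<otimes> a \<in> lgen R (S \<union> JA)}"
      have "left_ideal R ?I"
        using VD(2-4) a Ac by (intro left_idealI) (auto simp: l_distr m_assoc)
      moreover have "\<Union>\<T> \<union> jacobson R \<subseteq> ?I"
      proof
        fix d assume d: "d \<in> \<Union>\<T> \<union> jacobson R"
        then have dc: "d \<in> carrier R" using TD(1) Jc by blast
        have "d \<otimes> a \<in> lgen R (S \<union> JA)"
        proof (cases "d \<in> jacobson R")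
          case True
          then have "d \<otimes> a \<in> JA" using a by (auto simp: JA_def)
          then show ?thesis using gb[OF S(2)] by blast
        next
          case False
          then show ?thesis using d n a by blast
        qed
        then show "d \<in> ?I" using dc by simp
      qed
      ultimately have "lgen R (\<Union>\<T> \<union> jacobson R) \<subseteq> ?I" by (rule lspan_least)
      then have "\<one> \<otimes> a \<in> lgen R (S \<union> JA)" using one by blast
      then show False using a Ac by simp
    qed
    define c where "c S = (SOME y. ?E y \<and> y \<notin> lgen R (S \<union> JA))" for S
    have c: "?E (c S) \<and> c S \<notin> lgen R (S \<union> JA)" if "finite S" "S \<subseteq> A" for S
      unfolding c_def by (rule someI_ex[OF ex[OF that]])
    define Y where "Y n = rec_nat {} (\<lambda>_ S. insert (c S) S) n" for n
    have Y0: "Y 0 = {}" and YS: "Y (Suc n) = insert (c (Y n)) (Y n)" for n by (auto simp: Y_def)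
    have Yf: "finite (Y n) \<and> Y n \<subseteq> A" for n
    proof (induction n)
      case (Suc n)
      then show ?case using c[of "Y n"] Ec by (simp add: YS)
    qed (simp add: Y0)
    define y where "y n = c (Y n)" for n
    have yE: "?E (y n)" and yn: "y n \<notin> lgen R (Y n \<union> JA)" for n
      using c Yf by (auto simp: y_def)
    have yA: "y n \<in> A" for n using Ec yE by blast
    have yY: "m < n \<Longrightarrow> y m \<in> Y n" for m n
      by (induction n) (auto simp: YS y_def less_Suc_eq)
    define V where "V n = lgen R (y ` {n..} \<union> JA)" for n
    have Vs: "submodule (V n) R (left_regular R)" for n
      unfolding V_def L.submodule_iff_lsub using gl yA by blast
    have Vd: "V (Suc n) \<subseteq> V n" for n
      unfolding V_def by (rule lspan_mono) auto
    obtain n where stable: "\<forall>m\<ge>n. V m = V n"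
      using descending_chain_condition[of V, OF Vs Vd] by (rule exE)
    have "V (Suc n) = V n" by (rule stable[rule_format]) (rule le_SucI, rule order_refl)
    moreover have "y n \<in> V n" unfolding V_def using gb[of "y ` {n..}"] yA by auto
    ultimately have "y n \<in> lgen R (y ` {Suc n..} \<union> JA)" by (simp add: V_def)
    then obtain T0 where T0: "finite T0" "T0 \<subseteq> y ` {Suc n..} \<union> JA" "y n \<in> lgen R T0"
      using L.lspan_finite_support[of "y n"] by blast
    have "\<exists>r. T0 \<subseteq> y ` {Suc n..r} \<union> JA"
      using T0(1,2)
    proof (induction T0 rule: finite_induct)
      case (insert s T0)
      then obtain r where r: "T0 \<subseteq> y ` {Suc n..r} \<union> JA" by auto
      show ?case
      proof (cases "s \<in> JA")
        case True
        then show ?thesis using r by blast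
      next
        case False
        then obtain k where "k \<ge> Suc n" "s = y k" using insert by auto
        then have "insert s T0 \<subseteq> y ` {Suc n..max r k} \<union> JA" using r by fastforce
        then show ?thesis by blast
      qed
    qed auto
    then obtain r where "T0 \<subseteq> y ` {Suc n..r} \<union> JA" by blast
    then have yr: "y n \<in> lgen R (y ` {Suc n..r} \<union> JA)" using T0(3) lspan_mono by blast
    have "y n \<notin> lgen R (y ` {Suc n..r} \<union> JA)" for r
    proof (induction r)
      case 0
      have "lgen R JA \<subseteq> lgen R (Y n \<union> JA)" by (rule lspan_mono) blast
      then show ?case using yn[of n] by auto
    next
      case (Suc r)
      show ?case
      proof (cases "Suc n \<le> Suc r")
        case False
        then have "{Suc n..Suc r} = {}" "{Suc n..r} = {}" by auto
        then show ?thesis using Suc by simp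
      next
        case True
        let ?B = "y ` {Suc n..r} \<union> JA"
        have BA: "y ` {Suc n..r} \<subseteq> A" using yA by blast
        have set: "y ` {Suc n..Suc r} \<union> JA = insert (y (Suc r)) ?B"
          using True by (simp add: atLeastAtMostSuc_conv)
        show ?thesis
        proof
          assume "y n \<in> lgen R (y ` {Suc n..Suc r} \<union> JA)"
          then have "y n \<in> lgen R (insert (y (Suc r)) ?B)" by (simp only: set)
          then obtain d v where dv: "d \<in> carrier R" "v \<in> lgen R ?B" "y n = d \<otimes> y (Suc r) \<oplus> v"
            using L.lspan_insert[of ?B "y (Suc r)" "y n"] sc[OF BA] Ac[OF yA] by auto
          note BD = left_idealD[OF gl[OF BA]]
          have vc: "v \<in> carrier R" using dv(2) BD(1) by blast
          obtain T t x where t: "T \<in> \<T>" "t \<in> T" "x \<in> A" "y (Suc r) = t \<otimes> x" using yE by blast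
          have tc: "t \<in> carrier R" "x \<in> carrier R" using t TD(1) Ac by auto
          have dt: "d \<otimes> t \<in> T" using TD(4)[OF t(1) dv(1) t(2)] .
          show False
          proof (cases "d \<otimes> t \<in> jacobson R")
            case True
            then have "(d \<otimes> t) \<otimes> x \<in> JA" using t(3) by (auto simp: JA_def)
            then have "d \<otimes> y (Suc r) \<in> lgen R ?B" using gb[OF BA] t(4) dv(1) tc by (auto simp: m_assoc)
            then have "y n \<in> lgen R ?B" using dv BD(3) by simp
            then show False using Suc by blast
          next
            case False
            then obtain e where e: "e \<in> carrier R" "t \<ominus> e \<otimes> (d \<otimes> t) \<in> jacobson R"
              using Ts[OF t(1) dt False t(2)] by blast
            have "Y (Suc r) \<subseteq> A" using Yf by blast
            note CD = left_idealD[OF gl[OF this]] and Cb = gb[OF this]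
            have "y n \<in> lgen R (Y (Suc r) \<union> JA)" using Cb yY[of n "Suc r"] True by auto
            moreover have "?B \<subseteq> Y (Suc r) \<union> JA" using yY by auto
            then have "v \<in> lgen R (Y (Suc r) \<union> JA)" using dv(2) lspan_mono by blast
            ultimately have "y n \<ominus> v \<in> lgen R (Y (Suc r) \<union> JA)"
              using left_ideal_minus[OF gl] Yf by blast
            moreover have "y n \<ominus> v = d \<otimes> y (Suc r)"
              using dv vc Ac[OF yA] by (simp add: a_minus_def a_assoc r_neg)
            ultimately have "e \<otimes> (d \<otimes> y (Suc r)) \<in> lgen R (Y (Suc r) \<union> JA)" using CD(4) e(1) by simp
            moreover have "(t \<ominus> e \<otimes> (d \<otimes> t)) \<otimes> x \<in> JA" using e(2) t(3) by (auto simp: JA_def)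
            then have "(t \<ominus> e \<otimes> (d \<otimes> t)) \<otimes> x \<in> lgen R (Y (Suc r) \<union> JA)" using Cb by blast
            ultimately have "(t \<ominus> e \<otimes> (d \<otimes> t)) \<otimes> x \<oplus> e \<otimes> (d \<otimes> y (Suc r)) \<in> lgen R (Y (Suc r) \<union> JA)"
              using CD(3) by blast
            moreover have "(t \<ominus> e \<otimes> (d \<otimes> t)) \<otimes> x \<oplus> e \<otimes> (d \<otimes> y (Suc r)) = y (Suc r)"
              using tc e(1) dv(1) unfolding t(4)
              by (simp add: a_minus_def l_distr l_minus m_assoc a_assoc l_neg)
            ultimately show False using yn by simp
          qed
        qed
      qed
    qed
    then show False using yr by blast
  qed
  then obtain S where S: "finite S" "S \<subseteq> A" "A \<subseteq> lgen R (S \<union> JA)" by blast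
  have Sc: "S \<subseteq> carrier R" "JA \<subseteq> carrier R" using S JAc AD(1) by auto
  have "A \<subseteq> lgen R S"
  proof (rule left_ideal_nakayama[OF _ A])
    show "left_ideal R (lgen R S)" using L.lsub_lspan Sc by simp
    fix a assume "a \<in> A"
    then show "\<exists>f\<in>lgen R S. \<exists>z\<in>lgen R {j \<otimes> a | j a. j \<in> jacobson R \<and> a \<in> A}. a = f \<oplus> z"
      using lgen_union[OF Sc] S(3) unfolding JA_def by blast
  qed
  then show ?thesis using S lspan_least[OF A S(2)] by blast
qed

text \<open>Induction on the rank: a submodule of \<open>R \<oplus> R\<^sup>n\<close> is generated by lifts of generators of its image
  in the first summand, together with generators of its part in \<open>R\<^sup>n\<close>.\<close>
theorem free_submodule_fg:
  assumes "finite I" "lsub R (free_module R I) V"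
  shows "\<exists>S. finite S \<and> S \<subseteq> V \<and> V \<subseteq> lspan R (free_module R I) S"
  using assms
proof (induction I arbitrary: V rule: finite_induct)
  case empty
  then have "V \<subseteq> {\<lambda>_. \<zero>}" by (auto simp: lsub_def free_module_carrier fun_eq_iff)
  then show ?case using lspan.zero[of "free_module R {}" R "{}"] by (intro exI[of _ "{}"]) auto
next
  case (insert i I)
  interpret F: left_module R "free_module R (insert i I)" by (rule left_module_free) (rule ring_axioms)
  note VD = lsubD[OF insert.prems]
  have res: "free_module R I = (free_module R (insert i I))\<lparr>carrier := carrier (free_module R I)\<rparr>"
    by (simp add: free_module_def)
  let ?p = "\<lambda>v. v i"
  have ph: "?p \<in> lmod_hom R (free_module R (insert i I)) (left_regular R)"
    by (auto simp: lmod_hom_def free_module_component[OF ring_axioms])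
  have pl: "left_ideal R (?p ` V)"
  proof -
    have "?p ` lspan R (free_module R (insert i I)) V = lgen R (?p ` V)"
      by (rule lmod_hom_lspan[OF ph F.left_module_axioms L.left_module_axioms VD(1)])
    then have "?p ` V = lgen R (?p ` V)" by (simp add: F.lspan_carrier_fixed[OF insert.prems])
    moreover have "?p ` V \<subseteq> carrier (left_regular R)"
      using free_module_component[OF ring_axioms subsetD[OF VD(1)]] by auto
    ultimately show ?thesis using L.lsub_lspan[of "?p ` V"] by simp
  qed
  then obtain S' where S': "finite S'" "S' \<subseteq> ?p ` V" "lgen R S' = ?p ` V"
    using left_ideal_fg[OF pl] by (elim exE conjE)
  obtain S1 where S1: "S1 \<subseteq> V" "finite S1" "S' = ?p ` S1"
    using finite_subset_image[OF S'(1,2)] by (elim exE conjE)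
  let ?V0 = "{v \<in> V. v i = \<zero>}"
  have V0c: "?V0 \<subseteq> carrier (free_module R I)" 
  proof
    fix v assume v: "v \<in> ?V0"
    then have "v \<in> carrier (free_module R (insert i I))" using VD(1) by blast
    then show "v \<in> carrier (free_module R I)" using v by (auto simp: free_module_carrier)
  qed
  have "lsub R (free_module R I) ?V0"
    using VD(2-4) V0c by (intro lsubI) auto
  then obtain S0 where S0: "finite S0" "S0 \<subseteq> ?V0" "?V0 \<subseteq> lspan R (free_module R I) S0"
    using insert.IH by blast
  have eq: "lspan R (free_module R I) S0 = lspan R (free_module R (insert i I)) S0"
    by (subst res) (rule lspan_restrict)
  let ?S = "S0 \<union> S1"
  have SV: "?S \<subseteq> V" using S0 S1 by blast
  have Sc: "?S \<subseteq> carrier (free_module R (insert i I))" using SV VD(1) by blast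
  have "V \<subseteq> lspan R (free_module R (insert i I)) ?S"
  proof
    fix v assume v: "v \<in> V"
    have S1c: "S1 \<subseteq> carrier (free_module R (insert i I))" using Sc by blast
    have "v i \<in> lgen R (?p ` S1)" using v S'(3) S1(3) by blast
    have "v i \<in> ?p ` lspan R (free_module R (insert i I)) S1"
      using lmod_hom_lspan[OF ph F.left_module_axioms L.left_module_axioms S1c] \<open>v i \<in> lgen R (?p ` S1)\<close> by simp
    then obtain w where w: "w \<in> lspan R (free_module R (insert i I)) S1" "v i = w i" by blast
    have wV: "w \<in> V" using w(1) lspan_least[OF insert.prems S1(1)] by blast
    have c: "v \<in> carrier (free_module R (insert i I))" "w \<in> carrier (free_module R (insert i I))"
      using v wV VD(1) by auto
    let ?u = "v \<ominus>\<^bsub>free_module R (insert i I)\<^esub> w"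
    have uV: "?u \<in> V" using F.lsub_minus[OF insert.prems v wV] .
    have "addmap (free_module R (insert i I)) (left_regular R) ?p" by (rule lmod_hom_addmap[OF ph])
    from addmap_minus[OF this F.M_group L.M_group c] have "?u i = \<zero>"
      using w(2) L.M.r_neg[of "w i"] free_module_component[OF ring_axioms c(2)] by (simp add: a_minus_def)
    then have "?u \<in> lspan R (free_module R (insert i I)) ?S"
      using uV S0(3) eq lspan_mono[of S0 ?S] by blast
    moreover have "w \<in> lspan R (free_module R (insert i I)) ?S" using w(1) lspan_mono[of S1 ?S] by blast
    ultimately have "?u \<oplus>\<^bsub>free_module R (insert i I)\<^esub> w \<in> lspan R (free_module R (insert i I)) ?S"
      by (rule F.lspan_add[OF Sc])
    moreover have "?u \<oplus>\<^bsub>free_module R (insert i I)\<^esub> w = v"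
      using c F.M.minus_closed unfolding a_minus_def by (simp only: F.M.a_assoc F.M.a_inv_closed F.M.l_neg F.M.r_zero)
    ultimately show "v \<in> lspan R (free_module R (insert i I)) ?S" by simp
  qed
  then show ?case using S0(1) S1(2) SV by (intro exI[of _ ?S]) auto
qed

end

section \<open>Relations and coherence\<close>

definition rel :: "('a, 'r) ring_scheme \<Rightarrow> ('a, 'b, 'm) module_scheme \<Rightarrow> 'i set \<Rightarrow> ('i \<Rightarrow> 'b) \<Rightarrow> ('i \<Rightarrow> 'a) set"
  where "rel R M I r = {a \<in> carrier (free_module R I). lin R M r a = \<zero>\<^bsub>M\<^esub>}"

definition fgen :: "('a, 'r) ring_scheme \<Rightarrow> ('a, 'b, 'm) module_scheme \<Rightarrow> 'b set \<Rightarrow> bool"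
  where "fgen R M N \<longleftrightarrow> (\<exists>S. finite S \<and> S \<subseteq> N \<and> N \<subseteq> lspan R M S)"

lemma (in left_module) lsub_rel:
  assumes "\<And>i. i \<in> I \<Longrightarrow> r i \<in> carrier M"
  shows "lsub R (free_module R I) (rel R M I r)"
  unfolding rel_def
  by (rule lsub_kernel[OF lin_hom left_module_free[OF R_ring] left_module_axioms]) (rule assms)

lemma (in left_module) finitely_generated_restrict':
  assumes N: "lsub R M N"
  shows "finitely_generated R (M\<lparr>carrier := N\<rparr>) \<longleftrightarrow> fgen R M N"
proof -
  have "lspan R M S \<subseteq> N" if "S \<subseteq> N" for S using lspan_least[OF N that] .
  then show ?thesis unfolding finitely_generated_restrict[OF N] fgen_def by (metis subset_antisym order_refl)
qed

lemma lin_in_lspan_id: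
  assumes R: "ring R" and g: "g \<in> lmod_hom R (free_module R I) M" and M: "left_module R M"
    and a: "a \<in> carrier (free_module R I)"
  shows "g a \<in> lspan R M ((\<lambda>i. g (monomial R i \<one>\<^bsub>R\<^esub>)) ` I)"
proof -
  interpret M: left_module R M by fact
  have c: "g (monomial R i \<one>\<^bsub>R\<^esub>) \<in> carrier M" if "i \<in> I" for i
    by (rule lmod_hom_closed[OF g monomial_closed[OF R that]]) simp
  have sub: "(\<lambda>i. g (monomial R i \<one>\<^bsub>R\<^esub>)) ` I \<subseteq> carrier M" using c by blast
  show ?thesis
    unfolding M.lin_unique[OF g a]
    by (rule M.lin_in_lspan[OF c a sub]) (use M.lspan_base[OF sub] in auto)
qed

text \<open>Schanuel's lemma: whether the relations are finitely generated does not depend on the choice of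
  finitely many generators.\<close>
lemma fp_relations:
  assumes M: "left_module R M" and fp: "finitely_presented R M" and I: "finite I"
    and r: "\<And>i. i \<in> I \<Longrightarrow> r i \<in> carrier M" and gen: "carrier M \<subseteq> lspan R M (r ` I)"
  shows "fgen R (free_module R I) (rel R M I r)"
proof -
  interpret M: left_module R M by fact
  obtain n :: nat and p where p: "p \<in> lmod_hom R (free_module R {..<n}) M"
    and sur: "p ` carrier (free_module R {..<n}) = carrier M"
    and ker: "finitely_generated R ((free_module R {..<n})\<lparr>carrier := a_kernel (free_module R {..<n}) M p\<rparr>)"
    using fp unfolding finitely_presented_def by blast
  let ?F = "free_module R {..<n}" and ?G = "free_module R I"
  interpret F: left_module R ?F by (rule left_module_free[OF M.R_ring])
  interpret G: left_module R ?G by (rule left_module_free[OF M.R_ring])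
  let ?\<pi> = "lin R M r"
  have \<pi>: "?\<pi> \<in> lmod_hom R ?G M" by (rule M.lin_hom[OF r])
  have kl: "lsub R ?F (a_kernel ?F M p)"
    unfolding a_kernel_def' by (rule lsub_kernel[OF p F.left_module_axioms M.left_module_axioms])
  obtain \<kappa> where \<kappa>: "finite \<kappa>" "\<kappa> \<subseteq> a_kernel ?F M p" "a_kernel ?F M p \<subseteq> lspan R ?F \<kappa>"
    using ker unfolding F.finitely_generated_restrict'[OF kl] fgen_def by blast
  have \<kappa>c: "\<kappa> \<subseteq> carrier ?F" using \<kappa>(2) by (auto simp: a_kernel_def')
  have "\<forall>i\<in>I. \<exists>x. x \<in> carrier ?F \<and> p x = r i"
  proof
    fix i assume "i \<in> I"
    then have "r i \<in> p ` carrier ?F" using r sur by simp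
    then show "\<exists>x. x \<in> carrier ?F \<and> p x = r i" by auto
  qed
  then obtain \<alpha> where \<alpha>: "\<forall>i\<in>I. \<alpha> i \<in> carrier ?F \<and> p (\<alpha> i) = r i" by (rule bchoice[THEN exE])
  have "\<forall>j\<in>{..<n}. \<exists>b. b \<in> carrier ?G \<and> ?\<pi> b = p (monomial R j \<one>\<^bsub>R\<^esub>)"
  proof
    fix j assume j: "j \<in> {..<n}"
    have "p (monomial R j \<one>\<^bsub>R\<^esub>) \<in> carrier M"
      by (rule lmod_hom_closed[OF p monomial_closed[OF M.R_ring j]]) simp
    then have "p (monomial R j \<one>\<^bsub>R\<^esub>) \<in> ?\<pi> ` carrier ?G"
      using gen M.lspan_image_eq[of I r, OF r] by auto
    then show "\<exists>b. b \<in> carrier ?G \<and> ?\<pi> b = p (monomial R j \<one>\<^bsub>R\<^esub>)" by auto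
  qed
  then obtain \<beta> where \<beta>: "\<forall>j\<in>{..<n}. \<beta> j \<in> carrier ?G \<and> ?\<pi> (\<beta> j) = p (monomial R j \<one>\<^bsub>R\<^esub>)"
    by (rule bchoice[THEN exE])
  let ?A = "lin R ?F \<alpha>" and ?B = "lin R ?G \<beta>"
  have A: "?A \<in> lmod_hom R ?G ?F" by (rule F.lin_hom) (use \<alpha> in blast)
  have B: "?B \<in> lmod_hom R ?F ?G" by (rule G.lin_hom) (use \<beta> in blast)
  have pA: "p (?A a) = ?\<pi> a" if "a \<in> carrier ?G" for a
  proof (rule lmod_hom_free_eqI[OF M.R_ring M.left_module_axioms lmod_hom_comp[OF A p] \<pi> _ that])
    fix i assume i: "i \<in> I"
    have "?A (monomial R i \<one>\<^bsub>R\<^esub>) = \<alpha> i" by (rule F.lin_monomial[OF _ i]) (use \<alpha> in blast)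
    moreover have "?\<pi> (monomial R i \<one>\<^bsub>R\<^esub>) = r i" by (rule M.lin_monomial[OF r i])
    ultimately show "p (?A (monomial R i \<one>\<^bsub>R\<^esub>)) = ?\<pi> (monomial R i \<one>\<^bsub>R\<^esub>)" using \<alpha> i by simp
  qed
  have \<pi>B: "?\<pi> (?B a) = p a" if "a \<in> carrier ?F" for a
  proof (rule lmod_hom_free_eqI[OF M.R_ring M.left_module_axioms lmod_hom_comp[OF B \<pi>] p _ that])
    fix i assume i: "i \<in> {..<n}"
    have "?B (monomial R i \<one>\<^bsub>R\<^esub>) = \<beta> i" by (rule G.lin_monomial[OF _ i]) (use \<beta> in blast)
    then show "?\<pi> (?B (monomial R i \<one>\<^bsub>R\<^esub>)) = p (monomial R i \<one>\<^bsub>R\<^esub>)" using \<beta> i by simp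
  qed
  let ?c = "\<lambda>a. a \<ominus>\<^bsub>?G\<^esub> ?B (?A a)"
  have c: "?c \<in> lmod_hom R ?G ?G"
    by (rule lmod_hom_diff[OF _ lmod_hom_comp[OF A B] G.left_module_axioms]) (auto simp: lmod_hom_def)
  have BA: "?B (?A a) \<in> carrier ?G" if "a \<in> carrier ?G" for a
    by (rule lmod_hom_closed[OF B lmod_hom_closed[OF A that]])
  have \<pi>c: "?\<pi> (?c a) = \<zero>\<^bsub>M\<^esub>" if a: "a \<in> carrier ?G" for a
    using addmap_minus[OF lmod_hom_addmap[OF \<pi>] G.M_group M.M_group a BA[OF a]]
      \<pi>B[OF lmod_hom_closed[OF A a]] pA[OF a] lmod_hom_closed[OF \<pi> a]
    by (simp add: a_minus_def M.M.r_neg)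
  let ?S = "(\<lambda>i. ?c (monomial R i \<one>\<^bsub>R\<^esub>)) ` I \<union> ?B ` \<kappa>"
  have mc: "monomial R i \<one>\<^bsub>R\<^esub> \<in> carrier ?G" if "i \<in> I" for i
    by (rule monomial_closed[OF M.R_ring that]) simp
  have Srel: "?S \<subseteq> rel R M I r"
  proof
    fix s assume "s \<in> ?S"
    then consider i where "i \<in> I" "s = ?c (monomial R i \<one>\<^bsub>R\<^esub>)" | k where "k \<in> \<kappa>" "s = ?B k" by blast
    then show "s \<in> rel R M I r"
    proof cases
      case 1
      then show ?thesis using \<pi>c[OF mc] lmod_hom_closed[OF c mc] by (simp add: rel_def)
    next
      case 2
      then have "k \<in> carrier ?F" "p k = \<zero>\<^bsub>M\<^esub>" using \<kappa>(2) by (auto simp: a_kernel_def')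
      then show ?thesis using 2 \<pi>B lmod_hom_closed[OF B] by (simp add: rel_def)
    qed
  qed
  have Sc: "?S \<subseteq> carrier ?G" using Srel by (auto simp: rel_def)
  have "rel R M I r \<subseteq> lspan R ?G ?S"
  proof
    fix a assume "a \<in> rel R M I r"
    then have a: "a \<in> carrier ?G" "?\<pi> a = \<zero>\<^bsub>M\<^esub>" by (auto simp: rel_def)
    have "?A a \<in> a_kernel ?F M p" using a pA[OF a(1)] lmod_hom_closed[OF A a(1)] by (simp add: a_kernel_def')
    then have "?B (?A a) \<in> ?B ` lspan R ?F \<kappa>" using \<kappa>(3) by blast
    then have 1: "?B (?A a) \<in> lspan R ?G ?S"
      using lmod_hom_lspan[OF B F.left_module_axioms G.left_module_axioms \<kappa>c]
        lspan_mono[of "?B ` \<kappa>" ?S R ?G] by blast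
    have 2: "?c a \<in> lspan R ?G ?S"
      using lin_in_lspan_id[OF M.R_ring c G.left_module_axioms a(1)]
        lspan_mono[of "(\<lambda>i. ?c (monomial R i \<one>\<^bsub>R\<^esub>)) ` I" ?S R ?G] by blast
    have "?c a \<oplus>\<^bsub>?G\<^esub> ?B (?A a) = a"
      unfolding a_minus_def using a(1) BA[OF a(1)]
      by (simp only: G.M.a_assoc G.M.a_inv_closed G.M.l_neg G.M.r_zero)
    then show "a \<in> lspan R ?G ?S" using G.lspan_add[OF Sc 2 1] by simp
  qed
  moreover have "finite ?S" using I \<kappa>(1) by blast
  ultimately show ?thesis unfolding fgen_def using Srel by blast
qed

lemma relations_fp:
  fixes n :: nat
  assumes M: "left_module R M" and r: "\<And>i. i \<in> {..<n} \<Longrightarrow> r i \<in> carrier M"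
    and gen: "carrier M \<subseteq> lspan R M (r ` {..<n})"
    and fg: "fgen R (free_module R {..<n}) (rel R M {..<n} r)"
  shows "finitely_presented R M"
proof -
  interpret M: left_module R M by fact
  interpret F: left_module R "free_module R {..<n}" by (rule left_module_free[OF M.R_ring])
  have h: "lin R M r \<in> lmod_hom R (free_module R {..<n}) M" by (rule M.lin_hom[OF r])
  have 1: "lin R M r ` carrier (free_module R {..<n}) = carrier M"
    using gen lmod_hom_closed[OF h] M.lspan_image_eq[of "{..<n}" r, OF r] by auto
  have 2: "finitely_generated R ((free_module R {..<n})\<lparr>carrier := a_kernel (free_module R {..<n}) M (lin R M r)\<rparr>)"
    using fg F.finitely_generated_restrict'[OF M.lsub_rel[of "{..<n}" r, OF r]]
    unfolding a_kernel_def' rel_def by simp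
  show ?thesis
    unfolding finitely_presented_def by (rule exI[of _ n], rule bexI[OF _ h], rule conjI[OF 1 2])
qed

lemma lin_restrict:
  assumes M: "left_module R M" and N: "lsub R M N" and r: "\<And>i. i \<in> I \<Longrightarrow> r i \<in> N"
    and a: "a \<in> carrier (free_module R I)"
  shows "lin R (M\<lparr>carrier := N\<rparr>) r a = lin R M r a"
proof -
  interpret M: left_module R M by fact
  have "(\<lambda>x. x) \<in> lmod_hom R (M\<lparr>carrier := N\<rparr>) M"
    using lsubD(1)[OF N] by (auto simp: lmod_hom_def)
  from lin_comp[OF M.left_module_restrict[OF N] M this _ a] show ?thesis using r by simp
qed

lemma rel_restrict:
  assumes M: "left_module R M" and N: "lsub R M N" and r: "\<And>i. i \<in> I \<Longrightarrow> r i \<in> N"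
  shows "rel R (M\<lparr>carrier := N\<rparr>) I r = rel R M I r"
proof -
  have "lin R (M\<lparr>carrier := N\<rparr>) r a = lin R M r a" if "a \<in> carrier (free_module R I)" for a
    by (rule lin_restrict[OF M N r that])
  then show ?thesis unfolding rel_def by auto
qed

lemma coherent_relations:
  assumes coh: "coherent_ring S" and I: "finite I" and r: "\<And>i. i \<in> I \<Longrightarrow> r i \<in> carrier S"
  shows "fgen S (free_module S I) (rel S (left_regular S) I r)"
proof -
  have S: "ring S" using coh by (simp add: coherent_ring_def)
  interpret L: left_module S "left_regular S" by (rule left_module_left_regular[OF S])
  let ?A = "lspan S (left_regular S) (r ` I)"
  have rc: "r ` I \<subseteq> carrier (left_regular S)" using r by auto
  have A: "lsub S (left_regular S) ?A" by (rule L.lsub_lspan[OF rc])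
  have rA: "r i \<in> ?A" if "i \<in> I" for i using L.lspan_base[OF rc] that by blast
  have "fgen S (left_regular S) ?A"
    unfolding fgen_def using I rA by (intro exI[of _ "r ` I"]) auto
  then have "finitely_presented S ((left_regular S)\<lparr>carrier := ?A\<rparr>)"
    using coh A unfolding coherent_ring_def L.submodule_iff_lsub L.finitely_generated_restrict'[OF A, symmetric]
    by simp
  from fp_relations[OF L.left_module_restrict[OF A] this I, of r]
  have "fgen S (free_module S I) (rel S ((left_regular S)\<lparr>carrier := ?A\<rparr>) I r)"
    using rA by (simp add: lspan_restrict)
  moreover have "rel S ((left_regular S)\<lparr>carrier := ?A\<rparr>) I r = rel S (left_regular S) I r"
    by (rule rel_restrict[OF L.left_module_axioms A rA])
  ultimately show ?thesis by simp
qed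

text \<open>Coherence for finitely generated submodules of free modules of finite rank: the relations between
  vectors are the relations between their first coordinates, then between the second ones, and so
  on, each time expressed in the generators found before.\<close>
lemma coherent_relations_finite_rank:
  assumes coh: "coherent_ring S" and I: "finite I" and C: "finite C"
    and r: "\<And>i c. i \<in> I \<Longrightarrow> r i c \<in> carrier S"
  shows "fgen S (free_module S I) (carrier (free_module S I) \<inter> (\<Inter>c\<in>C. rel S (left_regular S) I (\<lambda>i. r i c)))"
  using C
proof (induction C rule: finite_induct)
  have S: "ring S" using coh by (simp add: coherent_ring_def)
  interpret S: ring S by (rule S)
  case empty
  have "(\<lambda>i. monomial S i \<one>\<^bsub>S\<^esub>) ` I \<subseteq> carrier (free_module S I)"
    by (intro image_subsetI monomial_closed[OF S] S.one_closed)
  moreover have "finite ((\<lambda>i. monomial S i \<one>\<^bsub>S\<^esub>) ` I)" using I by (rule finite_imageI)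
  ultimately show ?case unfolding fgen_def
    using free_module_eq_lspan[OF S, of I] by (intro exI[of _ "(\<lambda>i. monomial S i \<one>\<^bsub>S\<^esub>) ` I"]) simp
next
  have S: "ring S" using coh by (simp add: coherent_ring_def)
  interpret L: left_module S "left_regular S" by (rule left_module_left_regular[OF S])
  let ?F = "free_module S I"
  interpret F: left_module S ?F by (rule left_module_free[OF S])
  case (insert c C)
  let ?N = "\<lambda>C. carrier ?F \<inter> (\<Inter>c\<in>C. rel S (left_regular S) I (\<lambda>i. r i c))"
  have rl: "lsub S ?F (rel S (left_regular S) I (\<lambda>i. r i c))" for c
    by (rule L.lsub_rel) (simp add: r)
  have Nl: "lsub S ?F (?N C)" for C
  proof (rule lsubI)
    show "?N C \<subseteq> carrier ?F" by blast
    show "\<zero>\<^bsub>?F\<^esub> \<in> ?N C" using lsubD(2)[OF rl] lsubD(2)[OF F.lsub_carrier] by blast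
    show "u \<oplus>\<^bsub>?F\<^esub> v \<in> ?N C" if "u \<in> ?N C" "v \<in> ?N C" for u v
      using that lsubD(3)[OF rl] lsubD(3)[OF F.lsub_carrier] by blast
    show "a \<odot>\<^bsub>?F\<^esub> v \<in> ?N C" if "a \<in> carrier S" "v \<in> ?N C" for a v
      using that lsubD(4)[OF rl] lsubD(4)[OF F.lsub_carrier] by blast
  qed
  obtain P where P: "finite P" "P \<subseteq> ?N C" "?N C \<subseteq> lspan S ?F P"
    using insert.IH unfolding fgen_def by blast
  have Pc: "\<And>p. p \<in> P \<Longrightarrow> p \<in> carrier ?F" using P(2) by blast
  let ?l = "lin S (left_regular S) (\<lambda>i. r i c)"
  have l: "?l \<in> lmod_hom S ?F (left_regular S)" by (rule L.lin_hom) (simp add: r)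
  have "fgen S (free_module S P) (rel S (left_regular S) P ?l)"
    by (rule coherent_relations[OF coh P(1)]) (use lmod_hom_closed[OF l Pc] in simp)
  then obtain E where E: "finite E" "E \<subseteq> rel S (left_regular S) P ?l"
      "rel S (left_regular S) P ?l \<subseteq> lspan S (free_module S P) E"
    unfolding fgen_def by blast
  interpret G: left_module S "free_module S P" by (rule left_module_free[OF S])
  let ?B = "lin S ?F (\<lambda>p. p)"
  have B: "?B \<in> lmod_hom S (free_module S P) ?F" by (rule F.lin_hom[OF Pc])
  have lB: "?l (?B b) = lin S (left_regular S) ?l b" if "b \<in> carrier (free_module S P)" for b
    by (rule lin_comp[OF F.left_module_axioms L.left_module_axioms l Pc that])
  have Bimg: "lspan S ?F P = ?B ` carrier (free_module S P)"
    using F.lspan_image_eq[of P "\<lambda>p. p", OF Pc] by simp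
  have Ec: "E \<subseteq> carrier (free_module S P)" using E(2) by (auto simp: rel_def)
  have Nins: "?N (insert c C) = {a \<in> ?N C. ?l a = \<zero>\<^bsub>S\<^esub>}" by (auto simp: rel_def)
  have "?B ` E \<subseteq> ?N (insert c C)"
  proof
    fix x assume "x \<in> ?B ` E"
    then obtain e where e: "e \<in> E" "x = ?B e" by blast
    then have ec: "e \<in> carrier (free_module S P)" "lin S (left_regular S) ?l e = \<zero>\<^bsub>S\<^esub>"
      using E(2) by (auto simp: rel_def)
    have "x \<in> lspan S ?F P" using Bimg e ec by blast
    then have "x \<in> ?N C" using lspan_least[OF Nl P(2)] by blast
    then show "x \<in> ?N (insert c C)" unfolding Nins using lB[OF ec(1)] ec(2) e(2) by simp
  qed
  moreover have "?N (insert c C) \<subseteq> lspan S ?F (?B ` E)"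
  proof
    fix a assume "a \<in> ?N (insert c C)"
    then have a: "a \<in> ?N C" "?l a = \<zero>\<^bsub>S\<^esub>" unfolding Nins by blast+
    then obtain b where b: "b \<in> carrier (free_module S P)" "a = ?B b" using P(3) Bimg by blast
    have "b \<in> rel S (left_regular S) P ?l" using b a(2) lB[OF b(1)] by (simp add: rel_def)
    then have "?B b \<in> ?B ` lspan S (free_module S P) E" using E(3) by blast
    then show "a \<in> lspan S ?F (?B ` E)"
      using lmod_hom_lspan[OF B G.left_module_axioms F.left_module_axioms Ec] b(2) by simp
  qed
  ultimately show ?case unfolding fgen_def using E(1) by blast
qed

section \<open>Group algebras\<close>

locale group_algebra = K: field K + G: group G + R: ring "group_ring K G"
  for K :: "('k, 'r) ring_scheme" and G :: "('g, 's) monoid_scheme" (structure)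
begin

abbreviation "KG \<equiv> group_ring K G"
abbreviation mon :: "'g \<Rightarrow> 'k \<Rightarrow> 'g \<Rightarrow> 'k" where "mon \<equiv> monomial K"

text \<open>Scalars, group elements and their inverses as elements of \<open>KG\<close>.\<close>
abbreviation scal :: "'k \<Rightarrow> 'g \<Rightarrow> 'k" where "scal \<equiv> mon \<one>"
abbreviation gel :: "'g \<Rightarrow> 'g \<Rightarrow> 'k" where "gel g \<equiv> mon g \<one>\<^bsub>K\<^esub>"
abbreviation ginv :: "'g \<Rightarrow> 'g \<Rightarrow> 'k" where "ginv g \<equiv> gel (inv g)"

lemmas K_ring = K.ring_axioms
lemmas KG_ring = R.ring_axioms

lemma KG_carrier: "carrier KG = carrier (free_module K (carrier G))"
  by (simp add: group_ring_def)

lemma KG_zero: "\<zero>\<^bsub>KG\<^esub> = (\<lambda>i. \<zero>\<^bsub>K\<^esub>)"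
  by (simp add: group_ring_def)

lemma KG_add: "a \<oplus>\<^bsub>KG\<^esub> b = (\<lambda>g. a g \<oplus>\<^bsub>K\<^esub> b g)"
  by (simp add: group_ring_def)

lemma KG_one: "\<one>\<^bsub>KG\<^esub> = scal \<one>\<^bsub>K\<^esub>"
  by (simp add: group_ring_def)

lemma KG_mult: "(a \<otimes>\<^bsub>KG\<^esub> b) g = (if g \<in> carrier G
   then \<Oplus>\<^bsub>K\<^esub>h\<in>{h \<in> carrier G. a h \<noteq> \<zero>\<^bsub>K\<^esub>}. a h \<otimes>\<^bsub>K\<^esub> b (inv h \<otimes> g) else \<zero>\<^bsub>K\<^esub>)"
  by (simp add: group_ring_def)

lemma KG_apply: "a \<in> carrier KG \<Longrightarrow> a g \<in> carrier K"
  unfolding KG_carrier by (rule free_module_component[OF K_ring])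

lemma KG_outside: "a \<in> carrier KG \<Longrightarrow> g \<notin> carrier G \<Longrightarrow> a g = \<zero>\<^bsub>K\<^esub>"
  unfolding KG_carrier by (rule free_module_outside)

lemma KG_finite: "a \<in> carrier KG \<Longrightarrow> finite {g. a g \<noteq> \<zero>\<^bsub>K\<^esub>}"
  unfolding KG_carrier by (rule free_module_finite)

lemma mon_closed: "g \<in> carrier G \<Longrightarrow> k \<in> carrier K \<Longrightarrow> mon g k \<in> carrier KG"
  unfolding KG_carrier by (rule monomial_closed[OF K_ring])

lemma mon_mult_apply:
  assumes h: "h \<in> carrier G" "k \<in> carrier K" and b: "b \<in> carrier KG" and g: "g \<in> carrier G"
  shows "(mon h k \<otimes>\<^bsub>KG\<^esub> b) g = k \<otimes>\<^bsub>K\<^esub> b (inv h \<otimes> g)"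
proof (cases "k = \<zero>\<^bsub>K\<^esub>")
  case True
  then have e: "{h' \<in> carrier G. mon h k h' \<noteq> \<zero>\<^bsub>K\<^esub>} = {}" by (auto simp: monomial_def)
  show ?thesis unfolding KG_mult e using g True KG_apply[OF b] by simp
next
  case False
  then have e: "{h' \<in> carrier G. mon h k h' \<noteq> \<zero>\<^bsub>K\<^esub>} = {h}" using h by (auto simp: monomial_def)
  show ?thesis unfolding KG_mult e using g h KG_apply[OF b] by (simp add: monomial_def)
qed

lemma mon_mult:
  assumes "g \<in> carrier G" "h \<in> carrier G" "k \<in> carrier K" "l \<in> carrier K"
  shows "mon g k \<otimes>\<^bsub>KG\<^esub> mon h l = mon (g \<otimes> h) (k \<otimes>\<^bsub>K\<^esub> l)"
proof
  fix x
  show "(mon g k \<otimes>\<^bsub>KG\<^esub> mon h l) x = mon (g \<otimes> h) (k \<otimes>\<^bsub>K\<^esub> l) x"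
  proof (cases "x \<in> carrier G")
    case True
    have "inv g \<otimes> x = h \<longleftrightarrow> x = g \<otimes> h"
      using True assms by (metis G.inv_solve_left G.m_closed)
    then show ?thesis
      using mon_mult_apply[OF assms(1,3) mon_closed[OF assms(2,4)] True] assms by (simp add: monomial_def)
  next
    case False
    then have "x \<noteq> g \<otimes> h" using assms by auto
    then show ?thesis using False by (simp add: KG_mult monomial_def)
  qed
qed

lemma KG_mult_fext:
  assumes a: "a \<in> carrier KG" and s: "s \<in> carrier G"
  shows "(a \<otimes>\<^bsub>KG\<^esub> b) s = fext K K (\<lambda>h k. k \<otimes>\<^bsub>K\<^esub> b (inv h \<otimes> s)) a"
proof -
  have "{h \<in> carrier G. a h \<noteq> \<zero>\<^bsub>K\<^esub>} = {h. a h \<noteq> \<zero>\<^bsub>K\<^esub>}" using KG_outside[OF a] by auto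
  then show ?thesis using s by (simp add: KG_mult fext_def)
qed

lemma addmap_KG: "addmap KG A f \<longleftrightarrow> addmap (free_module K (carrier G)) A f"
  by (simp add: addmap_def KG_carrier KG_add)

lemma addmap_to_KG: "addmap A KG f \<longleftrightarrow> addmap A (free_module K (carrier G)) f"
  by (simp add: addmap_def KG_carrier KG_add)

lemma addmap_KG_eqI:
  assumes A: "abelian_group A" and f: "addmap KG A f" and g: "addmap KG A g"
    and eq: "\<And>y k. y \<in> carrier G \<Longrightarrow> k \<in> carrier K \<Longrightarrow> f (mon y k) = g (mon y k)"
    and v: "v \<in> carrier KG"
  shows "f v = g v"
  by (rule addmap_free_eqI[OF K_ring A f[unfolded addmap_KG] g[unfolded addmap_KG] eq v[unfolded KG_carrier]])

lemma addmap_free_KG_eqI: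
  assumes A: "abelian_group A" and f: "addmap (free_module KG B) A f" and g: "addmap (free_module KG B) A g"
    and eq: "\<And>b y k. b \<in> B \<Longrightarrow> y \<in> carrier G \<Longrightarrow> k \<in> carrier K \<Longrightarrow>
       f (monomial KG b (mon y k)) = g (monomial KG b (mon y k))"
    and v: "v \<in> carrier (free_module KG B)"
  shows "f v = g v"
proof (rule addmap_free_eqI[OF KG_ring A f g _ v])
  fix b a assume b: "b \<in> B" and a: "a \<in> carrier KG"
  note m = addmap_monomial[OF KG_ring b]
  show "f (monomial KG b a) = g (monomial KG b a)"
    by (rule addmap_KG_eqI[OF A addmap_comp[OF m f] addmap_comp[OF m g] eq[OF b] a])
qed

lemma addmap_mon: "g \<in> carrier G \<Longrightarrow> addmap K KG (mon g)"
  unfolding addmap_to_KG by (rule addmap_monomial[OF K_ring])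

lemma addmap_KG_apply: "addmap KG K (\<lambda>a. a g)"
  unfolding addmap_KG by (rule addmap_component[OF K_ring])

lemma addmap_KG_mult_left: "a \<in> carrier KG \<Longrightarrow> addmap KG KG (\<lambda>x. a \<otimes>\<^bsub>KG\<^esub> x)"
  by (rule addmapI) (auto simp: R.r_distr)

lemma addmap_KG_mult_right: "a \<in> carrier KG \<Longrightarrow> addmap KG KG (\<lambda>x. x \<otimes>\<^bsub>KG\<^esub> a)"
  by (rule addmapI) (auto simp: R.l_distr)

lemma mon_act:
  assumes V: "left_module KG V" and v: "v \<in> carrier V"
    and "g \<in> carrier G" "h \<in> carrier G" "k \<in> carrier K" "l \<in> carrier K"
  shows "mon g k \<odot>\<^bsub>V\<^esub> (mon h l \<odot>\<^bsub>V\<^esub> v) = mon (g \<otimes> h) (k \<otimes>\<^bsub>K\<^esub> l) \<odot>\<^bsub>V\<^esub> v"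
  using left_module.smult_assoc[OF V mon_closed[OF assms(3,5)] mon_closed[OF assms(4,6)] v]
    mon_mult[OF assms(3-6)] by simp

lemma mon_one_act:
  assumes V: "left_module KG V" and v: "v \<in> carrier V"
  shows "scal \<one>\<^bsub>K\<^esub> \<odot>\<^bsub>V\<^esub> v = v"
  using left_module.smult_one[OF V v] by (simp add: KG_one)

end

lemma fext_cong:
  assumes "abelian_group A" "\<And>y. v y \<noteq> \<zero>\<^bsub>K\<^esub> \<Longrightarrow> c y (v y) = d y (v y)"
    and "\<And>y. v y \<noteq> \<zero>\<^bsub>K\<^esub> \<Longrightarrow> d y (v y) \<in> carrier A"
  shows "fext A K c v = fext A K d v"
proof -
  interpret A: abelian_group A by fact
  show ?thesis unfolding fext_def using assms(2,3) by (intro A.finsum_cong') auto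
qed

lemma fext_zero:
  assumes "abelian_group A" "\<And>y. v y \<noteq> \<zero>\<^bsub>K\<^esub> \<Longrightarrow> c y (v y) = \<zero>\<^bsub>A\<^esub>"
  shows "fext A K c v = \<zero>\<^bsub>A\<^esub>"
proof -
  interpret A: abelian_group A by fact
  have "fext A K c v = fext A K (\<lambda>_ _. \<zero>\<^bsub>A\<^esub>) v"
    by (rule fext_cong[OF assms(1)]) (use assms(2) in auto)
  also have "\<dots> = \<zero>\<^bsub>A\<^esub>" unfolding fext_def by (rule A.finsum_zero)
  finally show ?thesis .
qed

section \<open>Subgroup algebras\<close>

locale subgroup_algebra = group_algebra K G + H: subgroup H G + S: ring "group_ring K (G\<lparr>carrier := H\<rparr>)"
  for K :: "('k, 'r) ring_scheme" and G :: "('g, 's) monoid_scheme" (structure) and H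
begin

abbreviation "KH \<equiv> group_ring K (G\<lparr>carrier := H\<rparr>)"

sublocale KHA: group_algebra K "G\<lparr>carrier := H\<rparr>"
  by (intro group_algebra.intro K.field_axioms S.ring_axioms G.subgroup_imp_group H.subgroup_axioms)

lemma KH_inv: "h \<in> H \<Longrightarrow> inv\<^bsub>G\<lparr>carrier := H\<rparr>\<^esub> h = inv h"
  by (rule G.m_inv_consistent[OF H.subgroup_axioms])

lemma KH_carrier_iff: "a \<in> carrier KH \<longleftrightarrow> a \<in> carrier KG \<and> (\<forall>g. g \<notin> H \<longrightarrow> a g = \<zero>\<^bsub>K\<^esub>)"
  unfolding KG_carrier KHA.KG_carrier using H.subset by (auto simp: free_module_carrier)

lemma KH_zero: "\<zero>\<^bsub>KH\<^esub> = \<zero>\<^bsub>KG\<^esub>"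
  by (simp add: KG_zero KHA.KG_zero)

text \<open>The part of \<open>r\<close> on the coset \<open>H c\<close>, moved to \<open>H\<close>.\<close>
definition translate :: "'g \<Rightarrow> ('g \<Rightarrow> 'k) \<Rightarrow> 'g \<Rightarrow> 'k"
  where "translate c r = (\<lambda>t. if t \<in> H then r (t \<otimes> c) else \<zero>\<^bsub>K\<^esub>)"

lemma translate_closed:
  assumes r: "r \<in> carrier KG" and c: "c \<in> carrier G"
  shows "translate c r \<in> carrier KH"
  unfolding KHA.KG_carrier
proof (rule free_moduleI)
  show "translate c r i \<in> carrier K" if "i \<in> carrier (G\<lparr>carrier := H\<rparr>)" for i
    using KG_apply[OF r] by (simp add: translate_def)
  show "translate c r i = \<zero>\<^bsub>K\<^esub>" if "i \<notin> carrier (G\<lparr>carrier := H\<rparr>)" for i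
    using that by (simp add: translate_def)
  have "inj_on (\<lambda>t. t \<otimes> c) H"
    using c H.subset by (auto simp: inj_on_def)
  moreover have "(\<lambda>t. t \<otimes> c) ` {i. translate c r i \<noteq> \<zero>\<^bsub>K\<^esub>} \<subseteq> {g. r g \<noteq> \<zero>\<^bsub>K\<^esub>}"
    by (auto simp: translate_def split: if_splits)
  moreover have "{i. translate c r i \<noteq> \<zero>\<^bsub>K\<^esub>} \<subseteq> H" by (auto simp: translate_def split: if_splits)
  ultimately show "finite {i. translate c r i \<noteq> \<zero>\<^bsub>K\<^esub>}"
    using inj_on_finite[OF inj_on_subset[of "\<lambda>t. t \<otimes> c" H "{i. translate c r i \<noteq> \<zero>\<^bsub>K\<^esub>}"]
      _ KG_finite[OF r]] by blast
qed

lemma translate_mult: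
  assumes a: "a \<in> carrier KH" and r: "r \<in> carrier KG" and s: "s \<in> H" and c: "c \<in> carrier G"
  shows "(a \<otimes>\<^bsub>KG\<^esub> r) (s \<otimes> c) = (a \<otimes>\<^bsub>KH\<^esub> translate c r) s"
proof -
  have aG: "a \<in> carrier KG" using a by (simp add: KH_carrier_iff)
  have sG: "s \<in> carrier G" using s H.subset by auto
  have "(a \<otimes>\<^bsub>KG\<^esub> r) (s \<otimes> c) = fext K K (\<lambda>h k. k \<otimes>\<^bsub>K\<^esub> r (inv h \<otimes> (s \<otimes> c))) a"
    using sG c by (intro KG_mult_fext[OF aG]) auto
  also have "\<dots> = fext K K (\<lambda>h k. k \<otimes>\<^bsub>K\<^esub> translate c r (inv\<^bsub>G\<lparr>carrier := H\<rparr>\<^esub> h \<otimes>\<^bsub>G\<lparr>carrier := H\<rparr>\<^esub> s)) a"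
  proof (rule fext_cong[OF K.abelian_group_axioms])
    fix h assume "a h \<noteq> \<zero>\<^bsub>K\<^esub>"
    then have h: "h \<in> H" "h \<in> carrier G" using a H.subset by (auto simp: KH_carrier_iff)
    then have ih: "inv h \<otimes> s \<in> H" using s by auto
    show "a h \<otimes>\<^bsub>K\<^esub> r (inv h \<otimes> (s \<otimes> c)) =
        a h \<otimes>\<^bsub>K\<^esub> translate c r (inv\<^bsub>G\<lparr>carrier := H\<rparr>\<^esub> h \<otimes>\<^bsub>G\<lparr>carrier := H\<rparr>\<^esub> s)"
      using h sG c ih by (simp add: translate_def KH_inv G.m_assoc)
    show "a h \<otimes>\<^bsub>K\<^esub> translate c r (inv\<^bsub>G\<lparr>carrier := H\<rparr>\<^esub> h \<otimes>\<^bsub>G\<lparr>carrier := H\<rparr>\<^esub> s) \<in> carrier K"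
      using KG_apply[OF aG] KG_apply[OF r] by (simp add: translate_def)
  qed
  also have "\<dots> = (a \<otimes>\<^bsub>KH\<^esub> translate c r) s"
    using s by (intro KHA.KG_mult_fext[OF a, symmetric]) simp
  finally show ?thesis .
qed

lemma KH_mult:
  assumes a: "a \<in> carrier KH" and b: "b \<in> carrier KH"
  shows "a \<otimes>\<^bsub>KH\<^esub> b = a \<otimes>\<^bsub>KG\<^esub> b"
proof
  fix s
  have G: "a \<in> carrier KG" "b \<in> carrier KG" using a b by (auto simp: KH_carrier_iff)
  show "(a \<otimes>\<^bsub>KH\<^esub> b) s = (a \<otimes>\<^bsub>KG\<^esub> b) s"
  proof (cases "s \<in> H")
    case True
    have "translate \<one> b = b"
      using b H.subset by (auto simp: translate_def fun_eq_iff KH_carrier_iff)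
    then show ?thesis using translate_mult[OF a G(2) True G.one_closed] True H.subset by auto
  next
    case False
    have 1: "(a \<otimes>\<^bsub>KH\<^esub> b) s = \<zero>\<^bsub>K\<^esub>" using False by (simp add: KHA.KG_mult)
    show ?thesis
    proof (cases "s \<in> carrier G")
      case True
      have "(a \<otimes>\<^bsub>KG\<^esub> b) s = \<zero>\<^bsub>K\<^esub>"
        unfolding KG_mult_fext[OF G(1) True]
      proof (rule fext_zero[OF K.abelian_group_axioms])
        fix h assume "a h \<noteq> \<zero>\<^bsub>K\<^esub>"
        then have h: "h \<in> H" "h \<in> carrier G" using a H.subset by (auto simp: KH_carrier_iff)
        have "inv h \<otimes> s \<notin> H"
        proof
          assume "inv h \<otimes> s \<in> H"
          then have "h \<otimes> (inv h \<otimes> s) \<in> H" using h by auto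
          then show False using False h True by (simp add: G.m_assoc[symmetric])
        qed
        then show "a h \<otimes>\<^bsub>K\<^esub> b (inv h \<otimes> s) = \<zero>\<^bsub>K\<^esub>"
          using b KG_apply[OF G(1)] by (simp add: KH_carrier_iff)
      qed
      then show ?thesis using 1 by simp
    next
      case False
      then show ?thesis using 1 by (simp add: KG_mult)
    qed
  qed
qed

text \<open>A linear combination over the subgroup algebra is computed coset by coset.\<close>
lemma translate_lin:
  assumes r: "\<And>i. i \<in> I \<Longrightarrow> r i \<in> carrier KG" and a: "a \<in> carrier (free_module KH I)"
    and s: "s \<in> H" and c: "c \<in> carrier G"
  shows "lin KG (left_regular KG) r a (s \<otimes> c) = lin KH (left_regular KH) (\<lambda>i. translate c (r i)) a s"
proof -
  interpret L: left_module KG "left_regular KG" by (rule left_module_left_regular[OF KG_ring])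
  interpret LH: left_module KH "left_regular KH" by (rule left_module_left_regular[OF KHA.KG_ring])
  have inc: "addmap (free_module KH I) (free_module KG I) (\<lambda>x. x)"
  proof (rule addmapI)
    fix x assume x: "x \<in> carrier (free_module KH I)"
    show "x \<in> carrier (free_module KG I)"
      using x by (auto simp: free_module_carrier KH_carrier_iff KH_zero)
  qed (simp add: KG_add KHA.KG_add)
  have m: "monomial KH i x = monomial KG i x" for i :: 'c and x by (auto simp: monomial_def KH_zero fun_eq_iff)
  have e1: "addmap (left_regular KG) K (\<lambda>x. x (s \<otimes> c))"
    using addmap_KG_apply by (simp add: addmap_def)
  have e2: "addmap (left_regular KH) K (\<lambda>x. x s)"
    using KHA.addmap_KG_apply by (simp add: addmap_def)
  have l1: "addmap (free_module KG I) (left_regular KG) (lin KG (left_regular KG) r)"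
    by (rule L.lin_addmap) (simp add: r)
  have l2: "addmap (free_module KH I) (left_regular KH) (lin KH (left_regular KH) (\<lambda>i. translate c (r i)))"
    by (rule LH.lin_addmap) (simp add: r translate_closed c)
  show ?thesis
  proof (rule addmap_free_eqI[OF KHA.KG_ring K.abelian_group_axioms
        addmap_comp[OF addmap_comp[OF inc l1] e1] addmap_comp[OF l2 e2] _ a])
    fix i x assume i: "i \<in> I" and x: "x \<in> carrier KH"
    have "lin KG (left_regular KG) r (monomial KG i x) = x \<otimes>\<^bsub>KG\<^esub> r i"
      using L.lin_monomial_coeff[of I r i x] r i x by (simp add: KH_carrier_iff)
    moreover have "lin KH (left_regular KH) (\<lambda>i. translate c (r i)) (monomial KH i x) = x \<otimes>\<^bsub>KH\<^esub> translate c (r i)"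
      using LH.lin_monomial_coeff[of I "\<lambda>i. translate c (r i)" i x] r i x c by (simp add: translate_closed)
    ultimately show "lin KG (left_regular KG) r (monomial KH i x) (s \<otimes> c) =
        lin KH (left_regular KH) (\<lambda>i. translate c (r i)) (monomial KH i x) s"
      using translate_mult[OF x r[OF i] s c] by (simp add: m)
  qed
qed

lemma free_KH_subset: "a \<in> carrier (free_module KH I) \<Longrightarrow> a \<in> carrier (free_module KG I)"
  by (auto simp: free_module_carrier KH_carrier_iff KH_zero)

lemma lspan_KH_subset:
  assumes E: "E \<subseteq> carrier (free_module KH I)" and a: "a \<in> lspan KH (free_module KH I) E"
  shows "a \<in> lspan KG (free_module KG J) E"
  using a
proof (induction rule: lspan.induct)
  case zero
  show ?case using lspan.zero[of "free_module KG J" KG E] by (simp add: KH_zero)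
next
  case (step b s v)
  have s: "s i \<in> carrier KH" for i
    by (rule free_module_component[OF KHA.KG_ring subsetD[OF E step(2)]])
  have "(\<lambda>i. (b \<otimes>\<^bsub>KH\<^esub> s i) \<oplus>\<^bsub>KH\<^esub> v i) = (\<lambda>i. (b \<otimes>\<^bsub>KG\<^esub> s i) \<oplus>\<^bsub>KG\<^esub> v i)"
    using KH_mult[OF step(1) s] by (simp add: KG_add KHA.KG_add)
  then show ?case
    using lspan.step[of b KG s E v "free_module KG J"] step by (simp add: KH_carrier_iff)
qed

text \<open>Over the subgroup algebra, \<open>KG\<close> is a free left module with one basis element for each coset, and
  finitely many elements involve only finitely many cosets.  So they are vectors in a free module of
  finite rank.\<close>
lemma coherent_subgroup_relations:
  assumes coh: "coherent_ring KH" and I: "finite I" and r: "\<And>i. i \<in> I \<Longrightarrow> r i \<in> carrier KG"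
  shows "\<exists>E. finite E \<and> E \<subseteq> {a \<in> carrier (free_module KH I). lin KG (left_regular KG) r a = \<zero>\<^bsub>KG\<^esub>} \<and>
     {a \<in> carrier (free_module KH I). lin KG (left_regular KG) r a = \<zero>\<^bsub>KG\<^esub>} \<subseteq> lspan KH (free_module KH I) E"
proof -
  interpret L: left_module KG "left_regular KG" by (rule left_module_left_regular[OF KG_ring])
  interpret LH: left_module KH "left_regular KH" by (rule left_module_left_regular[OF KHA.KG_ring])
  define C where "C = (\<Union>i\<in>I. {g. r i g \<noteq> \<zero>\<^bsub>K\<^esub>})"
  have C: "finite C" unfolding C_def by (intro finite_UN_I I KG_finite r)
  have CG: "C \<subseteq> carrier G" unfolding C_def using KG_outside r by blast
  let ?r = "\<lambda>i c. if c \<in> carrier G then translate c (r i) else \<zero>\<^bsub>KH\<^esub>"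
  let ?N = "{a \<in> carrier (free_module KH I). lin KG (left_regular KG) r a = \<zero>\<^bsub>KG\<^esub>}"
  have rc: "?r i c \<in> carrier KH" if "i \<in> I" for i c using r[OF that] by (simp add: translate_closed)
  have lc: "lin KG (left_regular KG) r a \<in> carrier KG" if "a \<in> carrier (free_module KH I)" for a
    using L.lin_closed[of I r a] r free_KH_subset[OF that] by simp
  have tl: "lin KG (left_regular KG) r a (s \<otimes> c) = lin KH (left_regular KH) (\<lambda>i. ?r i c) a s"
    if "a \<in> carrier (free_module KH I)" "s \<in> H" "c \<in> carrier G" for a s c
    using translate_lin[of I r a s c, OF r that] that(3) by simp
  have eq: "carrier (free_module KH I) \<inter> (\<Inter>c\<in>C. rel KH (left_regular KH) I (\<lambda>i. ?r i c)) = ?N"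
  proof (intro equalityI subsetI)
    fix a assume a: "a \<in> carrier (free_module KH I) \<inter> (\<Inter>c\<in>C. rel KH (left_regular KH) I (\<lambda>i. ?r i c))"
    then have ac: "a \<in> carrier (free_module KH I)" by blast
    have "lin KG (left_regular KG) r a g = \<zero>\<^bsub>K\<^esub>" for g
    proof (cases "g \<in> carrier G")
      case False
      then show ?thesis using KG_outside[OF lc[OF ac]] by blast
    next
      case True
      show ?thesis
      proof (cases "\<exists>s\<in>H. \<exists>c\<in>C. g = s \<otimes> c")
        case True
        then obtain s c where s: "s \<in> H" "c \<in> C" "g = s \<otimes> c" by blast
        have "lin KH (left_regular KH) (\<lambda>i. ?r i c) a = \<zero>\<^bsub>KH\<^esub>" using a s(2) by (simp add: rel_def)
        then show ?thesis using tl[OF ac s(1)] s CG by (auto simp: KHA.KG_zero)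
      next
        case False
        have rz: "?r i g = \<zero>\<^bsub>KH\<^esub>" if i: "i \<in> I" for i
        proof -
          have "r i (t \<otimes> g) = \<zero>\<^bsub>K\<^esub>" if t: "t \<in> H" for t
          proof (rule ccontr)
            assume "r i (t \<otimes> g) \<noteq> \<zero>\<^bsub>K\<^esub>"
            then have "t \<otimes> g \<in> C" using i by (auto simp: C_def)
            moreover have "g = inv t \<otimes> (t \<otimes> g)"
              using t True H.subset by (auto simp: G.m_assoc[symmetric])
            moreover have "inv t \<in> H" using t by simp
            ultimately show False using False by blast
          qed
          then show ?thesis using True by (auto simp: translate_def KHA.KG_zero)
        qed
        have "lin KH (left_regular KH) (\<lambda>i. ?r i g) a = \<zero>\<^bsub>left_regular KH\<^esub>"
          unfolding lin_def
        proof (rule fext_zero[OF LH.M_group])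
          fix i assume "a i \<noteq> \<zero>\<^bsub>KH\<^esub>"
          then have "i \<in> I" using free_module_outside[OF ac] by blast
          show "a i \<odot>\<^bsub>left_regular KH\<^esub> ?r i g = \<zero>\<^bsub>left_regular KH\<^esub>"
            unfolding rz[OF \<open>i \<in> I\<close>] left_regular_simps
            by (intro S.r_null free_module_component[OF KHA.KG_ring ac])
        qed
        then have z: "lin KH (left_regular KH) (\<lambda>i. ?r i g) a = \<zero>\<^bsub>KH\<^esub>" by (simp only: left_regular_simps)
        have "lin KG (left_regular KG) r a (\<one> \<otimes> g) = \<zero>\<^bsub>K\<^esub>"
          unfolding tl[OF ac H.one_closed True] z by (simp add: KHA.KG_zero)
        then show ?thesis using True by simp
      qed
    qed
    then show "a \<in> ?N" using ac by (auto simp: KG_zero)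
  next
    fix a assume a: "a \<in> ?N"
    then have ac: "a \<in> carrier (free_module KH I)" by blast
    have "lin KH (left_regular KH) (\<lambda>i. ?r i c) a = \<zero>\<^bsub>KH\<^esub>" if c: "c \<in> C" for c
    proof
      fix s
      have lcH: "lin KH (left_regular KH) (\<lambda>i. ?r i c) a \<in> carrier KH"
        using LH.lin_closed[of I "\<lambda>i. ?r i c" a] rc ac by simp
      show "lin KH (left_regular KH) (\<lambda>i. ?r i c) a s = \<zero>\<^bsub>KH\<^esub> s"
      proof (cases "s \<in> H")
        case True
        have "lin KG (left_regular KG) r a (s \<otimes> c) = \<zero>\<^bsub>K\<^esub>" using a by (simp add: KG_zero)
        then show ?thesis using tl[OF ac True] c CG by (auto simp: KHA.KG_zero)
      next
        case False
        then show ?thesis using KHA.KG_outside[OF lcH] by (simp add: KHA.KG_zero)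
      qed
    qed
    then show "a \<in> carrier (free_module KH I) \<inter> (\<Inter>c\<in>C. rel KH (left_regular KH) I (\<lambda>i. ?r i c))"
      using ac by (simp add: rel_def)
  qed
  show ?thesis
    using coherent_relations_finite_rank[OF coh I C, of ?r, OF rc] unfolding eq fgen_def .
qed

end

section \<open>Group pairs: permutation modules with coefficients\<close>

locale pair_algebra = group_algebra K G + A: group_action G X \<phi>
  for K :: "('k, 'r) ring_scheme" and G :: "('g, 's) monoid_scheme" (structure)
    and X :: "'x set" and \<phi> :: "'g \<Rightarrow> 'x \<Rightarrow> 'x"
begin

abbreviation "KX \<equiv> free_module K X"
abbreviation "W \<equiv> free_module KG X"

lemma W_module: "left_module KG W"
  by (rule left_module_free[OF KG_ring])

lemma W_group: "abelian_group W"
  by (rule abelian_group_free[OF KG_ring])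

lemma KX_group: "abelian_group KX"
  by (rule abelian_group_free[OF K_ring])

lemma LKG_module: "left_module KG (left_regular KG)"
  by (rule left_module_left_regular[OF KG_ring])

lemma act_closed [simp]: "g \<in> carrier G \<Longrightarrow> x \<in> X \<Longrightarrow> \<phi> g x \<in> X"
  using A.element_image by blast

lemma act_mult: "x \<in> X \<Longrightarrow> g \<in> carrier G \<Longrightarrow> h \<in> carrier G \<Longrightarrow> \<phi> (g \<otimes> h) x = \<phi> g (\<phi> h x)"
  by (rule A.composition_rule)

lemma act_one [simp]: "x \<in> X \<Longrightarrow> \<phi> \<one> x = x"
  using A.id_eq_one by (metis restrict_apply')

lemma act_inv1 [simp]: "x \<in> X \<Longrightarrow> g \<in> carrier G \<Longrightarrow> \<phi> (inv g) (\<phi> g x) = x"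
  by (metis G.inv_closed G.l_inv act_mult act_one)

lemma act_inv2 [simp]: "x \<in> X \<Longrightarrow> g \<in> carrier G \<Longrightarrow> \<phi> g (\<phi> (inv g) x) = x"
  by (metis G.inv_closed G.r_inv act_mult act_one)

text \<open>The tensor \<open>w \<otimes> m\<close> in \<open>K[X] \<otimes> KG\<close> with the diagonal action.  Since \<open>g (x \<otimes> 1) = g x \<otimes> g\<close>, this module
  is free on the \<open>x \<otimes> 1\<close>, and is represented by \<open>W\<close>: the coefficient of \<open>g\<close> at the basis element
  \<open>x\<close> is that of \<open>g x \<otimes> g\<close>.  All submodules \<open>K[X] \<otimes> I\<close> and \<open>\<omega> \<otimes> I\<close> live in \<open>W\<close>.\<close>
definition tens :: "('x \<Rightarrow> 'k) \<Rightarrow> ('g \<Rightarrow> 'k) \<Rightarrow> 'x \<Rightarrow> 'g \<Rightarrow> 'k"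
  where "tens w m = (\<lambda>x g. if x \<in> X \<and> g \<in> carrier G then w (\<phi> g x) \<otimes>\<^bsub>K\<^esub> m g else \<zero>\<^bsub>K\<^esub>)"

lemma KX_apply: "w \<in> carrier KX \<Longrightarrow> w x \<in> carrier K"
  by (rule free_module_component[OF K_ring])

lemma tens_closed:
  assumes w: "w \<in> carrier KX" and m: "m \<in> carrier KG"
  shows "tens w m \<in> carrier W"
proof (rule free_moduleI)
  fix x assume x: "x \<in> X"
  show "tens w m x \<in> carrier KG"
    unfolding KG_carrier
  proof (rule free_moduleI)
    show "finite {i. tens w m x i \<noteq> \<zero>\<^bsub>K\<^esub>}"
      by (rule finite_subset[OF _ KG_finite[OF m]]) (use KX_apply[OF w] in \<open>auto simp: tens_def\<close>)
  qed (use KX_apply[OF w] KG_apply[OF m] x in \<open>auto simp: tens_def\<close>)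
next
  fix x assume "x \<notin> X"
  then show "tens w m x = \<zero>\<^bsub>KG\<^esub>" by (auto simp: tens_def KG_zero)
next
  let ?S = "\<Union>g\<in>{g. m g \<noteq> \<zero>\<^bsub>K\<^esub>}. (\<lambda>y. \<phi> (inv g) y) ` {y. w y \<noteq> \<zero>\<^bsub>K\<^esub>}"
  have "finite ?S" using KG_finite[OF m] free_module_finite[OF w] by blast
  moreover have "{x. tens w m x \<noteq> \<zero>\<^bsub>KG\<^esub>} \<subseteq> ?S"
  proof
    fix x assume "x \<in> {x. tens w m x \<noteq> \<zero>\<^bsub>KG\<^esub>}"
    then obtain g where "tens w m x g \<noteq> \<zero>\<^bsub>K\<^esub>" by (auto simp: KG_zero fun_eq_iff)
    then have g: "x \<in> X" "g \<in> carrier G" "w (\<phi> g x) \<otimes>\<^bsub>K\<^esub> m g \<noteq> \<zero>\<^bsub>K\<^esub>" by (auto simp: tens_def split: if_splits)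
    then have "m g \<noteq> \<zero>\<^bsub>K\<^esub>" "w (\<phi> g x) \<noteq> \<zero>\<^bsub>K\<^esub>" using KX_apply[OF w] KG_apply[OF m] by auto
    moreover have "x = \<phi> (inv g) (\<phi> g x)" using g by simp
    ultimately show "x \<in> ?S" by blast
  qed
  ultimately show "finite {x. tens w m x \<noteq> \<zero>\<^bsub>KG\<^esub>}" by (rule finite_subset[rotated])
qed

lemma addmap_tens_left: "m \<in> carrier KG \<Longrightarrow> addmap KX W (\<lambda>w. tens w m)"
  by (rule addmapI) (auto simp: tens_closed, auto simp: tens_def KG_add fun_eq_iff KX_apply KG_apply K.l_distr)

lemma addmap_tens_right: "w \<in> carrier KX \<Longrightarrow> addmap KG W (\<lambda>m. tens w m)"
  by (rule addmapI) (auto simp: tens_closed, auto simp: tens_def KG_add fun_eq_iff KX_apply KG_apply K.r_distr)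

text \<open>The action of \<open>k h\<close> on \<open>K[X]\<close>.\<close>
definition move :: "'g \<Rightarrow> 'k \<Rightarrow> ('x \<Rightarrow> 'k) \<Rightarrow> 'x \<Rightarrow> 'k"
  where "move h k w = (\<lambda>x. if x \<in> X then k \<otimes>\<^bsub>K\<^esub> w (\<phi> (inv h) x) else \<zero>\<^bsub>K\<^esub>)"

lemma mon_tens:
  assumes "h \<in> carrier G" "k \<in> carrier K" "l \<in> carrier K" and w: "w \<in> carrier KX" and m: "m \<in> carrier KG"
  shows "mon h (k \<otimes>\<^bsub>K\<^esub> l) \<odot>\<^bsub>W\<^esub> tens w m = tens (move h k w) (mon h l \<otimes>\<^bsub>KG\<^esub> m)"
proof (intro ext)
  fix x g
  have kl: "k \<otimes>\<^bsub>K\<^esub> l \<in> carrier K" using assms by simp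
  show "(mon h (k \<otimes>\<^bsub>K\<^esub> l) \<odot>\<^bsub>W\<^esub> tens w m) x g = tens (move h k w) (mon h l \<otimes>\<^bsub>KG\<^esub> m) x g"
  proof (cases "x \<in> X \<and> g \<in> carrier G")
    case True
    have tc: "tens w m x \<in> carrier KG" using free_module_component[OF KG_ring tens_closed[OF w m]] .
    have "(mon h (k \<otimes>\<^bsub>K\<^esub> l) \<odot>\<^bsub>W\<^esub> tens w m) x g = (k \<otimes>\<^bsub>K\<^esub> l) \<otimes>\<^bsub>K\<^esub> tens w m x (inv h \<otimes> g)"
      using mon_mult_apply[OF assms(1) kl tc] True by simp
    also have "\<dots> = (k \<otimes>\<^bsub>K\<^esub> w (\<phi> (inv h) (\<phi> g x))) \<otimes>\<^bsub>K\<^esub> (l \<otimes>\<^bsub>K\<^esub> m (inv h \<otimes> g))"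
      using True assms(1-3) KX_apply[OF w] KG_apply[OF m]
      by (simp add: tens_def act_mult K.m_ac)
    also have "\<dots> = tens (move h k w) (mon h l \<otimes>\<^bsub>KG\<^esub> m) x g"
      using True mon_mult_apply[OF assms(1,3) m] by (simp add: tens_def move_def)
    finally show ?thesis .
  next
    case False
    let ?v = "mon h (k \<otimes>\<^bsub>K\<^esub> l) \<odot>\<^bsub>W\<^esub> tens w m"
    have vc: "?v \<in> carrier W"
      by (rule left_module.smult_closed[OF W_module mon_closed[OF assms(1) kl] tens_closed[OF w m]])
    have "?v x g = \<zero>\<^bsub>K\<^esub>"
    proof (cases "x \<in> X")
      case True
      then show ?thesis using False KG_outside[OF free_module_component[OF KG_ring vc]] by blast
    next
      case False
      show ?thesis using free_module_outside[OF vc False] by (simp only: KG_zero)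
    qed
    moreover have "tens (move h k w) (mon h l \<otimes>\<^bsub>KG\<^esub> m) x g = \<zero>\<^bsub>K\<^esub>"
      using False by (auto simp: tens_def)
    ultimately show ?thesis by (simp only:)
  qed
qed

lemma tens_monomial:
  assumes "y \<in> X" "g \<in> carrier G" "k \<in> carrier K" "c \<in> carrier K"
  shows "tens (monomial K y k) (mon g c) = monomial KG (\<phi> (inv g) y) (mon g (k \<otimes>\<^bsub>K\<^esub> c))"
  using assms by (auto simp: tens_def monomial_def fun_eq_iff KG_zero)

definition aug :: "('x \<Rightarrow> 'k) \<Rightarrow> 'k"
  where "aug = fext K K (\<lambda>_ k. k)"

lemma addmap_aug: "addmap KX K aug"
  unfolding aug_def by (rule addmap_fext[OF K_ring K.abelian_group_axioms addmap_id])

lemma aug_monomial: "y \<in> X \<Longrightarrow> k \<in> carrier K \<Longrightarrow> aug (monomial K y k) = k"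
  unfolding aug_def by (rule fext_monomial[OF K_ring K.abelian_group_axioms addmap_id])

lemma augmentation_eq: "w \<in> carrier KX \<Longrightarrow> augmentation K X w = aug w"
proof -
  assume w: "w \<in> carrier KX"
  have "{x \<in> X. w x \<noteq> \<zero>\<^bsub>K\<^esub>} = {x. w x \<noteq> \<zero>\<^bsub>K\<^esub>}" using free_module_outside[OF w] by auto
  then show ?thesis by (simp add: augmentation_def aug_def fext_def)
qed

text \<open>The map \<open>K[X] \<otimes> KG \<rightarrow> KG\<close> given by the augmentation of \<open>K[X]\<close>.\<close>
definition total :: "('x \<Rightarrow> 'g \<Rightarrow> 'k) \<Rightarrow> 'g \<Rightarrow> 'k"
  where "total = lin KG (left_regular KG) (\<lambda>_. \<one>\<^bsub>KG\<^esub>)"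

lemma total_hom: "total \<in> lmod_hom KG W (left_regular KG)"
  unfolding total_def by (rule left_module.lin_hom[OF LKG_module]) simp

lemma total_monomial: "x \<in> X \<Longrightarrow> a \<in> carrier KG \<Longrightarrow> total (monomial KG x a) = a"
  unfolding total_def using left_module.lin_monomial_coeff[OF LKG_module, of X "\<lambda>_. \<one>\<^bsub>KG\<^esub>" x a] by simp

lemma total_addmap: "addmap W KG total"
  using lmod_hom_addmap[OF total_hom] by (simp add: addmap_def)

lemma total_tens:
  assumes w: "w \<in> carrier KX" and m: "m \<in> carrier KG"
  shows "total (tens w m) = scal (aug w) \<otimes>\<^bsub>KG\<^esub> m"
proof (rule addmap_free_eqI[OF K_ring R.abelian_group_axioms _ _ _ w])
  show "addmap KX KG (\<lambda>w. total (tens w m))"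
    by (rule addmap_comp[OF addmap_tens_left[OF m] total_addmap])
  show "addmap KX KG (\<lambda>w. scal (aug w) \<otimes>\<^bsub>KG\<^esub> m)"
    by (rule addmap_comp[OF addmap_comp[OF addmap_aug addmap_mon[OF G.one_closed]] addmap_KG_mult_right[OF m]])
  fix y k assume y: "y \<in> X" and k: "k \<in> carrier K"
  have yk: "monomial K y k \<in> carrier KX" by (rule monomial_closed[OF K_ring y k])
  have mk: "scal k \<in> carrier KG" using k by (simp add: mon_closed)
  show "total (tens (monomial K y k) m) = scal (aug (monomial K y k)) \<otimes>\<^bsub>KG\<^esub> m"
    unfolding aug_monomial[OF y k]
  proof (rule addmap_KG_eqI[OF R.abelian_group_axioms addmap_comp[OF addmap_tens_right[OF yk] total_addmap]
        addmap_KG_mult_left[OF mk] _ m])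
    fix g c assume g: "g \<in> carrier G" and c: "c \<in> carrier K"
    have "total (tens (monomial K y k) (mon g c)) = mon g (k \<otimes>\<^bsub>K\<^esub> c)"
      using y g k c by (simp add: tens_monomial total_monomial mon_closed)
    then show "total (tens (monomial K y k) (mon g c)) = scal k \<otimes>\<^bsub>KG\<^esub> mon g c"
      using g k c by (simp add: mon_mult)
  qed
qed

abbreviation pt :: "'x \<Rightarrow> 'x \<Rightarrow> 'k" where "pt y \<equiv> monomial K y \<one>\<^bsub>K\<^esub>"

lemma pt_closed: "y \<in> X \<Longrightarrow> pt y \<in> carrier KX"
  by (rule monomial_closed[OF K_ring]) auto

lemma move_pt:
  assumes "h \<in> carrier G" "y \<in> X" "k \<in> carrier K"
  shows "move h k (pt y) = monomial K (\<phi> h y) k"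
  using assms by (auto simp: move_def monomial_def fun_eq_iff)

section \<open>Relations over the stabilisers\<close>

text \<open>The part of a combination of the \<open>y\<^sub>i \<otimes> r\<^sub>i\<close> whose terms lie in \<open>z \<otimes> KG\<close>.\<close>
definition cut :: "('i \<Rightarrow> 'x) \<Rightarrow> 'x \<Rightarrow> ('i \<Rightarrow> 'g \<Rightarrow> 'k) \<Rightarrow> 'i \<Rightarrow> 'g \<Rightarrow> 'k"
  where "cut y z a = (\<lambda>i g. if g \<in> carrier G \<and> \<phi> g (y i) = z then a i g else \<zero>\<^bsub>K\<^esub>)"

lemma cut_closed:
  assumes a: "a \<in> carrier (free_module KG I)"
  shows "cut y z a \<in> carrier (free_module KG I)"
proof (rule free_moduleI)
  fix i assume "i \<in> I"
  have ai: "a i \<in> carrier KG" by (rule free_module_component[OF KG_ring a])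
  show "cut y z a i \<in> carrier KG"
    unfolding KG_carrier
  proof (rule free_moduleI)
    show "finite {g. cut y z a i g \<noteq> \<zero>\<^bsub>K\<^esub>}"
      by (rule finite_subset[OF _ KG_finite[OF ai]]) (auto simp: cut_def)
  qed (use KG_apply[OF ai] in \<open>auto simp: cut_def\<close>)
next
  fix i assume "i \<notin> I"
  then show "cut y z a i = \<zero>\<^bsub>KG\<^esub>"
    using free_module_outside[OF a] by (auto simp: cut_def KG_zero)
next
  show "finite {i. cut y z a i \<noteq> \<zero>\<^bsub>KG\<^esub>}"
    by (rule finite_subset[OF _ free_module_finite[OF a]]) (auto simp: cut_def KG_zero)
qed

lemma addmap_cut: "addmap (free_module KG I) (free_module KG I) (cut y z)"
  by (rule addmapI) (auto simp: cut_closed, auto simp: cut_def KG_add fun_eq_iff)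

lemma cut_monomial:
  assumes "h \<in> carrier G" "c \<in> carrier K"
  shows "cut y z (monomial KG i (mon h c)) = (if \<phi> h (y i) = z then monomial KG i (mon h c) else (\<lambda>_. \<zero>\<^bsub>KG\<^esub>))"
  using assms by (auto simp: cut_def monomial_def fun_eq_iff KG_zero)

text \<open>A combination of the \<open>y\<^sub>i \<otimes> r\<^sub>i\<close> is computed separately at each point of \<open>X\<close>, and in the part
  \<open>z \<otimes> KG\<close> it is the combination of the \<open>r\<^sub>i\<close> with the same coefficients.\<close>
lemma lin_tens:
  assumes y: "\<And>i. i \<in> I \<Longrightarrow> y i \<in> X" and r: "\<And>i. i \<in> I \<Longrightarrow> r i \<in> carrier KG"
    and a: "a \<in> carrier (free_module KG I)" and x: "x \<in> X" and g: "g \<in> carrier G"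
  shows "lin KG W (\<lambda>i. tens (pt (y i)) (r i)) a x g =
     lin KG (left_regular KG) r (cut y (\<phi> g x) a) g"
proof -
  interpret Wm: left_module KG W by (rule W_module)
  interpret L: left_module KG "left_regular KG" by (rule LKG_module)
  let ?t = "\<lambda>i. tens (pt (y i)) (r i)"
  have t: "?t i \<in> carrier W" if "i \<in> I" for i using tens_closed pt_closed y r that by simp
  have e1: "addmap W K (\<lambda>v. v x g)"
    using addmap_comp[OF addmap_component[OF KG_ring] addmap_KG_apply] .
  have e2: "addmap (left_regular KG) K (\<lambda>v. v g)"
    using addmap_KG_apply by (simp add: addmap_def)
  have l1: "addmap (free_module KG I) W (lin KG W ?t)" by (rule Wm.lin_addmap[OF t])
  have l2: "addmap (free_module KG I) (left_regular KG) (lin KG (left_regular KG) r)"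
    by (rule L.lin_addmap) (simp add: r)
  have z: "lin KG (left_regular KG) r (\<lambda>_. \<zero>\<^bsub>KG\<^esub>) = \<zero>\<^bsub>KG\<^esub>"
    using addmap_zero[OF l2 abelian_group_free[OF KG_ring] L.M_group] by simp
  show ?thesis
  proof (rule addmap_free_KG_eqI[OF K.abelian_group_axioms addmap_comp[OF l1 e1]
        addmap_comp[OF addmap_comp[OF addmap_cut l2] e2] _ a])
    fix i h c assume i: "i \<in> I" and h: "h \<in> carrier G" and c: "c \<in> carrier K"
    note mc = mon_closed[OF h c]
    have hg: "inv h \<otimes> g \<in> carrier G" using h g by simp
    have "lin KG W ?t (monomial KG i (mon h c)) = mon h c \<odot>\<^bsub>W\<^esub> ?t i"
      by (rule Wm.lin_monomial_coeff[OF t i mc])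
    then have "lin KG W ?t (monomial KG i (mon h c)) x g = (mon h c \<otimes>\<^bsub>KG\<^esub> ?t i x) g" by simp
    also have "\<dots> = c \<otimes>\<^bsub>K\<^esub> ?t i x (inv h \<otimes> g)"
      by (rule mon_mult_apply[OF h c free_module_component[OF KG_ring t[OF i]] g])
    also have "?t i x (inv h \<otimes> g) = (if \<phi> h (y i) = \<phi> g x then r i (inv h \<otimes> g) else \<zero>\<^bsub>K\<^esub>)"
    proof -
      have "\<phi> (inv h) (\<phi> g x) = y i \<longleftrightarrow> \<phi> h (y i) = \<phi> g x"
        using act_inv1[OF y[OF i] h] act_inv2[OF act_closed[OF g x] h] by metis
      then show ?thesis using x hg g h KG_apply[OF r[OF i]] by (simp add: tens_def monomial_def act_mult)
    qed
    also have "c \<otimes>\<^bsub>K\<^esub> \<dots> = (if \<phi> h (y i) = \<phi> g x then c \<otimes>\<^bsub>K\<^esub> r i (inv h \<otimes> g) else \<zero>\<^bsub>K\<^esub>)"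
      using c by simp
    also have "\<dots> = lin KG (left_regular KG) r (cut y (\<phi> g x) (monomial KG i (mon h c))) g"
    proof (cases "\<phi> h (y i) = \<phi> g x")
      case True
      have "lin KG (left_regular KG) r (monomial KG i (mon h c)) = mon h c \<otimes>\<^bsub>KG\<^esub> r i"
        using L.lin_monomial_coeff[of I r i "mon h c"] r i mc by simp
      then show ?thesis
        using True cut_monomial[OF h c, of y "\<phi> g x" i] mon_mult_apply[OF h c r[OF i] g] by simp
    next
      case False
      then show ?thesis using cut_monomial[OF h c, of y "\<phi> g x" i] z by (simp add: KG_zero)
    qed
    finally show "lin KG W ?t (monomial KG i (mon h c)) x g =
       lin KG (left_regular KG) r (cut y (\<phi> g x) (monomial KG i (mon h c))) g" .
  qed
qed

lemma lin_tens_zero_iff: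
  assumes y: "\<And>i. i \<in> I \<Longrightarrow> y i \<in> X" and r: "\<And>i. i \<in> I \<Longrightarrow> r i \<in> carrier KG"
    and a: "a \<in> carrier (free_module KG I)"
  shows "lin KG W (\<lambda>i. tens (pt (y i)) (r i)) a = \<zero>\<^bsub>W\<^esub> \<longleftrightarrow>
     (\<forall>z\<in>X. lin KG (left_regular KG) r (cut y z a) = \<zero>\<^bsub>KG\<^esub>)"
    (is "?l a = _ \<longleftrightarrow> _")
proof -
  interpret Wm: left_module KG W by (rule W_module)
  interpret L: left_module KG "left_regular KG" by (rule LKG_module)
  note key = lin_tens[of I y r a, OF y r a]
  have lc: "lin KG (left_regular KG) r (cut y z a) \<in> carrier KG" for z
    using L.lin_closed[of I r "cut y z a"] r cut_closed[OF a] by simp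
  have tc: "?l a \<in> carrier W"
    by (rule Wm.lin_closed[OF _ a]) (intro tens_closed pt_closed y r)
  show ?thesis
  proof
    assume z0: "?l a = \<zero>\<^bsub>W\<^esub>"
    show "\<forall>z\<in>X. lin KG (left_regular KG) r (cut y z a) = \<zero>\<^bsub>KG\<^esub>"
    proof
      fix z assume z: "z \<in> X"
      show "lin KG (left_regular KG) r (cut y z a) = \<zero>\<^bsub>KG\<^esub>"
      proof
        fix g
        show "lin KG (left_regular KG) r (cut y z a) g = \<zero>\<^bsub>KG\<^esub> g"
        proof (cases "g \<in> carrier G")
          case True
          have "?l a (\<phi> (inv g) z) g = lin KG (left_regular KG) r (cut y z a) g"
            using key[of "\<phi> (inv g) z" g] True z by simp
          then show ?thesis using z0 by (simp add: KG_zero)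
        next
          case False
          then show ?thesis using KG_outside[OF lc] by (simp add: KG_zero)
        qed
      qed
    qed
  next
    assume z: "\<forall>z\<in>X. lin KG (left_regular KG) r (cut y z a) = \<zero>\<^bsub>KG\<^esub>"
    show "?l a = \<zero>\<^bsub>W\<^esub>"
    proof (intro ext)
      fix x g
      show "?l a x g = \<zero>\<^bsub>W\<^esub> x g"
      proof (cases "x \<in> X \<and> g \<in> carrier G")
        case True
        then show ?thesis using key[of x g] z by (simp add: KG_zero)
      next
        case False
        then show ?thesis
          using free_module_outside[OF tc, of x] KG_outside[OF free_module_component[OF KG_ring tc]]
          by (auto simp: KG_zero)
      qed
    qed
  qed
qed

lemma cut_cut: "cut y z (cut y z' a) = (if z = z' then cut y z a else (\<lambda>_. \<zero>\<^bsub>KG\<^esub>))"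
  by (auto simp: cut_def fun_eq_iff KG_zero)

text \<open>Relations split into their parts at the points \<open>z\<close> of \<open>X\<close>.  A part at \<open>z\<close> involves only the \<open>y\<^sub>i\<close> in the
  orbit of \<open>z\<close>, which are all equal; translated from \<open>z\<close> to this \<open>y\<^sub>i\<close>, it has its coefficients in the
  stabiliser algebra of \<open>y\<^sub>i\<close>.  So the relations are generated by the finitely many that generate
  those over the coherent stabiliser algebras.\<close>
lemma stabiliser_relations:
  assumes I: "finite I" and y: "\<And>i. i \<in> I \<Longrightarrow> y i \<in> X" and r: "\<And>i. i \<in> I \<Longrightarrow> r i \<in> carrier KG"
    and reps: "\<And>i j g. i \<in> I \<Longrightarrow> j \<in> I \<Longrightarrow> g \<in> carrier G \<Longrightarrow> \<phi> g (y i) = y j \<Longrightarrow> y i = y j"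
    and coh: "\<And>i. i \<in> I \<Longrightarrow> coherent_ring (group_ring K (G\<lparr>carrier := stabilizer G \<phi> (y i)\<rparr>))"
  shows "fgen KG (free_module KG I) (rel KG W I (\<lambda>i. tens (pt (y i)) (r i)))"
proof -
  let ?F = "free_module KG I"
  interpret F: left_module KG ?F by (rule left_module_free[OF KG_ring])
  interpret Wm: left_module KG W by (rule W_module)
  interpret L: left_module KG "left_regular KG" by (rule LKG_module)
  let ?t = "\<lambda>i. tens (pt (y i)) (r i)"
  let ?l = "lin KG (left_regular KG) r"
  have lh: "?l \<in> lmod_hom KG ?F (left_regular KG)" by (rule L.lin_hom) (simp add: r)
  have l0: "?l (\<lambda>_. \<zero>\<^bsub>KG\<^esub>) = \<zero>\<^bsub>KG\<^esub>"
    using addmap_zero[OF lmod_hom_addmap[OF lh] F.M_group L.M_group] by simp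
  have t: "?t i \<in> carrier W" if "i \<in> I" for i using that by (intro tens_closed pt_closed y r)
  have rl: "lsub KG ?F (rel KG W I ?t)" by (rule Wm.lsub_rel[OF t])
  have rel_iff: "a \<in> rel KG W I ?t \<longleftrightarrow> a \<in> carrier ?F \<and> (\<forall>z\<in>X. ?l (cut y z a) = \<zero>\<^bsub>KG\<^esub>)" for a
    using lin_tens_zero_iff[of I y r a, OF y r] by (auto simp: rel_def)
  define J where "J i = {j \<in> I. y j = y i}" for i
  define N where "N i = {a \<in> carrier (free_module (group_ring K (G\<lparr>carrier := stabilizer G \<phi> (y i)\<rparr>)) (J i)).
     ?l a = \<zero>\<^bsub>KG\<^esub>}" for i
  have N_iff: "a \<in> N i \<longleftrightarrow> a \<in> carrier ?F \<and> ?l a = \<zero>\<^bsub>KG\<^esub> \<and>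
      (\<forall>j g. a j g \<noteq> \<zero>\<^bsub>K\<^esub> \<longrightarrow> y j = y i \<and> g \<in> carrier G \<and> \<phi> g (y i) = y i)" (is "?A \<longleftrightarrow> ?B")
    and EN: "\<exists>E. finite E \<and> E \<subseteq> N i \<and> N i \<subseteq> lspan KG ?F E"
    if i: "i \<in> I" for i a
  proof -
    let ?H = "stabilizer G \<phi> (y i)"
    have Hs: "subgroup ?H G" by (rule A.stabilizer_subgroup[OF y[OF i]])
    have Hr: "ring (group_ring K (G\<lparr>carrier := ?H\<rparr>))" using coh[OF i] by (simp add: coherent_ring_def)
    interpret H: subgroup_algebra K G ?H
      by (rule subgroup_algebra.intro[OF group_algebra_axioms Hs Hr])
    have r': "\<And>j. j \<in> J i \<Longrightarrow> r j \<in> carrier KG" using r by (simp add: J_def)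
    have fJ: "finite (J i)" using I by (simp add: J_def)
    from H.coherent_subgroup_relations[OF coh[OF i] fJ r']
    have "\<exists>E. finite E \<and> E \<subseteq> N i \<and> N i \<subseteq> lspan H.KH (free_module H.KH (J i)) E"
      unfolding N_def .
    then obtain E where E: "finite E" "E \<subseteq> N i" "N i \<subseteq> lspan H.KH (free_module H.KH (J i)) E"
      by (elim exE conjE)
    have Ecar: "E \<subseteq> carrier (free_module H.KH (J i))" using E(2) by (auto simp: N_def)
    have "lspan H.KH (free_module H.KH (J i)) E \<subseteq> lspan KG ?F E"
      by (rule subsetI) (rule H.lspan_KH_subset[OF Ecar])
    then have "N i \<subseteq> lspan KG ?F E" by (rule subset_trans[OF E(3)])
    then show "\<exists>E. finite E \<and> E \<subseteq> N i \<and> N i \<subseteq> lspan KG ?F E" using E(1,2) by blast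
    show "?A \<longleftrightarrow> ?B"
    proof
      assume a: ?A
      then have ac: "a \<in> carrier (free_module H.KH (J i))" by (simp add: N_def)
      have "a \<in> carrier (free_module KG (J i))" by (rule H.free_KH_subset[OF ac])
      then have "a \<in> carrier ?F" unfolding free_module_carrier J_def by auto
      moreover have "y j = y i \<and> g \<in> carrier G \<and> \<phi> g (y i) = y i" if "a j g \<noteq> \<zero>\<^bsub>K\<^esub>" for j g
      proof -
        have "j \<in> J i"
        proof (rule ccontr)
          assume "j \<notin> J i"
          then have "a j = \<zero>\<^bsub>H.KH\<^esub>" by (rule free_module_outside[OF ac])
          then show False using that by (simp add: H.KHA.KG_zero)
        qed
        moreover have "g \<in> ?H"
          using that free_module_component[OF H.KHA.KG_ring ac, of j] unfolding H.KH_carrier_iff by blast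
        ultimately show ?thesis unfolding J_def stabilizer_def by blast
      qed
      moreover have "?l a = \<zero>\<^bsub>KG\<^esub>" using a unfolding N_def by blast
      ultimately show ?B by blast
    next
      assume b: ?B
      have "a \<in> carrier (free_module H.KH (J i))"
      proof (rule free_moduleI)
        fix j assume "j \<in> J i"
        have "a j \<in> carrier KG" using b free_module_component[OF KG_ring, of a I j] by blast
        moreover have "\<forall>g. g \<notin> ?H \<longrightarrow> a j g = \<zero>\<^bsub>K\<^esub>"
          using b unfolding stabilizer_def by blast
        ultimately show "a j \<in> carrier H.KH"
          unfolding H.KH_carrier_iff by (rule conjI)
      next
        fix j assume j: "j \<notin> J i"
        have "a j g = \<zero>\<^bsub>K\<^esub>" for g
        proof (cases "j \<in> I")
          case True
          then show ?thesis using j b unfolding J_def by blast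
        next
          case False
          then have "a j = \<zero>\<^bsub>KG\<^esub>" using b free_module_outside[of a KG I j] by blast
          then show ?thesis by (simp add: KG_zero)
        qed
        then show "a j = \<zero>\<^bsub>H.KH\<^esub>" by (auto simp: H.KHA.KG_zero)
      next
        show "finite {j. a j \<noteq> \<zero>\<^bsub>H.KH\<^esub>}"
          unfolding H.KH_zero by (rule free_module_finite) (use b in blast)
      qed
      then show ?A using b unfolding N_def by blast
    qed
  qed
  have "\<forall>i\<in>I. \<exists>E. finite E \<and> E \<subseteq> N i \<and> N i \<subseteq> lspan KG ?F E" using EN by blast
  then obtain E where E: "\<forall>i\<in>I. finite (E i) \<and> E i \<subseteq> N i \<and> N i \<subseteq> lspan KG ?F (E i)"
    by (rule bchoice[THEN exE])
  let ?E = "\<Union>i\<in>I. E i"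
  have Nrel: "N i \<subseteq> rel KG W I ?t" if i: "i \<in> I" for i
  proof
    fix a assume "a \<in> N i"
    note a = this[unfolded N_iff[OF i]]
    have "cut y z a = (if z = y i then a else (\<lambda>_. \<zero>\<^bsub>KG\<^esub>))" for z
    proof (intro ext)
      fix j g
      show "cut y z a j g = (if z = y i then a else (\<lambda>_. \<zero>\<^bsub>KG\<^esub>)) j g"
        using a by (cases "a j g = \<zero>\<^bsub>K\<^esub>") (auto simp: cut_def KG_zero)
    qed
    then show "a \<in> rel KG W I ?t" unfolding rel_iff using a l0 by simp
  qed
  have Erel: "?E \<subseteq> rel KG W I ?t" using E Nrel by blast
  have Ec: "?E \<subseteq> carrier ?F" using Erel lsubD(1)[OF rl] by blast
  have local: "cut y z a \<in> lspan KG ?F ?E" if a: "a \<in> rel KG W I ?t" and z: "z \<in> X" for a z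
  proof (cases "\<exists>i g. cut y z a i g \<noteq> \<zero>\<^bsub>K\<^esub>")
    case False
    then have "cut y z a = \<zero>\<^bsub>?F\<^esub>" by (auto simp: KG_zero fun_eq_iff)
    then show ?thesis by (metis lspan.zero)
  next
    case True
    then obtain i h where ih: "cut y z a i h \<noteq> \<zero>\<^bsub>K\<^esub>" by blast
    have ac: "a \<in> carrier ?F" using a by (simp add: rel_def)
    have cc: "cut y z a \<in> carrier ?F" by (rule cut_closed[OF ac])
    have h: "h \<in> carrier G" "\<phi> h (y i) = z" using ih by (auto simp: cut_def split: if_splits)
    have i: "i \<in> I"
    proof (rule ccontr)
      assume "i \<notin> I"
      then have "cut y z a i = \<zero>\<^bsub>KG\<^esub>" by (rule free_module_outside[OF cc])
      then show False using ih by (simp add: KG_zero)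
    qed
    let ?m = "ginv h" and ?m' = "gel h"
    have mc: "?m \<in> carrier KG" "?m' \<in> carrier KG" using h by (auto intro: mon_closed)
    let ?b = "?m \<odot>\<^bsub>?F\<^esub> cut y z a"
    have bc: "?b \<in> carrier ?F" by (rule F.smult_closed[OF mc(1) cc])
    have "?l ?b = ?m \<odot>\<^bsub>left_regular KG\<^esub> ?l (cut y z a)" by (rule lmod_hom_smult[OF lh mc(1) cc])
    moreover have "?l (cut y z a) = \<zero>\<^bsub>KG\<^esub>" using a z by (simp add: rel_iff)
    ultimately have lb: "?l ?b = \<zero>\<^bsub>KG\<^esub>" using mc by simp
    have "y j = y i \<and> g \<in> carrier G \<and> \<phi> g (y i) = y i" if "?b j g \<noteq> \<zero>\<^bsub>K\<^esub>" for j g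
    proof -
      have jc: "cut y z a j \<in> carrier KG" by (rule free_module_component[OF KG_ring cc])
      have gc: "g \<in> carrier G" using that KG_outside[OF free_module_component[OF KG_ring bc, of j], of g] by blast
      have "?b j g = cut y z a j (h \<otimes> g)"
        using mon_mult_apply[OF _ _ jc gc, of "inv h" "\<one>\<^bsub>K\<^esub>"] h KG_apply[OF jc] by simp
      then have ne: "cut y z a j (h \<otimes> g) \<noteq> \<zero>\<^bsub>K\<^esub>" using that by simp
      have j: "j \<in> I"
      proof (rule ccontr)
        assume "j \<notin> I"
        then have "cut y z a j = \<zero>\<^bsub>KG\<^esub>" by (rule free_module_outside[OF cc])
        then show False using ne by (simp add: KG_zero)
      qed
      have "\<phi> (h \<otimes> g) (y j) = z" using ne by (auto simp: cut_def split: if_splits)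
      then have "\<phi> h (\<phi> g (y j)) = \<phi> h (y i)" using act_mult[OF y[OF j] h(1) gc] h(2) by simp
      then have "\<phi> (inv h) (\<phi> h (\<phi> g (y j))) = \<phi> (inv h) (\<phi> h (y i))" by (rule arg_cong)
      then have e: "\<phi> g (y j) = y i"
        unfolding act_inv1[OF act_closed[OF gc y[OF j]] h(1)] act_inv1[OF y[OF i] h(1)] .
      have ji: "y j = y i" by (rule reps[OF j i gc e])
      show ?thesis using e gc unfolding ji by blast
    qed
    then have "?b \<in> N i" unfolding N_iff[OF i] using bc lb by blast
    then have "?b \<in> lspan KG ?F (E i)" using E i by blast
    moreover have "lspan KG ?F (E i) \<subseteq> lspan KG ?F ?E" by (rule lspan_mono) (use i in blast)
    ultimately have "?b \<in> lspan KG ?F ?E" by blast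
    then have "?m' \<odot>\<^bsub>?F\<^esub> ?b \<in> lspan KG ?F ?E" by (rule F.lspan_smult[OF Ec mc(2)])
    moreover have "?m' \<odot>\<^bsub>?F\<^esub> ?b = cut y z a"
      using mon_act[OF F.left_module_axioms cc h(1) G.inv_closed[OF h(1)] K.one_closed K.one_closed]
        mon_one_act[OF F.left_module_axioms cc] h by simp
    ultimately show ?thesis by simp
  qed
  have "finite Z \<Longrightarrow> Z \<subseteq> X \<Longrightarrow> (\<forall>a\<in>rel KG W I ?t. (\<forall>z\<in>X - Z. cut y z a = (\<lambda>_. \<zero>\<^bsub>KG\<^esub>)) \<longrightarrow> a \<in> lspan KG ?F ?E)" for Z
  proof (induction Z rule: finite_induct)
    case empty
    show ?case
    proof (intro ballI impI)
      fix a assume a: "a \<in> rel KG W I ?t" and z: "\<forall>z\<in>X - {}. cut y z a = (\<lambda>_. \<zero>\<^bsub>KG\<^esub>)"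
      have ac: "a \<in> carrier ?F" using a by (simp add: rel_def)
      have "a j g = \<zero>\<^bsub>K\<^esub>" for j g
      proof (cases "j \<in> I \<and> g \<in> carrier G")
        case True
        then have "cut y (\<phi> g (y j)) a j = \<zero>\<^bsub>KG\<^esub>" using z y by simp
        then have "cut y (\<phi> g (y j)) a j g = \<zero>\<^bsub>K\<^esub>" by (simp add: KG_zero)
        then show ?thesis using True by (simp add: cut_def)
      next
        case False
        then show ?thesis
          using free_module_outside[OF ac, of j] KG_outside[OF free_module_component[OF KG_ring ac, of j], of g]
          by (auto simp: KG_zero)
      qed
      then have "a = \<zero>\<^bsub>?F\<^esub>" by (auto simp: KG_zero fun_eq_iff)
      then show "a \<in> lspan KG ?F ?E" by (metis lspan.zero)
    qed
  next
    case (insert z Z)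
    show ?case
    proof (intro ballI impI)
      fix a assume a: "a \<in> rel KG W I ?t" and v: "\<forall>z'\<in>X - insert z Z. cut y z' a = (\<lambda>_. \<zero>\<^bsub>KG\<^esub>)"
      have z: "z \<in> X" using insert by blast
      have ac: "a \<in> carrier ?F" using a by (simp add: rel_def)
      have cc: "cut y z a \<in> carrier ?F" by (rule cut_closed[OF ac])
      have "cut y z a \<in> rel KG W I ?t"
        unfolding rel_iff using cc a l0 by (auto simp: cut_cut rel_iff)
      then have d: "a \<ominus>\<^bsub>?F\<^esub> cut y z a \<in> rel KG W I ?t" by (rule F.lsub_minus[OF rl a])
      have "cut y z' (a \<ominus>\<^bsub>?F\<^esub> cut y z a) = (\<lambda>_. \<zero>\<^bsub>KG\<^esub>)" if z': "z' \<in> X - Z" for z'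
      proof -
        have "cut y z' (a \<ominus>\<^bsub>?F\<^esub> cut y z a) = cut y z' a \<ominus>\<^bsub>?F\<^esub> cut y z' (cut y z a)"
          by (rule addmap_minus[OF addmap_cut F.M_group F.M_group ac cc])
        also have "\<dots> = \<zero>\<^bsub>?F\<^esub>"
        proof (cases "z' = z")
          case True
          then show ?thesis using F.M.r_neg[OF cc] by (simp add: cut_cut a_minus_def)
        next
          case False
          then have "cut y z' a = \<zero>\<^bsub>?F\<^esub>" "cut y z' (cut y z a) = \<zero>\<^bsub>?F\<^esub>" using z' v by (auto simp: cut_cut)
          then show ?thesis using F.M.r_neg[OF F.M.zero_closed] by (simp only: a_minus_def)
        qed
        finally show ?thesis by simp
      qed
      then have "a \<ominus>\<^bsub>?F\<^esub> cut y z a \<in> lspan KG ?F ?E" using insert d by blast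
      then have "(a \<ominus>\<^bsub>?F\<^esub> cut y z a) \<oplus>\<^bsub>?F\<^esub> cut y z a \<in> lspan KG ?F ?E"
        by (rule F.lspan_add[OF Ec _ local[OF a z]])
      moreover have "(a \<ominus>\<^bsub>?F\<^esub> cut y z a) \<oplus>\<^bsub>?F\<^esub> cut y z a = a"
        unfolding a_minus_def by (simp only: F.M.a_assoc F.M.a_inv_closed F.M.l_neg F.M.r_zero ac cc)
      ultimately show "a \<in> lspan KG ?F ?E" by (simp only:)
    qed
  qed
  note positions = this
  have "rel KG W I ?t \<subseteq> lspan KG ?F ?E"
  proof
    fix a assume a: "a \<in> rel KG W I ?t"
    have ac: "a \<in> carrier ?F" using a by (simp add: rel_def)
    let ?Z = "\<Union>i\<in>I. (\<lambda>g. \<phi> g (y i)) ` {g. a i g \<noteq> \<zero>\<^bsub>K\<^esub>}"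
    have fz: "finite ?Z"
      using I KG_finite[OF free_module_component[OF KG_ring ac]] by (intro finite_UN_I finite_imageI)
    have gG: "g \<in> carrier G" if "a i g \<noteq> \<zero>\<^bsub>K\<^esub>" for i g
      using that KG_outside[OF free_module_component[OF KG_ring ac, of i], of g] by blast
    have ZX: "?Z \<subseteq> X" using gG y by auto
    have "cut y z a = (\<lambda>_. \<zero>\<^bsub>KG\<^esub>)" if z: "z \<in> X - ?Z" for z
    proof (intro ext)
      fix i g
      show "cut y z a i g = \<zero>\<^bsub>KG\<^esub> g"
      proof (cases "i \<in> I")
        case True
        then show ?thesis using z by (auto simp: cut_def KG_zero)
      next
        case False
        have "a i = \<zero>\<^bsub>KG\<^esub>" by (rule free_module_outside[OF ac False])
        then show ?thesis by (simp add: cut_def KG_zero)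
      qed
    qed
    then show "a \<in> lspan KG ?F ?E" using positions[OF fz ZX] a by blast
  qed
  moreover have "finite ?E" using I E by blast
  ultimately show ?thesis unfolding fgen_def using Erel by blast
qed

end

section \<open>Tensor products and flatness\<close>

abbreviation frags :: "'c set \<Rightarrow> ('c \<Rightarrow>\<^sub>0 int) set"
  where "frags S \<equiv> carrier (free_Abelian_group S)"

lemma frags_zero: "0 \<in> frags S"
  by simp

lemma frags_diff: "a \<in> frags S \<Longrightarrow> b \<in> frags S \<Longrightarrow> a - b \<in> frags S"
  using keys_diff[of a b] by auto

lemma frags_add: "a \<in> frags S \<Longrightarrow> b \<in> frags S \<Longrightarrow> a + b \<in> frags S"
  using Poly_Mapping.keys_add[of a b] by auto

lemma frags_extend: "(\<And>s. s \<in> S \<Longrightarrow> f s \<in> frags T) \<Longrightarrow> c \<in> frags S \<Longrightarrow> frag_extend f c \<in> frags T"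
  using keys_frag_extend[of f c] by fastforce

lemma frags_induct [consumes 1, case_names zero one diff]:
  assumes "c \<in> frags S" "P 0" "\<And>s. s \<in> S \<Longrightarrow> P (frag_of s)"
    "\<And>a b. a \<in> frags S \<Longrightarrow> b \<in> frags S \<Longrightarrow> P a \<Longrightarrow> P b \<Longrightarrow> P (a - b)"
  shows "P c"
  using free_Abelian_group_induct[of c S P] assms by auto

definition fragmap :: "'c set \<Rightarrow> ('b, 'n) ring_scheme \<Rightarrow> (('c \<Rightarrow>\<^sub>0 int) \<Rightarrow> 'b) \<Rightarrow> bool"
  where "fragmap S B h \<longleftrightarrow> h \<in> hom (free_Abelian_group S) (add_monoid B)"

lemma fragmap_exists:
  assumes B: "abelian_group B" and f: "\<And>s. s \<in> S \<Longrightarrow> f s \<in> carrier B"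
  shows "\<exists>h. fragmap S B h \<and> (\<forall>s\<in>S. h (frag_of s) = f s)"
proof -
  interpret B: abelian_group B by fact
  have "f ` S \<subseteq> carrier (add_monoid B)" using f by auto
  then obtain h where "h \<in> hom (free_Abelian_group S) (add_monoid B)" "\<And>s. s \<in> S \<Longrightarrow> h (frag_of s) = f s"
    by (rule comm_group.free_Abelian_group_universal[OF B.a_comm_group]) blast
  then show ?thesis unfolding fragmap_def by blast
qed

lemma fragmap_closed: "fragmap S B h \<Longrightarrow> c \<in> frags S \<Longrightarrow> h c \<in> carrier B"
  unfolding fragmap_def by (drule hom_in_carrier, assumption) simp

lemma fragmap_add: "fragmap S B h \<Longrightarrow> c \<in> frags S \<Longrightarrow> d \<in> frags S \<Longrightarrow> h (c + d) = h c \<oplus>\<^bsub>B\<^esub> h d"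
  unfolding fragmap_def using hom_mult[of h "free_Abelian_group S" "add_monoid B" c d] by simp

lemma fragmap_zero: "abelian_group B \<Longrightarrow> fragmap S B h \<Longrightarrow> h 0 = \<zero>\<^bsub>B\<^esub>"
proof -
  assume B: "abelian_group B" and h: "fragmap S B h"
  interpret B: abelian_group B by fact
  have "h 0 = h 0 \<oplus>\<^bsub>B\<^esub> h 0" using fragmap_add[OF h frags_zero frags_zero] by simp
  then show ?thesis using fragmap_closed[OF h frags_zero] by (metis B.add.l_cancel_one')
qed

lemma fragmap_diff:
  assumes B: "abelian_group B" and h: "fragmap S B h" and c: "c \<in> frags S" "d \<in> frags S"
  shows "h (c - d) = h c \<ominus>\<^bsub>B\<^esub> h d"
proof -
  interpret B: abelian_group B by fact
  have "h c = h (c - d) \<oplus>\<^bsub>B\<^esub> h d" using fragmap_add[OF h frags_diff[OF c] c(2)] by simp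
  then show ?thesis
    using fragmap_closed[OF h c(2)] fragmap_closed[OF h frags_diff[OF c]]
    by (simp add: a_minus_def B.a_assoc B.r_neg)
qed

lemma fragmap_eqI:
  assumes B: "abelian_group B" and h: "fragmap S B h" and h': "fragmap S B h'"
    and eq: "\<And>s. s \<in> S \<Longrightarrow> h (frag_of s) = h' (frag_of s)" and c: "c \<in> frags S"
  shows "h c = h' c"
  using c
proof (induction rule: frags_induct)
  case zero
  then show ?case using fragmap_zero[OF B h] fragmap_zero[OF B h'] by simp
next
  case (diff a b)
  then show ?case using fragmap_diff[OF B h] fragmap_diff[OF B h'] by simp
qed (rule eq)

lemma fragmapI:
  assumes "\<And>c. c \<in> frags S \<Longrightarrow> h c \<in> carrier B"
    "\<And>c d. c \<in> frags S \<Longrightarrow> d \<in> frags S \<Longrightarrow> h (c + d) = h c \<oplus>\<^bsub>B\<^esub> h d"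
  shows "fragmap S B h"
  unfolding fragmap_def by (rule homI) (use assms in auto)

lemma fragmap_extend:
  assumes f: "\<And>s. s \<in> S \<Longrightarrow> f s \<in> frags T" and h: "fragmap T B h"
  shows "fragmap S B (\<lambda>c. h (frag_extend f c))"
proof (rule fragmapI)
  have e: "frag_extend f c \<in> frags T" if "c \<in> frags S" for c by (rule frags_extend[OF f that])
  show "h (frag_extend f c) \<in> carrier B" if "c \<in> frags S" for c
    by (rule fragmap_closed[OF h e[OF that]])
  show "h (frag_extend f (c + d)) = h (frag_extend f c) \<oplus>\<^bsub>B\<^esub> h (frag_extend f d)"
    if "c \<in> frags S" "d \<in> frags S" for c d
    unfolding frag_extend_add by (rule fragmap_add[OF h e[OF that(1)] e[OF that(2)]])
qed

lemma fragmap_comp: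
  assumes h: "fragmap S B h" and g: "addmap B C g"
  shows "fragmap S C (\<lambda>c. g (h c))"
proof (rule fragmapI)
  show "g (h c) \<in> carrier C" if "c \<in> frags S" for c by (rule addmap_closed[OF g fragmap_closed[OF h that]])
  show "g (h (c + d)) = g (h c) \<oplus>\<^bsub>C\<^esub> g (h d)" if "c \<in> frags S" "d \<in> frags S" for c d
    unfolding fragmap_add[OF h that]
    by (rule addmap_add[OF g fragmap_closed[OF h that(1)] fragmap_closed[OF h that(2)]])
qed

definition balanced :: "('a, 'r) ring_scheme \<Rightarrow> ('a, 'b, 'm) module_scheme \<Rightarrow> ('a, 'c, 'n) module_scheme \<Rightarrow>
    ('d, 'p) ring_scheme \<Rightarrow> ('b \<Rightarrow> 'c \<Rightarrow> 'd) \<Rightarrow> bool"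
  where "balanced R N A B f \<longleftrightarrow>
    (\<forall>x\<in>carrier N. \<forall>u\<in>carrier A. f x u \<in> carrier B) \<and>
    (\<forall>x\<in>carrier N. \<forall>y\<in>carrier N. \<forall>u\<in>carrier A. f (x \<oplus>\<^bsub>N\<^esub> y) u = f x u \<oplus>\<^bsub>B\<^esub> f y u) \<and>
    (\<forall>x\<in>carrier N. \<forall>u\<in>carrier A. \<forall>v\<in>carrier A. f x (u \<oplus>\<^bsub>A\<^esub> v) = f x u \<oplus>\<^bsub>B\<^esub> f x v) \<and>
    (\<forall>a\<in>carrier R. \<forall>x\<in>carrier N. \<forall>u\<in>carrier A. f (a \<odot>\<^bsub>N\<^esub> x) u = f x (a \<odot>\<^bsub>A\<^esub> u))"

locale tensor_pair =
  fixes R :: "('a, 'r) ring_scheme" and N :: "('a, 'b, 'm) module_scheme" and A :: "('a, 'c, 'n) module_scheme"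
  assumes N_add: "\<And>x y. x \<in> carrier N \<Longrightarrow> y \<in> carrier N \<Longrightarrow> x \<oplus>\<^bsub>N\<^esub> y \<in> carrier N"
    and A_add: "\<And>x y. x \<in> carrier A \<Longrightarrow> y \<in> carrier A \<Longrightarrow> x \<oplus>\<^bsub>A\<^esub> y \<in> carrier A"
    and N_smult: "\<And>a x. a \<in> carrier R \<Longrightarrow> x \<in> carrier N \<Longrightarrow> a \<odot>\<^bsub>N\<^esub> x \<in> carrier N"
    and A_smult: "\<And>a x. a \<in> carrier R \<Longrightarrow> x \<in> carrier A \<Longrightarrow> a \<odot>\<^bsub>A\<^esub> x \<in> carrier A"
begin

abbreviation "S \<equiv> carrier N \<times> carrier A"
abbreviation "T \<equiv> tensor_kernel R N A"

lemma relations_closed: "tensor_relations R N A \<subseteq> frags S"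
  unfolding tensor_relations_def
  by (auto intro!: frags_diff frags_add simp del: carrier_free_Abelian_group_iff simp: N_add A_add N_smult A_smult)

lemma T_induct [consumes 1, case_names zero rel add uminus]:
  assumes "c \<in> T" "P 0" "\<And>c. c \<in> tensor_relations R N A \<Longrightarrow> P c"
    "\<And>c d. c \<in> T \<Longrightarrow> d \<in> T \<Longrightarrow> P c \<Longrightarrow> P d \<Longrightarrow> P (c + d)" "\<And>c. c \<in> tensor_relations R N A \<Longrightarrow> P c \<Longrightarrow> P (- c)"
  shows "P c"
  using assms(1) unfolding tensor_kernel_def
proof (induction rule: generate.induct)
  case one
  then show ?case using assms(2) by simp
next
  case (incl h)
  then show ?case using assms(3) by blast
next
  case (inv h)
  then have "inv\<^bsub>free_Abelian_group S\<^esub> h = - h"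
    using subsetD[OF relations_closed inv] by (intro inv_free_Abelian_group) simp
  then show ?case using assms(3,5) inv by simp
next
  case (eng h1 h2)
  then show ?case using assms(4)[of h1 h2] by (simp add: tensor_kernel_def)
qed

lemma T_zero: "0 \<in> T"
  unfolding tensor_kernel_def using generate.one[of "free_Abelian_group S"] by simp

lemma T_rel: "c \<in> tensor_relations R N A \<Longrightarrow> c \<in> T"
  unfolding tensor_kernel_def by (rule generate.incl)

lemma T_add: "c \<in> T \<Longrightarrow> d \<in> T \<Longrightarrow> c + d \<in> T"
  unfolding tensor_kernel_def using generate.eng[of c "free_Abelian_group S" _ d] by simp

lemma T_closed: "c \<in> T \<Longrightarrow> c \<in> frags S"
proof (induction rule: T_induct)
  case (uminus c)
  then show ?case by simp
qed (use relations_closed frags_add in \<open>auto simp del: carrier_free_Abelian_group_iff simp: frags_zero\<close>)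

lemma T_uminus: "c \<in> T \<Longrightarrow> - c \<in> T"
proof (induction rule: T_induct)
  case zero
  then show ?case by (simp add: T_zero)
next
  case (rel c)
  have "inv\<^bsub>free_Abelian_group S\<^esub> c = - c"
    using subsetD[OF relations_closed rel] by (intro inv_free_Abelian_group) simp
  then show ?case using generate.inv[OF rel, of "free_Abelian_group S"] by (simp add: tensor_kernel_def)
next
  case (add c d)
  have "- (c + d) = - c + - d" by simp
  then show ?case using T_add[OF add(3,4)] by (simp only:)
next
  case (uminus c)
  then show ?case using T_rel by simp
qed

lemma T_diff: "c \<in> T \<Longrightarrow> d \<in> T \<Longrightarrow> c - d \<in> T"
  using T_add[of c "- d"] T_uminus[of d] by simp

lemma T_add_left: "x \<in> carrier N \<Longrightarrow> y \<in> carrier N \<Longrightarrow> u \<in> carrier A \<Longrightarrow>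
   frag_of (x \<oplus>\<^bsub>N\<^esub> y, u) - (frag_of (x, u) + frag_of (y, u)) \<in> T"
  by (rule T_rel) (auto simp: tensor_relations_def)

lemma T_add_right: "x \<in> carrier N \<Longrightarrow> u \<in> carrier A \<Longrightarrow> v \<in> carrier A \<Longrightarrow>
   frag_of (x, u \<oplus>\<^bsub>A\<^esub> v) - (frag_of (x, u) + frag_of (x, v)) \<in> T"
  by (rule T_rel) (auto simp: tensor_relations_def)

lemma T_smult: "a \<in> carrier R \<Longrightarrow> x \<in> carrier N \<Longrightarrow> u \<in> carrier A \<Longrightarrow>
   frag_of (a \<odot>\<^bsub>N\<^esub> x, u) - frag_of (x, a \<odot>\<^bsub>A\<^esub> u) \<in> T"
  by (rule T_rel) (auto simp: tensor_relations_def)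

lemma T_subst: "c - d \<in> T \<Longrightarrow> d \<in> T \<Longrightarrow> c \<in> T"
  using T_add[of "c - d" d] by simp

lemma T_zero_left:
  assumes "abelian_group N" "u \<in> carrier A"
  shows "frag_of (\<zero>\<^bsub>N\<^esub>, u) \<in> T"
proof -
  interpret N: abelian_group N by fact
  have "- (frag_of (\<zero>\<^bsub>N\<^esub> \<oplus>\<^bsub>N\<^esub> \<zero>\<^bsub>N\<^esub>, u) - (frag_of (\<zero>\<^bsub>N\<^esub>, u) + frag_of (\<zero>\<^bsub>N\<^esub>, u))) \<in> T"
    using assms by (intro T_uminus T_add_left) auto
  then show ?thesis by simp
qed

text \<open>A balanced map factors through the tensor product.\<close>
lemma T_balanced:
  assumes B: "abelian_group B" and f: "balanced R N A B f"
    and h: "fragmap S B h" "\<And>x u. x \<in> carrier N \<Longrightarrow> u \<in> carrier A \<Longrightarrow> h (frag_of (x, u)) = f x u"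
    and c: "c \<in> T"
  shows "h c = \<zero>\<^bsub>B\<^esub>"
proof -
  interpret B: abelian_group B by fact
  have rel: "h c = \<zero>\<^bsub>B\<^esub>" if "c \<in> tensor_relations R N A" for c
    using that unfolding tensor_relations_def
  proof (elim UnE)
    assume "c \<in> {frag_of (x \<oplus>\<^bsub>N\<^esub> y, u) - (frag_of (x, u) + frag_of (y, u)) | x y u.
        x \<in> carrier N \<and> y \<in> carrier N \<and> u \<in> carrier A}"
    then obtain x y u where c: "x \<in> carrier N" "y \<in> carrier N" "u \<in> carrier A"
      "c = frag_of (x \<oplus>\<^bsub>N\<^esub> y, u) - (frag_of (x, u) + frag_of (y, u))" by blast
    have m: "frag_of (x \<oplus>\<^bsub>N\<^esub> y, u) \<in> frags S" "frag_of (x, u) \<in> frags S" "frag_of (y, u) \<in> frags S"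
      using c N_add by auto
    have "h c = f (x \<oplus>\<^bsub>N\<^esub> y) u \<ominus>\<^bsub>B\<^esub> (f x u \<oplus>\<^bsub>B\<^esub> f y u)"
      unfolding c(4) fragmap_diff[OF B h(1) m(1) frags_add[OF m(2,3)]] fragmap_add[OF h(1) m(2,3)]
      using h(2) c N_add by simp
    then show ?thesis using f c by (simp add: balanced_def a_minus_def B.r_neg)
  next
    assume "c \<in> {frag_of (x, u \<oplus>\<^bsub>A\<^esub> v) - (frag_of (x, u) + frag_of (x, v)) | x u v.
        x \<in> carrier N \<and> u \<in> carrier A \<and> v \<in> carrier A}"
    then obtain x u v where c: "x \<in> carrier N" "u \<in> carrier A" "v \<in> carrier A"
      "c = frag_of (x, u \<oplus>\<^bsub>A\<^esub> v) - (frag_of (x, u) + frag_of (x, v))" by blast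
    have m: "frag_of (x, u \<oplus>\<^bsub>A\<^esub> v) \<in> frags S" "frag_of (x, u) \<in> frags S" "frag_of (x, v) \<in> frags S"
      using c A_add by auto
    have "h c = f x (u \<oplus>\<^bsub>A\<^esub> v) \<ominus>\<^bsub>B\<^esub> (f x u \<oplus>\<^bsub>B\<^esub> f x v)"
      unfolding c(4) fragmap_diff[OF B h(1) m(1) frags_add[OF m(2,3)]] fragmap_add[OF h(1) m(2,3)]
      using h(2) c A_add by simp
    then show ?thesis using f c by (simp add: balanced_def a_minus_def B.r_neg)
  next
    assume "c \<in> {frag_of (a \<odot>\<^bsub>N\<^esub> x, u) - frag_of (x, a \<odot>\<^bsub>A\<^esub> u) | x a u.
        x \<in> carrier N \<and> a \<in> carrier R \<and> u \<in> carrier A}"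
    then obtain x a u where c: "x \<in> carrier N" "a \<in> carrier R" "u \<in> carrier A"
      "c = frag_of (a \<odot>\<^bsub>N\<^esub> x, u) - frag_of (x, a \<odot>\<^bsub>A\<^esub> u)" by blast
    have m: "frag_of (a \<odot>\<^bsub>N\<^esub> x, u) \<in> frags S" "frag_of (x, a \<odot>\<^bsub>A\<^esub> u) \<in> frags S"
      using c N_smult A_smult by auto
    have "h c = f (a \<odot>\<^bsub>N\<^esub> x) u \<ominus>\<^bsub>B\<^esub> f x (a \<odot>\<^bsub>A\<^esub> u)"
      unfolding c(4) fragmap_diff[OF B h(1) m] using h(2) c N_smult A_smult by simp
    moreover have "f (a \<odot>\<^bsub>N\<^esub> x) u = f x (a \<odot>\<^bsub>A\<^esub> u)" using f c by (simp add: balanced_def)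
    moreover have "f x (a \<odot>\<^bsub>A\<^esub> u) \<in> carrier B" using f c A_smult by (simp add: balanced_def)
    ultimately show ?thesis by (simp add: a_minus_def B.r_neg)
  qed
  show ?thesis
    using c
  proof (induction rule: T_induct)
    case zero
    then show ?case by (rule fragmap_zero[OF B h(1)])
  next
    case (rel c)
    then show ?case by (rule \<open>\<And>c. c \<in> tensor_relations R N A \<Longrightarrow> h c = \<zero>\<^bsub>B\<^esub>\<close>)
  next
    case (add c d)
    then show ?case using fragmap_add[OF h(1) T_closed[OF add(1)] T_closed[OF add(2)]] by simp
  next
    case (uminus c)
    have "c \<in> frags S" using uminus relations_closed by blast
    then have "h (0 - c) = h 0 \<ominus>\<^bsub>B\<^esub> h c" by (rule fragmap_diff[OF B h(1) frags_zero])
    then show ?case using uminus fragmap_zero[OF B h(1)] by (simp add: a_minus_def)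
  qed
qed

lemma coset_def': "tensor_coset R N A c = {k + c | k. k \<in> T}"
  by (auto simp: tensor_coset_def r_coset_def)

lemma coset_self: "c \<in> tensor_coset R N A c"
  unfolding coset_def' using T_zero by (metis (mono_tags, lifting) add_0 mem_Collect_eq)

lemma coset_eq_iff: "tensor_coset R N A c = tensor_coset R N A d \<longleftrightarrow> c - d \<in> T"
proof
  assume "tensor_coset R N A c = tensor_coset R N A d"
  then obtain k where "k \<in> T" "c = k + d" using coset_self[of c] unfolding coset_def' by blast
  then show "c - d \<in> T" by simp
next
  assume cd: "c - d \<in> T"
  show "tensor_coset R N A c = tensor_coset R N A d"
    unfolding coset_def'
  proof (intro equalityI subsetI)
    fix x assume "x \<in> {k + c | k. k \<in> T}"
    then obtain k where "k \<in> T" "x = k + c" by blast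
    then have "x = (k + (c - d)) + d" "k + (c - d) \<in> T" using T_add[OF _ cd] by auto
    then show "x \<in> {k + d | k. k \<in> T}" by blast
  next
    fix x assume "x \<in> {k + d | k. k \<in> T}"
    then obtain k where "k \<in> T" "x = k + d" by blast
    then have "x = (k - (c - d)) + c" "k - (c - d) \<in> T" using T_diff[OF _ cd] by auto
    then show "x \<in> {k + c | k. k \<in> T}" by blast
  qed
qed

lemma coset_mem: "x \<in> tensor_coset R N A c \<longleftrightarrow> x - c \<in> T"
proof
  assume "x \<in> tensor_coset R N A c"
  then show "x - c \<in> T" unfolding coset_def' by auto
next
  assume "x - c \<in> T"
  moreover have "x = (x - c) + c" by simp
  ultimately show "x \<in> tensor_coset R N A c" unfolding coset_def' by blast
qed

lemma carrier_tensor_group: "carrier (tensor_group R N A) = tensor_coset R N A ` frags S"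
  unfolding tensor_group_def FactGroup_def RCOSETS_def tensor_coset_def by auto

lemma mult_tensor_group:
  "tensor_coset R N A c \<otimes>\<^bsub>tensor_group R N A\<^esub> tensor_coset R N A d = tensor_coset R N A (c + d)"
proof -
  have "tensor_coset R N A c \<otimes>\<^bsub>tensor_group R N A\<^esub> tensor_coset R N A d =
     {x + y | x y. x \<in> tensor_coset R N A c \<and> y \<in> tensor_coset R N A d}"
    by (auto simp: tensor_group_def FactGroup_def set_mult_def)
  also have "\<dots> = tensor_coset R N A (c + d)"
  proof (intro equalityI subsetI)
    fix z assume "z \<in> {x + y | x y. x \<in> tensor_coset R N A c \<and> y \<in> tensor_coset R N A d}"
    then obtain x y where "z = x + y" "x - c \<in> T" "y - d \<in> T" by (auto simp: coset_mem)
    moreover have "(x + y) - (c + d) = (x - c) + (y - d)" by simp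
    ultimately show "z \<in> tensor_coset R N A (c + d)" unfolding coset_mem using T_add by metis
  next
    fix z assume "z \<in> tensor_coset R N A (c + d)"
    then have "z - d \<in> tensor_coset R N A c" by (simp add: coset_mem algebra_simps)
    moreover have "z = (z - d) + d" by simp
    ultimately show "z \<in> {x + y | x y. x \<in> tensor_coset R N A c \<and> y \<in> tensor_coset R N A d}"
      using coset_self[of d] by blast
  qed
  finally show ?thesis .
qed

text \<open>Both the tensor map and the diagonal action are given on representatives of cosets by a choice
  with \<open>the_elem\<close>, which is harmless for maps that preserve the tensor relations.\<close>
lemma the_elem_coset:
  assumes "\<And>k. k \<in> T \<Longrightarrow> F (k + c) = F c"
  shows "the_elem (F ` tensor_coset R N A c) = F c"
proof -
  have "F ` tensor_coset R N A c = {F c}"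
    using assms coset_self[of c] unfolding coset_def' by auto
  then show ?thesis by simp
qed

end

text \<open>A copy of a left ideal on the type over which flatness is tested.\<close>
definition coded_ideal :: "('a, 'r) ring_scheme \<Rightarrow> 'a set \<Rightarrow> ('a, ('a, 'b) ambient) module"
  where "coded_ideal R J = \<lparr>carrier = (\<lambda>r. [Inl r]) ` J, monoid.mult = undefined, monoid.one = undefined,
     ring.zero = [Inl \<zero>\<^bsub>R\<^esub>], ring.add = (\<lambda>x y. [Inl (projl (hd x) \<oplus>\<^bsub>R\<^esub> projl (hd y))]),
     smult = (\<lambda>a x. [Inl (a \<otimes>\<^bsub>R\<^esub> projl (hd x))])\<rparr>"

lemma coded_ideal_simps [simp]:
  "carrier (coded_ideal R J) = (\<lambda>r. [Inl r]) ` J"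
  "\<zero>\<^bsub>coded_ideal R J\<^esub> = [Inl \<zero>\<^bsub>R\<^esub>]"
  "x \<oplus>\<^bsub>coded_ideal R J\<^esub> y = [Inl (projl (hd x) \<oplus>\<^bsub>R\<^esub> projl (hd y))]"
  "a \<odot>\<^bsub>coded_ideal R J\<^esub> x = [Inl (a \<otimes>\<^bsub>R\<^esub> projl (hd x))]"
  by (simp_all add: coded_ideal_def)

lemma left_module_coded_ideal:
  assumes R: "ring R" and J: "lsub R (left_regular R) J"
  shows "left_module R (coded_ideal R J)"
proof -
  interpret R: ring R by fact
  interpret L: left_module R "left_regular R" by (rule left_module_left_regular[OF R])
  note JD = lsubD[OF J, simplified]
  have c: "\<And>x. x \<in> J \<Longrightarrow> x \<in> carrier R" using JD(1) by blast
  have "abelian_group (coded_ideal R J)"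
  proof (rule abelian_groupI)
    fix x assume "x \<in> carrier (coded_ideal R J)"
    then obtain r where r: "x = [Inl r]" "r \<in> J" by auto
    have "\<ominus>\<^bsub>R\<^esub> r \<in> J" using L.lsub_uminus[OF J r(2)] c[OF r(2)] by (simp add: R.left_regular_uminus)
    then show "\<exists>y\<in>carrier (coded_ideal R J). y \<oplus>\<^bsub>coded_ideal R J\<^esub> x = \<zero>\<^bsub>coded_ideal R J\<^esub>"
      using r c by (intro bexI[of _ "[Inl (\<ominus>\<^bsub>R\<^esub> r)]"]) (auto simp: R.l_neg)
  qed (use JD c in \<open>auto simp: R.a_ac\<close>)
  then show ?thesis
    using R JD c by (intro left_module.intro left_module_axioms.intro)
      (auto simp: R.l_distr R.r_distr R.m_assoc)
qed

text \<open>Flatness, used through the injectivity of \<open>N \<otimes> I \<rightarrow> N \<otimes> R = N\<close> for a left ideal \<open>I\<close>: a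
  formal sum of \<open>n \<otimes> a\<close> whose products sum to \<open>0\<close> is killed by every balanced map on \<open>N \<times> I\<close>.\<close>
lemma flat_balanced:
  fixes R :: "('a, 'r) ring_scheme" and N :: "('a, 'b, 'm) module_scheme"
  assumes flat: "flat_right_module R N" and I: "lsub R (left_regular R) I"
    and c: "c \<in> frags (carrier N \<times> I)"
    and ev: "fragmap (carrier N \<times> I) N ev"
      "\<And>n a. n \<in> carrier N \<Longrightarrow> a \<in> I \<Longrightarrow> ev (frag_of (n, a)) = a \<odot>\<^bsub>N\<^esub> n"
      "ev c = \<zero>\<^bsub>N\<^esub>"
    and B: "abelian_group B" and f: "balanced R N ((left_regular R)\<lparr>carrier := I\<rparr>) B f"
    and h: "fragmap (carrier N \<times> I) B h" "\<And>n a. n \<in> carrier N \<Longrightarrow> a \<in> I \<Longrightarrow> h (frag_of (n, a)) = f n a"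
  shows "h c = \<zero>\<^bsub>B\<^esub>"
proof -
  interpret N: right_module R N using flat by (simp add: flat_right_module_def)
  have R: "ring R" by (rule N.R.ring_axioms)
  interpret L: left_module R "left_regular R" by (rule left_module_left_regular[OF R])
  note ID = lsubD[OF I, simplified]
  let ?A = "coded_ideal R I :: ('a, ('a, 'b) ambient) module"
  let ?B = "coded_ideal R (carrier R) :: ('a, ('a, 'b) ambient) module"
  interpret A: left_module R ?A by (rule left_module_coded_ideal[OF R I])
  have cR: "lsub R (left_regular R) (carrier R)" using L.lsub_carrier by simp
  interpret Bm: left_module R ?B by (rule left_module_coded_ideal[OF R cR])
  interpret TA: tensor_pair R N ?A
    using N.smult_closed A.smult_closed by (intro tensor_pair.intro N.M.a_closed A.M.a_closed)
  interpret TB: tensor_pair R N ?B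
    using N.smult_closed Bm.smult_closed by (intro tensor_pair.intro N.M.a_closed Bm.M.a_closed)
  have AB: "carrier ?A \<subseteq> carrier ?B" using ID(1) by auto
  have "tensor_relations R N ?A \<subseteq> tensor_relations R N ?B"
    unfolding tensor_relations_def coded_ideal_simps(3,4) using AB by blast
  note rel_sub = this
  have T_sub: "k \<in> TB.T" if "k \<in> TA.T" for k
    using that
  proof (induction rule: TA.T_induct)
    case (rel c)
    then show ?case using rel_sub by (intro TB.T_rel) blast
  qed (auto intro: TB.T_zero TB.T_add TB.T_uminus)
  let ?e = "\<lambda>(n, a). frag_of (n, [Inl a]) :: ('b \<times> ('a, 'b) ambient) \<Rightarrow>\<^sub>0 int"
  let ?c = "frag_extend ?e c"
  have e: "?e s \<in> frags TA.S" if "s \<in> carrier N \<times> I" for s using that by auto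
  have cA: "?c \<in> frags TA.S" by (rule frags_extend[OF e c])
  have id: "(\<lambda>x. x) \<in> lmod_hom R ?A ?B" using AB by (auto simp: lmod_hom_def)
  have inj: "inj_on (tensor_map R N ?B (\<lambda>x. x)) (carrier (tensor_group R N ?A))"
    using flat A.left_module_axioms Bm.left_module_axioms id
    unfolding flat_right_module_def by (metis inj_on_id2)
  have tm: "tensor_map R N ?B (\<lambda>x. x) (tensor_coset R N ?A d) = tensor_coset R N ?B d" for d
  proof -
    have fe: "frag_extend (\<lambda>(x, u). frag_of (x, u)) d' = d'" for d' :: "('b \<times> ('a, 'b) ambient) \<Rightarrow>\<^sub>0 int"
    proof -
      have "(\<lambda>(x, u). frag_of (x, u)) = (frag_of :: _ \<Rightarrow> ('b \<times> ('a, 'b) ambient) \<Rightarrow>\<^sub>0 int)" by auto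
      then show ?thesis using frag_expansion[of d'] by simp
    qed
    have "tensor_coset R N ?B (k + d) = tensor_coset R N ?B d" if "k \<in> TA.T" for k
      unfolding TB.coset_eq_iff using T_sub[OF that] by simp
    then show ?thesis
      unfolding tensor_map_def fe by (rule TA.the_elem_coset)
  qed
  have one: "[Inl \<one>\<^bsub>R\<^esub>] \<in> carrier ?B" by simp
  have key: "frag_extend ?e d - frag_of (ev d, [Inl \<one>\<^bsub>R\<^esub>]) \<in> TB.T" if "d \<in> frags (carrier N \<times> I)" for d
    using that
  proof (induction rule: frags_induct)
    case zero
    have "0 - frag_of (\<zero>\<^bsub>N\<^esub>, [Inl \<one>\<^bsub>R\<^esub>]) \<in> TB.T"
      by (rule TB.T_diff[OF TB.T_zero TB.T_zero_left[OF N.M.abelian_group_axioms one]])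
    then show ?case using fragmap_zero[OF N.M.abelian_group_axioms ev(1)] by simp
  next
    case (one s)
    then obtain n a where s: "s = (n, a)" "n \<in> carrier N" "a \<in> I" by blast
    then have aR: "a \<in> carrier R" using ID(1) by blast
    have "frag_of (a \<odot>\<^bsub>N\<^esub> n, [Inl \<one>\<^bsub>R\<^esub>]) - frag_of (n, a \<odot>\<^bsub>?B\<^esub> [Inl \<one>\<^bsub>R\<^esub>]) \<in> TB.T"
      by (rule TB.T_smult[OF aR s(2) \<open>[Inl \<one>\<^bsub>R\<^esub>] \<in> carrier ?B\<close>])
    then have "- (frag_of (a \<odot>\<^bsub>N\<^esub> n, [Inl \<one>\<^bsub>R\<^esub>]) - frag_of (n, [Inl a])) \<in> TB.T"
      using aR by (intro TB.T_uminus) simp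
    then show ?case using s by (simp add: ev(2))
  next
    case (diff a b)
    let ?u = "[Inl \<one>\<^bsub>R\<^esub>] :: ('a, 'b) ambient"
    have cl: "ev a \<in> carrier N" "ev b \<in> carrier N" "ev (a - b) \<in> carrier N"
      using fragmap_closed[OF ev(1)] diff frags_diff by blast+
    have ab: "ev a = ev (a - b) \<oplus>\<^bsub>N\<^esub> ev b"
      using fragmap_add[OF ev(1) frags_diff[OF diff(1,2)] diff(2)] by simp
    have "frag_of (ev (a - b) \<oplus>\<^bsub>N\<^esub> ev b, ?u) - (frag_of (ev (a - b), ?u) + frag_of (ev b, ?u)) \<in> TB.T"
      by (rule TB.T_add_left[OF cl(3,2) one])
    then have 1: "frag_of (ev a, ?u) - (frag_of (ev (a - b), ?u) + frag_of (ev b, ?u)) \<in> TB.T"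
      by (simp only: ab[symmetric])
    have "frag_extend ?e (a - b) - frag_of (ev (a - b), ?u) =
       (frag_extend ?e a - frag_of (ev a, ?u)) - (frag_extend ?e b - frag_of (ev b, ?u)) +
       (frag_of (ev a, ?u) - (frag_of (ev (a - b), ?u) + frag_of (ev b, ?u)))"
      by (simp add: frag_extend_diff)
    moreover have "\<dots> \<in> TB.T" by (intro TB.T_add TB.T_diff diff(3,4) 1)
    ultimately show ?case by (simp only:)
  qed
  have "?c \<in> TB.T"
    using TB.T_subst[OF key[OF c]] TB.T_zero_left[OF N.M.abelian_group_axioms one] ev(3) by simp
  then have "tensor_coset R N ?B ?c = tensor_coset R N ?B 0" unfolding TB.coset_eq_iff by simp
  then have "tensor_map R N ?B (\<lambda>x. x) (tensor_coset R N ?A ?c) = tensor_map R N ?B (\<lambda>x. x) (tensor_coset R N ?A 0)"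
    unfolding tm .
  moreover have "tensor_coset R N ?A ?c \<in> carrier (tensor_group R N ?A)"
    unfolding TA.carrier_tensor_group by (rule imageI[OF cA])
  moreover have "tensor_coset R N ?A 0 \<in> carrier (tensor_group R N ?A)"
    unfolding TA.carrier_tensor_group by (rule imageI[OF frags_zero])
  ultimately have "tensor_coset R N ?A ?c = tensor_coset R N ?A 0" by (rule inj_onD[OF inj])
  then have cT: "?c \<in> TA.T" unfolding TA.coset_eq_iff by simp
  let ?f = "\<lambda>n u. f n (projl (hd u))"
  have f': "balanced R N ?A B ?f"
    using f unfolding balanced_def by (auto simp: Ball_def)
  have "\<exists>h'. fragmap TA.S B h' \<and> (\<forall>s\<in>TA.S. h' (frag_of s) = (case s of (n, u) \<Rightarrow> ?f n u))"
    by (rule fragmap_exists[OF B]) (use f' in \<open>auto simp: balanced_def\<close>)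
  then obtain h' where h': "fragmap TA.S B h'" "\<forall>s\<in>TA.S. h' (frag_of s) = (case s of (n, u) \<Rightarrow> ?f n u)"
    by blast
  have "h' ?c = \<zero>\<^bsub>B\<^esub>"
    by (rule TA.T_balanced[OF B f' h'(1) _ cT]) (use h'(2) in auto)
  moreover have "h c = h' ?c"
    by (rule fragmap_eqI[OF B h(1) fragmap_extend[OF e h'(1)] _ c]) (use h(2) h'(2) in auto)
  ultimately show ?thesis by simp
qed

section \<open>The diagonal tensor product\<close>

context pair_algebra
begin

definition omega :: "('x \<Rightarrow> 'k) set"
  where "omega = {w \<in> carrier KX. aug w = \<zero>\<^bsub>K\<^esub>}"

lemma omega_KX: "w \<in> omega \<Longrightarrow> w \<in> carrier KX"
  by (simp add: omega_def)

lemma move_closed: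
  assumes h: "h \<in> carrier G" and k: "k \<in> carrier K" and w: "w \<in> carrier KX"
  shows "move h k w \<in> carrier KX"
proof (rule free_moduleI)
  show "finite {x. move h k w x \<noteq> \<zero>\<^bsub>K\<^esub>}"
  proof (rule finite_subset)
    show "{x. move h k w x \<noteq> \<zero>\<^bsub>K\<^esub>} \<subseteq> (\<lambda>x. \<phi> h x) ` {x. w x \<noteq> \<zero>\<^bsub>K\<^esub>}"
    proof
      fix x assume "x \<in> {x. move h k w x \<noteq> \<zero>\<^bsub>K\<^esub>}"
      then have x: "x \<in> X" "k \<otimes>\<^bsub>K\<^esub> w (\<phi> (inv h) x) \<noteq> \<zero>\<^bsub>K\<^esub>" by (auto simp: move_def split: if_splits)
      then have "w (\<phi> (inv h) x) \<noteq> \<zero>\<^bsub>K\<^esub>" using k by auto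
      moreover have "x = \<phi> h (\<phi> (inv h) x)" using x(1) h by simp
      ultimately show "x \<in> (\<lambda>x. \<phi> h x) ` {x. w x \<noteq> \<zero>\<^bsub>K\<^esub>}" by blast
    qed
    show "finite ((\<lambda>x. \<phi> h x) ` {x. w x \<noteq> \<zero>\<^bsub>K\<^esub>})" using free_module_finite[OF w] by simp
  qed
qed (use k KX_apply[OF w] in \<open>auto simp: move_def\<close>)

lemma addmap_move:
  assumes h: "h \<in> carrier G" and k: "k \<in> carrier K"
  shows "addmap KX KX (move h k)"
  by (rule addmapI) (auto simp: move_closed[OF h k], auto simp: move_def fun_eq_iff KX_apply k K.r_distr)

lemma move_monomial:
  assumes "h \<in> carrier G" "y \<in> X" "k \<in> carrier K" "c \<in> carrier K"
  shows "move h k (monomial K y c) = monomial K (\<phi> h y) (k \<otimes>\<^bsub>K\<^esub> c)"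
  using assms by (auto simp: move_def monomial_def fun_eq_iff)

lemma move_move:
  assumes "g \<in> carrier G" "h \<in> carrier G" "k \<in> carrier K" "l \<in> carrier K" "w \<in> carrier KX"
  shows "move g k (move h l w) = move (g \<otimes> h) (k \<otimes>\<^bsub>K\<^esub> l) w"
  using assms KX_apply[OF assms(5)]
  by (auto simp: move_def fun_eq_iff K.m_assoc G.inv_mult_group act_mult)

lemma move_one: "w \<in> carrier KX \<Longrightarrow> move \<one> \<one>\<^bsub>K\<^esub> w = w"
  using KX_apply[of w] free_module_outside[of w K X] by (auto simp: move_def fun_eq_iff)

lemma aug_move:
  assumes h: "h \<in> carrier G" and k: "k \<in> carrier K" and w: "w \<in> carrier KX"
  shows "aug (move h k w) = k \<otimes>\<^bsub>K\<^esub> aug w"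
proof (rule addmap_free_eqI[OF K_ring K.abelian_group_axioms addmap_comp[OF addmap_move[OF h k] addmap_aug]
      addmap_comp[OF addmap_aug] _ w])
  show "addmap K K (\<lambda>x. k \<otimes>\<^bsub>K\<^esub> x)" by (rule addmapI) (auto simp: k K.r_distr)
  fix y c assume "y \<in> X" "c \<in> carrier K"
  then show "aug (move h k (monomial K y c)) = k \<otimes>\<^bsub>K\<^esub> aug (monomial K y c)"
    using h k by (simp add: move_monomial aug_monomial)
qed

lemma omega_move: "h \<in> carrier G \<Longrightarrow> k \<in> carrier K \<Longrightarrow> w \<in> omega \<Longrightarrow> move h k w \<in> omega"
  by (simp add: omega_def move_closed aug_move)

lemma omega_add: "v \<in> omega \<Longrightarrow> w \<in> omega \<Longrightarrow> v \<oplus>\<^bsub>KX\<^esub> w \<in> omega"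
  using addmap_add[OF addmap_aug, of v w] free_module_add_closed[OF K_ring, of v X w]
  by (simp add: omega_def del: free_module_simps)

lemma omega_zero: "\<zero>\<^bsub>KX\<^esub> \<in> omega"
  using addmap_zero[OF addmap_aug KX_group K.abelian_group_axioms]
    abelian_monoid.zero_closed[OF abelian_group.axioms(1)[OF KX_group]]
  by (simp add: omega_def del: free_module_simps)

lemma permutation_smult_mon:
  assumes h: "h \<in> carrier G" and k: "k \<in> carrier K" and w: "w \<in> carrier KX"
  shows "mon h k \<odot>\<^bsub>permutation_module K G X \<phi>\<^esub> w = move h k w"
proof
  fix x
  show "(mon h k \<odot>\<^bsub>permutation_module K G X \<phi>\<^esub> w) x = move h k w x"
  proof (cases "k = \<zero>\<^bsub>K\<^esub>")
    case True
    then have e: "{g \<in> carrier G. mon h k g \<noteq> \<zero>\<^bsub>K\<^esub>} = {}" by (auto simp: monomial_def)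
    show ?thesis
      unfolding permutation_module_def module.simps e using True KX_apply[OF w] by (simp add: move_def)
  next
    case False
    then have e: "{g \<in> carrier G. mon h k g \<noteq> \<zero>\<^bsub>K\<^esub>} = {h}" using h by (auto simp: monomial_def)
    show ?thesis
      unfolding permutation_module_def module.simps e using k KX_apply[OF w] by (simp add: move_def monomial_def)
  qed
qed

abbreviation "Om \<equiv> augmentation_module K G X \<phi>"

lemma Om_carrier: "carrier Om = omega"
proof -
  have "carrier Om = {w \<in> carrier KX. augmentation K X w = \<zero>\<^bsub>K\<^esub>}"
    by (simp add: augmentation_module_def a_kernel_def' permutation_module_def)
  then show ?thesis unfolding omega_def using augmentation_eq by auto
qed

lemma Om_add: "v \<oplus>\<^bsub>Om\<^esub> w = v \<oplus>\<^bsub>KX\<^esub> w"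
  by (simp add: augmentation_module_def permutation_module_def)

lemma Om_zero: "\<zero>\<^bsub>Om\<^esub> = \<zero>\<^bsub>KX\<^esub>"
  by (simp add: augmentation_module_def permutation_module_def)

lemma Om_smult_mon:
  "h \<in> carrier G \<Longrightarrow> k \<in> carrier K \<Longrightarrow> w \<in> omega \<Longrightarrow> mon h k \<odot>\<^bsub>Om\<^esub> w = move h k w"
  using permutation_smult_mon[OF _ _ omega_KX] by (simp add: augmentation_module_def)

lemma opposite_mon:
  assumes "g \<in> carrier G"
  shows "(\<lambda>h. if h \<in> carrier G then mon g k (inv h) else \<zero>\<^bsub>K\<^esub>) = mon (inv g) k"
proof
  fix h
  have "h \<in> carrier G \<Longrightarrow> inv h = g \<longleftrightarrow> h = inv g" using assms by auto
  then show "(if h \<in> carrier G then mon g k (inv h) else \<zero>\<^bsub>K\<^esub>) = mon (inv g) k h"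
    using assms by (auto simp: monomial_def)
qed

end

lemma frag_extend_fun_sum: "frag_extend (\<lambda>s. \<Sum>i\<in>I. f i s) c = (\<Sum>i\<in>I. frag_extend (f i) c)"
proof -
  have "c \<in> frags UNIV" by simp
  then show ?thesis
    by (induction rule: frags_induct) (simp_all add: frag_extend_diff sum_subtractf)
qed

locale diagonal_pair = pair_algebra K G X \<phi> + D: ring D
  for K :: "('k, 'r) ring_scheme" and G :: "('g, 's) monoid_scheme" (structure)
    and X :: "'x set" and \<phi> :: "'g \<Rightarrow> 'x \<Rightarrow> 'x" and D :: "('d, 't) ring_scheme" +
  fixes \<iota> :: "('g \<Rightarrow> 'k) \<Rightarrow> 'd"
  assumes iota: "\<iota> \<in> ring_hom (group_ring K G) D"
    and right: "right_module (group_ring K G) (diagonal_tensor K G (restrict_scalars \<iota> (right_regular D))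
              (opposite_module K G (augmentation_module K G X \<phi>)))"
begin

text \<open>\<open>NN\<close> is \<open>D \<otimes> \<omega>\<^sup>o\<^sup>p\<close>; its factors are \<open>N0\<close> and \<open>M0\<close> as modules over \<open>KG\<close>, and \<open>N1\<close> and \<open>M1\<close> over \<open>K\<close>.\<close>
abbreviation "N0 \<equiv> restrict_scalars \<iota> (right_regular D)"
abbreviation "M0 \<equiv> opposite_module K G Om"
abbreviation "N1 \<equiv> scalar_restriction K G N0"
abbreviation "M1 \<equiv> scalar_restriction K G M0"
abbreviation "NN \<equiv> diagonal_tensor K G N0 M0"
abbreviation "DX \<equiv> free_module D X"

lemma iota_closed [simp]: "a \<in> carrier KG \<Longrightarrow> \<iota> a \<in> carrier D"
  using iota by (simp add: ring_hom_def Pi_iff)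

lemma iota_add: "a \<in> carrier KG \<Longrightarrow> b \<in> carrier KG \<Longrightarrow> \<iota> (a \<oplus>\<^bsub>KG\<^esub> b) = \<iota> a \<oplus>\<^bsub>D\<^esub> \<iota> b"
  using iota by (simp add: ring_hom_def)

lemma iota_mult: "a \<in> carrier KG \<Longrightarrow> b \<in> carrier KG \<Longrightarrow> \<iota> (a \<otimes>\<^bsub>KG\<^esub> b) = \<iota> a \<otimes>\<^bsub>D\<^esub> \<iota> b"
  using iota by (simp add: ring_hom_def)

lemma addmap_iota: "addmap KG D \<iota>"
  by (rule addmapI) (auto simp: iota_add)

lemma iota_zero: "\<iota> \<zero>\<^bsub>KG\<^esub> = \<zero>\<^bsub>D\<^esub>"
  using addmap_zero[OF addmap_iota R.abelian_group_axioms D.abelian_group_axioms] .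

lemma N0_smult: "a \<odot>\<^bsub>N0\<^esub> d = d \<otimes>\<^bsub>D\<^esub> \<iota> a"
  by (simp add: restrict_scalars_def right_regular_def)

lemma M0_smult_mon: "g \<in> carrier G \<Longrightarrow> k \<in> carrier K \<Longrightarrow> w \<in> omega \<Longrightarrow> mon g k \<odot>\<^bsub>M0\<^esub> w = move (inv g) k w"
  by (simp add: opposite_module_def restrict_scalars_def opposite_mon Om_smult_mon)

lemma N1_simps: "carrier N1 = carrier D" "x \<oplus>\<^bsub>N1\<^esub> y = x \<oplus>\<^bsub>D\<^esub> y" "\<zero>\<^bsub>N1\<^esub> = \<zero>\<^bsub>D\<^esub>"
    "k \<odot>\<^bsub>N1\<^esub> d = d \<otimes>\<^bsub>D\<^esub> \<iota> (scal k)"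
  by (simp_all add: scalar_restriction_def restrict_scalars_def right_regular_def)

lemma M1_simps: "carrier M1 = omega" "x \<oplus>\<^bsub>M1\<^esub> y = x \<oplus>\<^bsub>KX\<^esub> y" "\<zero>\<^bsub>M1\<^esub> = \<zero>\<^bsub>KX\<^esub>"
  using Om_carrier Om_add Om_zero by (simp_all add: scalar_restriction_def opposite_module_def restrict_scalars_def)

lemma M1_smult: "k \<in> carrier K \<Longrightarrow> w \<in> omega \<Longrightarrow> k \<odot>\<^bsub>M1\<^esub> w = move \<one> k w"
  using M0_smult_mon[OF G.one_closed] by (simp add: scalar_restriction_def restrict_scalars_def)

lemma mon1_closed [simp]: "k \<in> carrier K \<Longrightarrow> scal k \<in> carrier KG"
  by (simp add: mon_closed)

sublocale TP: tensor_pair K N1 M1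
  by unfold_locales
    (auto simp: N1_simps M1_simps M1_smult omega_move simp del: free_module_simps intro: omega_add)

definition cls :: "'d \<Rightarrow> ('x \<Rightarrow> 'k) \<Rightarrow> ('d \<times> ('x \<Rightarrow> 'k) \<Rightarrow>\<^sub>0 int) set"
  where "cls d w = tensor_coset K N1 M1 (frag_of (d, w))"

lemma S_eq: "TP.S = carrier D \<times> omega"
  by (simp add: N1_simps M1_simps)

lemma NN_carrier: "carrier NN = tensor_coset K N1 M1 ` frags TP.S"
  using TP.carrier_tensor_group by (simp add: diagonal_tensor_def Let_def)

lemma NN_add: "tensor_coset K N1 M1 c \<oplus>\<^bsub>NN\<^esub> tensor_coset K N1 M1 d = tensor_coset K N1 M1 (c + d)"
  using TP.mult_tensor_group by (simp add: diagonal_tensor_def Let_def)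

lemma NN_group: "abelian_group NN"
  using right by (simp add: right_module_def)

lemma cls_closed: "d \<in> carrier D \<Longrightarrow> w \<in> omega \<Longrightarrow> cls d w \<in> carrier NN"
  unfolding NN_carrier cls_def by (rule imageI) (simp add: S_eq)

lemma coset_fragmap: "fragmap TP.S NN (tensor_coset K N1 M1)"
  by (rule fragmapI) (auto simp: NN_add NN_carrier simp del: carrier_free_Abelian_group_iff)

text \<open>The universal property of the tensor product.\<close>
lemma NN_universal:
  assumes B: "abelian_group B" and f: "balanced K N1 M1 B f"
  shows "\<exists>H. addmap NN B H \<and> (\<forall>d\<in>carrier D. \<forall>w\<in>omega. H (cls d w) = f d w)"
proof -
  have "\<exists>h. fragmap TP.S B h \<and> (\<forall>s\<in>TP.S. h (frag_of s) = (case s of (d, w) \<Rightarrow> f d w))"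
    by (rule fragmap_exists[OF B]) (use f in \<open>auto simp: balanced_def\<close>)
  then obtain h where h: "fragmap TP.S B h" "\<forall>s\<in>TP.S. h (frag_of s) = (case s of (d, w) \<Rightarrow> f d w)" by blast
  have hT: "h c = \<zero>\<^bsub>B\<^esub>" if "c \<in> TP.T" for c
    by (rule TP.T_balanced[OF B f h(1) _ that]) (use h(2) in auto)
  let ?rep = "\<lambda>C. SOME c. c \<in> frags TP.S \<and> C = tensor_coset K N1 M1 c"
  let ?H = "\<lambda>C. h (?rep C)"
  have H: "?H (tensor_coset K N1 M1 c) = h c" if c: "c \<in> frags TP.S" for c
  proof -
    let ?c = "?rep (tensor_coset K N1 M1 c)"
    have "?c \<in> frags TP.S \<and> tensor_coset K N1 M1 c = tensor_coset K N1 M1 ?c"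
      by (rule someI[where x = c]) (use c in simp)
    then have c': "?c \<in> frags TP.S" and "c - ?c \<in> TP.T" unfolding TP.coset_eq_iff by auto
    then have 0: "h (c - ?c) = \<zero>\<^bsub>B\<^esub>" using hT by blast
    have "h c = h ((c - ?c) + ?c)" by simp
    also have "\<dots> = h (c - ?c) \<oplus>\<^bsub>B\<^esub> h ?c" by (rule fragmap_add[OF h(1) frags_diff[OF c c'] c'])
    finally show ?thesis
      using 0 fragmap_closed[OF h(1) c'] abelian_monoid.l_zero[OF abelian_group.axioms(1)[OF B]] by simp
  qed
  have "addmap NN B ?H"
  proof (rule addmapI)
    fix x assume "x \<in> carrier NN"
    then obtain c where c: "c \<in> frags TP.S" "x = tensor_coset K N1 M1 c" unfolding NN_carrier by blast
    show "?H x \<in> carrier B" unfolding c(2) H[OF c(1)] by (rule fragmap_closed[OF h(1) c(1)])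
    fix y assume "y \<in> carrier NN"
    then obtain d where d: "d \<in> frags TP.S" "y = tensor_coset K N1 M1 d" unfolding NN_carrier by blast
    show "?H (x \<oplus>\<^bsub>NN\<^esub> y) = ?H x \<oplus>\<^bsub>B\<^esub> ?H y"
      unfolding c(2) d(2) NN_add H[OF c(1)] H[OF d(1)] H[OF frags_add[OF c(1) d(1)]]
      by (rule fragmap_add[OF h(1) c(1) d(1)])
  qed
  moreover have "?H (cls d w) = f d w" if "d \<in> carrier D" "w \<in> omega" for d w
  proof -
    have s: "(d, w) \<in> TP.S" using that by (simp add: S_eq)
    then have "frag_of (d, w) \<in> frags TP.S" by simp
    then show ?thesis unfolding cls_def using H h(2) s by simp
  qed
  ultimately show ?thesis by blast
qed

lemma NN_eqI:
  assumes B: "abelian_group B" and H: "addmap NN B H" "addmap NN B H'"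
    and eq: "\<And>d w. d \<in> carrier D \<Longrightarrow> w \<in> omega \<Longrightarrow> H (cls d w) = H' (cls d w)" and n: "n \<in> carrier NN"
  shows "H n = H' n"
proof -
  obtain c where c: "c \<in> frags TP.S" "n = tensor_coset K N1 M1 c" using n unfolding NN_carrier by blast
  show ?thesis
    unfolding c(2)
  proof (rule fragmap_eqI[OF B fragmap_comp[OF coset_fragmap H(1)] fragmap_comp[OF coset_fragmap H(2)] _ c(1)])
    fix s assume "s \<in> TP.S"
    then obtain d w where "s = (d, w)" "d \<in> carrier D" "w \<in> omega" unfolding S_eq by blast
    then show "H (tensor_coset K N1 M1 (frag_of s)) = H' (tensor_coset K N1 M1 (frag_of s))"
      using eq by (simp add: cls_def)
  qed
qed

lemma cls_add_left:
  assumes "d \<in> carrier D" "e \<in> carrier D" "w \<in> omega"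
  shows "cls (d \<oplus>\<^bsub>D\<^esub> e) w = cls d w \<oplus>\<^bsub>NN\<^esub> cls e w"
  unfolding cls_def NN_add TP.coset_eq_iff using TP.T_add_left[of d e w] assms by (simp add: N1_simps M1_simps)

lemma cls_add_right:
  assumes "d \<in> carrier D" "v \<in> omega" "w \<in> omega"
  shows "cls d (v \<oplus>\<^bsub>KX\<^esub> w) = cls d v \<oplus>\<^bsub>NN\<^esub> cls d w"
  unfolding cls_def NN_add TP.coset_eq_iff using TP.T_add_right[of d v w] assms
  by (simp add: N1_simps M1_simps del: free_module_simps)

lemma cls_smult:
  assumes "d \<in> carrier D" "k \<in> carrier K" "w \<in> omega"
  shows "cls (d \<otimes>\<^bsub>D\<^esub> \<iota> (scal k)) w = cls d (move \<one> k w)"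
  unfolding cls_def TP.coset_eq_iff using TP.T_smult[of k d w] assms by (simp add: N1_simps M1_simps M1_smult)

text \<open>The action is defined by a sum over the support of \<open>k g\<close>, which is empty for \<open>k = 0\<close>; the formula
  holds in this case too, as \<open>0 \<otimes> w\<close> vanishes.\<close>
lemma NN_smult:
  assumes g: "g \<in> carrier G" and k: "k \<in> carrier K" and d: "d \<in> carrier D" and w: "w \<in> omega"
  shows "mon g k \<odot>\<^bsub>NN\<^esub> cls d w = cls (d \<otimes>\<^bsub>D\<^esub> \<iota> (mon g k)) (move (inv g) \<one>\<^bsub>K\<^esub> w)"
proof -
  let ?A = "{h \<in> carrier G. mon g k h \<noteq> \<zero>\<^bsub>K\<^esub>}"
  let ?F = "\<lambda>h (n, m). frag_of (monomial K h (mon g k h) \<odot>\<^bsub>N0\<^esub> n, monomial K h \<one>\<^bsub>K\<^esub> \<odot>\<^bsub>M0\<^esub> m) :: ('d \<times> ('x \<Rightarrow> 'k)) \<Rightarrow>\<^sub>0 int"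
  let ?f = "\<lambda>(n, m). \<Sum>h\<in>?A. frag_of (monomial K h (mon g k h) \<odot>\<^bsub>N0\<^esub> n, monomial K h \<one>\<^bsub>K\<^esub> \<odot>\<^bsub>M0\<^esub> m)"
  have def: "mon g k \<odot>\<^bsub>NN\<^esub> C = the_elem ((\<lambda>c. tensor_coset K N1 M1 (frag_extend ?f c)) ` C)" for C
    by (simp add: diagonal_tensor_def Let_def)
  have T: "frag_extend ?f c \<in> TP.T" if "c \<in> TP.T" for c
  proof -
    have sum: "frag_extend ?f c = (\<Sum>h\<in>?A. frag_extend (?F h) c)" for c
    proof -
      have "?f = (\<lambda>s. \<Sum>h\<in>?A. ?F h s)" by auto
      then show ?thesis using frag_extend_fun_sum[of ?F ?A c] by simp
    qed
    have one: "frag_extend (?F h) c \<in> TP.T" if h: "h \<in> carrier G" and c: "c \<in> TP.T" for h c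
      using c
    proof (induction rule: TP.T_induct)
      case zero
      show ?case by (simp add: TP.T_zero)
    next
      case (add c d)
      then show ?case by (simp add: frag_extend_add TP.T_add)
    next
      case (uminus c)
      then show ?case by (simp add: frag_extend_minus TP.T_uminus)
    next
      case (rel c)
      let ?l = "mon g k h"
      have l: "?l \<in> carrier K" using k by (simp add: monomial_def)
      have ml: "mon h ?l \<in> carrier KG" by (rule mon_closed[OF h l])
      have ih: "inv h \<in> carrier G" using h by simp
      have F: "?F h (n, m) = frag_of (n \<otimes>\<^bsub>D\<^esub> \<iota> (mon h ?l), move (inv h) \<one>\<^bsub>K\<^esub> m)" if "m \<in> omega" for n m
        using that h by (simp add: N0_smult M0_smult_mon)
      have mv: "move (inv h) \<one>\<^bsub>K\<^esub> m \<in> omega" if "m \<in> omega" for m using that by (simp add: omega_move ih)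
      let ?R1 = "{frag_of (x \<oplus>\<^bsub>D\<^esub> y, u) - (frag_of (x, u) + frag_of (y, u)) | x y u.
          x \<in> carrier D \<and> y \<in> carrier D \<and> u \<in> omega}"
      let ?R2 = "{frag_of (x, u \<oplus>\<^bsub>KX\<^esub> v) - (frag_of (x, u) + frag_of (x, v)) | x u v.
          x \<in> carrier D \<and> u \<in> omega \<and> v \<in> omega}"
      let ?R3 = "{frag_of (a \<odot>\<^bsub>N1\<^esub> x, u) - frag_of (x, a \<odot>\<^bsub>M1\<^esub> u) | x a u.
          x \<in> carrier D \<and> a \<in> carrier K \<and> u \<in> omega}"
      have "c \<in> ?R1 \<union> ?R2 \<union> ?R3"
        using rel unfolding tensor_relations_def N1_simps(1,2) M1_simps(1,2) .
      then consider "c \<in> ?R1" | "c \<in> ?R2" | "c \<in> ?R3" by (elim UnE)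
      then show ?case
      proof cases
        case 1
        then obtain x y u where 1: "x \<in> carrier D" "y \<in> carrier D" "u \<in> omega"
          "c = frag_of (x \<oplus>\<^bsub>D\<^esub> y, u) - (frag_of (x, u) + frag_of (y, u))" by blast
        have "frag_extend (?F h) c = frag_of (x \<otimes>\<^bsub>D\<^esub> \<iota> (mon h ?l) \<oplus>\<^bsub>D\<^esub> y \<otimes>\<^bsub>D\<^esub> \<iota> (mon h ?l), move (inv h) \<one>\<^bsub>K\<^esub> u) -
           (frag_of (x \<otimes>\<^bsub>D\<^esub> \<iota> (mon h ?l), move (inv h) \<one>\<^bsub>K\<^esub> u) + frag_of (y \<otimes>\<^bsub>D\<^esub> \<iota> (mon h ?l), move (inv h) \<one>\<^bsub>K\<^esub> u))"
          using 1 ml F by (simp add: frag_extend_diff frag_extend_add D.l_distr)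
        then show ?thesis
          using TP.T_add_left[of "x \<otimes>\<^bsub>D\<^esub> \<iota> (mon h ?l)" "y \<otimes>\<^bsub>D\<^esub> \<iota> (mon h ?l)" "move (inv h) \<one>\<^bsub>K\<^esub> u"]
            1 ml mv by (simp add: N1_simps M1_simps)
      next
        case 2
        then obtain x u v where 2: "x \<in> carrier D" "u \<in> omega" "v \<in> omega"
          "c = frag_of (x, u \<oplus>\<^bsub>KX\<^esub> v) - (frag_of (x, u) + frag_of (x, v))" by blast
        have uv: "u \<oplus>\<^bsub>KX\<^esub> v \<in> omega" by (rule omega_add[OF 2(2,3)])
        have "move (inv h) \<one>\<^bsub>K\<^esub> (u \<oplus>\<^bsub>KX\<^esub> v) = move (inv h) \<one>\<^bsub>K\<^esub> u \<oplus>\<^bsub>KX\<^esub> move (inv h) \<one>\<^bsub>K\<^esub> v"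
          by (rule addmap_add[OF addmap_move[OF ih K.one_closed] omega_KX[OF 2(2)] omega_KX[OF 2(3)]])
        then have "frag_extend (?F h) c =
           frag_of (x \<otimes>\<^bsub>D\<^esub> \<iota> (mon h ?l), move (inv h) \<one>\<^bsub>K\<^esub> u \<oplus>\<^bsub>KX\<^esub> move (inv h) \<one>\<^bsub>K\<^esub> v) -
           (frag_of (x \<otimes>\<^bsub>D\<^esub> \<iota> (mon h ?l), move (inv h) \<one>\<^bsub>K\<^esub> u) + frag_of (x \<otimes>\<^bsub>D\<^esub> \<iota> (mon h ?l), move (inv h) \<one>\<^bsub>K\<^esub> v))"
          unfolding 2(4) frag_extend_diff frag_extend_add frag_extend_of F[OF uv] F[OF 2(2)] F[OF 2(3)] by simp
        then show ?thesis
          using TP.T_add_right[of "x \<otimes>\<^bsub>D\<^esub> \<iota> (mon h ?l)" "move (inv h) \<one>\<^bsub>K\<^esub> u" "move (inv h) \<one>\<^bsub>K\<^esub> v"]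
            2 ml mv by (simp add: N1_simps M1_simps del: free_module_simps)
      next
        case 3
        then obtain x a u where 3: "x \<in> carrier D" "a \<in> carrier K" "u \<in> omega"
          "c = frag_of (a \<odot>\<^bsub>N1\<^esub> x, u) - frag_of (x, a \<odot>\<^bsub>M1\<^esub> u)" by blast
        have 1: "move \<one> a u \<in> omega" by (rule omega_move[OF G.one_closed 3(2,3)])
        have 2: "move (inv h) \<one>\<^bsub>K\<^esub> (move \<one> a u) = move \<one> a (move (inv h) \<one>\<^bsub>K\<^esub> u)"
          using ih 3 omega_KX[OF 3(3)] by (simp add: move_move)
        have "scal a \<otimes>\<^bsub>KG\<^esub> mon h ?l = mon h ?l \<otimes>\<^bsub>KG\<^esub> scal a"
          using h l 3(2) by (simp add: mon_mult K.m_comm)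
        then have c: "\<iota> (scal a) \<otimes>\<^bsub>D\<^esub> \<iota> (mon h ?l) = \<iota> (mon h ?l) \<otimes>\<^bsub>D\<^esub> \<iota> (scal a)"
          using iota_mult[of "scal a" "mon h ?l"] iota_mult[of "mon h ?l" "scal a"] ml 3(2) by simp
        have "frag_extend (?F h) c =
           frag_of ((x \<otimes>\<^bsub>D\<^esub> \<iota> (scal a)) \<otimes>\<^bsub>D\<^esub> \<iota> (mon h ?l), move (inv h) \<one>\<^bsub>K\<^esub> u) -
           frag_of (x \<otimes>\<^bsub>D\<^esub> \<iota> (mon h ?l), move (inv h) \<one>\<^bsub>K\<^esub> (move \<one> a u))"
          unfolding 3(4) frag_extend_diff frag_extend_of M1_smult[OF 3(2,3)] F[OF 3(3)] F[OF 1] N1_simps(4) by simp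
        also have "\<dots> = frag_of (a \<odot>\<^bsub>N1\<^esub> (x \<otimes>\<^bsub>D\<^esub> \<iota> (mon h ?l)), move (inv h) \<one>\<^bsub>K\<^esub> u) -
           frag_of (x \<otimes>\<^bsub>D\<^esub> \<iota> (mon h ?l), a \<odot>\<^bsub>M1\<^esub> (move (inv h) \<one>\<^bsub>K\<^esub> u))"
          unfolding 2 M1_smult[OF 3(2) mv[OF 3(3)]] N1_simps(4) using 3 ml c by (simp add: D.m_assoc)
        finally show ?thesis
          using TP.T_smult[of a "x \<otimes>\<^bsub>D\<^esub> \<iota> (mon h ?l)" "move (inv h) \<one>\<^bsub>K\<^esub> u"] 3 ml mv
          by (simp add: N1_simps M1_simps)
      qed
    qed
    have "finite B \<Longrightarrow> B \<subseteq> carrier G \<Longrightarrow> (\<Sum>h\<in>B. frag_extend (?F h) c) \<in> TP.T" for B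
      by (induction B rule: finite_induct) (simp_all add: TP.T_zero TP.T_add one that)
    moreover have "finite ?A" by (rule finite_subset[of _ "{g}"]) (auto simp: monomial_def)
    ultimately show ?thesis unfolding sum by blast
  qed
  have "mon g k \<odot>\<^bsub>NN\<^esub> cls d w = tensor_coset K N1 M1 (frag_extend ?f (frag_of (d, w)))"
    unfolding def cls_def
  proof (rule TP.the_elem_coset)
    fix c assume "c \<in> TP.T"
    then show "tensor_coset K N1 M1 (frag_extend ?f (c + frag_of (d, w))) =
      tensor_coset K N1 M1 (frag_extend ?f (frag_of (d, w)))"
      unfolding TP.coset_eq_iff frag_extend_add using T by simp
  qed
  also have "\<dots> = cls (d \<otimes>\<^bsub>D\<^esub> \<iota> (mon g k)) (move (inv g) \<one>\<^bsub>K\<^esub> w)"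
  proof (cases "k = \<zero>\<^bsub>K\<^esub>")
    case True
    then have e: "?A = {}" by (auto simp: monomial_def)
    have "mon g k = \<zero>\<^bsub>KG\<^esub>" using True by (auto simp: monomial_def KG_zero)
    then have "d \<otimes>\<^bsub>D\<^esub> \<iota> (mon g k) = \<zero>\<^bsub>N1\<^esub>" using d by (simp add: iota_zero N1_simps)
    moreover have "move (inv g) \<one>\<^bsub>K\<^esub> w \<in> carrier M1" using g w by (simp add: omega_move M1_simps)
    moreover have "abelian_group N1"
      by (rule abelian_group_cong[OF D.abelian_group_axioms]) (simp_all add: N1_simps)
    ultimately have "frag_of (d \<otimes>\<^bsub>D\<^esub> \<iota> (mon g k), move (inv g) \<one>\<^bsub>K\<^esub> w) \<in> TP.T"
      using TP.T_zero_left by simp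
    then show ?thesis
      unfolding cls_def TP.coset_eq_iff e by (simp add: TP.T_uminus)
  next
    case False
    then have e: "?A = {g}" using g by (auto simp: monomial_def)
    have "mon g k g = k" by (simp add: monomial_def)
    then show ?thesis
      unfolding cls_def e using g w by (simp add: N0_smult M0_smult_mon)
  qed
  finally show ?thesis .
qed

end

context pair_algebra
begin

text \<open>The \<open>K\<close>-linear projection of \<open>K[X]\<close> onto the augmentation kernel along \<open>x\<^sub>0\<close>.\<close>
definition center :: "'x \<Rightarrow> ('x \<Rightarrow> 'k) \<Rightarrow> 'x \<Rightarrow> 'k"
  where "center x0 w = w \<ominus>\<^bsub>KX\<^esub> monomial K x0 (aug w)"

lemma addmap_center_aux: "x0 \<in> X \<Longrightarrow> addmap KX KX (\<lambda>w. monomial K x0 (aug w))"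
  by (rule addmap_comp[OF addmap_aug addmap_monomial[OF K_ring]])

lemma addmap_center: "x0 \<in> X \<Longrightarrow> addmap KX KX (center x0)"
  unfolding center_def by (rule addmap_diff[OF addmap_id addmap_center_aux KX_group])

lemma center_omega:
  assumes x0: "x0 \<in> X" and w: "w \<in> carrier KX"
  shows "center x0 w \<in> omega"
proof -
  have m0w: "monomial K x0 (aug w) \<in> carrier KX" by (rule addmap_closed[OF addmap_center_aux[OF x0] w])
  have "aug (center x0 w) = aug w \<ominus>\<^bsub>K\<^esub> aug (monomial K x0 (aug w))"
    unfolding center_def by (rule addmap_minus[OF addmap_aug KX_group K.abelian_group_axioms w m0w])
  also have "\<dots> = \<zero>\<^bsub>K\<^esub>"
    using aug_monomial[OF x0] addmap_closed[OF addmap_aug w] by (simp add: a_minus_def K.r_neg)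
  finally show ?thesis using addmap_closed[OF addmap_center[OF x0] w] by (simp add: omega_def)
qed

lemma center_id:
  assumes w: "w \<in> omega"
  shows "center x0 w = w"
proof -
  interpret KXg: abelian_group KX by (rule KX_group)
  have "monomial K x0 (aug w) = \<zero>\<^bsub>KX\<^esub>" using w by (auto simp: omega_def monomial_def)
  then show ?thesis
    unfolding center_def a_minus_def using omega_KX[OF w] by (simp del: free_module_simps)
qed

lemma center_pt:
  assumes x0: "x0 \<in> X" and y: "y \<in> X" and k: "k \<in> carrier K"
  shows "move \<one> k (center x0 (pt y)) = center x0 (monomial K y k)"
proof -
  have "center x0 (pt y) = pt y \<ominus>\<^bsub>KX\<^esub> pt x0" unfolding center_def aug_monomial[OF y K.one_closed] ..
  then have "move \<one> k (center x0 (pt y)) = move \<one> k (pt y) \<ominus>\<^bsub>KX\<^esub> move \<one> k (pt x0)"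
    using addmap_minus[OF addmap_move[OF G.one_closed k] KX_group KX_group pt_closed[OF y] pt_closed[OF x0]] by simp
  also have "\<dots> = monomial K y k \<ominus>\<^bsub>KX\<^esub> monomial K x0 k"
    using move_pt[OF G.one_closed y k] move_pt[OF G.one_closed x0 k] y x0 by simp
  also have "\<dots> = center x0 (monomial K y k)" unfolding center_def aug_monomial[OF y k] ..
  finally show ?thesis .
qed

end

context diagonal_pair
begin

lemma DX_group: "abelian_group DX"
  by (rule abelian_group_free[OF D.ring_axioms])

lemma iota_KX_closed:
  assumes d: "d \<in> carrier D" and w: "w \<in> carrier KX"
  shows "(\<lambda>x. d \<otimes>\<^bsub>D\<^esub> \<iota> (scal (w x))) \<in> carrier DX"
proof (rule free_moduleI)
  have z: "d \<otimes>\<^bsub>D\<^esub> \<iota> (scal \<zero>\<^bsub>K\<^esub>) = \<zero>\<^bsub>D\<^esub>"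
  proof -
    have "scal \<zero>\<^bsub>K\<^esub> = \<zero>\<^bsub>KG\<^esub>" by (auto simp: monomial_def KG_zero)
    then show ?thesis using d by (simp add: iota_zero)
  qed
  show "d \<otimes>\<^bsub>D\<^esub> \<iota> (scal (w x)) \<in> carrier D" for x using d KX_apply[OF w] by simp
  show "d \<otimes>\<^bsub>D\<^esub> \<iota> (scal (w x)) = \<zero>\<^bsub>D\<^esub>" if "x \<notin> X" for x
    unfolding free_module_outside[OF w that] by (rule z)
  show "finite {x. d \<otimes>\<^bsub>D\<^esub> \<iota> (scal (w x)) \<noteq> \<zero>\<^bsub>D\<^esub>}"
  proof (rule finite_subset[OF _ free_module_finite[OF w]], rule subsetI)
    fix x assume "x \<in> {x. d \<otimes>\<^bsub>D\<^esub> \<iota> (scal (w x)) \<noteq> \<zero>\<^bsub>D\<^esub>}"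
    then have "w x \<noteq> \<zero>\<^bsub>K\<^esub>" using z by auto
    then show "x \<in> {x. w x \<noteq> \<zero>\<^bsub>K\<^esub>}" by simp
  qed
qed

lemma addmap_iota_KX:
  assumes d: "d \<in> carrier D"
  shows "addmap KX DX (\<lambda>w x. d \<otimes>\<^bsub>D\<^esub> \<iota> (scal (w x)))"
proof (rule addmapI)
  show "(\<lambda>x. d \<otimes>\<^bsub>D\<^esub> \<iota> (scal (w x))) \<in> carrier DX" if "w \<in> carrier KX" for w
    by (rule iota_KX_closed[OF d that])
  fix v w assume v: "v \<in> carrier KX" and w: "w \<in> carrier KX"
  have "d \<otimes>\<^bsub>D\<^esub> \<iota> (scal (v x \<oplus>\<^bsub>K\<^esub> w x)) = d \<otimes>\<^bsub>D\<^esub> \<iota> (scal (v x)) \<oplus>\<^bsub>D\<^esub> d \<otimes>\<^bsub>D\<^esub> \<iota> (scal (w x))" for x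
    using addmap_add[OF addmap_mon[OF G.one_closed] KX_apply[OF v] KX_apply[OF w]]
      iota_add[OF mon1_closed mon1_closed, OF KX_apply[OF v, of x] KX_apply[OF w, of x]]
      d KX_apply[OF v] KX_apply[OF w]
    by (simp add: D.r_distr)
  then show "(\<lambda>x. d \<otimes>\<^bsub>D\<^esub> \<iota> (scal ((v \<oplus>\<^bsub>KX\<^esub> w) x))) =
    (\<lambda>x. d \<otimes>\<^bsub>D\<^esub> \<iota> (scal (v x))) \<oplus>\<^bsub>DX\<^esub> (\<lambda>x. d \<otimes>\<^bsub>D\<^esub> \<iota> (scal (w x)))"
    by simp
qed

lemma coordinates_balanced: "balanced K N1 M1 DX (\<lambda>d w x. d \<otimes>\<^bsub>D\<^esub> \<iota> (scal (w x)))"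
  unfolding balanced_def N1_simps(1,2) M1_simps(1,2)
proof (intro conjI ballI)
  fix d w assume d: "d \<in> carrier D" and w: "w \<in> omega"
  show "(\<lambda>x. d \<otimes>\<^bsub>D\<^esub> \<iota> (scal (w x))) \<in> carrier DX" by (rule iota_KX_closed[OF d omega_KX[OF w]])
next
  fix d e w assume d: "d \<in> carrier D" "e \<in> carrier D" and w: "w \<in> omega"
  show "(\<lambda>x. (d \<oplus>\<^bsub>D\<^esub> e) \<otimes>\<^bsub>D\<^esub> \<iota> (scal (w x))) =
    (\<lambda>x. d \<otimes>\<^bsub>D\<^esub> \<iota> (scal (w x))) \<oplus>\<^bsub>DX\<^esub> (\<lambda>x. e \<otimes>\<^bsub>D\<^esub> \<iota> (scal (w x)))"
    using d KX_apply[OF omega_KX[OF w]] by (simp add: D.l_distr)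
next
  fix d v w assume d: "d \<in> carrier D" and v: "v \<in> omega" and w: "w \<in> omega"
  show "(\<lambda>x. d \<otimes>\<^bsub>D\<^esub> \<iota> (scal ((v \<oplus>\<^bsub>KX\<^esub> w) x))) =
    (\<lambda>x. d \<otimes>\<^bsub>D\<^esub> \<iota> (scal (v x))) \<oplus>\<^bsub>DX\<^esub> (\<lambda>x. d \<otimes>\<^bsub>D\<^esub> \<iota> (scal (w x)))"
    by (rule addmap_add[OF addmap_iota_KX[OF d] omega_KX[OF v] omega_KX[OF w]])
next
  fix k d w assume k: "k \<in> carrier K" and d: "d \<in> carrier D" and w: "w \<in> omega"
  note wc = KX_apply[OF omega_KX[OF w]]
  have "move \<one> k w x = k \<otimes>\<^bsub>K\<^esub> w x" for x
    using k free_module_outside[OF omega_KX[OF w], of x] by (auto simp: move_def)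
  moreover have "\<iota> (scal k) \<otimes>\<^bsub>D\<^esub> \<iota> (scal (w x)) = \<iota> (scal (k \<otimes>\<^bsub>K\<^esub> w x))" for x
    using iota_mult[of "scal k" "scal (w x)"] k wc by (simp add: mon_mult)
  ultimately show "(\<lambda>x. (k \<odot>\<^bsub>N1\<^esub> d) \<otimes>\<^bsub>D\<^esub> \<iota> (scal (w x))) =
     (\<lambda>x. d \<otimes>\<^bsub>D\<^esub> \<iota> (scal ((k \<odot>\<^bsub>M1\<^esub> w) x)))"
    unfolding M1_smult[OF k w] N1_simps(4) using d k wc by (simp add: D.m_assoc)
qed

text \<open>An element of \<open>D \<otimes> \<omega>\<close> is determined by its coordinates in \<open>D\<^sup>(\<^sup>X\<^sup>)\<close>: \<open>\<omega>\<close> has the basis \<open>x - x\<^sub>0\<close>,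
  so that the element is recovered as the sum of the \<open>d\<^sub>x \<otimes> (x - x\<^sub>0)\<close>.\<close>
lemma NN_coordinates:
  assumes x0: "x0 \<in> X"
  shows "\<exists>H. addmap NN DX H \<and>
     (\<forall>d\<in>carrier D. \<forall>w\<in>omega. H (cls d w) = (\<lambda>x. d \<otimes>\<^bsub>D\<^esub> \<iota> (scal (w x)))) \<and>
     (\<forall>n\<in>carrier NN. H n = \<zero>\<^bsub>DX\<^esub> \<longrightarrow> n = \<zero>\<^bsub>NN\<^esub>)"
proof -
  interpret NN: abelian_group NN by (rule NN_group)
  obtain H where H: "addmap NN DX H"
    and Hc: "\<forall>d\<in>carrier D. \<forall>w\<in>omega. H (cls d w) = (\<lambda>x. d \<otimes>\<^bsub>D\<^esub> \<iota> (scal (w x)))"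
    using NN_universal[OF DX_group coordinates_balanced] by blast
  define b where "b = center x0"
  note b_add = addmap_center[OF x0, folded b_def] and b_omega = center_omega[OF x0, folded b_def]
    and b_id = center_id[of _ x0, folded b_def]
  have cls_left: "addmap D NN (\<lambda>d. cls d w)" if "w \<in> omega" for w
    by (rule addmapI) (simp_all add: cls_closed cls_add_left that)
  have cls_b: "addmap KX NN (\<lambda>w. cls d (b w))" if d: "d \<in> carrier D" for d
  proof (rule addmapI)
    show "cls d (b w) \<in> carrier NN" if "w \<in> carrier KX" for w by (rule cls_closed[OF d b_omega[OF that]])
    show "cls d (b (v \<oplus>\<^bsub>KX\<^esub> w)) = cls d (b v) \<oplus>\<^bsub>NN\<^esub> cls d (b w)" if "v \<in> carrier KX" "w \<in> carrier KX" for v w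
      unfolding addmap_add[OF b_add that] by (rule cls_add_right[OF d b_omega[OF that(1)] b_omega[OF that(2)]])
  qed
  define \<theta> where "\<theta> = fext NN D (\<lambda>x d. cls d (b (pt x)))"
  have \<theta>c: "addmap D NN (\<lambda>d. cls d (b (pt x)))" if "x \<in> X" for x
    by (rule cls_left[OF b_omega[OF pt_closed[OF that]]])
  have \<theta>: "addmap DX NN \<theta>"
    unfolding \<theta>_def by (rule addmap_fext[OF D.ring_axioms NN_group \<theta>c])
  have \<theta>m: "\<theta> (monomial D x d) = cls d (b (pt x))" if "x \<in> X" "d \<in> carrier D" for x d
    unfolding \<theta>_def by (rule fext_monomial[OF D.ring_axioms NN_group \<theta>c that])
  have key: "\<theta> (\<lambda>x. d \<otimes>\<^bsub>D\<^esub> \<iota> (scal (w x))) = cls d (b w)" if d: "d \<in> carrier D" and w: "w \<in> carrier KX" for d w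
  proof (rule addmap_free_eqI[OF K_ring NN_group addmap_comp[OF addmap_iota_KX[OF d] \<theta>] cls_b[OF d] _ w])
    fix y k assume y: "y \<in> X" and k: "k \<in> carrier K"
    have "scal \<zero>\<^bsub>K\<^esub> = \<zero>\<^bsub>KG\<^esub>" by (auto simp: monomial_def KG_zero)
    then have e: "(\<lambda>x. d \<otimes>\<^bsub>D\<^esub> \<iota> (scal (monomial K y k x))) = monomial D y (d \<otimes>\<^bsub>D\<^esub> \<iota> (scal k))"
      using d by (auto simp: monomial_def[of K y] monomial_def[of D y] iota_zero)
    have "\<theta> (\<lambda>x. d \<otimes>\<^bsub>D\<^esub> \<iota> (scal (monomial K y k x))) = cls (d \<otimes>\<^bsub>D\<^esub> \<iota> (scal k)) (b (pt y))"
      unfolding e by (rule \<theta>m[OF y]) (simp add: d k)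
    also have "\<dots> = cls d (move \<one> k (b (pt y)))" by (rule cls_smult[OF d k b_omega[OF pt_closed[OF y]]])
    also have "move \<one> k (b (pt y)) = b (monomial K y k)"
      unfolding b_def by (rule center_pt[OF x0 y k])
    finally show "\<theta> (\<lambda>x. d \<otimes>\<^bsub>D\<^esub> \<iota> (scal (monomial K y k x))) = cls d (b (monomial K y k))" .
  qed
  have id: "\<theta> (H n) = n" if "n \<in> carrier NN" for n
  proof (rule NN_eqI[OF NN_group addmap_comp[OF H \<theta>] addmap_id _ that])
    fix d w assume d: "d \<in> carrier D" and w: "w \<in> omega"
    have "H (cls d w) = (\<lambda>x. d \<otimes>\<^bsub>D\<^esub> \<iota> (scal (w x)))" using Hc d w by blast
    then show "\<theta> (H (cls d w)) = cls d w" using key[OF d omega_KX[OF w]] b_id[OF w] by simp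
  qed
  have "n = \<zero>\<^bsub>NN\<^esub>" if n: "n \<in> carrier NN" "H n = \<zero>\<^bsub>DX\<^esub>" for n
    using id[OF n(1)] addmap_zero[OF \<theta> DX_group NN_group] n(2) by simp
  then show ?thesis using H Hc by blast
qed

text \<open>A graph of the map induced by \<open>s\<close> on \<open>D \<otimes>\<^bsub>KG\<^esub> (\<omega> \<otimes> I) = (D \<otimes> \<omega>\<^sup>o\<^sup>p) \<otimes>\<^bsub>KG\<^esub> I\<close>, with its source written
  in coordinates: \<open>d (w \<otimes> m)\<close> is read in \<open>D\<^sup>(\<^sup>X\<^sup>)\<close>, after \<open>(d \<otimes> w) \<otimes> m \<mapsto> (d \<otimes> w) m\<close>.\<close>
definition flat_graph ::
  "('g \<Rightarrow> 'k) set \<Rightarrow> (('x \<Rightarrow> 'k) \<Rightarrow> ('g \<Rightarrow> 'k) \<Rightarrow> 'g \<Rightarrow> 'k) \<Rightarrow> (('x \<Rightarrow> 'd) \<times> 'd) set \<Rightarrow> bool"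
  where "flat_graph I s \<Gamma> \<longleftrightarrow>
     (\<forall>d\<in>carrier D. \<forall>w\<in>omega. \<forall>m\<in>I. (\<lambda>x. d \<otimes>\<^bsub>D\<^esub> \<iota> (tens w m x), d \<otimes>\<^bsub>D\<^esub> \<iota> (s w m)) \<in> \<Gamma>) \<and>
     (\<forall>v e v' e'. (v, e) \<in> \<Gamma> \<longrightarrow> (v', e') \<in> \<Gamma> \<longrightarrow> (v \<oplus>\<^bsub>DX\<^esub> v', e \<oplus>\<^bsub>D\<^esub> e') \<in> \<Gamma>) \<and>
     (\<forall>e. (\<zero>\<^bsub>DX\<^esub>, e) \<in> \<Gamma> \<longrightarrow> e = \<zero>\<^bsub>D\<^esub>)"

lemma flat_graphD:
  assumes "flat_graph I s \<Gamma>"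
  shows "\<And>d w m. d \<in> carrier D \<Longrightarrow> w \<in> omega \<Longrightarrow> m \<in> I \<Longrightarrow>
       (\<lambda>x. d \<otimes>\<^bsub>D\<^esub> \<iota> (tens w m x), d \<otimes>\<^bsub>D\<^esub> \<iota> (s w m)) \<in> \<Gamma>"
    "\<And>v e v' e'. (v, e) \<in> \<Gamma> \<Longrightarrow> (v', e') \<in> \<Gamma> \<Longrightarrow> (v \<oplus>\<^bsub>DX\<^esub> v', e \<oplus>\<^bsub>D\<^esub> e') \<in> \<Gamma>"
    "\<And>e. (\<zero>\<^bsub>DX\<^esub>, e) \<in> \<Gamma> \<Longrightarrow> e = \<zero>\<^bsub>D\<^esub>"
  using assms unfolding flat_graph_def by blast+

text \<open>The map from \<open>(D \<otimes> \<omega>\<^sup>o\<^sup>p) \<otimes>\<^bsub>KG\<^esub> I\<close> to \<open>D\<^sup>(\<^sup>X\<^sup>)\<close> is injective, by flatness applied to the inclusion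
  of \<open>I\<close> into \<open>KG\<close>, so that every equivariant bilinear map on \<open>\<omega> \<times> I\<close> can be read off from its image.\<close>
lemma flat_pairs:
  assumes flat: "flat_right_module KG NN" and x0: "x0 \<in> X" and I: "lsub KG (left_regular KG) I"
    and s_closed: "\<And>w m. w \<in> omega \<Longrightarrow> m \<in> I \<Longrightarrow> s w m \<in> carrier KG"
    and s_left: "\<And>v w m. v \<in> omega \<Longrightarrow> w \<in> omega \<Longrightarrow> m \<in> I \<Longrightarrow> s (v \<oplus>\<^bsub>KX\<^esub> w) m = s v m \<oplus>\<^bsub>KG\<^esub> s w m"
    and s_right: "\<And>w m n. w \<in> omega \<Longrightarrow> m \<in> I \<Longrightarrow> n \<in> I \<Longrightarrow> s w (m \<oplus>\<^bsub>KG\<^esub> n) = s w m \<oplus>\<^bsub>KG\<^esub> s w n"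
    and s_scal: "\<And>k w m. k \<in> carrier K \<Longrightarrow> w \<in> omega \<Longrightarrow> m \<in> I \<Longrightarrow>
       s (move \<one> k w) m = scal k \<otimes>\<^bsub>KG\<^esub> s w m"
    and s_equiv: "\<And>g k w m. g \<in> carrier G \<Longrightarrow> k \<in> carrier K \<Longrightarrow> w \<in> omega \<Longrightarrow> m \<in> I \<Longrightarrow>
       s w (mon g k \<otimes>\<^bsub>KG\<^esub> m) = mon g k \<otimes>\<^bsub>KG\<^esub> s (move (inv g) \<one>\<^bsub>K\<^esub> w) m"
  shows "\<exists>\<Gamma>. flat_graph I s \<Gamma>"
proof -
  interpret N: right_module KG NN by (rule right)
  interpret L: left_module KG "left_regular KG" by (rule LKG_module)
  note ID = lsubD[OF I, simplified]
  have Ic: "\<And>m. m \<in> I \<Longrightarrow> m \<in> carrier KG" using ID(1) by blast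
  obtain H where H: "addmap NN DX H"
    and Hc: "\<forall>d\<in>carrier D. \<forall>w\<in>omega. H (cls d w) = (\<lambda>x. d \<otimes>\<^bsub>D\<^esub> \<iota> (scal (w x)))"
    and Hinj: "\<forall>n\<in>carrier NN. H n = \<zero>\<^bsub>DX\<^esub> \<longrightarrow> n = \<zero>\<^bsub>NN\<^esub>"
    using NN_coordinates[OF x0] by blast
  have "\<forall>m\<in>I. \<exists>F. addmap NN D F \<and> (\<forall>d\<in>carrier D. \<forall>w\<in>omega. F (cls d w) = d \<otimes>\<^bsub>D\<^esub> \<iota> (s w m))"
  proof
    fix m assume m: "m \<in> I"
    have "balanced K N1 M1 D (\<lambda>d w. d \<otimes>\<^bsub>D\<^esub> \<iota> (s w m))"
      unfolding balanced_def N1_simps(1,2) M1_simps(1,2)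
    proof (intro conjI ballI)
      fix k d w assume k: "k \<in> carrier K" and d: "d \<in> carrier D" and w: "w \<in> omega"
      have "\<iota> (scal k) \<otimes>\<^bsub>D\<^esub> \<iota> (s w m) = \<iota> (scal k \<otimes>\<^bsub>KG\<^esub> s w m)"
        using iota_mult[of "scal k" "s w m"] k s_closed[OF w m] by simp
      then show "(k \<odot>\<^bsub>N1\<^esub> d) \<otimes>\<^bsub>D\<^esub> \<iota> (s w m) = d \<otimes>\<^bsub>D\<^esub> \<iota> (s (k \<odot>\<^bsub>M1\<^esub> w) m)"
        unfolding M1_smult[OF k w] N1_simps(4) s_scal[OF k w m]
        using d k s_closed[OF w m] by (simp add: D.m_assoc)
    qed (use m s_closed in \<open>auto simp: s_left iota_add D.l_distr D.r_distr simp del: free_module_simps\<close>)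
    then show "\<exists>F. addmap NN D F \<and> (\<forall>d\<in>carrier D. \<forall>w\<in>omega. F (cls d w) = d \<otimes>\<^bsub>D\<^esub> \<iota> (s w m))"
      by (rule NN_universal[OF D.abelian_group_axioms])
  qed
  then obtain F where F: "\<forall>m\<in>I. addmap NN D (F m) \<and> (\<forall>d\<in>carrier D. \<forall>w\<in>omega. F m (cls d w) = d \<otimes>\<^bsub>D\<^esub> \<iota> (s w m))"
    by (rule bchoice[THEN exE])
  have Fa: "addmap NN D (F m)" if "m \<in> I" for m using F that by blast
  have Fc: "F m (cls d w) = d \<otimes>\<^bsub>D\<^esub> \<iota> (s w m)" if "m \<in> I" "d \<in> carrier D" "w \<in> omega" for m d w
    using F that by blast
  have F_add: "F (m \<oplus>\<^bsub>KG\<^esub> m') n = F m n \<oplus>\<^bsub>D\<^esub> F m' n" if m: "m \<in> I" "m' \<in> I" and n: "n \<in> carrier NN" for m m' n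
  proof (rule NN_eqI[OF D.abelian_group_axioms Fa[OF ID(3)[OF m]] addmap_plus[OF Fa[OF m(1)] Fa[OF m(2)] D.abelian_group_axioms] _ n])
    fix d w assume d: "d \<in> carrier D" and w: "w \<in> omega"
    show "F (m \<oplus>\<^bsub>KG\<^esub> m') (cls d w) = F m (cls d w) \<oplus>\<^bsub>D\<^esub> F m' (cls d w)"
      unfolding Fc[OF ID(3)[OF m] d w] Fc[OF m(1) d w] Fc[OF m(2) d w] s_right[OF w m]
      using iota_add[OF s_closed[OF w m(1)] s_closed[OF w m(2)]] s_closed[OF w m(1)] s_closed[OF w m(2)] d
      by (simp add: D.r_distr)
  qed
  have sm: "addmap KG NN (\<lambda>a. a \<odot>\<^bsub>NN\<^esub> n)" if n: "n \<in> carrier NN" for n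
    by (rule addmapI) (simp_all add: N.smult_closed N.smult_l_distr n)
  have sn: "addmap NN NN (\<lambda>n. a \<odot>\<^bsub>NN\<^esub> n)" if a: "a \<in> carrier KG" for a
    by (rule addmapI) (simp_all add: N.smult_closed N.smult_r_distr a)
  have bal: "balanced KG NN ((left_regular KG)\<lparr>carrier := I\<rparr>) D (\<lambda>n m. F m n)"
    unfolding balanced_def
  proof (intro conjI ballI; (unfold module.simps ring.simps partial_object.simps left_regular_simps)?)
    show "F m n \<in> carrier D" if "n \<in> carrier NN" "m \<in> carrier ((left_regular KG)\<lparr>carrier := I\<rparr>)" for n m
      using that addmap_closed[OF Fa] by simp
    show "F m (n \<oplus>\<^bsub>NN\<^esub> n') = F m n \<oplus>\<^bsub>D\<^esub> F m n'"
      if "n \<in> carrier NN" "n' \<in> carrier NN" "m \<in> carrier ((left_regular KG)\<lparr>carrier := I\<rparr>)" for n n' m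
      using that addmap_add[OF Fa] by simp
    show "F (m \<oplus>\<^bsub>(left_regular KG)\<lparr>carrier := I\<rparr>\<^esub> m') n = F m n \<oplus>\<^bsub>D\<^esub> F m' n"
      if "n \<in> carrier NN" "m \<in> carrier ((left_regular KG)\<lparr>carrier := I\<rparr>)"
        "m' \<in> carrier ((left_regular KG)\<lparr>carrier := I\<rparr>)" for n m m'
      using that F_add by simp
    fix a n m assume a: "a \<in> carrier KG" and n: "n \<in> carrier NN"
      and "m \<in> carrier ((left_regular KG)\<lparr>carrier := I\<rparr>)"
    then have m: "m \<in> I" by simp
    have mI: "addmap KG ((left_regular KG)\<lparr>carrier := I\<rparr>) (\<lambda>a. a \<otimes>\<^bsub>KG\<^esub> m)"
      using ID(4) m Ic by (intro addmapI) (auto simp: R.l_distr)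
    have FI: "addmap ((left_regular KG)\<lparr>carrier := I\<rparr>) D (\<lambda>m. F m n)"
      using addmap_closed[OF Fa n] F_add n by (intro addmapI) auto
    have "F m (a \<odot>\<^bsub>NN\<^esub> n) = F (a \<otimes>\<^bsub>KG\<^esub> m) n"
    proof (rule addmap_KG_eqI[OF D.abelian_group_axioms addmap_comp[OF sm[OF n] Fa[OF m]] addmap_comp[OF mI FI] _ a])
      fix g k assume g: "g \<in> carrier G" and k: "k \<in> carrier K"
      note gk = mon_closed[OF g k]
      have gkm: "mon g k \<otimes>\<^bsub>KG\<^esub> m \<in> I" by (rule ID(4)[OF gk m])
      show "F m (mon g k \<odot>\<^bsub>NN\<^esub> n) = F (mon g k \<otimes>\<^bsub>KG\<^esub> m) n"
      proof (rule NN_eqI[OF D.abelian_group_axioms addmap_comp[OF sn[OF gk] Fa[OF m]] Fa[OF gkm] _ n])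
        fix d w assume d: "d \<in> carrier D" and w: "w \<in> omega"
        have mv: "move (inv g) \<one>\<^bsub>K\<^esub> w \<in> omega" using g w by (simp add: omega_move)
        have dg: "d \<otimes>\<^bsub>D\<^esub> \<iota> (mon g k) \<in> carrier D" using d gk by simp
        show "F m (mon g k \<odot>\<^bsub>NN\<^esub> cls d w) = F (mon g k \<otimes>\<^bsub>KG\<^esub> m) (cls d w)"
          unfolding NN_smult[OF g k d w] Fc[OF m dg mv] Fc[OF gkm d w] s_equiv[OF g k w m]
          using iota_mult[OF gk s_closed[OF mv m]] d gk s_closed[OF mv m] by (simp add: D.m_assoc)
      qed
    qed
    then show "F m (a \<odot>\<^bsub>NN\<^esub> n) = F (a \<odot>\<^bsub>(left_regular KG)\<lparr>carrier := I\<rparr>\<^esub> m) n" by simp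
  qed
  let ?S = "carrier NN \<times> I"
  have "\<exists>ev. fragmap ?S NN ev \<and> (\<forall>s\<in>?S. ev (frag_of s) = (case s of (n, m) \<Rightarrow> m \<odot>\<^bsub>NN\<^esub> n))"
    by (rule fragmap_exists[OF NN_group]) (use N.smult_closed Ic in auto)
  then obtain ev where ev: "fragmap ?S NN ev" "\<forall>s\<in>?S. ev (frag_of s) = (case s of (n, m) \<Rightarrow> m \<odot>\<^bsub>NN\<^esub> n)" by blast
  have "\<exists>h. fragmap ?S D h \<and> (\<forall>s\<in>?S. h (frag_of s) = (case s of (n, m) \<Rightarrow> F m n))"
    by (rule fragmap_exists[OF D.abelian_group_axioms]) (use addmap_closed[OF Fa] in auto)
  then obtain h where h: "fragmap ?S D h" "\<forall>s\<in>?S. h (frag_of s) = (case s of (n, m) \<Rightarrow> F m n)" by blast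
  have kill: "h c = \<zero>\<^bsub>D\<^esub>" if c: "c \<in> frags ?S" "ev c = \<zero>\<^bsub>NN\<^esub>" for c
    by (rule flat_balanced[OF flat I c(1) ev(1) _ c(2) D.abelian_group_axioms bal h(1)]) (use ev(2) h(2) in auto)
  define \<Gamma> where "\<Gamma> = (\<lambda>c. (H (ev c), h c)) ` frags ?S"
  have "(\<lambda>x. d \<otimes>\<^bsub>D\<^esub> \<iota> (tens w m x), d \<otimes>\<^bsub>D\<^esub> \<iota> (s w m)) \<in> \<Gamma>"
    if d: "d \<in> carrier D" and w: "w \<in> omega" and m: "m \<in> I" for d w m
  proof -
    have cm: "(cls d w, m) \<in> ?S" using cls_closed[OF d w] m by blast
    have e: "ev (frag_of (cls d w, m)) = m \<odot>\<^bsub>NN\<^esub> cls d w" "h (frag_of (cls d w, m)) = d \<otimes>\<^bsub>D\<^esub> \<iota> (s w m)"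
      using ev(2) h(2) cm Fc[OF m d w] by auto
    have tc: "tens w a x \<in> carrier KG" if "a \<in> carrier KG" for a x
      by (rule free_module_component[OF KG_ring tens_closed[OF omega_KX[OF w] that]])
    have tz: "\<iota> (tens w a x) = \<zero>\<^bsub>D\<^esub>" if "tens w a x = \<zero>\<^bsub>KG\<^esub>" for a x
      using that iota_zero by simp
    have am: "addmap KG DX (\<lambda>a x. d \<otimes>\<^bsub>D\<^esub> \<iota> (tens w a x))"
    proof (rule addmapI)
      fix a assume a: "a \<in> carrier KG"
      note ta = tens_closed[OF omega_KX[OF w] a]
      show "(\<lambda>x. d \<otimes>\<^bsub>D\<^esub> \<iota> (tens w a x)) \<in> carrier DX"
      proof (rule free_moduleI)
        show "d \<otimes>\<^bsub>D\<^esub> \<iota> (tens w a x) \<in> carrier D" for x using d tc[OF a] by simp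
        show "d \<otimes>\<^bsub>D\<^esub> \<iota> (tens w a x) = \<zero>\<^bsub>D\<^esub>" if "x \<notin> X" for x
          using tz[OF free_module_outside[OF ta that]] d by simp
        show "finite {x. d \<otimes>\<^bsub>D\<^esub> \<iota> (tens w a x) \<noteq> \<zero>\<^bsub>D\<^esub>}"
        proof (rule finite_subset[OF _ free_module_finite[OF ta]], rule subsetI)
          fix x assume "x \<in> {x. d \<otimes>\<^bsub>D\<^esub> \<iota> (tens w a x) \<noteq> \<zero>\<^bsub>D\<^esub>}"
          then show "x \<in> {x. tens w a x \<noteq> \<zero>\<^bsub>KG\<^esub>}" using tz d by auto
        qed
      qed
      fix a' assume a': "a' \<in> carrier KG"
      have "tens w (a \<oplus>\<^bsub>KG\<^esub> a') x = tens w a x \<oplus>\<^bsub>KG\<^esub> tens w a' x" for x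
        using addmap_add[OF addmap_tens_right[OF omega_KX[OF w]] a a'] by simp
      then show "(\<lambda>x. d \<otimes>\<^bsub>D\<^esub> \<iota> (tens w (a \<oplus>\<^bsub>KG\<^esub> a') x)) =
         (\<lambda>x. d \<otimes>\<^bsub>D\<^esub> \<iota> (tens w a x)) \<oplus>\<^bsub>DX\<^esub> (\<lambda>x. d \<otimes>\<^bsub>D\<^esub> \<iota> (tens w a' x))"
        using iota_add[OF tc[OF a] tc[OF a']] d tc[OF a] tc[OF a'] by (simp add: D.r_distr)
    qed
    have "H (m \<odot>\<^bsub>NN\<^esub> cls d w) = (\<lambda>x. d \<otimes>\<^bsub>D\<^esub> \<iota> (tens w m x))"
    proof (rule addmap_KG_eqI[OF DX_group addmap_comp[OF sm[OF cls_closed[OF d w]] H] am _ Ic[OF m]])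
      fix g k assume g: "g \<in> carrier G" and k: "k \<in> carrier K"
      note gk = mon_closed[OF g k]
      have mv: "move (inv g) \<one>\<^bsub>K\<^esub> w \<in> omega" using g w by (simp add: omega_move)
      have dg: "d \<otimes>\<^bsub>D\<^esub> \<iota> (mon g k) \<in> carrier D" using d gk by simp
      have wc: "w y \<in> carrier K" for y by (rule KX_apply[OF omega_KX[OF w]])
      have "H (mon g k \<odot>\<^bsub>NN\<^esub> cls d w) = (\<lambda>x. (d \<otimes>\<^bsub>D\<^esub> \<iota> (mon g k)) \<otimes>\<^bsub>D\<^esub> \<iota> (scal (move (inv g) \<one>\<^bsub>K\<^esub> w x)))"
        unfolding NN_smult[OF g k d w] using Hc dg mv by blast
      also have "\<dots> = (\<lambda>x. d \<otimes>\<^bsub>D\<^esub> \<iota> (tens w (mon g k) x))"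
      proof
        fix x
        have mc: "move (inv g) \<one>\<^bsub>K\<^esub> w x \<in> carrier K" by (rule KX_apply[OF omega_KX[OF mv]])
        have "mon g k \<otimes>\<^bsub>KG\<^esub> scal (move (inv g) \<one>\<^bsub>K\<^esub> w x) = mon g (k \<otimes>\<^bsub>K\<^esub> move (inv g) \<one>\<^bsub>K\<^esub> w x)"
          using g k mc by (simp add: mon_mult)
        also have "\<dots> = tens w (mon g k) x"
          using g k wc by (auto simp: tens_def move_def monomial_def K.m_comm)
        finally show "(d \<otimes>\<^bsub>D\<^esub> \<iota> (mon g k)) \<otimes>\<^bsub>D\<^esub> \<iota> (scal (move (inv g) \<one>\<^bsub>K\<^esub> w x)) = d \<otimes>\<^bsub>D\<^esub> \<iota> (tens w (mon g k) x)"
          using iota_mult[OF gk mon1_closed[OF mc]] d gk mc by (simp add: D.m_assoc)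
      qed
      finally show "H (mon g k \<odot>\<^bsub>NN\<^esub> cls d w) = (\<lambda>x. d \<otimes>\<^bsub>D\<^esub> \<iota> (tens w (mon g k) x))" .
    qed
    then have "(\<lambda>x. d \<otimes>\<^bsub>D\<^esub> \<iota> (tens w m x), d \<otimes>\<^bsub>D\<^esub> \<iota> (s w m)) =
       (H (ev (frag_of (cls d w, m))), h (frag_of (cls d w, m)))" unfolding e by simp
    moreover have "frag_of (cls d w, m) \<in> frags ?S" using cm by simp
    ultimately show ?thesis unfolding \<Gamma>_def by (rule image_eqI)
  qed
  moreover have "(v \<oplus>\<^bsub>DX\<^esub> v', e \<oplus>\<^bsub>D\<^esub> e') \<in> \<Gamma>" if "(v, e) \<in> \<Gamma>" "(v', e') \<in> \<Gamma>" for v e v' e'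
  proof -
    from that obtain c c' where c: "c \<in> frags ?S" "v = H (ev c)" "e = h c"
      and c': "c' \<in> frags ?S" "v' = H (ev c')" "e' = h c'" unfolding \<Gamma>_def by blast
    have "(v \<oplus>\<^bsub>DX\<^esub> v', e \<oplus>\<^bsub>D\<^esub> e') = (H (ev (c + c')), h (c + c'))"
      unfolding c c' fragmap_add[OF ev(1) c(1) c'(1)] fragmap_add[OF h(1) c(1) c'(1)]
        addmap_add[OF H fragmap_closed[OF ev(1) c(1)] fragmap_closed[OF ev(1) c'(1)]] ..
    then show ?thesis unfolding \<Gamma>_def by (rule image_eqI[OF _ frags_add[OF c(1) c'(1)]])
  qed
  moreover have "e = \<zero>\<^bsub>D\<^esub>" if "(\<zero>\<^bsub>DX\<^esub>, e) \<in> \<Gamma>" for e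
  proof -
    from that obtain c where c: "c \<in> frags ?S" "H (ev c) = \<zero>\<^bsub>DX\<^esub>" "e = h c" unfolding \<Gamma>_def by (auto simp del: free_module_simps)
    then have "ev c = \<zero>\<^bsub>NN\<^esub>" using Hinj fragmap_closed[OF ev(1) c(1)] by blast
    then show ?thesis using kill c by simp
  qed
  ultimately show ?thesis unfolding flat_graph_def by (intro exI[of _ \<Gamma>]) blast
qed

end

section \<open>Projectivity of \<open>\<omega> \<otimes> I\<close>\<close>

lemma minus_eq_zeroD:
  assumes "abelian_group B" "x \<in> carrier B" "y \<in> carrier B" "x \<ominus>\<^bsub>B\<^esub> y = \<zero>\<^bsub>B\<^esub>"
  shows "x = y"
proof -
  interpret B: abelian_group B by fact
  have "x = x \<ominus>\<^bsub>B\<^esub> y \<oplus>\<^bsub>B\<^esub> y"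
    using assms(2,3) by (simp add: a_minus_def B.a_assoc B.l_neg)
  then show ?thesis using assms(3,4) by simp
qed

context group_algebra
begin

text \<open>Left ideals are complemented as vector spaces.  By Zorn's lemma there is a maximal set \<open>\<Delta>\<close> of group elements such
  that no nonzero element of \<open>I\<close> is supported in \<open>\<Delta>\<close>; the span of \<open>\<Delta>\<close> is a complement, and \<open>\<mu> g\<close> is the
  projection of \<open>g\<close> to \<open>I\<close>.\<close>
lemma left_ideal_complement:
  assumes I: "lsub KG (left_regular KG) I"
  shows "\<exists>\<mu>. (\<forall>g\<in>carrier G. \<mu> g \<in> I) \<and>
     (\<forall>m\<in>I. fext KG K (\<lambda>g k. scal k \<otimes>\<^bsub>KG\<^esub> \<mu> g) m = m)"
proof -
  interpret L: left_module KG "left_regular KG" by (rule left_module_left_regular[OF KG_ring])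
  note ID = lsubD[OF I, simplified]
  have Ic: "\<And>m. m \<in> I \<Longrightarrow> m \<in> carrier KG" using ID(1) by blast
  have m1: "scal k \<in> carrier KG" if "k \<in> carrier K" for k using that by (simp add: mon_closed)
  let ?A = "{\<Delta>. \<Delta> \<subseteq> carrier G \<and> (\<forall>m\<in>I. {g. m g \<noteq> \<zero>\<^bsub>K\<^esub>} \<subseteq> \<Delta> \<longrightarrow> m = \<zero>\<^bsub>KG\<^esub>)}"
  have "{} \<in> ?A" by (auto simp: KG_zero)
  then have ne: "?A \<noteq> {}" by blast
  have chain: "\<Union>\<C> \<in> ?A" if ch: "\<C> \<noteq> {}" "subset.chain ?A \<C>" for \<C>
  proof -
    have mem: "\<And>\<Delta>. \<Delta> \<in> \<C> \<Longrightarrow> \<Delta> \<in> ?A" using ch(2) unfolding subset_chain_def by blast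
    have "m = \<zero>\<^bsub>KG\<^esub>" if m: "m \<in> I" "{g. m g \<noteq> \<zero>\<^bsub>K\<^esub>} \<subseteq> \<Union>\<C>" for m
    proof -
      obtain \<Delta> where "\<Delta> \<in> \<C>" "{g. m g \<noteq> \<zero>\<^bsub>K\<^esub>} \<subseteq> \<Delta>"
        using finite_subset_Union_chain[OF KG_finite[OF Ic[OF m(1)]] m(2) ch] by blast
      then show ?thesis using mem m(1) by blast
    qed
    then show ?thesis using mem by blast
  qed
  have "\<exists>\<Delta>\<in>?A. \<forall>\<Delta>'\<in>?A. \<Delta> \<subseteq> \<Delta>' \<longrightarrow> \<Delta>' = \<Delta>" by (rule subset_Zorn_nonempty[OF ne chain])
  then obtain \<Delta> where \<Delta>: "\<Delta> \<in> ?A" and max: "\<forall>\<Delta>'\<in>?A. \<Delta> \<subseteq> \<Delta>' \<longrightarrow> \<Delta>' = \<Delta>" by (rule bexE)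
  have ex: "\<exists>m. m \<in> I \<and> (\<forall>h\<in>carrier G - \<Delta>. m h = (if h = g then \<one>\<^bsub>K\<^esub> else \<zero>\<^bsub>K\<^esub>))"
    if g: "g \<in> carrier G - \<Delta>" for g
  proof -
    have "insert g \<Delta> \<notin> ?A"
    proof
      assume "insert g \<Delta> \<in> ?A"
      then have "insert g \<Delta> = \<Delta>" using max by blast
      then show False using g by blast
    qed
    moreover have "insert g \<Delta> \<subseteq> carrier G" using g \<Delta> by blast
    ultimately obtain m where m: "m \<in> I" "{h. m h \<noteq> \<zero>\<^bsub>K\<^esub>} \<subseteq> insert g \<Delta>" "m \<noteq> \<zero>\<^bsub>KG\<^esub>" by blast
    have mg: "m g \<noteq> \<zero>\<^bsub>K\<^esub>"
    proof
      assume "m g = \<zero>\<^bsub>K\<^esub>"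
      then have "{h. m h \<noteq> \<zero>\<^bsub>K\<^esub>} \<subseteq> \<Delta>" using m(2) by auto
      then show False using m \<Delta> by blast
    qed
    have u: "m g \<in> Units K" using mg KG_apply[OF Ic[OF m(1)]] K.field_Units by auto
    let ?u = "inv\<^bsub>K\<^esub> (m g)"
    have uc: "?u \<in> carrier K" using u by simp
    let ?m = "scal ?u \<otimes>\<^bsub>KG\<^esub> m"
    have "?m \<in> I" by (rule ID(4)[OF m1[OF uc] m(1)])
    moreover have "?m h = (if h = g then \<one>\<^bsub>K\<^esub> else \<zero>\<^bsub>K\<^esub>)" if h: "h \<in> carrier G - \<Delta>" for h
    proof -
      have e: "?m h = ?u \<otimes>\<^bsub>K\<^esub> m h" using mon_mult_apply[OF G.one_closed uc Ic[OF m(1)], of h] h by simp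
      show ?thesis
      proof (cases "h = g")
        case True
        then show ?thesis using e u K.Units_l_inv by simp
      next
        case False
        then have "m h = \<zero>\<^bsub>K\<^esub>" using m(2) h by blast
        then show ?thesis using e False uc by simp
      qed
    qed
    ultimately show ?thesis by blast
  qed
  define \<mu> where "\<mu> g = (if g \<in> carrier G - \<Delta> then
      (SOME m. m \<in> I \<and> (\<forall>h\<in>carrier G - \<Delta>. m h = (if h = g then \<one>\<^bsub>K\<^esub> else \<zero>\<^bsub>K\<^esub>))) else \<zero>\<^bsub>KG\<^esub>)" for g
  have \<mu>1: "\<mu> g \<in> I \<and> (\<forall>h\<in>carrier G - \<Delta>. \<mu> g h = (if h = g then \<one>\<^bsub>K\<^esub> else \<zero>\<^bsub>K\<^esub>))"
    if g: "g \<in> carrier G - \<Delta>" for g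
  proof -
    have e: "\<mu> g = (SOME m. m \<in> I \<and> (\<forall>h\<in>carrier G - \<Delta>. m h = (if h = g then \<one>\<^bsub>K\<^esub> else \<zero>\<^bsub>K\<^esub>)))"
      unfolding \<mu>_def if_P[OF g] ..
    show ?thesis unfolding e by (rule someI_ex[OF ex[OF g]])
  qed
  have \<mu>2: "\<mu> g = \<zero>\<^bsub>KG\<^esub>" if "g \<notin> carrier G - \<Delta>" for g using that unfolding \<mu>_def by (simp only: if_False)
  have \<mu>I: "\<mu> g \<in> I" for g using \<mu>1[of g] \<mu>2[of g] ID(2) by (cases "g \<in> carrier G - \<Delta>") auto
  let ?\<rho> = "fext KG K (\<lambda>g k. scal k \<otimes>\<^bsub>KG\<^esub> \<mu> g)"
  have \<rho>c: "addmap K KG (\<lambda>k. scal k \<otimes>\<^bsub>KG\<^esub> \<mu> g)" for g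
    by (rule addmap_comp[OF addmap_mon[OF G.one_closed] addmap_KG_mult_right[OF Ic[OF \<mu>I]]])
  have \<rho>: "addmap KG KG ?\<rho>"
    unfolding addmap_KG by (rule addmap_fext[OF K_ring R.abelian_group_axioms \<rho>c])
  have \<rho>m: "?\<rho> (mon g k) = scal k \<otimes>\<^bsub>KG\<^esub> \<mu> g" if "g \<in> carrier G" "k \<in> carrier K" for g k
    by (rule fext_monomial[OF K_ring R.abelian_group_axioms \<rho>c that])
  have \<rho>I: "?\<rho> m \<in> I" if m: "m \<in> carrier KG" for m
  proof -
    have "m \<in> carrier (free_module K (carrier G))" using m by (simp only: KG_carrier)
    with K_ring show ?thesis
    proof (induction rule: free_module_induct)
      case zero
      show ?case using addmap_zero[OF \<rho> R.abelian_group_axioms R.abelian_group_axioms] ID(2) by (simp add: KG_zero)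
    next
      case (step y k v)
      have "?\<rho> (mon y k \<oplus>\<^bsub>KG\<^esub> v) = ?\<rho> (mon y k) \<oplus>\<^bsub>KG\<^esub> ?\<rho> v"
        by (rule addmap_add[OF \<rho> mon_closed[OF step(1,2)]]) (use step(3) in \<open>simp only: KG_carrier\<close>)
      moreover have "?\<rho> (mon y k) \<in> I" unfolding \<rho>m[OF step(1,2)] by (rule ID(4)[OF m1[OF step(2)] \<mu>I])
      ultimately show ?case using ID(3) step(4) by (simp add: KG_add)
    qed
  qed
  have "?\<rho> m = m" if m: "m \<in> I" for m
  proof -
    have mc: "m \<in> carrier KG" by (rule Ic[OF m])
    have at: "?\<rho> m h = m h" if h: "h \<in> carrier G - \<Delta>" for h
    proof (rule addmap_KG_eqI[OF K.abelian_group_axioms addmap_comp[OF \<rho> addmap_KG_apply] addmap_KG_apply _ mc])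
      fix g k assume g: "g \<in> carrier G" and k: "k \<in> carrier K"
      have "?\<rho> (mon g k) h = k \<otimes>\<^bsub>K\<^esub> \<mu> g h"
        unfolding \<rho>m[OF g k] using mon_mult_apply[OF G.one_closed k Ic[OF \<mu>I], of h] h by simp
      also have "\<dots> = mon g k h"
      proof (cases "g \<in> \<Delta>")
        case True
        then show ?thesis using \<mu>2[of g] h k by (auto simp: KG_zero monomial_def)
      next
        case False
        then show ?thesis using \<mu>1[of g] g h k by (auto simp: monomial_def)
      qed
      finally show "?\<rho> (mon g k) h = mon g k h" .
    qed
    let ?d = "?\<rho> m \<ominus>\<^bsub>KG\<^esub> m"
    have rI: "?\<rho> m \<in> I" by (rule \<rho>I[OF mc])
    have dI: "?d \<in> I" by (rule R.left_ideal_minus[OF I rI m])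
    have "?d h = \<zero>\<^bsub>K\<^esub>" if h: "h \<in> carrier G - \<Delta>" for h
      using addmap_minus[OF addmap_KG_apply R.abelian_group_axioms K.abelian_group_axioms Ic[OF rI] mc, of h]
        at[OF h] KG_apply[OF mc, of h] by (simp add: a_minus_def K.r_neg)
    then have "{h. ?d h \<noteq> \<zero>\<^bsub>K\<^esub>} \<subseteq> \<Delta>" using KG_outside[OF Ic[OF dI]] by blast
    then have "?d = \<zero>\<^bsub>KG\<^esub>" using \<Delta> dI by blast
    then show ?thesis by (rule minus_eq_zeroD[OF R.abelian_group_axioms Ic[OF rI] mc])
  qed
  then show ?thesis using \<mu>I by blast
qed

text \<open>Bilinear maps \<open>V \<times> I \<rightarrow> F\<close> that are equivariant for the diagonal action, that is, the
  homomorphisms \<open>V \<otimes> I \<rightarrow> F\<close>.\<close>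
definition equibilinear ::
  "('g \<Rightarrow> 'k, 'v, 'p) module_scheme \<Rightarrow> ('g \<Rightarrow> 'k) set \<Rightarrow> ('g \<Rightarrow> 'k, 'f, 'q) module_scheme \<Rightarrow>
   ('v \<Rightarrow> ('g \<Rightarrow> 'k) \<Rightarrow> 'f) \<Rightarrow> bool"
  where "equibilinear V I F h \<longleftrightarrow>
     (\<forall>m\<in>I. addmap V F (\<lambda>v. h v m)) \<and>
     (\<forall>v\<in>carrier V. \<forall>m\<in>I. \<forall>n\<in>I. h v (m \<oplus>\<^bsub>KG\<^esub> n) = h v m \<oplus>\<^bsub>F\<^esub> h v n) \<and>
     (\<forall>k\<in>carrier K. \<forall>v\<in>carrier V. \<forall>m\<in>I. h (scal k \<odot>\<^bsub>V\<^esub> v) m = scal k \<odot>\<^bsub>F\<^esub> h v m) \<and>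
     (\<forall>g\<in>carrier G. \<forall>k\<in>carrier K. \<forall>v\<in>carrier V. \<forall>m\<in>I.
        h v (mon g k \<otimes>\<^bsub>KG\<^esub> m) = mon g k \<odot>\<^bsub>F\<^esub> h (ginv g \<odot>\<^bsub>V\<^esub> v) m)"

lemma equibilinearD:
  assumes "equibilinear V I F h"
  shows "\<And>m. m \<in> I \<Longrightarrow> addmap V F (\<lambda>v. h v m)"
    "\<And>v m n. v \<in> carrier V \<Longrightarrow> m \<in> I \<Longrightarrow> n \<in> I \<Longrightarrow> h v (m \<oplus>\<^bsub>KG\<^esub> n) = h v m \<oplus>\<^bsub>F\<^esub> h v n"
    "\<And>k v m. k \<in> carrier K \<Longrightarrow> v \<in> carrier V \<Longrightarrow> m \<in> I \<Longrightarrow>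
       h (scal k \<odot>\<^bsub>V\<^esub> v) m = scal k \<odot>\<^bsub>F\<^esub> h v m"
    "\<And>g k v m. g \<in> carrier G \<Longrightarrow> k \<in> carrier K \<Longrightarrow> v \<in> carrier V \<Longrightarrow> m \<in> I \<Longrightarrow>
       h v (mon g k \<otimes>\<^bsub>KG\<^esub> m) = mon g k \<odot>\<^bsub>F\<^esub> h (ginv g \<odot>\<^bsub>V\<^esub> v) m"
  using assms unfolding equibilinear_def by blast+

text \<open>The restriction of \<open>h\<close> to \<open>P\<^sub>1 \<otimes> I\<close> extends to \<open>P\<^sub>0 \<otimes> KG\<close>, and subtracting the extension corrects
  \<open>h\<close>.  For the extension, note that a homomorphism on \<open>V \<otimes> KG\<close> amounts to a linear map on \<open>V\<close>, its
  value at \<open>v \<otimes> 1\<close>.  Let \<open>V\<close> be the free module on \<open>B\<^sub>1\<close>, which retracts onto \<open>P\<^sub>1\<close>.  With a linear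
  projection \<open>\<mu>\<close> of \<open>KG\<close> onto \<open>I\<close>, the map \<open>b \<otimes> g \<mapsto> h b (\<mu> g)\<close> for basis elements \<open>b\<close> extends to a homomorphism
  on \<open>V \<otimes> KG\<close>, whose value at \<open>j b \<otimes> 1 = j (b \<otimes> j\<^sup>-\<^sup>1)\<close> is \<open>j h b (\<mu> j\<^sup>-\<^sup>1)\<close>.  The corresponding
  linear map, composed with \<open>P\<^sub>0 \<rightarrow> P\<^sub>1 \<rightarrow> V\<close>, where the first arrow is the linear retraction \<open>\<rho>\<close>, gives the
  extension.  All its values are combinations of values of \<open>h\<close> on \<open>P\<^sub>1 \<times> I\<close>, so \<open>\<Psi>\<close> kills it.\<close>
lemma equibilinear_correction:
  assumes I: "lsub KG (left_regular KG) I"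
    and P0: "left_module KG P0" and P1: "left_module KG P1" and F: "left_module KG F"
    and d: "d \<in> lmod_hom KG P1 P0"
    and \<rho>: "addmap P0 P1 \<rho>" "\<And>p. p \<in> carrier P1 \<Longrightarrow> \<rho> (d p) = p"
      "\<And>k p. k \<in> carrier K \<Longrightarrow> p \<in> carrier P0 \<Longrightarrow> \<rho> (scal k \<odot>\<^bsub>P0\<^esub> p) = scal k \<odot>\<^bsub>P1\<^esub> \<rho> p"
    and s1: "s1 \<in> lmod_hom KG P1 (free_module KG B1)" and p1: "p1 \<in> lmod_hom KG (free_module KG B1) P1"
    and ps1: "\<And>p. p \<in> carrier P1 \<Longrightarrow> p1 (s1 p) = p"
    and h: "equibilinear P0 I F h"
    and W: "left_module KG W" and \<Psi>: "\<Psi> \<in> lmod_hom KG F W"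
    and \<Psi>h: "\<And>p m. p \<in> carrier P1 \<Longrightarrow> m \<in> I \<Longrightarrow> \<Psi> (h (d p) m) = \<zero>\<^bsub>W\<^esub>"
  shows "\<exists>H. equibilinear P0 I F H \<and> (\<forall>p\<in>carrier P1. \<forall>m\<in>I. H (d p) m = \<zero>\<^bsub>F\<^esub>) \<and>
     (\<forall>p\<in>carrier P0. \<forall>m\<in>I. \<Psi> (H p m) = \<Psi> (h p m))"
proof -
  interpret P0: left_module KG P0 by (rule P0)
  interpret P1: left_module KG P1 by (rule P1)
  interpret F: left_module KG F by (rule F)
  interpret W: left_module KG W by (rule W)
  let ?B = "free_module KG B1"
  interpret B: left_module KG ?B by (rule left_module_free[OF KG_ring])
  note ID = lsubD[OF I, simplified]
  note hD = equibilinearD[OF h]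
  have Ic: "\<And>m. m \<in> I \<Longrightarrow> m \<in> carrier KG" using ID(1) by blast
  have hc: "h v m \<in> carrier F" if "v \<in> carrier P0" "m \<in> I" for v m
    by (rule addmap_closed[OF hD(1)[OF that(2)] that(1)])
  have m1: "scal k \<in> carrier KG" if "k \<in> carrier K" for k using that by (simp add: mon_closed)
  obtain \<mu> where \<mu>I: "\<And>g. g \<in> carrier G \<Longrightarrow> \<mu> g \<in> I"
    and \<mu>: "\<And>m. m \<in> I \<Longrightarrow> fext KG K (\<lambda>g k. scal k \<otimes>\<^bsub>KG\<^esub> \<mu> g) m = m"
    using left_ideal_complement[OF I] by blast
  have ih: "inv g \<in> carrier G" if "g \<in> carrier G" for g using that by simp
  let ?I = "(left_regular KG)\<lparr>carrier := I\<rparr>"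
  interpret L: left_module KG "left_regular KG" by (rule left_module_left_regular[OF KG_ring])
  interpret LI: left_module KG ?I by (rule L.left_module_restrict[OF I])
  let ?r = "fext ?I K (\<lambda>g k. scal k \<otimes>\<^bsub>KG\<^esub> \<mu> g)"
  have rc: "addmap K ?I (\<lambda>k. scal k \<otimes>\<^bsub>KG\<^esub> \<mu> g)" if "g \<in> carrier G" for g
    using addmap_add[OF addmap_mon[OF G.one_closed]] ID(4)[OF m1 \<mu>I[OF that]] Ic[OF \<mu>I[OF that]] m1
    by (intro addmapI) (auto simp: R.l_distr)
  have r: "addmap KG ?I ?r"
    unfolding addmap_KG by (rule addmap_fext[OF K_ring LI.M_group rc])
  have r_mon: "?r (mon g k) = scal k \<otimes>\<^bsub>KG\<^esub> \<mu> g" if "g \<in> carrier G" "k \<in> carrier K" for g k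
    by (rule fext_monomial[OF K_ring LI.M_group rc that])
  have inc: "addmap ?I KG (\<lambda>x. x)" using Ic by (intro addmapI) auto
  have r_id: "?r m = m" if m: "m \<in> I" for m
  proof -
    have c: "addmap K KG (\<lambda>k. scal k \<otimes>\<^bsub>KG\<^esub> \<mu> g)" if "g \<in> carrier G" for g
      by (rule addmap_comp[OF addmap_mon[OF G.one_closed] addmap_KG_mult_right[OF Ic[OF \<mu>I[OF that]]]])
    have "addmap KG KG (fext KG K (\<lambda>g k. scal k \<otimes>\<^bsub>KG\<^esub> \<mu> g))"
      unfolding addmap_KG by (rule addmap_fext[OF K_ring R.abelian_group_axioms c])
    note f = this
    have "?r m = fext KG K (\<lambda>g k. scal k \<otimes>\<^bsub>KG\<^esub> \<mu> g) m"
    proof (rule addmap_KG_eqI[OF R.abelian_group_axioms addmap_comp[OF r inc] f _ Ic[OF m]])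
      fix g k assume gk: "g \<in> carrier G" "k \<in> carrier K"
      show "?r (mon g k) = fext KG K (\<lambda>g k. scal k \<otimes>\<^bsub>KG\<^esub> \<mu> g) (mon g k)"
        unfolding r_mon[OF gk] by (rule fext_monomial[OF K_ring R.abelian_group_axioms c gk, symmetric])
    qed
    then show ?thesis using \<mu>[OF m] by simp
  qed
  let ?e = "\<lambda>b. d (p1 (monomial KG b \<one>\<^bsub>KG\<^esub>))"
  have ec: "?e b \<in> carrier P0" if "b \<in> B1" for b
    by (rule lmod_hom_closed[OF d lmod_hom_closed[OF p1 monomial_closed[OF KG_ring that R.one_closed]]])
  let ?x = "\<lambda>b j. h (?e b) (\<mu> (inv j))"
  have xc: "?x b j \<in> carrier F" if "b \<in> B1" "j \<in> carrier G" for b j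
    by (rule hc[OF ec[OF that(1)] \<mu>I[OF ih[OF that(2)]]])
  \<comment> \<open>The values \<open>j h b (\<mu> j\<^sup>-\<^sup>1)\<close> at \<open>j b \<otimes> 1\<close>.\<close>
  define f0 where "f0 b = fext F K (\<lambda>j c. mon j c \<odot>\<^bsub>F\<^esub> ?x b j)" for b
  have f0c: "addmap K F (\<lambda>c. mon j c \<odot>\<^bsub>F\<^esub> ?x b j)" if "b \<in> B1" "j \<in> carrier G" for b j
    by (rule addmap_comp[OF addmap_mon[OF that(2)] F.addmap_scal[OF xc[OF that]]])
  have f0: "addmap KG F (f0 b)" if "b \<in> B1" for b
    unfolding f0_def addmap_KG by (rule addmap_fext[OF K_ring F.M_group f0c[OF that]])
  have f0_mon: "f0 b (mon j c) = mon j c \<odot>\<^bsub>F\<^esub> ?x b j" if "b \<in> B1" "j \<in> carrier G" "c \<in> carrier K" for b j c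
    unfolding f0_def by (rule fext_monomial[OF K_ring F.M_group f0c[OF that(1)] that(2,3)])
  define f1 where "f1 = fext F KG f0"
  have f1: "addmap ?B F f1" unfolding f1_def by (rule addmap_fext[OF KG_ring F.M_group f0])
  have f1_mon: "f1 (monomial KG b (mon j c)) = mon j c \<odot>\<^bsub>F\<^esub> ?x b j"
    if "b \<in> B1" "j \<in> carrier G" "c \<in> carrier K" for b j c
    using fext_monomial[OF KG_ring F.M_group f0 that(1) mon_closed[OF that(2,3)]] f0_mon[OF that]
    unfolding f1_def by simp
  have mon_monomial: "mon g k \<odot>\<^bsub>?B\<^esub> monomial KG b (mon j c) = monomial KG b (mon (g \<otimes> j) (k \<otimes>\<^bsub>K\<^esub> c))"
    if "g \<in> carrier G" "k \<in> carrier K" "j \<in> carrier G" "c \<in> carrier K" for g k b j c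
    using mon_closed[OF that(1,2)] that by (auto simp: monomial_def[of KG] fun_eq_iff[of _ "\<lambda>h. if h = b then _ else _"] mon_mult)
  have f1_scal: "f1 (scal k \<odot>\<^bsub>?B\<^esub> v) = scal k \<odot>\<^bsub>F\<^esub> f1 v" if k: "k \<in> carrier K" and v: "v \<in> carrier ?B" for k v
  proof (rule addmap_free_KG_eqI[OF F.M_group addmap_comp[OF B.addmap_smult[OF m1[OF k]] f1]
        addmap_comp[OF f1 F.addmap_smult[OF m1[OF k]]] _ v])
    fix b j c assume b: "b \<in> B1" and j: "j \<in> carrier G" and c: "c \<in> carrier K"
    show "f1 (scal k \<odot>\<^bsub>?B\<^esub> monomial KG b (mon j c)) = scal k \<odot>\<^bsub>F\<^esub> f1 (monomial KG b (mon j c))"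
      unfolding mon_monomial[OF G.one_closed k j c] f1_mon[OF b j c]
        mon_act[OF F xc[OF b j] G.one_closed j k c]
      using f1_mon[OF b, of j "k \<otimes>\<^bsub>K\<^esub> c"] j k c by simp
  qed
  define g1 where "g1 p = f1 (s1 (\<rho> p))" for p
  have g1: "addmap P0 F g1"
    unfolding g1_def by (rule addmap_comp[OF addmap_comp[OF \<rho>(1) lmod_hom_addmap[OF s1]] f1])
  have g1_scal: "g1 (scal k \<odot>\<^bsub>P0\<^esub> p) = scal k \<odot>\<^bsub>F\<^esub> g1 p" if k: "k \<in> carrier K" and p: "p \<in> carrier P0" for k p
    unfolding g1_def \<rho>(3)[OF k p] lmod_hom_smult[OF s1 m1[OF k] addmap_closed[OF \<rho>(1) p]]
    by (rule f1_scal[OF k lmod_hom_closed[OF s1 addmap_closed[OF \<rho>(1) p]]])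
  have sh: "addmap P0 P0 (\<lambda>p. ginv g \<odot>\<^bsub>P0\<^esub> p)" if "g \<in> carrier G" for g
    by (rule P0.addmap_smult[OF mon_closed[OF ih[OF that] K.one_closed]])
  let ?g = "\<lambda>p g. g1 (ginv g \<odot>\<^bsub>P0\<^esub> p)"
  have gc: "?g p g \<in> carrier F" if "g \<in> carrier G" "p \<in> carrier P0" for p g
    by (rule addmap_closed[OF addmap_comp[OF sh[OF that(1)] g1] that(2)])
  \<comment> \<open>The homomorphism on \<open>P\<^sub>0 \<otimes> KG\<close>, as \<open>p \<otimes> g = g (g\<^sup>-\<^sup>1 p \<otimes> 1)\<close>.\<close>
  define f2 where "f2 p = fext F K (\<lambda>g c. mon g c \<odot>\<^bsub>F\<^esub> ?g p g)" for p
  have f2c: "addmap K F (\<lambda>c. mon g c \<odot>\<^bsub>F\<^esub> ?g p g)" if "p \<in> carrier P0" "g \<in> carrier G" for p g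
    by (rule addmap_comp[OF addmap_mon[OF that(2)] F.addmap_scal[OF gc[OF that(2,1)]]])
  have f2: "addmap KG F (f2 p)" if "p \<in> carrier P0" for p
    unfolding f2_def addmap_KG by (rule addmap_fext[OF K_ring F.M_group f2c[OF that]])
  have f2_mon: "f2 p (mon g c) = mon g c \<odot>\<^bsub>F\<^esub> ?g p g" if "p \<in> carrier P0" "g \<in> carrier G" "c \<in> carrier K" for p g c
    unfolding f2_def by (rule fext_monomial[OF K_ring F.M_group f2c[OF that(1)] that(2,3)])
  have f2_left: "addmap P0 F (\<lambda>p. f2 p m)" if m: "m \<in> carrier KG" for m
  proof (rule addmapI)
    show "f2 p m \<in> carrier F" if "p \<in> carrier P0" for p by (rule addmap_closed[OF f2[OF that] m])
    fix p q assume p: "p \<in> carrier P0" and q: "q \<in> carrier P0"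
    have pq: "p \<oplus>\<^bsub>P0\<^esub> q \<in> carrier P0" using p q by simp
    show "f2 (p \<oplus>\<^bsub>P0\<^esub> q) m = f2 p m \<oplus>\<^bsub>F\<^esub> f2 q m"
    proof (rule addmap_KG_eqI[OF F.M_group f2[OF pq] addmap_plus[OF f2[OF p] f2[OF q] F.M_group] _ m])
      fix g c assume g: "g \<in> carrier G" and c: "c \<in> carrier K"
      show "f2 (p \<oplus>\<^bsub>P0\<^esub> q) (mon g c) = f2 p (mon g c) \<oplus>\<^bsub>F\<^esub> f2 q (mon g c)"
        unfolding f2_mon[OF pq g c] f2_mon[OF p g c] f2_mon[OF q g c] addmap_add[OF addmap_comp[OF sh[OF g] g1] p q]
        by (rule F.smult_r_distr[OF mon_closed[OF g c] gc[OF g p] gc[OF g q]])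
    qed
  qed
  have f2_scal: "f2 (scal k \<odot>\<^bsub>P0\<^esub> p) m = scal k \<odot>\<^bsub>F\<^esub> f2 p m"
    if k: "k \<in> carrier K" and p: "p \<in> carrier P0" and m: "m \<in> carrier KG" for k p m
  proof -
    have kp: "scal k \<odot>\<^bsub>P0\<^esub> p \<in> carrier P0" by (rule P0.smult_closed[OF m1[OF k] p])
    show ?thesis
    proof (rule addmap_KG_eqI[OF F.M_group f2[OF kp] addmap_comp[OF f2[OF p] F.addmap_smult[OF m1[OF k]]] _ m])
      fix g c assume g: "g \<in> carrier G" and c: "c \<in> carrier K"
      have gp: "ginv g \<odot>\<^bsub>P0\<^esub> p \<in> carrier P0" by (rule addmap_closed[OF sh[OF g] p])
      have e: "ginv g \<odot>\<^bsub>P0\<^esub> (scal k \<odot>\<^bsub>P0\<^esub> p) = scal k \<odot>\<^bsub>P0\<^esub> (ginv g \<odot>\<^bsub>P0\<^esub> p)"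
        unfolding mon_act[OF P0 p ih[OF g] G.one_closed K.one_closed k] mon_act[OF P0 p G.one_closed ih[OF g] k K.one_closed]
        using g k by simp
      show "f2 (scal k \<odot>\<^bsub>P0\<^esub> p) (mon g c) = scal k \<odot>\<^bsub>F\<^esub> f2 p (mon g c)"
        unfolding f2_mon[OF kp g c] f2_mon[OF p g c] e g1_scal[OF k gp]
          mon_act[OF F gc[OF g p] g G.one_closed c k] mon_act[OF F gc[OF g p] G.one_closed g k c]
        using g k c by (simp add: K.m_comm)
    qed
  qed
  have f2_equiv: "f2 p (mon j k \<otimes>\<^bsub>KG\<^esub> m) = mon j k \<odot>\<^bsub>F\<^esub> f2 (ginv j \<odot>\<^bsub>P0\<^esub> p) m"
    if j: "j \<in> carrier G" and k: "k \<in> carrier K" and p: "p \<in> carrier P0" and m: "m \<in> carrier KG" for j k p m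
  proof -
    have jp: "ginv j \<odot>\<^bsub>P0\<^esub> p \<in> carrier P0" by (rule addmap_closed[OF sh[OF j] p])
    note jk = mon_closed[OF j k]
    show ?thesis
    proof (rule addmap_KG_eqI[OF F.M_group addmap_comp[OF addmap_KG_mult_left[OF jk] f2[OF p]]
          addmap_comp[OF f2[OF jp] F.addmap_smult[OF jk]] _ m])
      fix g c assume g: "g \<in> carrier G" and c: "c \<in> carrier K"
      have jg: "j \<otimes> g \<in> carrier G" and kc: "k \<otimes>\<^bsub>K\<^esub> c \<in> carrier K" using j g k c by auto
      have e: "mon (inv (j \<otimes> g)) \<one>\<^bsub>K\<^esub> \<odot>\<^bsub>P0\<^esub> p = ginv g \<odot>\<^bsub>P0\<^esub> (ginv j \<odot>\<^bsub>P0\<^esub> p)"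
        unfolding mon_act[OF P0 p ih[OF g] ih[OF j] K.one_closed K.one_closed]
        using j g by (simp add: G.inv_mult_group)
      show "f2 p (mon j k \<otimes>\<^bsub>KG\<^esub> mon g c) = mon j k \<odot>\<^bsub>F\<^esub> f2 (ginv j \<odot>\<^bsub>P0\<^esub> p) (mon g c)"
        unfolding mon_mult[OF j g k c] f2_mon[OF p jg kc] f2_mon[OF jp g c] e
          mon_act[OF F gc[OF g jp] j g k c] ..
    qed
  qed
  have h1: "h v (scal c \<otimes>\<^bsub>KG\<^esub> m) = scal c \<odot>\<^bsub>F\<^esub> h v m"
    if "c \<in> carrier K" "v \<in> carrier P0" "m \<in> I" for c v m
    using hD(4)[OF G.one_closed that] mon_one_act[OF P0 that(2)] by simp
  have h_add: "addmap ?I F (h v)" if "v \<in> carrier P0" for v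
    using hc[OF that] hD(2)[OF that] by (intro addmapI) auto
  have key: "fext F K (\<lambda>g c. mon g c \<odot>\<^bsub>F\<^esub> f1 (ginv g \<odot>\<^bsub>?B\<^esub> v)) m = h (d (p1 v)) m"
    if v: "v \<in> carrier ?B" and m: "m \<in> I" for v m
  proof -
    let ?c = "\<lambda>v g c. mon g c \<odot>\<^bsub>F\<^esub> f1 (ginv g \<odot>\<^bsub>?B\<^esub> v)"
    have bs: "addmap ?B F (\<lambda>v. f1 (ginv g \<odot>\<^bsub>?B\<^esub> v))" if "g \<in> carrier G" for g
      by (rule addmap_comp[OF B.addmap_smult[OF mon_closed[OF ih[OF that] K.one_closed]] f1])
    have cc: "addmap K F (?c v g)" if "v \<in> carrier ?B" "g \<in> carrier G" for v g
      by (rule addmap_comp[OF addmap_mon[OF that(2)] F.addmap_scal[OF addmap_closed[OF bs[OF that(2)] that(1)]]])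
    have Gm: "addmap KG F (fext F K (?c v))" if "v \<in> carrier ?B" for v
      unfolding addmap_KG by (rule addmap_fext[OF K_ring F.M_group cc[OF that]])
    have Gmon: "fext F K (?c v) (mon g c) = ?c v g c" if "v \<in> carrier ?B" "g \<in> carrier G" "c \<in> carrier K" for v g c
      by (rule fext_monomial[OF K_ring F.M_group cc[OF that(1)] that(2,3)])
    have Gv: "addmap ?B F (\<lambda>v. fext F K (?c v) m)"
    proof (rule addmapI)
      show "fext F K (?c v) m \<in> carrier F" if "v \<in> carrier ?B" for v by (rule addmap_closed[OF Gm[OF that] Ic[OF m]])
      fix v w assume v: "v \<in> carrier ?B" and w: "w \<in> carrier ?B"
      have vw: "v \<oplus>\<^bsub>?B\<^esub> w \<in> carrier ?B" by (rule B.M.a_closed[OF v w])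
      show "fext F K (?c (v \<oplus>\<^bsub>?B\<^esub> w)) m = fext F K (?c v) m \<oplus>\<^bsub>F\<^esub> fext F K (?c w) m"
      proof (rule addmap_KG_eqI[OF F.M_group Gm[OF vw] addmap_plus[OF Gm[OF v] Gm[OF w] F.M_group] _ Ic[OF m]])
        fix g c assume g: "g \<in> carrier G" and c: "c \<in> carrier K"
        show "fext F K (?c (v \<oplus>\<^bsub>?B\<^esub> w)) (mon g c) = fext F K (?c v) (mon g c) \<oplus>\<^bsub>F\<^esub> fext F K (?c w) (mon g c)"
          unfolding Gmon[OF vw g c] Gmon[OF v g c] Gmon[OF w g c] addmap_add[OF bs[OF g] v w]
          by (rule F.smult_r_distr[OF mon_closed[OF g c] addmap_closed[OF bs[OF g] v] addmap_closed[OF bs[OF g] w]])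
      qed
    qed
    show ?thesis
    proof (rule addmap_free_KG_eqI[OF F.M_group Gv
          addmap_comp[OF addmap_comp[OF lmod_hom_addmap[OF p1] lmod_hom_addmap[OF d]] hD(1)[OF m]] _ v])
      fix b j k assume b: "b \<in> B1" and j: "j \<in> carrier G" and k: "k \<in> carrier K"
      let ?v = "monomial KG b (mon j k)"
      note jk = mon_closed[OF j k]
      have vc: "?v \<in> carrier ?B" by (rule monomial_closed[OF KG_ring b jk])
      note e = ec[OF b]
      have j1: "ginv j \<in> carrier KG" by (rule mon_closed[OF ih[OF j] K.one_closed])
      have all: "fext F K (?c ?v) r = mon j k \<odot>\<^bsub>F\<^esub> h (?e b) (?r (ginv j \<otimes>\<^bsub>KG\<^esub> r))"
        if r': "r \<in> carrier KG" for r
      proof (rule addmap_KG_eqI[OF F.M_group Gm[OF vc] addmap_comp[OF addmap_comp[OF addmap_comp[OF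
              addmap_KG_mult_left[OF j1] r] h_add[OF e]] F.addmap_smult[OF jk]] _ r'])
        fix g c assume g: "g \<in> carrier G" and c: "c \<in> carrier K"
        have gj: "inv g \<otimes> j \<in> carrier G" "inv j \<otimes> g \<in> carrier G" using g j by auto
        have inv: "inv (inv g \<otimes> j) = inv j \<otimes> g" using g j by (simp add: G.inv_mult_group)
        let ?y = "h (?e b) (\<mu> (inv j \<otimes> g))"
        have yc: "?y \<in> carrier F" by (rule hc[OF e \<mu>I[OF gj(2)]])
        have "fext F K (?c ?v) (mon g c) = mon g c \<odot>\<^bsub>F\<^esub> (mon (inv g \<otimes> j) k \<odot>\<^bsub>F\<^esub> ?y)"
          unfolding Gmon[OF vc g c] mon_monomial[OF ih[OF g] K.one_closed j k]
          using f1_mon[OF b gj(1) k] inv k by simp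
        also have "\<dots> = mon j (c \<otimes>\<^bsub>K\<^esub> k) \<odot>\<^bsub>F\<^esub> ?y"
          unfolding mon_act[OF F yc g gj(1) c k] using g j by (simp add: G.m_assoc[symmetric])
        also have "\<dots> = mon j k \<odot>\<^bsub>F\<^esub> (scal c \<odot>\<^bsub>F\<^esub> ?y)"
          unfolding mon_act[OF F yc j G.one_closed k c] using j k c by (simp add: K.m_comm)
        also have "scal c \<odot>\<^bsub>F\<^esub> ?y = h (?e b) (?r (ginv j \<otimes>\<^bsub>KG\<^esub> mon g c))"
          using mon_mult[OF ih[OF j] g K.one_closed c] r_mon[OF gj(2) c] h1[OF c e \<mu>I[OF gj(2)]] c by simp
        finally show "fext F K (?c ?v) (mon g c) = mon j k \<odot>\<^bsub>F\<^esub> h (?e b) (?r (ginv j \<otimes>\<^bsub>KG\<^esub> mon g c))" .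
      qed
      have jm: "ginv j \<otimes>\<^bsub>KG\<^esub> m \<in> I" by (rule ID(4)[OF j1 m])
      have je: "gel j \<odot>\<^bsub>P0\<^esub> ?e b \<in> carrier P0" by (rule P0.smult_closed[OF mon_closed[OF j K.one_closed] e])
      have "fext F K (?c ?v) m = mon j k \<odot>\<^bsub>F\<^esub> h (?e b) (ginv j \<otimes>\<^bsub>KG\<^esub> m)"
        unfolding all[OF Ic[OF m]] r_id[OF jm] ..
      also have "h (?e b) (ginv j \<otimes>\<^bsub>KG\<^esub> m) = ginv j \<odot>\<^bsub>F\<^esub> h (gel j \<odot>\<^bsub>P0\<^esub> ?e b) m"
        using hD(4)[OF ih[OF j] K.one_closed e m] j by simp
      also have "mon j k \<odot>\<^bsub>F\<^esub> \<dots> = scal k \<odot>\<^bsub>F\<^esub> h (gel j \<odot>\<^bsub>P0\<^esub> ?e b) m"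
        unfolding mon_act[OF F hc[OF je m] j ih[OF j] k K.one_closed] using j k by simp
      also have "\<dots> = h (scal k \<odot>\<^bsub>P0\<^esub> (gel j \<odot>\<^bsub>P0\<^esub> ?e b)) m" by (rule hD(3)[OF k je m, symmetric])
      also have "scal k \<odot>\<^bsub>P0\<^esub> (gel j \<odot>\<^bsub>P0\<^esub> ?e b) = mon j k \<odot>\<^bsub>P0\<^esub> ?e b"
        unfolding mon_act[OF P0 e G.one_closed j k K.one_closed] using j k by simp
      also have "\<dots> = d (p1 ?v)"
      proof -
        have b1: "monomial KG b \<one>\<^bsub>KG\<^esub> \<in> carrier ?B" by (rule monomial_closed[OF KG_ring b R.one_closed])
        have "?v = mon j k \<odot>\<^bsub>?B\<^esub> monomial KG b \<one>\<^bsub>KG\<^esub>" using jk by (auto simp: monomial_def[of KG])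
        then show ?thesis
          using lmod_hom_smult[OF p1 jk b1] lmod_hom_smult[OF d jk lmod_hom_closed[OF p1 b1]] by simp
      qed
      finally show "fext F K (?c ?v) m = h (d (p1 ?v)) m" .
    qed
  qed
  have f2_d: "f2 (d p) m = h (d p) m" if p: "p \<in> carrier P1" and m: "m \<in> I" for p m
  proof -
    have dp: "d p \<in> carrier P0" by (rule lmod_hom_closed[OF d p])
    have sp: "s1 p \<in> carrier ?B" by (rule lmod_hom_closed[OF s1 p])
    have "?g (d p) g = f1 (ginv g \<odot>\<^bsub>?B\<^esub> s1 p)" if g: "g \<in> carrier G" for g
    proof -
      note g1' = mon_closed[OF ih[OF g] K.one_closed]
      show ?thesis
        unfolding g1_def lmod_hom_smult[OF d g1' p, symmetric] \<rho>(2)[OF P1.smult_closed[OF g1' p]]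
          lmod_hom_smult[OF s1 g1' p] ..
    qed
    note eq = this
    have "f2 (d p) m = fext F K (\<lambda>g c. mon g c \<odot>\<^bsub>F\<^esub> f1 (ginv g \<odot>\<^bsub>?B\<^esub> s1 p)) m"
      unfolding f2_def
    proof (rule fext_cong[OF F.M_group])
      fix g assume "m g \<noteq> \<zero>\<^bsub>K\<^esub>"
      then have g: "g \<in> carrier G" using KG_outside[OF Ic[OF m], of g] by blast
      show "mon g (m g) \<odot>\<^bsub>F\<^esub> ?g (d p) g = mon g (m g) \<odot>\<^bsub>F\<^esub> f1 (ginv g \<odot>\<^bsub>?B\<^esub> s1 p)"
        unfolding eq[OF g] ..
      show "mon g (m g) \<odot>\<^bsub>F\<^esub> f1 (ginv g \<odot>\<^bsub>?B\<^esub> s1 p) \<in> carrier F"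
        unfolding eq[OF g, symmetric]
        by (rule F.smult_closed[OF mon_closed[OF g KG_apply[OF Ic[OF m]]] gc[OF g dp]])
    qed
    then show ?thesis using key[OF sp m] ps1[OF p] by simp
  qed
  have f2_\<Psi>: "\<Psi> (f2 p m) = \<zero>\<^bsub>W\<^esub>" if p: "p \<in> carrier P0" and m: "m \<in> carrier KG" for p m
  proof -
    have f1\<Psi>: "\<Psi> (f1 v) = \<zero>\<^bsub>W\<^esub>" if v: "v \<in> carrier ?B" for v
    proof (rule addmap_free_KG_eqI[OF W.M_group addmap_comp[OF f1 lmod_hom_addmap[OF \<Psi>]] addmap_const_zero[OF W.M_group] _ v])
      fix b j c assume b: "b \<in> B1" and j: "j \<in> carrier G" and c: "c \<in> carrier K"
      have "p1 (monomial KG b \<one>\<^bsub>KG\<^esub>) \<in> carrier P1"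
        by (rule lmod_hom_closed[OF p1 monomial_closed[OF KG_ring b R.one_closed]])
      then have "\<Psi> (?x b j) = \<zero>\<^bsub>W\<^esub>" by (rule \<Psi>h[OF _ \<mu>I[OF ih[OF j]]])
      then show "\<Psi> (f1 (monomial KG b (mon j c))) = \<zero>\<^bsub>W\<^esub>"
        unfolding f1_mon[OF b j c] lmod_hom_smult[OF \<Psi> mon_closed[OF j c] xc[OF b j]]
        using W.smult_zero_r[OF mon_closed[OF j c]] by simp
    qed
    show ?thesis
    proof (rule addmap_KG_eqI[OF W.M_group addmap_comp[OF f2[OF p] lmod_hom_addmap[OF \<Psi>]] addmap_const_zero[OF W.M_group] _ m])
      fix g c assume g: "g \<in> carrier G" and c: "c \<in> carrier K"
      have gp: "ginv g \<odot>\<^bsub>P0\<^esub> p \<in> carrier P0" by (rule addmap_closed[OF sh[OF g] p])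
      have "\<Psi> (?g p g) = \<zero>\<^bsub>W\<^esub>"
        unfolding g1_def by (rule f1\<Psi>[OF lmod_hom_closed[OF s1 addmap_closed[OF \<rho>(1) gp]]])
      then show "\<Psi> (f2 p (mon g c)) = \<zero>\<^bsub>W\<^esub>"
        unfolding f2_mon[OF p g c] lmod_hom_smult[OF \<Psi> mon_closed[OF g c] gc[OF g p]]
        using W.smult_zero_r[OF mon_closed[OF g c]] by simp
    qed
  qed
  let ?H = "\<lambda>p m. h p m \<ominus>\<^bsub>F\<^esub> f2 p m"
  have f2cl: "f2 p m \<in> carrier F" if "p \<in> carrier P0" "m \<in> I" for p m
    by (rule addmap_closed[OF f2[OF that(1)] Ic[OF that(2)]])
  have smult_minus: "a \<odot>\<^bsub>F\<^esub> (x \<ominus>\<^bsub>F\<^esub> y) = a \<odot>\<^bsub>F\<^esub> x \<ominus>\<^bsub>F\<^esub> a \<odot>\<^bsub>F\<^esub> y"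
    if "a \<in> carrier KG" "x \<in> carrier F" "y \<in> carrier F" for a x y
    by (rule addmap_minus[OF F.addmap_smult[OF that(1)] F.M_group F.M_group that(2,3)])
  have "equibilinear P0 I F ?H"
    unfolding equibilinear_def
  proof (intro conjI ballI)
    show "addmap P0 F (\<lambda>p. ?H p m)" if "m \<in> I" for m
      by (rule addmap_diff[OF hD(1)[OF that] f2_left[OF Ic[OF that]] F.M_group])
    show "?H p (m \<oplus>\<^bsub>KG\<^esub> n) = ?H p m \<oplus>\<^bsub>F\<^esub> ?H p n" if p: "p \<in> carrier P0" and m: "m \<in> I" and n: "n \<in> I" for p m n
      unfolding hD(2)[OF p m n] addmap_add[OF f2[OF p] Ic[OF m] Ic[OF n]]
      using hc[OF p m] hc[OF p n] f2cl[OF p m] f2cl[OF p n]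
      by (simp add: a_minus_def F.M.minus_add F.M.add.m_ac)
    show "?H (scal k \<odot>\<^bsub>P0\<^esub> p) m = scal k \<odot>\<^bsub>F\<^esub> ?H p m" if k: "k \<in> carrier K" and p: "p \<in> carrier P0" and m: "m \<in> I" for k p m
      unfolding hD(3)[OF k p m] f2_scal[OF k p Ic[OF m]] smult_minus[OF m1[OF k] hc[OF p m] f2cl[OF p m]] ..
    fix g k p m assume g: "g \<in> carrier G" and k: "k \<in> carrier K" and p: "p \<in> carrier P0" and m: "m \<in> I"
    have gp: "ginv g \<odot>\<^bsub>P0\<^esub> p \<in> carrier P0" by (rule addmap_closed[OF sh[OF g] p])
    show "?H p (mon g k \<otimes>\<^bsub>KG\<^esub> m) = mon g k \<odot>\<^bsub>F\<^esub> ?H (ginv g \<odot>\<^bsub>P0\<^esub> p) m"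
      unfolding hD(4)[OF g k p m] f2_equiv[OF g k p Ic[OF m]] smult_minus[OF mon_closed[OF g k] hc[OF gp m] f2cl[OF gp m]] ..
  qed
  moreover have "?H (d p) m = \<zero>\<^bsub>F\<^esub>" if "p \<in> carrier P1" "m \<in> I" for p m
    using f2_d[OF that] hc[OF lmod_hom_closed[OF d that(1)] that(2)] by (simp add: a_minus_def F.M.r_neg)
  moreover have "\<Psi> (?H p m) = \<Psi> (h p m)" if p: "p \<in> carrier P0" and m: "m \<in> I" for p m
    using addmap_minus[OF lmod_hom_addmap[OF \<Psi>] F.M_group W.M_group hc[OF p m] f2cl[OF p m]]
      f2_\<Psi>[OF p Ic[OF m]] lmod_hom_closed[OF \<Psi> hc[OF p m]] by (simp add: a_minus_def)
  ultimately show ?thesis by (intro exI[of _ ?H]) blast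
qed

end

context group_algebra
begin

text \<open>For a free module with basis \<open>B\<close>, the map \<open>v, m\<close> to the coordinates of \<open>v \<otimes> m\<close> with respect to
  the elements \<open>b \<otimes> \<gamma>\<close>, which form a basis of \<open>KG\<^sup>(\<^sup>B\<^sup>) \<otimes> KG\<close>.\<close>
definition coords :: "('b \<Rightarrow> 'g \<Rightarrow> 'k) \<Rightarrow> ('g \<Rightarrow> 'k) \<Rightarrow> 'b \<times> 'g \<Rightarrow> 'g \<Rightarrow> 'k"
  where "coords v m = (\<lambda>(b, \<gamma>) j. if \<gamma> \<in> carrier G \<and> j \<in> carrier G then v b j \<otimes>\<^bsub>K\<^esub> m (j \<otimes> \<gamma>) else \<zero>\<^bsub>K\<^esub>)"

lemma coords_closed:
  assumes v: "v \<in> carrier (free_module KG B)" and m: "m \<in> carrier KG"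
  shows "coords v m \<in> carrier (free_module KG (B \<times> carrier G))"
proof (rule free_moduleI)
  note vc = free_module_component[OF KG_ring v]
  show "coords v m c \<in> carrier KG" for c
  proof (cases c)
    case (Pair b \<gamma>)
    show ?thesis
      unfolding KG_carrier
    proof (rule free_moduleI)
      show "finite {j. coords v m c j \<noteq> \<zero>\<^bsub>K\<^esub>}"
        by (rule finite_subset[OF _ KG_finite[OF vc[of b]]])
          (use KG_apply[OF m] in \<open>auto simp: coords_def Pair\<close>)
    qed (use KG_apply[OF vc] KG_apply[OF m] in \<open>auto simp: coords_def Pair\<close>)
  qed
  show "coords v m c = \<zero>\<^bsub>KG\<^esub>" if c: "c \<notin> B \<times> carrier G" for c
  proof (cases c)
    case (Pair b \<gamma>)
    have "v b j = \<zero>\<^bsub>K\<^esub>" if "b \<notin> B" for j using free_module_outside[OF v that] by (simp add: KG_zero)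
    then show ?thesis using c Pair KG_apply[OF m] by (auto simp: coords_def KG_zero fun_eq_iff)
  qed
  let ?S = "\<Union>b\<in>{b. v b \<noteq> \<zero>\<^bsub>KG\<^esub>}. \<Union>j\<in>{j. v b j \<noteq> \<zero>\<^bsub>K\<^esub>}. (\<lambda>g. (b, inv j \<otimes> g)) ` {g. m g \<noteq> \<zero>\<^bsub>K\<^esub>}"
  have "finite ?S"
    by (intro finite_UN_I free_module_finite[OF v] KG_finite[OF vc] finite_imageI KG_finite[OF m])
  moreover have "{c. coords v m c \<noteq> \<zero>\<^bsub>KG\<^esub>} \<subseteq> ?S"
  proof
    fix c assume "c \<in> {c. coords v m c \<noteq> \<zero>\<^bsub>KG\<^esub>}"
    then obtain j where j: "coords v m c j \<noteq> \<zero>\<^bsub>K\<^esub>" by (auto simp: KG_zero fun_eq_iff)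
    obtain b \<gamma> where c: "c = (b, \<gamma>)" by (cases c)
    have g: "\<gamma> \<in> carrier G" "j \<in> carrier G" "v b j \<otimes>\<^bsub>K\<^esub> m (j \<otimes> \<gamma>) \<noteq> \<zero>\<^bsub>K\<^esub>"
      using j by (auto simp: coords_def c split: if_splits)
    then have ne: "v b j \<noteq> \<zero>\<^bsub>K\<^esub>" "m (j \<otimes> \<gamma>) \<noteq> \<zero>\<^bsub>K\<^esub>" using KG_apply[OF vc] KG_apply[OF m] by auto
    then have "v b \<noteq> \<zero>\<^bsub>KG\<^esub>" by (auto simp: KG_zero)
    moreover have "\<gamma> = inv j \<otimes> (j \<otimes> \<gamma>)" using g by (simp add: G.m_assoc[symmetric])
    ultimately show "c \<in> ?S" using ne c by blast
  qed
  ultimately show "finite {c. coords v m c \<noteq> \<zero>\<^bsub>KG\<^esub>}" by (rule finite_subset[rotated])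
qed

lemma addmap_coords_left:
  assumes m: "m \<in> carrier KG"
  shows "addmap (free_module KG B) (free_module KG (B \<times> carrier G)) (\<lambda>v. coords v m)"
proof (rule addmapI)
  fix v w assume v: "v \<in> carrier (free_module KG B)" and w: "w \<in> carrier (free_module KG B)"
  show "coords v m \<in> carrier (free_module KG (B \<times> carrier G))" by (rule coords_closed[OF v m])
  show "coords (v \<oplus>\<^bsub>free_module KG B\<^esub> w) m = coords v m \<oplus>\<^bsub>free_module KG (B \<times> carrier G)\<^esub> coords w m"
    using KG_apply[OF free_module_component[OF KG_ring v]] KG_apply[OF free_module_component[OF KG_ring w]] KG_apply[OF m]
    by (auto simp: coords_def KG_add fun_eq_iff K.l_distr)
qed

lemma addmap_coords_right:
  assumes v: "v \<in> carrier (free_module KG B)"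
  shows "addmap KG (free_module KG (B \<times> carrier G)) (coords v)"
proof (rule addmapI)
  fix m n assume m: "m \<in> carrier KG" and n: "n \<in> carrier KG"
  show "coords v m \<in> carrier (free_module KG (B \<times> carrier G))" by (rule coords_closed[OF v m])
  show "coords v (m \<oplus>\<^bsub>KG\<^esub> n) = coords v m \<oplus>\<^bsub>free_module KG (B \<times> carrier G)\<^esub> coords v n"
    using KG_apply[OF free_module_component[OF KG_ring v]] KG_apply[OF m] KG_apply[OF n]
    by (auto simp: coords_def KG_add fun_eq_iff K.r_distr)
qed

lemma coords_shift:
  fixes v :: "'b \<Rightarrow> 'g \<Rightarrow> 'k"
  assumes g: "g \<in> carrier G" and k: "k \<in> carrier K" and l: "l \<in> carrier K"
    and v: "v \<in> carrier (free_module KG B)" and m: "m \<in> carrier KG"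
  shows "coords (mon g k \<odot>\<^bsub>free_module KG B\<^esub> v) (mon g l \<otimes>\<^bsub>KG\<^esub> m) =
     mon g (k \<otimes>\<^bsub>K\<^esub> l) \<odot>\<^bsub>free_module KG (B \<times> carrier G)\<^esub> coords v m"
proof (intro ext)
  fix c :: "'b \<times> 'g" and j
  obtain b \<gamma> where c: "c = (b, \<gamma>)" by (cases c)
  note vc = free_module_component[OF KG_ring v] and cc = free_module_component[OF KG_ring coords_closed[OF v m]]
  have kl: "k \<otimes>\<^bsub>K\<^esub> l \<in> carrier K" using k l by simp
  show "coords (mon g k \<odot>\<^bsub>free_module KG B\<^esub> v) (mon g l \<otimes>\<^bsub>KG\<^esub> m) c j =
     (mon g (k \<otimes>\<^bsub>K\<^esub> l) \<odot>\<^bsub>free_module KG (B \<times> carrier G)\<^esub> coords v m) c j"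
  proof (cases "\<gamma> \<in> carrier G \<and> j \<in> carrier G")
    case True
    have "coords (mon g k \<odot>\<^bsub>free_module KG B\<^esub> v) (mon g l \<otimes>\<^bsub>KG\<^esub> m) c j =
       (k \<otimes>\<^bsub>K\<^esub> v b (inv g \<otimes> j)) \<otimes>\<^bsub>K\<^esub> (l \<otimes>\<^bsub>K\<^esub> m (inv g \<otimes> (j \<otimes> \<gamma>)))"
      using True mon_mult_apply[OF g k vc[of b], of j] mon_mult_apply[OF g l m, of "j \<otimes> \<gamma>"]
      by (simp add: coords_def c)
    also have "\<dots> = (k \<otimes>\<^bsub>K\<^esub> l) \<otimes>\<^bsub>K\<^esub> coords v m c (inv g \<otimes> j)"
      using True g k l KG_apply[OF vc] KG_apply[OF m]
      by (simp add: coords_def c G.m_assoc K.m_ac)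
    also have "\<dots> = (mon g (k \<otimes>\<^bsub>K\<^esub> l) \<odot>\<^bsub>free_module KG (B \<times> carrier G)\<^esub> coords v m) c j"
      using mon_mult_apply[OF g kl cc[of c], of j] True by simp
    finally show ?thesis .
  next
    case False
    have z: "(mon g (k \<otimes>\<^bsub>K\<^esub> l) \<otimes>\<^bsub>KG\<^esub> coords v m c) j = \<zero>\<^bsub>K\<^esub>"
    proof (cases "j \<in> carrier G")
      case True
      then show ?thesis
        using False mon_mult_apply[OF g kl cc[of c] True] kl by (simp add: coords_def c)
    next
      case False
      then show ?thesis by (simp add: KG_mult)
    qed
    have "coords (mon g k \<odot>\<^bsub>free_module KG B\<^esub> v) (mon g l \<otimes>\<^bsub>KG\<^esub> m) c j = \<zero>\<^bsub>K\<^esub>"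
      using False by (auto simp: coords_def c)
    then show ?thesis using z by simp
  qed
qed

lemma coords_monomial:
  fixes b :: 'b
  assumes "j \<in> carrier G" "g \<in> carrier G" "k \<in> carrier K" "c \<in> carrier K"
  shows "coords (monomial KG b (mon j k)) (mon g c) = monomial KG (b, inv j \<otimes> g) (mon j (k \<otimes>\<^bsub>K\<^esub> c))"
proof (intro ext)
  fix x :: "'b \<times> 'g" and i
  obtain b' \<gamma> where x: "x = (b', \<gamma>)" by (cases x)
  have e: "j \<otimes> \<gamma> = g \<longleftrightarrow> \<gamma> = inv j \<otimes> g" if "\<gamma> \<in> carrier G"
    using G.inv_solve_left[of \<gamma> j g] assms that by metis
  show "coords (monomial KG b (mon j k)) (mon g c) x i = monomial KG (b, inv j \<otimes> g) (mon j (k \<otimes>\<^bsub>K\<^esub> c)) x i"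
    using assms e by (auto simp: coords_def x monomial_def KG_zero)
qed

lemma coords_equibilinear:
  assumes I: "I \<subseteq> carrier KG" and P: "left_module KG P" and s: "s \<in> lmod_hom KG P (free_module KG B)"
  shows "equibilinear P I (free_module KG (B \<times> carrier G)) (\<lambda>p m. coords (s p) m)"
  unfolding equibilinear_def
proof (intro conjI ballI)
  interpret P: left_module KG P by (rule P)
  let ?B = "free_module KG B" and ?C = "free_module KG (B \<times> carrier G)"
  interpret B: left_module KG ?B by (rule left_module_free[OF KG_ring])
  show "addmap P ?C (\<lambda>p. coords (s p) m)" if "m \<in> I" for m
    by (rule addmap_comp[OF lmod_hom_addmap[OF s] addmap_coords_left]) (use that I in blast)
  fix p assume p: "p \<in> carrier P"
  note sp = lmod_hom_closed[OF s p]
  show "coords (s p) (m \<oplus>\<^bsub>KG\<^esub> n) = coords (s p) m \<oplus>\<^bsub>?C\<^esub> coords (s p) n" if "m \<in> I" "n \<in> I" for m n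
    by (rule addmap_add[OF addmap_coords_right[OF sp]]) (use that I in blast)+
  fix m assume "m \<in> I"
  then have m: "m \<in> carrier KG" using I by blast
  show "coords (s (scal k \<odot>\<^bsub>P\<^esub> p)) m = scal k \<odot>\<^bsub>?C\<^esub> coords (s p) m" if k: "k \<in> carrier K" for k
  proof -
    have "scal \<one>\<^bsub>K\<^esub> \<otimes>\<^bsub>KG\<^esub> m = m" using m by (simp add: KG_one[symmetric])
    then show ?thesis
      using coords_shift[OF G.one_closed k K.one_closed sp m] lmod_hom_smult[OF s mon_closed[OF G.one_closed k] p] k
      by (simp del: free_module_simps)
  qed
  fix g k assume g: "g \<in> carrier G" and k: "k \<in> carrier K"
  have ig: "inv g \<in> carrier G" using g by simp
  note i1 = mon_closed[OF ig K.one_closed]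
  have "s p = gel g \<odot>\<^bsub>?B\<^esub> s (ginv g \<odot>\<^bsub>P\<^esub> p)"
    unfolding lmod_hom_smult[OF s i1 p] mon_act[OF B.left_module_axioms sp g ig K.one_closed K.one_closed]
    using mon_one_act[OF B.left_module_axioms sp] g by (simp del: free_module_simps)
  then have "coords (s p) (mon g k \<otimes>\<^bsub>KG\<^esub> m) =
     coords (gel g \<odot>\<^bsub>?B\<^esub> s (ginv g \<odot>\<^bsub>P\<^esub> p)) (mon g k \<otimes>\<^bsub>KG\<^esub> m)" by simp
  also have "\<dots> = mon g (\<one>\<^bsub>K\<^esub> \<otimes>\<^bsub>K\<^esub> k) \<odot>\<^bsub>?C\<^esub> coords (s (ginv g \<odot>\<^bsub>P\<^esub> p)) m"
    by (rule coords_shift[OF g K.one_closed k lmod_hom_closed[OF s P.smult_closed[OF i1 p]] m])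
  finally show "coords (s p) (mon g k \<otimes>\<^bsub>KG\<^esub> m) = mon g k \<odot>\<^bsub>?C\<^esub> coords (s (ginv g \<odot>\<^bsub>P\<^esub> p)) m"
    using k by (simp del: free_module_simps)
qed

end

context pair_algebra
begin

lemma addmap_to_KX: "addmap A Om f \<Longrightarrow> addmap A KX f"
  using omega_KX by (auto simp: addmap_def Om_carrier Om_add Pi_iff simp del: free_module_simps)

lemma mon_tens_scal:
  assumes c: "c \<in> carrier K" and w: "w \<in> carrier KX" and m: "m \<in> carrier KG"
  shows "tens w (scal c \<otimes>\<^bsub>KG\<^esub> m) = scal c \<odot>\<^bsub>W\<^esub> tens w m"
  using mon_tens[OF G.one_closed K.one_closed c w m] move_one[OF w] c by (simp del: free_module_simps)

text \<open>A dual basis of \<open>\<omega> \<otimes> I\<close>: the homomorphism \<open>s\<close> to the free module on \<open>C\<close> is given by its values on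
  tensors, and followed by the homomorphism with values \<open>q\<^sub>c\<close> it is the identity of \<open>\<omega> \<otimes> I\<close>.\<close>
definition dual_frame ::
  "('g \<Rightarrow> 'k) set \<Rightarrow> 'c set \<Rightarrow> (('x \<Rightarrow> 'k) \<Rightarrow> ('g \<Rightarrow> 'k) \<Rightarrow> 'c \<Rightarrow> 'g \<Rightarrow> 'k) \<Rightarrow>
   ('c \<Rightarrow> 'x \<Rightarrow> 'g \<Rightarrow> 'k) \<Rightarrow> bool"
  where "dual_frame I C s q \<longleftrightarrow> (\<forall>w\<in>omega. \<forall>m\<in>I. s w m \<in> carrier (free_module KG C)) \<and>
     (\<forall>v\<in>omega. \<forall>w\<in>omega. \<forall>m\<in>I. s (v \<oplus>\<^bsub>KX\<^esub> w) m = s v m \<oplus>\<^bsub>free_module KG C\<^esub> s w m) \<and>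
     (\<forall>w\<in>omega. \<forall>m\<in>I. \<forall>n\<in>I. s w (m \<oplus>\<^bsub>KG\<^esub> n) = s w m \<oplus>\<^bsub>free_module KG C\<^esub> s w n) \<and>
     (\<forall>k\<in>carrier K. \<forall>w\<in>omega. \<forall>m\<in>I.
        s (move \<one> k w) m = scal k \<odot>\<^bsub>free_module KG C\<^esub> s w m) \<and>
     (\<forall>g\<in>carrier G. \<forall>k\<in>carrier K. \<forall>w\<in>omega. \<forall>m\<in>I. s w (mon g k \<otimes>\<^bsub>KG\<^esub> m) =
        mon g k \<odot>\<^bsub>free_module KG C\<^esub> s (move (inv g) \<one>\<^bsub>K\<^esub> w) m) \<and>
     (\<forall>c\<in>C. \<exists>w\<in>omega. \<exists>m\<in>I. q c = tens w m) \<and>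
     (\<forall>w\<in>omega. \<forall>m\<in>I. lin KG W q (s w m) = tens w m)"

lemma dual_frameD:
  assumes "dual_frame I C s q"
  shows "\<And>w m. w \<in> omega \<Longrightarrow> m \<in> I \<Longrightarrow> s w m \<in> carrier (free_module KG C)"
    "\<And>v w m. v \<in> omega \<Longrightarrow> w \<in> omega \<Longrightarrow> m \<in> I \<Longrightarrow> s (v \<oplus>\<^bsub>KX\<^esub> w) m = s v m \<oplus>\<^bsub>free_module KG C\<^esub> s w m"
    "\<And>w m n. w \<in> omega \<Longrightarrow> m \<in> I \<Longrightarrow> n \<in> I \<Longrightarrow> s w (m \<oplus>\<^bsub>KG\<^esub> n) = s w m \<oplus>\<^bsub>free_module KG C\<^esub> s w n"
    "\<And>k w m. k \<in> carrier K \<Longrightarrow> w \<in> omega \<Longrightarrow> m \<in> I \<Longrightarrow>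
       s (move \<one> k w) m = scal k \<odot>\<^bsub>free_module KG C\<^esub> s w m"
    "\<And>g k w m. g \<in> carrier G \<Longrightarrow> k \<in> carrier K \<Longrightarrow> w \<in> omega \<Longrightarrow> m \<in> I \<Longrightarrow>
       s w (mon g k \<otimes>\<^bsub>KG\<^esub> m) = mon g k \<odot>\<^bsub>free_module KG C\<^esub> s (move (inv g) \<one>\<^bsub>K\<^esub> w) m"
    "\<And>c. c \<in> C \<Longrightarrow> \<exists>w\<in>omega. \<exists>m\<in>I. q c = tens w m"
    "\<And>w m. w \<in> omega \<Longrightarrow> m \<in> I \<Longrightarrow> lin KG W q (s w m) = tens w m"
  using assms unfolding dual_frame_def by blast+

text \<open>The module \<open>\<omega> \<otimes> I\<close> is projective if \<open>0 \<rightarrow> P\<^sub>1 \<rightarrow> P\<^sub>0 \<rightarrow> \<omega> \<rightarrow> 0\<close> is a projective resolution.  The coordinates of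
  \<open>p \<otimes> m\<close> in the free module \<open>KG\<^sup>(\<^sup>B\<^sup>) \<otimes> KG\<close>, with \<open>B = B\<^sub>0\<close>, define a map on \<open>P\<^sub>0 \<otimes> I\<close>; corrected so that it
  vanishes on \<open>P\<^sub>1 \<otimes> I\<close>, it descends to \<open>\<omega> \<otimes> I\<close>.  The basis element \<open>b \<otimes> \<gamma>\<close> corresponds to
  \<open>q = w\<^sub>b \<otimes> \<mu> \<gamma>\<close>, where \<open>w\<^sub>b\<close> is the image of \<open>b\<close> in \<open>\<omega>\<close> and \<open>\<mu>\<close> is a linear projection of
  \<open>KG\<close> onto \<open>I\<close>.\<close>
lemma equivariant_frame:
  assumes I: "lsub KG (left_regular KG) I" and x0: "x0 \<in> X"
    and P0: "left_module KG P0" and P1: "left_module KG P1"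
    and \<epsilon>: "\<epsilon> \<in> lmod_hom KG P0 Om" "\<epsilon> ` carrier P0 = carrier Om"
    and d: "d \<in> lmod_hom KG P1 P0" "inj_on d (carrier P1)"
      "d ` carrier P1 = {p \<in> carrier P0. \<epsilon> p = \<zero>\<^bsub>Om\<^esub>}"
    and s0: "s0 \<in> lmod_hom KG P0 (free_module KG B0)" and p0: "p0 \<in> lmod_hom KG (free_module KG B0) P0"
    and ps0: "\<forall>p\<in>carrier P0. p0 (s0 p) = p"
    and s1: "s1 \<in> lmod_hom KG P1 (free_module KG B1)" and p1: "p1 \<in> lmod_hom KG (free_module KG B1) P1"
    and ps1: "\<forall>p\<in>carrier P1. p1 (s1 p) = p"
  shows "\<exists>s q. dual_frame I (B0 \<times> carrier G) s q"
proof -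
  interpret P0: left_module KG P0 by (rule P0)
  interpret P1: left_module KG P1 by (rule P1)
  interpret Wm: left_module KG W by (rule W_module)
  let ?B = "free_module KG B0" and ?C = "free_module KG (B0 \<times> carrier G)"
  interpret B: left_module KG ?B by (rule left_module_free[OF KG_ring])
  interpret C: left_module KG ?C by (rule left_module_free[OF KG_ring])
  note ID = lsubD[OF I, simplified]
  have Ic: "\<And>m. m \<in> I \<Longrightarrow> m \<in> carrier KG" using ID(1) by blast
  have m1: "scal k \<in> carrier KG" if "k \<in> carrier K" for k using that by (simp add: mon_closed)
  have eo: "\<epsilon> p \<in> omega" if "p \<in> carrier P0" for p using lmod_hom_closed[OF \<epsilon>(1) that] by (simp add: Om_carrier)
  have ea: "addmap P0 KX \<epsilon>" by (rule addmap_to_KX[OF lmod_hom_addmap[OF \<epsilon>(1)]])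
  have em: "\<epsilon> (mon g k \<odot>\<^bsub>P0\<^esub> p) = move g k (\<epsilon> p)" if "g \<in> carrier G" "k \<in> carrier K" "p \<in> carrier P0" for g k p
    using lmod_hom_smult[OF \<epsilon>(1) mon_closed[OF that(1,2)] that(3)] Om_smult_mon[OF that(1,2) eo[OF that(3)]] by simp
  have ker: "p \<in> d ` carrier P1" if "p \<in> carrier P0" "\<epsilon> p = \<zero>\<^bsub>KX\<^esub>" for p
    unfolding d(3) using that by (simp add: Om_zero)
  have ed: "\<epsilon> (d p) = \<zero>\<^bsub>KX\<^esub>" if "p \<in> carrier P1" for p
  proof -
    have "d p \<in> {p \<in> carrier P0. \<epsilon> p = \<zero>\<^bsub>Om\<^esub>}" using d(3) that by blast
    then show ?thesis by (simp add: Om_zero)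
  qed
  \<comment> \<open>A linear section of \<open>\<epsilon>\<close>.\<close>
  have "\<forall>x\<in>X. \<exists>y. y \<in> carrier P0 \<and> \<epsilon> y = center x0 (pt x)"
  proof
    fix x assume "x \<in> X"
    then have "center x0 (pt x) \<in> \<epsilon> ` carrier P0"
      unfolding \<epsilon>(2) Om_carrier by (rule center_omega[OF x0 pt_closed])
    then show "\<exists>y. y \<in> carrier P0 \<and> \<epsilon> y = center x0 (pt x)" by auto
  qed
  then obtain y where y: "\<forall>x\<in>X. y x \<in> carrier P0 \<and> \<epsilon> (y x) = center x0 (pt x)" by (rule bchoice[THEN exE])
  define \<tau> where "\<tau> = fext P0 K (\<lambda>x k. scal k \<odot>\<^bsub>P0\<^esub> y x)"
  have \<tau>c: "addmap K P0 (\<lambda>k. scal k \<odot>\<^bsub>P0\<^esub> y x)" if "x \<in> X" for x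
    by (rule addmap_comp[OF addmap_mon[OF G.one_closed] P0.addmap_scal]) (use y that in blast)
  have \<tau>: "addmap KX P0 \<tau>" unfolding \<tau>_def by (rule addmap_fext[OF K_ring P0.M_group \<tau>c])
  have \<tau>m: "\<tau> (monomial K x k) = scal k \<odot>\<^bsub>P0\<^esub> y x" if "x \<in> X" "k \<in> carrier K" for x k
    unfolding \<tau>_def by (rule fext_monomial[OF K_ring P0.M_group \<tau>c that])
  have e\<tau>: "\<epsilon> (\<tau> w) = center x0 w" if w: "w \<in> carrier KX" for w
  proof (rule addmap_free_eqI[OF K_ring KX_group addmap_comp[OF \<tau> ea] addmap_center[OF x0] _ w])
    fix x k assume x: "x \<in> X" and k: "k \<in> carrier K"
    have yx: "y x \<in> carrier P0" "\<epsilon> (y x) = center x0 (pt x)" using y x by blast+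
    show "\<epsilon> (\<tau> (monomial K x k)) = center x0 (monomial K x k)"
      unfolding \<tau>m[OF x k] em[OF G.one_closed k yx(1)] yx(2) by (rule center_pt[OF x0 x k])
  qed
  have \<tau>s: "\<tau> (move \<one> k w) = scal k \<odot>\<^bsub>P0\<^esub> \<tau> w" if k: "k \<in> carrier K" and w: "w \<in> carrier KX" for k w
  proof (rule addmap_free_eqI[OF K_ring P0.M_group addmap_comp[OF addmap_move[OF G.one_closed k] \<tau>]
        addmap_comp[OF \<tau> P0.addmap_smult[OF m1[OF k]]] _ w])
    fix x c assume x: "x \<in> X" and c: "c \<in> carrier K"
    have yx: "y x \<in> carrier P0" using y x by blast
    have "move \<one> k (monomial K x c) = monomial K x (k \<otimes>\<^bsub>K\<^esub> c)" using move_monomial[OF G.one_closed x k c] x by simp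
    then show "\<tau> (move \<one> k (monomial K x c)) = scal k \<odot>\<^bsub>P0\<^esub> \<tau> (monomial K x c)"
      unfolding \<tau>m[OF x c] mon_act[OF P0 yx G.one_closed G.one_closed k c]
      using \<tau>m[OF x, of "k \<otimes>\<^bsub>K\<^esub> c"] k c by simp
  qed
  have \<tau>c': "\<tau> w \<in> carrier P0" if "w \<in> omega" for w by (rule addmap_closed[OF \<tau> omega_KX[OF that]])
  have e\<tau>': "\<epsilon> (\<tau> w) = w" if "w \<in> omega" for w unfolding e\<tau>[OF omega_KX[OF that]] by (rule center_id[OF that])
  \<comment> \<open>The corresponding linear retraction onto \<open>P\<^sub>1\<close>.\<close>
  let ?q = "\<lambda>p. p \<ominus>\<^bsub>P0\<^esub> \<tau> (\<epsilon> p)"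
  have qa: "addmap P0 P0 ?q" by (rule addmap_diff[OF addmap_id addmap_comp[OF ea \<tau>] P0.M_group])
  have qd: "?q p \<in> d ` carrier P1" if p: "p \<in> carrier P0" for p
  proof (rule ker[OF addmap_closed[OF qa p]])
    have "\<epsilon> (?q p) = \<epsilon> p \<ominus>\<^bsub>KX\<^esub> \<epsilon> (\<tau> (\<epsilon> p))"
      by (rule addmap_minus[OF ea P0.M_group KX_group p \<tau>c'[OF eo[OF p]]])
    then show "\<epsilon> (?q p) = \<zero>\<^bsub>KX\<^esub>"
      unfolding e\<tau>'[OF eo[OF p]] a_minus_def
      using abelian_group.r_neg[OF KX_group omega_KX[OF eo[OF p]]] by (simp only:)
  qed
  define \<rho> where "\<rho> p = the_inv_into (carrier P1) d (?q p)" for p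
  have \<rho>c: "\<rho> p \<in> carrier P1" and d\<rho>: "d (\<rho> p) = ?q p" if p: "p \<in> carrier P0" for p
    unfolding \<rho>_def using the_inv_into_into[OF d(2) qd[OF p] order_refl] f_the_inv_into_f[OF d(2) qd[OF p]] by blast+
  have dinj: "u = v" if "d u = d v" "u \<in> carrier P1" "v \<in> carrier P1" for u v using inj_onD[OF d(2) that] .
  have \<rho>a: "addmap P0 P1 \<rho>"
  proof (rule addmapI[OF \<rho>c])
    fix p p' assume p: "p \<in> carrier P0" and p': "p' \<in> carrier P0"
    have pp: "p \<oplus>\<^bsub>P0\<^esub> p' \<in> carrier P0" using p p' by simp
    show "\<rho> (p \<oplus>\<^bsub>P0\<^esub> p') = \<rho> p \<oplus>\<^bsub>P1\<^esub> \<rho> p'"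
    proof (rule dinj)
      show "d (\<rho> (p \<oplus>\<^bsub>P0\<^esub> p')) = d (\<rho> p \<oplus>\<^bsub>P1\<^esub> \<rho> p')"
        unfolding d\<rho>[OF pp] lmod_hom_add[OF d(1) \<rho>c[OF p] \<rho>c[OF p']] d\<rho>[OF p] d\<rho>[OF p']
        by (rule addmap_add[OF qa p p'])
    qed (use \<rho>c[OF p] \<rho>c[OF p'] \<rho>c[OF pp] in auto)
  qed
  have \<rho>d: "\<rho> (d p) = p" if p: "p \<in> carrier P1" for p
  proof (rule dinj)
    have dp: "d p \<in> carrier P0" by (rule lmod_hom_closed[OF d(1) p])
    have "\<tau> (\<epsilon> (d p)) = \<zero>\<^bsub>P0\<^esub>" unfolding ed[OF p] by (rule addmap_zero[OF \<tau> KX_group P0.M_group])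
    then show "d (\<rho> (d p)) = d p" unfolding d\<rho>[OF dp] using dp by (simp add: a_minus_def)
    show "\<rho> (d p) \<in> carrier P1" by (rule \<rho>c[OF dp])
  qed (rule p)
  have \<rho>s: "\<rho> (scal k \<odot>\<^bsub>P0\<^esub> p) = scal k \<odot>\<^bsub>P1\<^esub> \<rho> p" if k: "k \<in> carrier K" and p: "p \<in> carrier P0" for k p
  proof (rule dinj)
    have kp: "scal k \<odot>\<^bsub>P0\<^esub> p \<in> carrier P0" by (rule P0.smult_closed[OF m1[OF k] p])
    show "d (\<rho> (scal k \<odot>\<^bsub>P0\<^esub> p)) = d (scal k \<odot>\<^bsub>P1\<^esub> \<rho> p)"
      unfolding d\<rho>[OF kp] lmod_hom_smult[OF d(1) m1[OF k] \<rho>c[OF p]] d\<rho>[OF p] em[OF G.one_closed k p] \<tau>s[OF k omega_KX[OF eo[OF p]]]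
      by (rule addmap_minus[OF P0.addmap_smult[OF m1[OF k]] P0.M_group P0.M_group p \<tau>c'[OF eo[OF p]], symmetric])
    show "\<rho> (scal k \<odot>\<^bsub>P0\<^esub> p) \<in> carrier P1" by (rule \<rho>c[OF kp])
    show "scal k \<odot>\<^bsub>P1\<^esub> \<rho> p \<in> carrier P1" by (rule P1.smult_closed[OF m1[OF k] \<rho>c[OF p]])
  qed
  \<comment> \<open>The coordinates of \<open>p \<otimes> m\<close>, and the elements that they refer to.\<close>
  let ?h = "\<lambda>p m. coords (s0 p) m"
  have h: "equibilinear P0 I ?C ?h" by (rule coords_equibilinear[OF ID(1) P0 s0])
  obtain \<mu> where \<mu>I: "\<And>g. g \<in> carrier G \<Longrightarrow> \<mu> g \<in> I"
    and \<mu>: "\<And>m. m \<in> I \<Longrightarrow> fext KG K (\<lambda>g k. scal k \<otimes>\<^bsub>KG\<^esub> \<mu> g) m = m"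
    using left_ideal_complement[OF I] by blast
  let ?r = "fext KG K (\<lambda>g k. scal k \<otimes>\<^bsub>KG\<^esub> \<mu> g)"
  have rc: "addmap K KG (\<lambda>k. scal k \<otimes>\<^bsub>KG\<^esub> \<mu> g)" if "g \<in> carrier G" for g
    by (rule addmap_comp[OF addmap_mon[OF G.one_closed] addmap_KG_mult_right[OF Ic[OF \<mu>I[OF that]]]])
  have r: "addmap KG KG ?r" unfolding addmap_KG by (rule addmap_fext[OF K_ring R.abelian_group_axioms rc])
  have r_mon: "?r (mon g k) = scal k \<otimes>\<^bsub>KG\<^esub> \<mu> g" if "g \<in> carrier G" "k \<in> carrier K" for g k
    by (rule fext_monomial[OF K_ring R.abelian_group_axioms rc that])
  let ?w = "\<lambda>b. \<epsilon> (p0 (monomial KG b \<one>\<^bsub>KG\<^esub>))"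
  have b1: "monomial KG b \<one>\<^bsub>KG\<^esub> \<in> carrier ?B" if "b \<in> B0" for b by (rule monomial_closed[OF KG_ring that R.one_closed])
  have pb: "p0 (monomial KG b \<one>\<^bsub>KG\<^esub>) \<in> carrier P0" if "b \<in> B0" for b by (rule lmod_hom_closed[OF p0 b1[OF that]])
  have wo: "?w b \<in> omega" if "b \<in> B0" for b by (rule eo[OF pb[OF that]])
  let ?Q = "\<lambda>(b, \<gamma>). tens (?w b) (\<mu> \<gamma>)"
  have Qc: "?Q c \<in> carrier W" if "c \<in> B0 \<times> carrier G" for c
    using that tens_closed[OF omega_KX[OF wo] Ic[OF \<mu>I]] by auto
  have \<Psi>: "lin KG W ?Q \<in> lmod_hom KG ?C W" by (rule Wm.lin_hom[OF Qc])
  note \<Psi>a = lmod_hom_addmap[OF \<Psi>]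
  have \<Psi>m: "lin KG W ?Q (monomial KG (b, \<gamma>) a) = a \<odot>\<^bsub>W\<^esub> tens (?w b) (\<mu> \<gamma>)"
    if "b \<in> B0" "\<gamma> \<in> carrier G" "a \<in> carrier KG" for b \<gamma> a
    using Wm.lin_monomial_coeff[of "B0 \<times> carrier G" ?Q "(b, \<gamma>)" a, OF Qc] that by simp
  have \<Psi>h0: "lin KG W ?Q (coords v m) = tens (\<epsilon> (p0 v)) m" if v: "v \<in> carrier ?B" and m: "m \<in> I" for v m
  proof (rule addmap_free_KG_eqI[OF W_group addmap_comp[OF addmap_coords_left[OF Ic[OF m]] \<Psi>a]
        addmap_comp[OF addmap_comp[OF lmod_hom_addmap[OF p0] ea] addmap_tens_left[OF Ic[OF m]]] _ v])
    fix b j k assume b: "b \<in> B0" and j: "j \<in> carrier G" and k: "k \<in> carrier K"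
    let ?v = "monomial KG b (mon j k)"
    note jk = mon_closed[OF j k] and wK = omega_KX[OF wo[OF b]]
    have ij: "inv j \<in> carrier G" using j by simp
    have vc: "?v \<in> carrier ?B" by (rule monomial_closed[OF KG_ring b jk])
    note j1 = mon_closed[OF ij K.one_closed]
    have all: "lin KG W ?Q (coords ?v a) = mon j k \<odot>\<^bsub>W\<^esub> tens (?w b) (?r (ginv j \<otimes>\<^bsub>KG\<^esub> a))"
      if a: "a \<in> carrier KG" for a
    proof (rule addmap_KG_eqI[OF W_group addmap_comp[OF addmap_coords_right[OF vc] \<Psi>a]
          addmap_comp[OF addmap_comp[OF addmap_comp[OF addmap_KG_mult_left[OF j1] r] addmap_tens_right[OF wK]]
            Wm.addmap_smult[OF jk]] _ a])
      fix g c assume g: "g \<in> carrier G" and c: "c \<in> carrier K"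
      have gj: "inv j \<otimes> g \<in> carrier G" using g j by simp
      have kc: "k \<otimes>\<^bsub>K\<^esub> c \<in> carrier K" using k c by simp
      let ?t = "tens (?w b) (\<mu> (inv j \<otimes> g))"
      have tc: "?t \<in> carrier W" by (rule tens_closed[OF wK Ic[OF \<mu>I[OF gj]]])
      have "lin KG W ?Q (coords ?v (mon g c)) = mon j (k \<otimes>\<^bsub>K\<^esub> c) \<odot>\<^bsub>W\<^esub> ?t"
        unfolding coords_monomial[OF j g k c] by (rule \<Psi>m[OF b gj mon_closed[OF j kc]])
      also have "\<dots> = mon j k \<odot>\<^bsub>W\<^esub> (scal c \<odot>\<^bsub>W\<^esub> ?t)"
        unfolding mon_act[OF W_module tc j G.one_closed k c] using j by simp
      also have "scal c \<odot>\<^bsub>W\<^esub> ?t = tens (?w b) (scal c \<otimes>\<^bsub>KG\<^esub> \<mu> (inv j \<otimes> g))"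
        by (rule mon_tens_scal[OF c wK Ic[OF \<mu>I[OF gj]], symmetric])
      also have "scal c \<otimes>\<^bsub>KG\<^esub> \<mu> (inv j \<otimes> g) = ?r (ginv j \<otimes>\<^bsub>KG\<^esub> mon g c)"
        unfolding mon_mult[OF ij g K.one_closed c] using r_mon[OF gj c] c by simp
      finally show "lin KG W ?Q (coords ?v (mon g c)) = mon j k \<odot>\<^bsub>W\<^esub> tens (?w b) (?r (ginv j \<otimes>\<^bsub>KG\<^esub> mon g c))" .
    qed
    have jm: "ginv j \<otimes>\<^bsub>KG\<^esub> m \<in> I" by (rule ID(4)[OF j1 m])
    have "lin KG W ?Q (coords ?v m) = mon j k \<odot>\<^bsub>W\<^esub> tens (?w b) (ginv j \<otimes>\<^bsub>KG\<^esub> m)"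
      unfolding all[OF Ic[OF m]] \<mu>[OF jm] ..
    also have "\<dots> = tens (move j k (?w b)) (gel j \<otimes>\<^bsub>KG\<^esub> (ginv j \<otimes>\<^bsub>KG\<^esub> m))"
      using mon_tens[OF j k K.one_closed wK Ic[OF jm]] k by (simp del: free_module_simps)
    also have "gel j \<otimes>\<^bsub>KG\<^esub> (ginv j \<otimes>\<^bsub>KG\<^esub> m) = m"
      using R.m_assoc[OF mon_closed[OF j K.one_closed] j1 Ic[OF m]] mon_mult[OF j ij K.one_closed K.one_closed]
        j Ic[OF m] by (simp add: KG_one[symmetric])
    also have "move j k (?w b) = \<epsilon> (p0 ?v)"
    proof -
      have "?v = mon j k \<odot>\<^bsub>?B\<^esub> monomial KG b \<one>\<^bsub>KG\<^esub>" using jk by (auto simp: monomial_def[of KG])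
      then show ?thesis using lmod_hom_smult[OF p0 jk b1[OF b]] em[OF j k pb[OF b]] by simp
    qed
    finally show "lin KG W ?Q (coords ?v m) = tens (\<epsilon> (p0 ?v)) m" .
  qed
  have \<Psi>h: "lin KG W ?Q (?h p m) = tens (\<epsilon> p) m" if "p \<in> carrier P0" "m \<in> I" for p m
    using \<Psi>h0[OF lmod_hom_closed[OF s0 that(1)] that(2)] bspec[OF ps0 that(1)] by simp
  have \<Psi>d: "lin KG W ?Q (?h (d p) m) = \<zero>\<^bsub>W\<^esub>" if p: "p \<in> carrier P1" and m: "m \<in> I" for p m
    unfolding \<Psi>h[OF lmod_hom_closed[OF d(1) p] m] ed[OF p]
    by (rule addmap_zero[OF addmap_tens_left[OF Ic[OF m]] KX_group W_group])
  have "\<exists>H. equibilinear P0 I ?C H \<and> (\<forall>p\<in>carrier P1. \<forall>m\<in>I. H (d p) m = \<zero>\<^bsub>?C\<^esub>) \<and>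
     (\<forall>p\<in>carrier P0. \<forall>m\<in>I. lin KG W ?Q (H p m) = lin KG W ?Q (?h p m))"
    by (rule equibilinear_correction[OF I P0 P1 C.left_module_axioms d(1) \<rho>a \<rho>d \<rho>s s1 p1 bspec[OF ps1] h W_module \<Psi>])
      (assumption | rule \<Psi>d)+
  then obtain H where H: "equibilinear P0 I ?C H" and Hd: "\<forall>p\<in>carrier P1. \<forall>m\<in>I. H (d p) m = \<zero>\<^bsub>?C\<^esub>"
    and H\<Psi>: "\<forall>p\<in>carrier P0. \<forall>m\<in>I. lin KG W ?Q (H p m) = lin KG W ?Q (?h p m)"
    by (elim exE conjE)
  note HD = equibilinearD[OF H]
  have H_cong: "H p m = H p' m" if p: "p \<in> carrier P0" "p' \<in> carrier P0" "\<epsilon> p = \<epsilon> p'" and m: "m \<in> I" for p p' m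
  proof -
    have pc: "p \<ominus>\<^bsub>P0\<^esub> p' \<in> carrier P0" using p by simp
    have "\<epsilon> (p \<ominus>\<^bsub>P0\<^esub> p') = \<epsilon> p \<ominus>\<^bsub>KX\<^esub> \<epsilon> p'" by (rule addmap_minus[OF ea P0.M_group KX_group p(1,2)])
    also have "\<dots> = \<zero>\<^bsub>KX\<^esub>"
      unfolding p(3) a_minus_def by (rule abelian_group.r_neg[OF KX_group omega_KX[OF eo[OF p(2)]]])
    finally obtain u where u: "u \<in> carrier P1" "p \<ominus>\<^bsub>P0\<^esub> p' = d u" using ker[OF pc] by blast
    have "H p m \<ominus>\<^bsub>?C\<^esub> H p' m = H (p \<ominus>\<^bsub>P0\<^esub> p') m"
      by (rule addmap_minus[OF HD(1)[OF m] P0.M_group C.M_group p(1,2), symmetric])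
    also have "\<dots> = \<zero>\<^bsub>?C\<^esub>" unfolding u(2) using Hd u(1) m by blast
    finally show ?thesis
      by (rule minus_eq_zeroD[OF C.M_group addmap_closed[OF HD(1)[OF m] p(1)] addmap_closed[OF HD(1)[OF m] p(2)]])
  qed
  let ?s = "\<lambda>w m. H (\<tau> w) m"
  have c1: "\<forall>w\<in>omega. \<forall>m\<in>I. ?s w m \<in> carrier ?C"
    using addmap_closed[OF HD(1)] \<tau>c' by blast
  have c2: "\<forall>v\<in>omega. \<forall>w\<in>omega. \<forall>m\<in>I. ?s (v \<oplus>\<^bsub>KX\<^esub> w) m = ?s v m \<oplus>\<^bsub>?C\<^esub> ?s w m"
  proof (intro ballI)
    fix v w m assume v: "v \<in> omega" and w: "w \<in> omega" and m: "m \<in> I"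
    show "?s (v \<oplus>\<^bsub>KX\<^esub> w) m = ?s v m \<oplus>\<^bsub>?C\<^esub> ?s w m"
      unfolding addmap_add[OF \<tau> omega_KX[OF v] omega_KX[OF w]]
      by (rule addmap_add[OF HD(1)[OF m] \<tau>c'[OF v] \<tau>c'[OF w]])
  qed
  have c3: "\<forall>w\<in>omega. \<forall>m\<in>I. \<forall>n\<in>I. ?s w (m \<oplus>\<^bsub>KG\<^esub> n) = ?s w m \<oplus>\<^bsub>?C\<^esub> ?s w n"
    using HD(2) \<tau>c' by blast
  have c4: "\<forall>k\<in>carrier K. \<forall>w\<in>omega. \<forall>m\<in>I. ?s (move \<one> k w) m = scal k \<odot>\<^bsub>?C\<^esub> ?s w m"
  proof (intro ballI)
    fix k w m assume k: "k \<in> carrier K" and w: "w \<in> omega" and m: "m \<in> I"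
    show "?s (move \<one> k w) m = scal k \<odot>\<^bsub>?C\<^esub> ?s w m"
      unfolding \<tau>s[OF k omega_KX[OF w]] by (rule HD(3)[OF k \<tau>c'[OF w] m])
  qed
  have c5: "\<forall>g\<in>carrier G. \<forall>k\<in>carrier K. \<forall>w\<in>omega. \<forall>m\<in>I. ?s w (mon g k \<otimes>\<^bsub>KG\<^esub> m) =
      mon g k \<odot>\<^bsub>?C\<^esub> ?s (move (inv g) \<one>\<^bsub>K\<^esub> w) m"
  proof (intro ballI)
    fix g k w m assume g: "g \<in> carrier G" and k: "k \<in> carrier K" and w: "w \<in> omega" and m: "m \<in> I"
    have ig: "inv g \<in> carrier G" using g by simp
    have mv: "move (inv g) \<one>\<^bsub>K\<^esub> w \<in> omega" by (rule omega_move[OF ig K.one_closed w])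
    have "H (ginv g \<odot>\<^bsub>P0\<^esub> \<tau> w) m = ?s (move (inv g) \<one>\<^bsub>K\<^esub> w) m"
    proof (rule H_cong[OF P0.smult_closed[OF mon_closed[OF ig K.one_closed] \<tau>c'[OF w]] \<tau>c'[OF mv] _ m])
      show "\<epsilon> (ginv g \<odot>\<^bsub>P0\<^esub> \<tau> w) = \<epsilon> (\<tau> (move (inv g) \<one>\<^bsub>K\<^esub> w))"
        unfolding em[OF ig K.one_closed \<tau>c'[OF w]] e\<tau>'[OF w] e\<tau>'[OF mv] ..
    qed
    then show "?s w (mon g k \<otimes>\<^bsub>KG\<^esub> m) = mon g k \<odot>\<^bsub>?C\<^esub> ?s (move (inv g) \<one>\<^bsub>K\<^esub> w) m"
      unfolding HD(4)[OF g k \<tau>c'[OF w] m] by simp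
  qed
  have c6: "\<forall>c\<in>B0 \<times> carrier G. \<exists>w\<in>omega. \<exists>m\<in>I. ?Q c = tens w m"
  proof
    fix c assume "c \<in> B0 \<times> carrier G"
    then obtain b \<gamma> where c: "c = (b, \<gamma>)" "b \<in> B0" "\<gamma> \<in> carrier G" by blast
    then show "\<exists>w\<in>omega. \<exists>m\<in>I. ?Q c = tens w m"
      using wo[OF c(2)] \<mu>I[OF c(3)] by (intro bexI[of _ "?w b"] bexI[of _ "\<mu> \<gamma>"]) auto
  qed
  have c7: "\<forall>w\<in>omega. \<forall>m\<in>I. lin KG W ?Q (?s w m) = tens w m"
  proof (intro ballI)
    fix w m assume w: "w \<in> omega" and m: "m \<in> I"
    show "lin KG W ?Q (?s w m) = tens w m"
      using H\<Psi> \<tau>c'[OF w] m \<Psi>h[OF \<tau>c'[OF w] m] e\<tau>'[OF w] by simp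
  qed
  show ?thesis
    by (rule exI[of _ ?s], rule exI[of _ ?Q], unfold dual_frame_def, intro conjI c1 c2 c3 c4 c5 c6 c7)
qed

end

section \<open>Passing from relations of tensors to relations in the group algebra\<close>

text \<open>Suppose that \<open>t\<close> has finitely generated relations, and that \<open>\<theta>\<close> maps the span of \<open>t\<close> onto the span
  of the \<open>\<theta> u\<^sub>i\<close>.  Modulo \<open>\<theta>\<close>, each \<open>t\<^sub>j\<close> can be written in the \<open>u\<^sub>i\<close>; these substitutions turn a relation
  between the \<open>\<theta> t\<^sub>j\<close> into one between the \<open>\<theta> u\<^sub>i\<close>, which by assumption is accounted for, up to
  relations of \<open>t\<close>, by the finitely many elements \<open>S\<close> of the kernel of \<open>\<theta>\<close>.\<close>
lemma descend_relations:
  assumes W: "left_module R W" and M: "left_module R M" and \<theta>: "\<theta> \<in> lmod_hom R W M"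
    and J: "finite J" and t: "\<And>j. j \<in> J \<Longrightarrow> t j \<in> carrier W"
    and relt: "fgen R (free_module R J) (rel R W J t)"
    and u: "\<And>i. i \<in> N \<Longrightarrow> u i \<in> lspan R W (t ` J)"
    and S: "finite S" "S \<subseteq> lspan R W (t ` J)" "\<And>s. s \<in> S \<Longrightarrow> \<theta> s = \<zero>\<^bsub>M\<^esub>"
    and gen: "\<And>j. j \<in> J \<Longrightarrow> \<theta> (t j) \<in> lspan R M ((\<lambda>i. \<theta> (u i)) ` N)"
    and relu: "\<And>l. l \<in> rel R M N (\<lambda>i. \<theta> (u i)) \<Longrightarrow> lin R W u l \<in> lspan R W S"
  shows "fgen R (free_module R J) (rel R M J (\<lambda>j. \<theta> (t j)))"
proof -
  interpret W: left_module R W by (rule W)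
  interpret M: left_module R M by (rule M)
  let ?F = "free_module R J" and ?G = "free_module R N"
  interpret F: left_module R ?F by (rule left_module_free[OF W.R_ring])
  interpret G: left_module R ?G by (rule left_module_free[OF W.R_ring])
  let ?\<pi> = "lin R W t"
  have tJ: "t ` J \<subseteq> carrier W" by (rule image_subsetI) (rule t)
  have \<pi>: "?\<pi> \<in> lmod_hom R ?F W" by (rule W.lin_hom[OF t])
  have img: "lspan R W (t ` J) = ?\<pi> ` carrier ?F" by (rule W.lspan_image_eq[OF t])
  have uc: "u i \<in> carrier W" if "i \<in> N" for i using u[OF that] W.lspan_closed[OF tJ] by blast
  have \<theta>u: "\<theta> (u i) \<in> carrier M" if "i \<in> N" for i by (rule lmod_hom_closed[OF \<theta> uc[OF that]])
  have "\<forall>s\<in>S. \<exists>e. e \<in> carrier ?F \<and> ?\<pi> e = s" using S(2) unfolding img by blast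
  then obtain e where e: "\<forall>s\<in>S. e s \<in> carrier ?F \<and> ?\<pi> (e s) = s" by (rule bchoice[THEN exE])
  have "\<forall>i\<in>N. \<exists>c. c \<in> carrier ?F \<and> ?\<pi> c = u i"
  proof
    fix i assume "i \<in> N"
    from u[OF this] show "\<exists>c. c \<in> carrier ?F \<and> ?\<pi> c = u i" unfolding img by (elim imageE) auto
  qed
  then obtain c where c: "\<forall>i\<in>N. c i \<in> carrier ?F \<and> ?\<pi> (c i) = u i" by (rule bchoice[THEN exE])
  have "\<forall>j\<in>J. \<exists>b. b \<in> carrier ?G \<and> lin R M (\<lambda>i. \<theta> (u i)) b = \<theta> (t j)"
  proof
    fix j assume "j \<in> J"
    from gen[OF this] have "\<theta> (t j) \<in> lin R M (\<lambda>i. \<theta> (u i)) ` carrier ?G"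
      using M.lspan_image_eq[of N "\<lambda>i. \<theta> (u i)", OF \<theta>u] by simp
    then show "\<exists>b. b \<in> carrier ?G \<and> lin R M (\<lambda>i. \<theta> (u i)) b = \<theta> (t j)" by (elim imageE) auto
  qed
  then obtain b where b: "\<forall>j\<in>J. b j \<in> carrier ?G \<and> lin R M (\<lambda>i. \<theta> (u i)) (b j) = \<theta> (t j)"
    by (rule bchoice[THEN exE])
  let ?c = "lin R ?F c" and ?b = "lin R ?G b"
  have ch: "?c \<in> lmod_hom R ?G ?F" by (rule F.lin_hom) (use c in blast)
  have bh: "?b \<in> lmod_hom R ?F ?G" by (rule G.lin_hom) (use b in blast)
  have \<pi>c: "?\<pi> (?c l) = lin R W u l" if l: "l \<in> carrier ?G" for l
  proof (rule lmod_hom_free_eqI[OF W.R_ring W lmod_hom_comp[OF ch \<pi>] W.lin_hom[OF uc] _ l], assumption)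
    fix i assume i: "i \<in> N"
    have "?c (monomial R i \<one>\<^bsub>R\<^esub>) = c i" by (rule F.lin_monomial[OF _ i]) (use c in blast)
    moreover have "lin R W u (monomial R i \<one>\<^bsub>R\<^esub>) = u i" by (rule W.lin_monomial[OF uc i])
    ultimately show "?\<pi> (?c (monomial R i \<one>\<^bsub>R\<^esub>)) = lin R W u (monomial R i \<one>\<^bsub>R\<^esub>)" using c i by simp
  qed
  have \<theta>b: "lin R M (\<lambda>i. \<theta> (u i)) (?b a) = \<theta> (?\<pi> a)" if a: "a \<in> carrier ?F" for a
  proof (rule lmod_hom_free_eqI[OF W.R_ring M lmod_hom_comp[OF bh M.lin_hom[OF \<theta>u]] lmod_hom_comp[OF \<pi> \<theta>] _ a], assumption)
    fix j assume j: "j \<in> J"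
    have "?b (monomial R j \<one>\<^bsub>R\<^esub>) = b j" by (rule G.lin_monomial[OF _ j]) (use b in blast)
    moreover have "?\<pi> (monomial R j \<one>\<^bsub>R\<^esub>) = t j" by (rule W.lin_monomial[OF t j])
    ultimately show "lin R M (\<lambda>i. \<theta> (u i)) (?b (monomial R j \<one>\<^bsub>R\<^esub>)) = \<theta> (?\<pi> (monomial R j \<one>\<^bsub>R\<^esub>))"
      using b j by simp
  qed
  have \<theta>\<pi>: "lin R M (\<lambda>j. \<theta> (t j)) a = \<theta> (?\<pi> a)" if a: "a \<in> carrier ?F" for a
    by (rule lin_comp[OF W M \<theta> t a, symmetric])
  have mem: "a \<in> rel R M J (\<lambda>j. \<theta> (t j)) \<longleftrightarrow> a \<in> carrier ?F \<and> \<theta> (?\<pi> a) = \<zero>\<^bsub>M\<^esub>" for a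
    using \<theta>\<pi> by (auto simp: rel_def)
  have bc: "?b a \<in> carrier ?G" if "a \<in> carrier ?F" for a by (rule lmod_hom_closed[OF bh that])
  have cc: "?c l \<in> carrier ?F" if "l \<in> carrier ?G" for l by (rule lmod_hom_closed[OF ch that])
  \<comment> \<open>Subtracting the lift of the combination of the \<open>u\<^sub>i\<close> with the same image turns every vector of
    coefficients into a relation.\<close>
  let ?A = "\<lambda>a. a \<ominus>\<^bsub>?F\<^esub> ?c (?b a)"
  have A: "?A \<in> lmod_hom R ?F ?F"
    by (rule lmod_hom_diff[OF _ lmod_hom_comp[OF bh ch] F.left_module_axioms]) (auto simp: lmod_hom_def)
  have \<theta>0: "addmap ?F M (\<lambda>a. \<theta> (?\<pi> a))"
    by (rule addmap_comp[OF lmod_hom_addmap[OF \<pi>] lmod_hom_addmap[OF \<theta>]])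
  have \<theta>uu: "\<theta> (lin R W u l) = lin R M (\<lambda>i. \<theta> (u i)) l" if "l \<in> carrier ?G" for l
    by (rule lin_comp[OF W M \<theta> uc that])
  have Arel: "?A a \<in> rel R M J (\<lambda>j. \<theta> (t j))" if a: "a \<in> carrier ?F" for a
  proof -
    have "\<theta> (?\<pi> (?A a)) = \<theta> (?\<pi> a) \<ominus>\<^bsub>M\<^esub> \<theta> (?\<pi> (?c (?b a)))"
      by (rule addmap_minus[OF \<theta>0 F.M_group M.M_group a cc[OF bc[OF a]]])
    also have "\<dots> = \<theta> (?\<pi> a) \<ominus>\<^bsub>M\<^esub> \<theta> (?\<pi> a)"
      unfolding \<pi>c[OF bc[OF a]] \<theta>uu[OF bc[OF a]] \<theta>b[OF a] ..
    also have "\<dots> = \<zero>\<^bsub>M\<^esub>"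
      unfolding a_minus_def by (rule M.M.r_neg[OF addmap_closed[OF \<theta>0 a]])
    finally show ?thesis unfolding mem using lmod_hom_closed[OF A a] by blast
  qed
  obtain E where E: "finite E" "E \<subseteq> rel R W J t" "rel R W J t \<subseteq> lspan R ?F E"
    using relt unfolding fgen_def by blast
  let ?S = "(\<lambda>j. ?A (monomial R j \<one>\<^bsub>R\<^esub>)) ` J \<union> e ` S \<union> E"
  have Srel: "?S \<subseteq> rel R M J (\<lambda>j. \<theta> (t j))"
  proof (rule Un_least[OF Un_least])
    show "(\<lambda>j. ?A (monomial R j \<one>\<^bsub>R\<^esub>)) ` J \<subseteq> rel R M J (\<lambda>j. \<theta> (t j))"
    proof (rule image_subsetI)
      fix j assume "j \<in> J"
      then show "?A (monomial R j \<one>\<^bsub>R\<^esub>) \<in> rel R M J (\<lambda>j. \<theta> (t j))"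
        by (rule Arel[OF monomial_closed[OF W.R_ring _ W.R.one_closed]])
    qed
    show "e ` S \<subseteq> rel R M J (\<lambda>j. \<theta> (t j))"
    proof (rule image_subsetI)
      fix x assume x: "x \<in> S"
      then have "e x \<in> carrier ?F" "?\<pi> (e x) = x" using e by blast+
      then show "e x \<in> rel R M J (\<lambda>j. \<theta> (t j))" unfolding mem using S(3)[OF x] by simp
    qed
    show "E \<subseteq> rel R M J (\<lambda>j. \<theta> (t j))"
    proof (rule subsetI)
      fix x assume "x \<in> E"
      then have "x \<in> carrier ?F" "?\<pi> x = \<zero>\<^bsub>W\<^esub>" using E(2) by (auto simp: rel_def)
      then show "x \<in> rel R M J (\<lambda>j. \<theta> (t j))"
        unfolding mem using addmap_zero[OF lmod_hom_addmap[OF \<theta>] W.M_group M.M_group] by simp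
    qed
  qed
  have Sc: "?S \<subseteq> carrier ?F"
    by (rule subset_trans[OF Srel]) (simp add: rel_def)
  have eS: "e ` S \<subseteq> carrier ?F" using e by blast
  have \<pi>eS: "?\<pi> ` e ` S = S" unfolding image_image using e by simp
  have "rel R M J (\<lambda>j. \<theta> (t j)) \<subseteq> lspan R ?F ?S"
  proof (rule subsetI)
    fix a assume "a \<in> rel R M J (\<lambda>j. \<theta> (t j))"
    then have a: "a \<in> carrier ?F" "\<theta> (?\<pi> a) = \<zero>\<^bsub>M\<^esub>" unfolding mem by (rule conjunct1, rule conjunct2)
    note l = bc[OF a(1)]
    have "?b a \<in> rel R M N (\<lambda>i. \<theta> (u i))"
      unfolding rel_def by (rule CollectI, rule conjI, rule l, rule trans, rule \<theta>b[OF a(1)], rule a(2))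
    then have "lin R W u (?b a) \<in> lspan R W S" by (rule relu)
    also have "lspan R W S = ?\<pi> ` lspan R ?F (e ` S)"
      using lmod_hom_lspan[OF \<pi> F.left_module_axioms W eS] unfolding \<pi>eS by simp
    finally obtain v where v: "v \<in> lspan R ?F (e ` S)" "lin R W u (?b a) = ?\<pi> v" by (elim imageE)
    have vc: "v \<in> carrier ?F" using v(1) F.lspan_closed[OF eS] by blast
    have "?\<pi> (?c (?b a) \<ominus>\<^bsub>?F\<^esub> v) = ?\<pi> (?c (?b a)) \<ominus>\<^bsub>W\<^esub> ?\<pi> v"
      by (rule addmap_minus[OF lmod_hom_addmap[OF \<pi>] F.M_group W.M_group cc[OF l] vc])
    also have "\<dots> = \<zero>\<^bsub>W\<^esub>"
      unfolding \<pi>c[OF l] v(2) a_minus_def by (rule W.M.r_neg[OF lmod_hom_closed[OF \<pi> vc]])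
    finally have "?c (?b a) \<ominus>\<^bsub>?F\<^esub> v \<in> rel R W J t"
      unfolding rel_def by (intro CollectI conjI F.M.minus_closed[OF cc[OF l] vc])
    then have "?c (?b a) \<ominus>\<^bsub>?F\<^esub> v \<in> lspan R ?F E" by (rule subsetD[OF E(3)])
    then have 1: "?c (?b a) \<ominus>\<^bsub>?F\<^esub> v \<in> lspan R ?F ?S"
      by (rule subsetD[OF lspan_mono, rotated]) (rule Un_upper2)
    have 2: "v \<in> lspan R ?F ?S"
      by (rule subsetD[OF lspan_mono v(1)]) (rule le_supI1, rule Un_upper2)
    have 3: "?A a \<in> lspan R ?F ?S"
      by (rule subsetD[OF lspan_mono lin_in_lspan_id[OF W.R_ring A F.left_module_axioms a(1)]])
        (rule le_supI1, rule Un_upper1)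
    have "?A a \<oplus>\<^bsub>?F\<^esub> ((?c (?b a) \<ominus>\<^bsub>?F\<^esub> v) \<oplus>\<^bsub>?F\<^esub> v) = a"
      unfolding a_minus_def
      by (simp only: F.M.a_assoc F.M.a_inv_closed F.M.l_neg F.M.r_zero F.M.a_closed a(1) cc[OF l] vc)
    then show "a \<in> lspan R ?F ?S"
      using F.lspan_add[OF Sc 3 F.lspan_add[OF Sc 1 2]] by (simp only:)
  qed
  moreover have "finite ?S" by (intro finite_UnI finite_imageI J S(1) E(1))
  ultimately show ?thesis unfolding fgen_def using Srel by (intro exI[of _ ?S] conjI)
qed

context group_algebra
begin

lemma addmap_free_KG_mem:
  assumes A: "abelian_group A" and f: "addmap (free_module KG B) A f"
    and Z: "\<zero>\<^bsub>A\<^esub> \<in> Z" "\<And>x y. x \<in> Z \<Longrightarrow> y \<in> Z \<Longrightarrow> x \<oplus>\<^bsub>A\<^esub> y \<in> Z"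
    and mono: "\<And>b y k. b \<in> B \<Longrightarrow> y \<in> carrier G \<Longrightarrow> k \<in> carrier K \<Longrightarrow> f (monomial KG b (mon y k)) \<in> Z"
    and v: "v \<in> carrier (free_module KG B)"
  shows "f v \<in> Z"
  using KG_ring v
proof (induction rule: free_module_induct)
  case zero
  then show ?case using addmap_zero[OF f abelian_group_free[OF KG_ring] A] Z(1) by simp
next
  case (step b a v)
  have fb: "addmap KG A (\<lambda>a. f (monomial KG b a))"
    by (rule addmap_comp[OF addmap_monomial[OF KG_ring step(1)] f])
  have "a \<in> carrier (free_module K (carrier G))" using step(2) by (simp add: KG_carrier)
  with K_ring have "f (monomial KG b a) \<in> Z"
  proof (induction rule: free_module_induct)
    case zero
    then show ?case using addmap_zero[OF fb R.abelian_group_axioms A] Z(1) by (simp add: KG_zero)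
  next
    case (step g k a)
    then have "f (monomial KG b (mon g k \<oplus>\<^bsub>KG\<^esub> a)) = f (monomial KG b (mon g k)) \<oplus>\<^bsub>A\<^esub> f (monomial KG b a)"
      by (intro addmap_add[OF fb]) (simp_all add: mon_closed KG_carrier[symmetric])
    then show ?case using Z(2)[OF mono[OF \<open>b \<in> B\<close> step(1,2)] step(4)] by (simp add: KG_add)
  qed
  then show ?case
    using Z(2)[OF _ step(4)] addmap_add[OF f monomial_closed[OF KG_ring step(1,2)] step(3)] by simp
qed

end

context pair_algebra
begin

lemma tens_monomial_pt:
  assumes y: "y \<in> X" and k: "k \<in> carrier K" and m: "m \<in> carrier KG"
  shows "tens (monomial K y k) m = tens (pt y) (scal k \<otimes>\<^bsub>KG\<^esub> m)"
  using mon_tens[OF G.one_closed k K.one_closed pt_closed[OF y] m]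
    mon_tens[OF G.one_closed K.one_closed k pt_closed[OF y] m] y k m
  by (simp add: move_pt KG_one[symmetric] del: free_module_simps)

text \<open>The multiples of \<open>x \<otimes> m\<close> differ from tensors with first factor \<open>x\<close> by elements of \<open>\<omega> \<otimes> KG\<close>, as \<open>g x - x\<close>
  has augmentation \<open>0\<close>.\<close>
lemma mon_act_pt:
  assumes x: "x \<in> X" and g: "g \<in> carrier G" and k: "k \<in> carrier K" and m: "m \<in> carrier KG"
  shows "mon g k \<odot>\<^bsub>W\<^esub> tens (pt x) m =
     tens (monomial K (\<phi> g x) k \<ominus>\<^bsub>KX\<^esub> monomial K x k) (gel g \<otimes>\<^bsub>KG\<^esub> m) \<oplus>\<^bsub>W\<^esub>
     tens (pt x) (mon g k \<otimes>\<^bsub>KG\<^esub> m)"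
proof -
  interpret Wm: left_module KG W by (rule W_module)
  note g1 = mon_closed[OF g K.one_closed]
  have n: "gel g \<otimes>\<^bsub>KG\<^esub> m \<in> carrier KG" using g1 m by simp
  have c1: "monomial K (\<phi> g x) k \<in> carrier KX" by (rule monomial_closed[OF K_ring act_closed[OF g x] k])
  have c2: "monomial K x k \<in> carrier KX" by (rule monomial_closed[OF K_ring x k])
  have "scal k \<otimes>\<^bsub>KG\<^esub> (gel g \<otimes>\<^bsub>KG\<^esub> m) = mon g k \<otimes>\<^bsub>KG\<^esub> m"
    using R.m_assoc[OF mon_closed[OF G.one_closed k] g1 m] mon_mult[OF G.one_closed g k K.one_closed] g k by simp
  then have e2: "tens (monomial K x k) (gel g \<otimes>\<^bsub>KG\<^esub> m) = tens (pt x) (mon g k \<otimes>\<^bsub>KG\<^esub> m)"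
    using tens_monomial_pt[OF x k n] by simp
  have "mon g k \<odot>\<^bsub>W\<^esub> tens (pt x) m = tens (monomial K (\<phi> g x) k) (gel g \<otimes>\<^bsub>KG\<^esub> m)"
    using mon_tens[OF g k K.one_closed pt_closed[OF x] m] k by (simp add: move_pt[OF g x k] del: free_module_simps)
  moreover have "tens (monomial K (\<phi> g x) k \<ominus>\<^bsub>KX\<^esub> monomial K x k) (gel g \<otimes>\<^bsub>KG\<^esub> m) =
      tens (monomial K (\<phi> g x) k) (gel g \<otimes>\<^bsub>KG\<^esub> m) \<ominus>\<^bsub>W\<^esub> tens (monomial K x k) (gel g \<otimes>\<^bsub>KG\<^esub> m)"
    by (rule addmap_minus[OF addmap_tens_left[OF n] KX_group W_group c1 c2])
  ultimately show ?thesis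
    unfolding e2[symmetric] a_minus_def
    using tens_closed[OF c1 n] tens_closed[OF c2 n]
    by (simp only: Wm.M.a_assoc Wm.M.a_inv_closed Wm.M.l_neg Wm.M.r_zero)
qed

lemma tens_in_span_of_points:
  assumes I: "lsub KG (left_regular KG) I" and \<rho>: "\<And>y. y \<in> X \<Longrightarrow> \<rho> y \<in> X \<and> (\<exists>h\<in>carrier G. \<phi> h (\<rho> y) = y)"
    and w: "w \<in> carrier KX" and m: "m \<in> I"
  shows "tens w m \<in> lspan KG W {tens (pt (\<rho> y)) r | y r. y \<in> X \<and> r \<in> I}"
proof -
  interpret Wm: left_module KG W by (rule W_module)
  note ID = lsubD[OF I, simplified]
  have Ic: "\<And>m. m \<in> I \<Longrightarrow> m \<in> carrier KG" using ID(1) by blast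
  let ?T = "{tens (pt (\<rho> y)) r | y r. y \<in> X \<and> r \<in> I}"
  have T: "?T \<subseteq> carrier W" using tens_closed[OF pt_closed Ic] \<rho> by auto
  have point: "tens (pt y) r \<in> lspan KG W ?T" if y: "y \<in> X" and r: "r \<in> I" for y r
  proof -
    obtain h where h: "h \<in> carrier G" "\<phi> h (\<rho> y) = y" using \<rho>[OF y] by blast
    have ry: "\<rho> y \<in> X" using \<rho>[OF y] by blast
    have ih: "inv h \<in> carrier G" using h by simp
    note h1 = mon_closed[OF h(1) K.one_closed] and ih1 = mon_closed[OF ih K.one_closed]
    have n: "ginv h \<otimes>\<^bsub>KG\<^esub> r \<in> I" by (rule ID(4)[OF ih1 r])
    have "gel h \<otimes>\<^bsub>KG\<^esub> (ginv h \<otimes>\<^bsub>KG\<^esub> r) = r"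
      using R.m_assoc[OF h1 ih1 Ic[OF r]] mon_mult[OF h(1) ih K.one_closed K.one_closed] h Ic[OF r]
      by (simp add: KG_one[symmetric])
    then have "tens (pt y) r = gel h \<odot>\<^bsub>W\<^esub> tens (pt (\<rho> y)) (ginv h \<otimes>\<^bsub>KG\<^esub> r)"
      using mon_tens[OF h(1) K.one_closed K.one_closed pt_closed[OF ry] Ic[OF n]] h(2)
      by (simp add: move_pt[OF h(1) ry K.one_closed] del: free_module_simps)
    moreover have "tens (pt (\<rho> y)) (ginv h \<otimes>\<^bsub>KG\<^esub> r) \<in> ?T" using y n by blast
    ultimately show ?thesis using Wm.lspan_smult[OF T h1 subsetD[OF Wm.lspan_base[OF T]]] by (simp only:)
  qed
  have tm: "addmap KX W (\<lambda>w. tens w m)" by (rule addmap_tens_left[OF Ic[OF m]])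
  from K_ring w show ?thesis
  proof (induction rule: free_module_induct)
    case zero
    have "tens \<zero>\<^bsub>KX\<^esub> m = \<zero>\<^bsub>W\<^esub>" by (rule addmap_zero[OF tm KX_group W_group])
    then have "tens \<zero>\<^bsub>KX\<^esub> m \<in> lspan KG W ?T" using lspan.zero[of W KG ?T] by (simp only:)
    then show ?case by simp
  next
    case (step y k v)
    have n: "scal k \<otimes>\<^bsub>KG\<^esub> m \<in> I" by (rule ID(4)[OF mon_closed[OF G.one_closed step(2)] m])
    show ?case
      unfolding addmap_add[OF tm monomial_closed[OF K_ring step(1,2)] step(3)]
        tens_monomial_pt[OF step(1,2) Ic[OF m]]
      by (rule Wm.lspan_add[OF T point[OF step(1) n] step(4)])
  qed
qed

lemma orbit_representatives:
  "\<exists>\<rho>. (\<forall>y\<in>X. \<rho> y \<in> X \<and> (\<exists>h\<in>carrier G. \<phi> h (\<rho> y) = y)) \<and>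
     (\<forall>y\<in>X. \<forall>z\<in>X. \<forall>g\<in>carrier G. \<phi> g (\<rho> y) = \<rho> z \<longrightarrow> \<rho> y = \<rho> z)"
proof -
  let ?O = "\<lambda>y z. z \<in> X \<and> (\<exists>h\<in>carrier G. \<phi> h z = y)"
  let ?\<rho> = "\<lambda>y. SOME z. ?O y z"
  have \<rho>: "?O y (?\<rho> y)" if "y \<in> X" for y
    by (rule someI[where x = y]) (use that in \<open>auto intro!: bexI[of _ "\<one>"]\<close>)
  have shift: "?O (\<phi> g y) = ?O y" if y: "y \<in> X" and g: "g \<in> carrier G" for g y
  proof
    fix z
    show "?O (\<phi> g y) z = ?O y z"
    proof
      assume z: "?O (\<phi> g y) z"
      then obtain h where h: "h \<in> carrier G" "\<phi> h z = \<phi> g y" by blast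
      then have "\<phi> (inv g \<otimes> h) z = y" using z y g by (simp add: act_mult)
      moreover have "inv g \<otimes> h \<in> carrier G" using g h by simp
      ultimately show "?O y z" using z by blast
    next
      assume z: "?O y z"
      then obtain h where h: "h \<in> carrier G" "\<phi> h z = y" by blast
      then have "\<phi> (g \<otimes> h) z = \<phi> g y" using z g by (simp add: act_mult)
      moreover have "g \<otimes> h \<in> carrier G" using g h by simp
      ultimately show "?O (\<phi> g y) z" using z by blast
    qed
  qed
  have idem: "?\<rho> (?\<rho> y) = ?\<rho> y" if y: "y \<in> X" for y
  proof -
    obtain h where h: "h \<in> carrier G" "\<phi> h (?\<rho> y) = y" using \<rho>[OF y] by blast
    have "?O (\<phi> h (?\<rho> y)) = ?O (?\<rho> y)" by (rule shift) (use \<rho>[OF y] h in blast)+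
    then show ?thesis unfolding h(2) by (simp only:)
  qed
  have "?\<rho> y = ?\<rho> z" if y: "y \<in> X" and z: "z \<in> X" and g: "g \<in> carrier G" "\<phi> g (?\<rho> y) = ?\<rho> z" for y z g
  proof -
    have "?O (\<phi> g (?\<rho> y)) = ?O (?\<rho> y)" by (rule shift) (use \<rho>[OF y] g in blast)+
    then have "?\<rho> (?\<rho> z) = ?\<rho> (?\<rho> y)" unfolding g(2) by (simp only:)
    then show ?thesis unfolding idem[OF y] idem[OF z] by (rule sym)
  qed
  then show ?thesis using \<rho> by (intro exI[of _ ?\<rho>]) blast
qed

end

section \<open>Relations have finite support\<close>

context diagonal_pair
begin

lemma addmap_iota_free: "addmap (free_module KG B) (free_module D B) (\<lambda>v i. \<iota> (v i))"
proof (rule addmapI)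
  fix v assume v: "v \<in> carrier (free_module KG B)"
  note vc = free_module_component[OF KG_ring v]
  show "(\<lambda>i. \<iota> (v i)) \<in> carrier (free_module D B)"
  proof (rule free_moduleI)
    show "\<iota> (v i) \<in> carrier D" for i by (rule iota_closed[OF vc])
    show "\<iota> (v i) = \<zero>\<^bsub>D\<^esub>" if "i \<notin> B" for i
      unfolding free_module_outside[OF v that] by (rule iota_zero)
    show "finite {i. \<iota> (v i) \<noteq> \<zero>\<^bsub>D\<^esub>}"
      by (rule finite_subset[OF _ free_module_finite[OF v]]) (use iota_zero in auto)
  qed
  fix w assume w: "w \<in> carrier (free_module KG B)"
  show "(\<lambda>i. \<iota> ((v \<oplus>\<^bsub>free_module KG B\<^esub> w) i)) = (\<lambda>i. \<iota> (v i)) \<oplus>\<^bsub>free_module D B\<^esub> (\<lambda>i. \<iota> (w i))"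
    using iota_add[OF vc free_module_component[OF KG_ring w]] by simp
qed

lemma iota_lin:
  assumes u: "\<And>i. i \<in> N \<Longrightarrow> u i \<in> carrier W" and l: "l \<in> carrier (free_module KG N)"
  shows "lin D DX (\<lambda>i x. \<iota> (u i x)) (\<lambda>i. \<iota> (l i)) = (\<lambda>x. \<iota> (lin KG W u l x))"
proof (rule addmap_free_eqI[OF KG_ring DX_group _ _ _ l])
  interpret Wm: left_module KG W by (rule W_module)
  interpret DXm: left_module D DX by (rule left_module_free[OF D.ring_axioms])
  have uD: "(\<lambda>x. \<iota> (u i x)) \<in> carrier DX" if "i \<in> N" for i
    by (rule addmap_closed[OF addmap_iota_free u[OF that]])
  show "addmap (free_module KG N) DX (\<lambda>l. lin D DX (\<lambda>i x. \<iota> (u i x)) (\<lambda>i. \<iota> (l i)))"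
    by (rule addmap_comp[OF addmap_iota_free DXm.lin_addmap[OF uD]])
  show "addmap (free_module KG N) DX (\<lambda>l x. \<iota> (lin KG W u l x))"
    by (rule addmap_comp[OF Wm.lin_addmap[OF u] addmap_iota_free])
  fix i a assume i: "i \<in> N" and a: "a \<in> carrier KG"
  have "(\<lambda>j. \<iota> (monomial KG i a j)) = monomial D i (\<iota> a)" by (auto simp: monomial_def iota_zero)
  then have "lin D DX (\<lambda>i x. \<iota> (u i x)) (\<lambda>j. \<iota> (monomial KG i a j)) = \<iota> a \<odot>\<^bsub>DX\<^esub> (\<lambda>x. \<iota> (u i x))"
    using DXm.lin_monomial_coeff[of N "\<lambda>i x. \<iota> (u i x)" i "\<iota> a", OF uD i iota_closed[OF a]] by simp
  also have "\<dots> = (\<lambda>x. \<iota> ((a \<odot>\<^bsub>W\<^esub> u i) x))"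
    using iota_mult[OF a free_module_component[OF KG_ring u[OF i]]] by simp
  also have "a \<odot>\<^bsub>W\<^esub> u i = lin KG W u (monomial KG i a)" by (rule Wm.lin_monomial_coeff[OF u i a, symmetric])
  finally show "lin D DX (\<lambda>i x. \<iota> (u i x)) (\<lambda>j. \<iota> (monomial KG i a j)) = (\<lambda>x. \<iota> (lin KG W u (monomial KG i a) x))" .
qed

text \<open>The elements \<open>x\<^sub>0 \<otimes> m\<^sub>i\<close> lift the generators \<open>m\<^sub>i\<close>, and a relation between the \<open>m\<^sub>i\<close> sends them to an
  element of \<open>\<omega> \<otimes> I\<close>, which is determined by its coordinates with respect to the dual basis.  By
  flatness, each coordinate extends to the \<open>D\<close>-span of the relations, so it vanishes on all relations
  if it vanishes on finitely many that generate this span.  These have finite support.\<close>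
lemma relations_in_finite_span:
  assumes flat: "flat_right_module KG NN" and D: "left_artinian_ring D" and inj: "inj_on \<iota> (carrier KG)"
    and x0: "x0 \<in> X" and I: "lsub KG (left_regular KG) I"
    and fr: "dual_frame I C s q"
    and N: "finite N" and mm: "\<And>i. i \<in> N \<Longrightarrow> mm i \<in> I"
  shows "\<exists>\<Phi>. finite \<Phi> \<and> \<Phi> \<subseteq> C \<and> (\<forall>l\<in>rel KG (left_regular KG) N mm.
     lin KG W (\<lambda>i. tens (pt x0) (mm i)) l \<in> lspan KG W (q ` \<Phi>))"
proof -
  interpret D: left_artinian_ring D by (rule D)
  note s_closed = dual_frameD(1)[OF fr] and s_left = dual_frameD(2)[OF fr] and s_right = dual_frameD(3)[OF fr]
    and s_scal = dual_frameD(4)[OF fr] and s_equiv = dual_frameD(5)[OF fr] and qs = dual_frameD(7)[OF fr]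
  interpret L: left_module KG "left_regular KG" by (rule LKG_module)
  interpret Wm: left_module KG W by (rule W_module)
  let ?C = "free_module KG C" and ?N = "free_module KG N" and ?DN = "free_module D N"
  interpret C: left_module KG ?C by (rule left_module_free[OF KG_ring])
  interpret Nm: left_module KG ?N by (rule left_module_free[OF KG_ring])
  interpret DXm: left_module D DX by (rule left_module_free[OF D.ring_axioms])
  interpret DNm: left_module D ?DN by (rule left_module_free[OF D.ring_axioms])
  note ID = lsubD[OF I, simplified]
  have Ic: "\<And>m. m \<in> I \<Longrightarrow> m \<in> carrier KG" using ID(1) by blast
  have q: "q c \<in> carrier W" if c: "c \<in> C" for c
  proof -
    obtain w m where wm: "w \<in> omega" "m \<in> I" "q c = tens w m" using dual_frameD(6)[OF fr c] by blast
    show ?thesis unfolding wm(3) by (rule tens_closed[OF omega_KX[OF wm(1)] Ic[OF wm(2)]])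
  qed
  let ?L = "rel KG (left_regular KG) N mm"
  let ?u = "\<lambda>i. tens (pt x0) (mm i)"
  let ?\<beta> = "lin KG W ?u"
  have mc: "mm i \<in> carrier KG" if "i \<in> N" for i by (rule Ic[OF mm[OF that]])
  have u: "?u i \<in> carrier W" if "i \<in> N" for i by (rule tens_closed[OF pt_closed[OF x0] mc[OF that]])
  have \<beta>: "addmap ?N W ?\<beta>" by (rule Wm.lin_addmap[OF u])
  have qa: "addmap ?C W (lin KG W q)" by (rule Wm.lin_addmap[OF q])
  have Lc: "l \<in> carrier ?N" if "l \<in> ?L" for l using that by (simp add: rel_def)
  \<comment> \<open>By flatness, each coordinate of \<open>s\<close> is a well-defined function of the tensors with
    coefficients in \<open>D\<close>.\<close>
  have "\<forall>c\<in>UNIV. \<exists>\<Gamma>. flat_graph I (\<lambda>w m. s w m c) \<Gamma>"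
  proof
    fix c
    show "\<exists>\<Gamma>. flat_graph I (\<lambda>w m. s w m c) \<Gamma>"
    proof (rule flat_pairs[OF flat x0 I, of "\<lambda>w m. s w m c"])
      show "s w m c \<in> carrier KG" if "w \<in> omega" "m \<in> I" for w m
        by (rule free_module_component[OF KG_ring s_closed[OF that]])
      show "s (v \<oplus>\<^bsub>KX\<^esub> w) m c = s v m c \<oplus>\<^bsub>KG\<^esub> s w m c" if "v \<in> omega" "w \<in> omega" "m \<in> I" for v w m
        using fun_cong[OF s_left[OF that], of c] by simp
      show "s w (m \<oplus>\<^bsub>KG\<^esub> n) c = s w m c \<oplus>\<^bsub>KG\<^esub> s w n c" if "w \<in> omega" "m \<in> I" "n \<in> I" for w m n
        using fun_cong[OF s_right[OF that], of c] by simp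
      show "s (move \<one> k w) m c = scal k \<otimes>\<^bsub>KG\<^esub> s w m c"
        if "k \<in> carrier K" "w \<in> omega" "m \<in> I" for k w m
        using fun_cong[OF s_scal[OF that], of c] by simp
      show "s w (mon g k \<otimes>\<^bsub>KG\<^esub> m) c = mon g k \<otimes>\<^bsub>KG\<^esub> s (move (inv g) \<one>\<^bsub>K\<^esub> w) m c"
        if "g \<in> carrier G" "k \<in> carrier K" "w \<in> omega" "m \<in> I" for g k w m
        using fun_cong[OF s_equiv[OF that], of c] by simp
    qed
  qed
  then obtain \<Gamma> where "\<forall>c\<in>UNIV. flat_graph I (\<lambda>w m. s w m c) (\<Gamma> c)"
    by (rule bchoice[THEN exE])
  then have gr: "flat_graph I (\<lambda>w m. s w m c) (\<Gamma> c)" for c by (rule bspec) (rule UNIV_I)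
  note \<Gamma> = flat_graphD(1)[OF gr] and \<Gamma>_add = flat_graphD(2)[OF gr] and \<Gamma>_zero = flat_graphD(3)[OF gr]
  \<comment> \<open>The graph of the linear extension of \<open>w \<otimes> m \<mapsto> s w m\<close> to \<open>\<omega> \<otimes> I\<close>.\<close>
  define Z where "Z = {v \<in> carrier W. \<exists>r\<in>carrier ?C. lin KG W q r = v \<and>
     (\<forall>c. \<forall>d\<in>carrier D. (\<lambda>x. d \<otimes>\<^bsub>D\<^esub> \<iota> (v x), d \<otimes>\<^bsub>D\<^esub> \<iota> (r c)) \<in> \<Gamma> c)}"
  have Z_tens: "tens w m \<in> Z" if w: "w \<in> omega" and m: "m \<in> I" for w m
    unfolding Z_def
    by (intro CollectI conjI tens_closed[OF omega_KX[OF w] Ic[OF m]] bexI[of _ "s w m"] s_closed[OF w m] qs[OF w m]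
        allI ballI \<Gamma>[OF _ w m])
  have Z_add: "v \<oplus>\<^bsub>W\<^esub> v' \<in> Z" if v: "v \<in> Z" and v': "v' \<in> Z" for v v'
  proof -
    obtain r where r: "r \<in> carrier ?C" "lin KG W q r = v"
      "\<forall>c. \<forall>d\<in>carrier D. (\<lambda>x. d \<otimes>\<^bsub>D\<^esub> \<iota> (v x), d \<otimes>\<^bsub>D\<^esub> \<iota> (r c)) \<in> \<Gamma> c"
      using v unfolding Z_def by blast
    obtain r' where r': "r' \<in> carrier ?C" "lin KG W q r' = v'"
      "\<forall>c. \<forall>d\<in>carrier D. (\<lambda>x. d \<otimes>\<^bsub>D\<^esub> \<iota> (v' x), d \<otimes>\<^bsub>D\<^esub> \<iota> (r' c)) \<in> \<Gamma> c"
      using v' unfolding Z_def by blast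
    have vc: "v \<in> carrier W" "v' \<in> carrier W" using v v' by (auto simp: Z_def)
    have i: "d \<otimes>\<^bsub>D\<^esub> \<iota> (a \<oplus>\<^bsub>KG\<^esub> b) = d \<otimes>\<^bsub>D\<^esub> \<iota> a \<oplus>\<^bsub>D\<^esub> d \<otimes>\<^bsub>D\<^esub> \<iota> b"
      if "d \<in> carrier D" "a \<in> carrier KG" "b \<in> carrier KG" for d a b
      using that by (simp add: iota_add D.r_distr)
    have "lin KG W q (r \<oplus>\<^bsub>?C\<^esub> r') = v \<oplus>\<^bsub>W\<^esub> v'"
      using addmap_add[OF qa r(1) r'(1)] unfolding r(2) r'(2) .
    moreover have "(\<lambda>x. d \<otimes>\<^bsub>D\<^esub> \<iota> ((v \<oplus>\<^bsub>W\<^esub> v') x), d \<otimes>\<^bsub>D\<^esub> \<iota> ((r \<oplus>\<^bsub>?C\<^esub> r') c)) \<in> \<Gamma> c"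
      if d: "d \<in> carrier D" for c d
      using \<Gamma>_add[OF bspec[OF spec[OF r(3)] d] bspec[OF spec[OF r'(3)] d], of c]
        i[OF d free_module_component[OF KG_ring vc(1)] free_module_component[OF KG_ring vc(2)]]
        i[OF d free_module_component[OF KG_ring r(1)] free_module_component[OF KG_ring r'(1)]]
      by simp
    ultimately show ?thesis
      unfolding Z_def
      by (intro CollectI conjI Wm.M.a_closed[OF vc] bexI[of _ "r \<oplus>\<^bsub>?C\<^esub> r'"] C.M.a_closed[OF r(1) r'(1)] allI ballI)
  qed
  have Z_zero: "\<zero>\<^bsub>W\<^esub> \<in> Z"
    using Z_tens[OF omega_zero ID(2)] addmap_zero[OF addmap_tens_right[OF omega_KX[OF omega_zero]] R.abelian_group_axioms W_group]
    by (simp only:)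
  \<comment> \<open>The combination \<open>\<Sum> l\<^sub>i (x\<^sub>0 \<otimes> m\<^sub>i)\<close> differs from \<open>x\<^sub>0 \<otimes> \<Sum> l\<^sub>i m\<^sub>i\<close> by an element of \<open>\<omega> \<otimes> I\<close>.\<close>
  let ?\<delta> = "\<lambda>l. ?\<beta> l \<ominus>\<^bsub>W\<^esub> tens (pt x0) (lin KG (left_regular KG) mm l)"
  have lm: "addmap ?N KG (lin KG (left_regular KG) mm)"
    using L.lin_addmap[of N mm] mc by (simp add: addmap_def)
  have \<delta>: "addmap ?N W ?\<delta>"
    by (rule addmap_diff[OF \<beta> addmap_comp[OF lm addmap_tens_right[OF pt_closed[OF x0]]] W_group])
  have \<delta>Z: "?\<delta> l \<in> Z" if l: "l \<in> carrier ?N" for l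
  proof (rule addmap_free_KG_mem[OF W_group \<delta> Z_zero Z_add _ l], assumption+)
    fix i g k assume i: "i \<in> N" and g: "g \<in> carrier G" and k: "k \<in> carrier K"
    note gk = mon_closed[OF g k]
    let ?w = "monomial K (\<phi> g x0) k \<ominus>\<^bsub>KX\<^esub> monomial K x0 k"
    have c1: "monomial K (\<phi> g x0) k \<in> carrier KX" by (rule monomial_closed[OF K_ring act_closed[OF g x0] k])
    have c2: "monomial K x0 k \<in> carrier KX" by (rule monomial_closed[OF K_ring x0 k])
    have wc: "?w \<in> carrier KX" using abelian_group.minus_closed[OF KX_group c1 c2] .
    have "aug ?w = k \<ominus>\<^bsub>K\<^esub> k"
      unfolding addmap_minus[OF addmap_aug KX_group K.abelian_group_axioms c1 c2]
        aug_monomial[OF x0 k] aug_monomial[OF act_closed[OF g x0] k] ..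
    then have w: "?w \<in> omega" using wc k by (simp add: omega_def a_minus_def K.r_neg)
    have n: "gel g \<otimes>\<^bsub>KG\<^esub> mm i \<in> I" by (rule ID(4)[OF mon_closed[OF g K.one_closed] mm[OF i]])
    have "?\<beta> (monomial KG i (mon g k)) = mon g k \<odot>\<^bsub>W\<^esub> ?u i" by (rule Wm.lin_monomial_coeff[OF u i gk])
    moreover have "lin KG (left_regular KG) mm (monomial KG i (mon g k)) = mon g k \<otimes>\<^bsub>KG\<^esub> mm i"
      using L.lin_monomial_coeff[of N mm i "mon g k"] mc i gk by simp
    ultimately have "?\<delta> (monomial KG i (mon g k)) = tens ?w (gel g \<otimes>\<^bsub>KG\<^esub> mm i)"
      unfolding mon_act_pt[OF x0 g k mc[OF i]]
      using tens_closed[OF wc Ic[OF n]] tens_closed[OF pt_closed[OF x0] R.m_closed[OF gk mc[OF i]]]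
      by (simp only: a_minus_def Wm.M.a_assoc Wm.M.a_inv_closed Wm.M.r_neg Wm.M.r_zero)
    then show "?\<delta> (monomial KG i (mon g k)) \<in> Z" using Z_tens[OF w n] by (simp only:)
  qed
  have \<beta>Z: "?\<beta> l \<in> Z" if l: "l \<in> ?L" for l
  proof -
    have "lin KG (left_regular KG) mm l = \<zero>\<^bsub>KG\<^esub>" using l by (simp add: rel_def)
    then have "?\<delta> l = ?\<beta> l \<ominus>\<^bsub>W\<^esub> \<zero>\<^bsub>W\<^esub>"
      using addmap_zero[OF addmap_tens_right[OF pt_closed[OF x0]] R.abelian_group_axioms W_group] by (simp only:)
    also have "\<dots> = ?\<beta> l"
      unfolding a_minus_def Wm.M.minus_equality[OF Wm.M.l_zero[OF Wm.M.zero_closed] Wm.M.zero_closed Wm.M.zero_closed]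
      by (rule Wm.M.r_zero[OF addmap_closed[OF \<beta> Lc[OF l]]])
    finally show ?thesis using \<delta>Z[OF Lc[OF l]] by (simp only:)
  qed
  have "\<forall>l\<in>?L. \<exists>r. r \<in> carrier ?C \<and> lin KG W q r = ?\<beta> l \<and>
     (\<forall>c. \<forall>d\<in>carrier D. (\<lambda>x. d \<otimes>\<^bsub>D\<^esub> \<iota> (?\<beta> l x), d \<otimes>\<^bsub>D\<^esub> \<iota> (r c)) \<in> \<Gamma> c)"
  proof
    fix l assume "l \<in> ?L"
    from \<beta>Z[OF this] show "\<exists>r. r \<in> carrier ?C \<and> lin KG W q r = ?\<beta> l \<and>
     (\<forall>c. \<forall>d\<in>carrier D. (\<lambda>x. d \<otimes>\<^bsub>D\<^esub> \<iota> (?\<beta> l x), d \<otimes>\<^bsub>D\<^esub> \<iota> (r c)) \<in> \<Gamma> c)"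
      unfolding Z_def by (elim CollectE conjE bexE) (intro exI conjI)
  qed
  then obtain r where "\<forall>l\<in>?L. r l \<in> carrier ?C \<and> lin KG W q (r l) = ?\<beta> l \<and>
     (\<forall>c. \<forall>d\<in>carrier D. (\<lambda>x. d \<otimes>\<^bsub>D\<^esub> \<iota> (?\<beta> l x), d \<otimes>\<^bsub>D\<^esub> \<iota> (r l c)) \<in> \<Gamma> c)"
    by (rule bchoice[THEN exE])
  then have r: "\<And>l. l \<in> ?L \<Longrightarrow> r l \<in> carrier ?C" "\<And>l. l \<in> ?L \<Longrightarrow> lin KG W q (r l) = ?\<beta> l"
    and r\<Gamma>: "\<And>l c d. l \<in> ?L \<Longrightarrow> d \<in> carrier D \<Longrightarrow> (\<lambda>x. d \<otimes>\<^bsub>D\<^esub> \<iota> (?\<beta> l x), d \<otimes>\<^bsub>D\<^esub> \<iota> (r l c)) \<in> \<Gamma> c"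
    by blast+
  \<comment> \<open>Over the Artinian ring \<open>D\<close>, finitely many relations generate all of them.\<close>
  let ?\<iota> = "\<lambda>l i. \<iota> (l i)"
  have \<iota>L: "?\<iota> ` ?L \<subseteq> carrier ?DN"
    by (rule image_subsetI) (rule addmap_closed[OF addmap_iota_free Lc])
  obtain S where S: "finite S" "S \<subseteq> lspan D ?DN (?\<iota> ` ?L)" "lspan D ?DN (?\<iota> ` ?L) \<subseteq> lspan D ?DN S"
    using D.free_submodule_fg[OF N DNm.lsub_lspan[OF \<iota>L]] by (elim exE conjE)
  obtain T where T: "finite T" "T \<subseteq> ?\<iota> ` ?L" "S \<subseteq> lspan D ?DN T"
    using DNm.lspan_finite_choice[OF \<iota>L S(1,2)] by (elim exE conjE)
  obtain L0 where L0: "L0 \<subseteq> ?L" "finite L0" "T = ?\<iota> ` L0"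
    using finite_subset_image[OF T(1,2)] by blast
  have Tc: "T \<subseteq> carrier ?DN" using T(2) \<iota>L by (rule subset_trans)
  have gen: "?\<iota> l \<in> lspan D ?DN (?\<iota> ` L0)" if "l \<in> ?L" for l
  proof -
    have "?\<iota> l \<in> lspan D ?DN S" by (rule subsetD[OF S(3) subsetD[OF DNm.lspan_base[OF \<iota>L] imageI[OF that]]])
    then show ?thesis unfolding L0(3)[symmetric] by (rule subsetD[OF DNm.lspan_subset_lspan[OF Tc T(3)]])
  qed
  let ?\<beta>D = "lin D DX (\<lambda>i x. \<iota> (?u i x))"
  have \<beta>D: "?\<beta>D \<in> lmod_hom D ?DN DX"
    by (rule DXm.lin_hom) (rule addmap_closed[OF addmap_iota_free u])
  have \<beta>D\<iota>: "?\<beta>D (?\<iota> l) = (\<lambda>x. \<iota> (?\<beta> l x))" if "l \<in> ?L" for l by (rule iota_lin[OF u Lc[OF that]])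
  have rc: "r l c \<in> carrier KG" if "l \<in> ?L" for l c by (rule free_module_component[OF KG_ring r(1)[OF that]])
  have \<beta>x: "?\<beta> l x \<in> carrier KG" if "l \<in> ?L" for l x
    by (rule free_module_component[OF KG_ring addmap_closed[OF \<beta> Lc[OF that]]])
  have vanish: "r l c = \<zero>\<^bsub>KG\<^esub>" if l: "l \<in> ?L" and c: "\<forall>l\<in>L0. r l c = \<zero>\<^bsub>KG\<^esub>" for l c
  proof -
    have "(?\<beta>D v, \<zero>\<^bsub>D\<^esub>) \<in> \<Gamma> c" if "v \<in> lspan D ?DN (?\<iota> ` L0)" for v
      using that
    proof (induction rule: lspan.induct)
      case zero
      have "(\<lambda>x. \<zero>\<^bsub>D\<^esub> \<otimes>\<^bsub>D\<^esub> \<iota> (?\<beta> l x), \<zero>\<^bsub>D\<^esub> \<otimes>\<^bsub>D\<^esub> \<iota> (r l c)) \<in> \<Gamma> c" by (rule r\<Gamma>[OF l D.zero_closed])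
      moreover have "?\<beta>D \<zero>\<^bsub>?DN\<^esub> = \<zero>\<^bsub>DX\<^esub>" by (rule addmap_zero[OF lmod_hom_addmap[OF \<beta>D] DNm.M_group DX_group])
      ultimately show ?case using \<beta>x[OF l] rc[OF l] by simp
    next
      case (step d t v)
      then obtain l0 where l0: "l0 \<in> L0" "t = ?\<iota> l0" by blast
      have l0L: "l0 \<in> ?L" using l0(1) L0(1) by blast
      have tc: "t \<in> carrier ?DN" unfolding l0(2) by (rule addmap_closed[OF addmap_iota_free Lc[OF l0L]])
      have vc: "v \<in> carrier ?DN" using step(3) DNm.lspan_closed[OF Tc] L0(3) by blast
      have "?\<beta>D (d \<odot>\<^bsub>?DN\<^esub> t \<oplus>\<^bsub>?DN\<^esub> v) = ?\<beta>D (d \<odot>\<^bsub>?DN\<^esub> t) \<oplus>\<^bsub>DX\<^esub> ?\<beta>D v"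
        by (rule lmod_hom_add[OF \<beta>D DNm.smult_closed[OF step(1) tc] vc])
      also have "?\<beta>D (d \<odot>\<^bsub>?DN\<^esub> t) = d \<odot>\<^bsub>DX\<^esub> ?\<beta>D t" by (rule lmod_hom_smult[OF \<beta>D step(1) tc])
      also have "?\<beta>D t = (\<lambda>x. \<iota> (?\<beta> l0 x))" unfolding l0(2) by (rule \<beta>D\<iota>[OF l0L])
      also have "d \<odot>\<^bsub>DX\<^esub> (\<lambda>x. \<iota> (?\<beta> l0 x)) = (\<lambda>x. d \<otimes>\<^bsub>D\<^esub> \<iota> (?\<beta> l0 x))" by simp
      finally have e: "?\<beta>D (d \<odot>\<^bsub>?DN\<^esub> t \<oplus>\<^bsub>?DN\<^esub> v) = (\<lambda>x. d \<otimes>\<^bsub>D\<^esub> \<iota> (?\<beta> l0 x)) \<oplus>\<^bsub>DX\<^esub> ?\<beta>D v" .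
      have "d \<otimes>\<^bsub>D\<^esub> \<iota> (r l0 c) = \<zero>\<^bsub>D\<^esub>" using c l0(1) step(1) by (simp add: iota_zero)
      then have "(\<lambda>x. d \<otimes>\<^bsub>D\<^esub> \<iota> (?\<beta> l0 x), \<zero>\<^bsub>D\<^esub>) \<in> \<Gamma> c" using r\<Gamma>[OF l0L step(1), of c] by (simp only:)
      from \<Gamma>_add[OF this step(4)] show ?case unfolding e by simp
    qed
    from this[OF gen[OF l]] have p: "(\<lambda>x. \<iota> (?\<beta> l x), \<zero>\<^bsub>D\<^esub>) \<in> \<Gamma> c" unfolding \<beta>D\<iota>[OF l] .
    have m1: "\<ominus>\<^bsub>D\<^esub> \<one>\<^bsub>D\<^esub> \<in> carrier D" by simp
    have neg: "(\<ominus>\<^bsub>D\<^esub> \<one>\<^bsub>D\<^esub>) \<otimes>\<^bsub>D\<^esub> a = \<ominus>\<^bsub>D\<^esub> a" if "a \<in> carrier D" for a using that by (simp add: D.l_minus)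
    have "((\<lambda>x. \<iota> (?\<beta> l x)) \<oplus>\<^bsub>DX\<^esub> (\<lambda>x. (\<ominus>\<^bsub>D\<^esub> \<one>\<^bsub>D\<^esub>) \<otimes>\<^bsub>D\<^esub> \<iota> (?\<beta> l x)),
       \<zero>\<^bsub>D\<^esub> \<oplus>\<^bsub>D\<^esub> (\<ominus>\<^bsub>D\<^esub> \<one>\<^bsub>D\<^esub>) \<otimes>\<^bsub>D\<^esub> \<iota> (r l c)) \<in> \<Gamma> c"
      by (rule \<Gamma>_add[OF p r\<Gamma>[OF l m1]])
    moreover have "\<iota> (?\<beta> l x) \<oplus>\<^bsub>D\<^esub> (\<ominus>\<^bsub>D\<^esub> \<one>\<^bsub>D\<^esub>) \<otimes>\<^bsub>D\<^esub> \<iota> (?\<beta> l x) = \<zero>\<^bsub>D\<^esub>" for x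
      unfolding neg[OF iota_closed[OF \<beta>x[OF l]]] by (rule D.r_neg[OF iota_closed[OF \<beta>x[OF l]]])
    ultimately have "(\<zero>\<^bsub>DX\<^esub>, \<zero>\<^bsub>D\<^esub> \<oplus>\<^bsub>D\<^esub> (\<ominus>\<^bsub>D\<^esub> \<one>\<^bsub>D\<^esub>) \<otimes>\<^bsub>D\<^esub> \<iota> (r l c)) \<in> \<Gamma> c"
      unfolding free_module_simps by (simp only:)
    then have "\<zero>\<^bsub>D\<^esub> \<oplus>\<^bsub>D\<^esub> (\<ominus>\<^bsub>D\<^esub> \<one>\<^bsub>D\<^esub>) \<otimes>\<^bsub>D\<^esub> \<iota> (r l c) = \<zero>\<^bsub>D\<^esub>"
      by (rule \<Gamma>_zero)
    then have "\<ominus>\<^bsub>D\<^esub> \<iota> (r l c) = \<zero>\<^bsub>D\<^esub>" using iota_closed[OF rc[OF l]] by (simp add: neg)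
    then have "\<iota> (r l c) = \<iota> \<zero>\<^bsub>KG\<^esub>"
      unfolding iota_zero using iota_closed[OF rc[OF l, of c]] by (metis D.minus_minus D.minus_zero)
    then show ?thesis by (rule inj_onD[OF inj _ rc[OF l] R.zero_closed])
  qed
  let ?\<Phi> = "\<Union>l\<in>L0. {c. r l c \<noteq> \<zero>\<^bsub>KG\<^esub>}"
  have fin: "finite ?\<Phi>"
    by (rule finite_UN_I[OF L0(2)]) (rule free_module_finite[OF r(1)], rule subsetD[OF L0(1)])
  have sub: "?\<Phi> \<subseteq> C"
  proof (rule UN_least, rule subsetI)
    fix l c assume l: "l \<in> L0" and c: "c \<in> {c. r l c \<noteq> \<zero>\<^bsub>KG\<^esub>}"
    have lL: "l \<in> ?L" using l L0(1) by blast
    show "c \<in> C" by (rule ccontr) (use c free_module_outside[OF r(1)[OF lL], of c] in simp)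
  qed
  have q\<Phi>: "q ` ?\<Phi> \<subseteq> carrier W" by (rule image_subsetI) (rule q[OF subsetD[OF sub]])
  have "?\<beta> l \<in> lspan KG W (q ` ?\<Phi>)" if l: "l \<in> ?L" for l
    unfolding r(2)[OF l, symmetric]
  proof (rule Wm.lin_in_lspan[OF q r(1)[OF l] q\<Phi>], assumption)
    fix c assume "r l c \<noteq> \<zero>\<^bsub>KG\<^esub>"
    then have "c \<in> ?\<Phi>" using vanish[OF l, of c] by blast
    then show "q c \<in> lspan KG W (q ` ?\<Phi>)" by (rule subsetD[OF Wm.lspan_base[OF q\<Phi>] imageI])
  qed
  then show ?thesis using fin sub by (intro exI[of _ ?\<Phi>] conjI ballI)
qed

end

section \<open>Coherence\<close>

context diagonal_pair
begin

text \<open>A finite set of tensors \<open>y \<otimes> r\<close> whose span contains the lifts \<open>x\<^sub>0 \<otimes> m\<close> of the generators and the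
  finitely many \<open>q\<^sub>c\<close> has finitely generated relations, because the stabilisers have coherent
  algebras; its image in \<open>KG\<close> generates \<open>I\<close>.\<close>
lemma left_ideal_presented:
  assumes flat: "flat_right_module KG NN" and D: "left_artinian_ring D" and inj: "inj_on \<iota> (carrier KG)"
    and ne: "X \<noteq> {}"
    and coh: "\<And>x. x \<in> X \<Longrightarrow> coherent_ring (group_ring K (G\<lparr>carrier := stabilizer G \<phi> x\<rparr>))"
    and P: "left_module KG P0" "left_module KG P1"
    and \<epsilon>: "\<epsilon> \<in> lmod_hom KG P0 Om" "\<epsilon> ` carrier P0 = carrier Om"
    and d: "d \<in> lmod_hom KG P1 P0" "inj_on d (carrier P1)"
      "d ` carrier P1 = {p \<in> carrier P0. \<epsilon> p = \<zero>\<^bsub>Om\<^esub>}"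
    and s0: "s0 \<in> lmod_hom KG P0 (free_module KG B0)" and p0: "p0 \<in> lmod_hom KG (free_module KG B0) P0"
    and ps0: "\<forall>p\<in>carrier P0. p0 (s0 p) = p"
    and s1: "s1 \<in> lmod_hom KG P1 (free_module KG B1)" and p1: "p1 \<in> lmod_hom KG (free_module KG B1) P1"
    and ps1: "\<forall>p\<in>carrier P1. p1 (s1 p) = p"
    and I: "lsub KG (left_regular KG) I" and fg: "fgen KG (left_regular KG) I"
  shows "finitely_presented KG ((left_regular KG)\<lparr>carrier := I\<rparr>)"
proof -
  interpret L: left_module KG "left_regular KG" by (rule LKG_module)
  interpret Wm: left_module KG W by (rule W_module)
  note ID = lsubD[OF I, simplified]
  have Ic: "\<And>m. m \<in> I \<Longrightarrow> m \<in> carrier KG" using ID(1) by blast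
  obtain x0 where x0: "x0 \<in> X" using ne by blast
  obtain N where N: "finite N" "N \<subseteq> I" "I \<subseteq> lspan KG (left_regular KG) N" using fg unfolding fgen_def by blast
  obtain s q where fr: "dual_frame I (B0 \<times> carrier G) s q"
    using equivariant_frame[OF I x0 P \<epsilon> d s0 p0 ps0 s1 p1 ps1] by blast
  let ?u = "\<lambda>m. tens (pt x0) m"
  have "\<exists>\<Phi>. finite \<Phi> \<and> \<Phi> \<subseteq> B0 \<times> carrier G \<and> (\<forall>l\<in>rel KG (left_regular KG) N (\<lambda>m. m).
     lin KG W ?u l \<in> lspan KG W (q ` \<Phi>))"
    by (rule relations_in_finite_span[OF flat D inj x0 I fr N(1) subsetD[OF N(2)]])
  then obtain \<Phi> where \<Phi>: "finite \<Phi>" "\<Phi> \<subseteq> B0 \<times> carrier G"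
    and relu: "\<forall>l\<in>rel KG (left_regular KG) N (\<lambda>m. m). lin KG W ?u l \<in> lspan KG W (q ` \<Phi>)"
    by (elim exE conjE)
  \<comment> \<open>The points \<open>y\<close> in the generators \<open>y \<otimes> r\<close> are orbit representatives, so that two of them in one
    orbit coincide.\<close>
  obtain \<rho> where \<rho>: "\<forall>y\<in>X. \<rho> y \<in> X \<and> (\<exists>h\<in>carrier G. \<phi> h (\<rho> y) = y)"
    and reps: "\<forall>y\<in>X. \<forall>z\<in>X. \<forall>g\<in>carrier G. \<phi> g (\<rho> y) = \<rho> z \<longrightarrow> \<rho> y = \<rho> z"
    using orbit_representatives by (elim exE conjE)
  have \<rho>X: "\<rho> y \<in> X" if "y \<in> X" for y using \<rho> that by blast
  let ?T = "{tens (pt (\<rho> y)) r | y r. y \<in> X \<and> r \<in> I}"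
  have Tc: "?T \<subseteq> carrier W" using tens_closed[OF pt_closed[OF \<rho>X] Ic] by auto
  have T: "tens w m \<in> lspan KG W ?T" if "w \<in> carrier KX" "m \<in> I" for w m
    by (rule tens_in_span_of_points[OF I _ that]) (use \<rho> in blast)
  have sub: "q ` \<Phi> \<union> ?u ` N \<subseteq> lspan KG W ?T"
  proof (rule Un_least; rule image_subsetI)
    fix c assume "c \<in> \<Phi>"
    then obtain w m where wm: "w \<in> omega" "m \<in> I" "q c = tens w m" using dual_frameD(6)[OF fr] \<Phi>(2) by blast
    show "q c \<in> lspan KG W ?T" unfolding wm(3) by (rule T[OF omega_KX[OF wm(1)] wm(2)])
  next
    fix m assume "m \<in> N"
    then show "?u m \<in> lspan KG W ?T" using N(2) by (intro T[OF pt_closed[OF x0]]) blast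
  qed
  have fin: "finite (q ` \<Phi> \<union> ?u ` N)" by (intro finite_UnI finite_imageI \<Phi>(1) N(1))
  obtain T0 where T0: "finite T0" "T0 \<subseteq> ?T" "q ` \<Phi> \<union> ?u ` N \<subseteq> lspan KG W T0"
    using Wm.lspan_finite_choice[OF Tc fin sub] by (elim exE conjE)
  obtain n :: nat and f where f: "T0 = f ` {..<n}"
    using T0(1) unfolding finite_conv_nat_seg_image lessThan_def by blast
  have "\<forall>j\<in>{..<n}. \<exists>z. fst z \<in> X \<and> snd z \<in> I \<and> f j = tens (pt (\<rho> (fst z))) (snd z)"
  proof
    fix j assume "j \<in> {..<n}"
    then have "f j \<in> ?T" using T0(2) f by blast
    then obtain y r where "y \<in> X" "r \<in> I" "f j = tens (pt (\<rho> y)) r" by blast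
    then show "\<exists>z. fst z \<in> X \<and> snd z \<in> I \<and> f j = tens (pt (\<rho> (fst z))) (snd z)"
      by (intro exI[of _ "(y, r)"]) simp
  qed
  then obtain z where z: "\<forall>j\<in>{..<n}. fst (z j) \<in> X \<and> snd (z j) \<in> I \<and> f j = tens (pt (\<rho> (fst (z j)))) (snd (z j))"
    by (rule bchoice[THEN exE])
  define y where "y j = \<rho> (fst (z j))" for j
  define r where "r j = snd (z j)" for j
  let ?t = "\<lambda>j. tens (pt (y j)) (r j)"
  have yX: "y j \<in> X" and rI: "r j \<in> I" and fj: "f j = ?t j" if "j \<in> {..<n}" for j
    using z that \<rho>X by (simp_all add: y_def r_def)
  have T0t: "?t ` {..<n} = T0" unfolding f using fj by (intro image_cong) auto
  have rc: "r j \<in> carrier KG" if "j \<in> {..<n}" for j by (rule Ic[OF rI[OF that]])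
  have tc: "?t j \<in> carrier W" if "j \<in> {..<n}" for j by (rule tens_closed[OF pt_closed[OF yX[OF that]] rc[OF that]])
  have relt: "fgen KG (free_module KG {..<n}) (rel KG W {..<n} ?t)"
  proof (rule stabiliser_relations)
    show "y i = y j" if "i \<in> {..<n}" "j \<in> {..<n}" "g \<in> carrier G" "\<phi> g (y i) = y j" for i j g
      using reps z that unfolding y_def by blast
    show "coherent_ring (group_ring K (G\<lparr>carrier := stabilizer G \<phi> (y i)\<rparr>))" if "i \<in> {..<n}" for i
      by (rule coh[OF yX[OF that]])
  qed (auto intro: yX rc)
  have total_pt: "total (tens (pt x) m) = m" if "x \<in> X" "m \<in> carrier KG" for x m
    using total_tens[OF pt_closed[OF that(1)] that(2)] aug_monomial[OF that(1) K.one_closed] that(2)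
    by (simp add: KG_one[symmetric])
  have total_u: "total (?u m) = m" if "m \<in> N" for m using total_pt[OF x0 Ic] N(2) that by blast
  have total_t: "total (?t j) = r j" if "j \<in> {..<n}" for j by (rule total_pt[OF yX[OF that] rc[OF that]])
  have totN: "(\<lambda>m. total (?u m)) ` N = N" using total_u by simp
  have lin_cong: "lin KG (left_regular KG) (\<lambda>j. total (?t j)) a = lin KG (left_regular KG) r a"
    if "a \<in> carrier (free_module KG {..<n})" for a
  proof (rule lmod_hom_free_eqI[OF KG_ring LKG_module _ _ _ that])
    show "lin KG (left_regular KG) (\<lambda>j. total (?t j)) \<in> lmod_hom KG (free_module KG {..<n}) (left_regular KG)"
      by (rule L.lin_hom) (simp add: total_t rc)
    show "lin KG (left_regular KG) r \<in> lmod_hom KG (free_module KG {..<n}) (left_regular KG)"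
      by (rule L.lin_hom) (simp add: rc)
    fix j assume j: "j \<in> {..<n}"
    show "lin KG (left_regular KG) (\<lambda>j. total (?t j)) (monomial KG j \<one>\<^bsub>KG\<^esub>) =
        lin KG (left_regular KG) r (monomial KG j \<one>\<^bsub>KG\<^esub>)"
      using L.lin_monomial[of "{..<n}" "\<lambda>j. total (?t j)" j] L.lin_monomial[of "{..<n}" r j] j
      by (simp add: total_t rc)
  qed
  have lin_congN: "lin KG (left_regular KG) (\<lambda>m. total (?u m)) a = lin KG (left_regular KG) (\<lambda>m. m) a"
    if "a \<in> carrier (free_module KG N)" for a
  proof (rule lmod_hom_free_eqI[OF KG_ring LKG_module _ _ _ that])
    have Nc: "m \<in> carrier KG" if "m \<in> N" for m using Ic N(2) that by blast
    show "lin KG (left_regular KG) (\<lambda>m. total (?u m)) \<in> lmod_hom KG (free_module KG N) (left_regular KG)"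
      by (rule L.lin_hom) (simp add: total_u Nc)
    show "lin KG (left_regular KG) (\<lambda>m. m) \<in> lmod_hom KG (free_module KG N) (left_regular KG)"
      by (rule L.lin_hom) (simp add: Nc)
    fix m assume m: "m \<in> N"
    show "lin KG (left_regular KG) (\<lambda>m. total (?u m)) (monomial KG m \<one>\<^bsub>KG\<^esub>) =
        lin KG (left_regular KG) (\<lambda>m. m) (monomial KG m \<one>\<^bsub>KG\<^esub>)"
      using L.lin_monomial[of N "\<lambda>m. total (?u m)" m] L.lin_monomial[of N "\<lambda>m. m" m] m
      by (simp add: total_u Nc)
  qed
  have "fgen KG (free_module KG {..<n}) (rel KG (left_regular KG) {..<n} (\<lambda>j. total (?t j)))"
  proof (rule descend_relations[OF W_module LKG_module total_hom _ tc relt, of N ?u "q ` \<Phi>"])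
    show "?u m \<in> lspan KG W (?t ` {..<n})" if "m \<in> N" for m using T0(3) that unfolding T0t by blast
    show "q ` \<Phi> \<subseteq> lspan KG W (?t ` {..<n})" using T0(3) unfolding T0t by blast
    show "finite (q ` \<Phi>)" using \<Phi>(1) by blast
    show "total v = \<zero>\<^bsub>left_regular KG\<^esub>" if v: "v \<in> q ` \<Phi>" for v
    proof -
      obtain c where c: "c \<in> B0 \<times> carrier G" "v = q c" using v \<Phi>(2) by blast
      obtain w m where wm: "w \<in> omega" "m \<in> I" "v = tens w m" using dual_frameD(6)[OF fr c(1)] c(2) by blast
      have "scal \<zero>\<^bsub>K\<^esub> = \<zero>\<^bsub>KG\<^esub>" by (auto simp: monomial_def KG_zero)
      then show ?thesis
        using total_tens[OF omega_KX[OF wm(1)] Ic[OF wm(2)]] wm Ic[OF wm(2)] by (simp add: omega_def)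
    qed
    show "total (?t j) \<in> lspan KG (left_regular KG) ((\<lambda>m. total (?u m)) ` N)" if "j \<in> {..<n}" for j
      unfolding totN total_t[OF that] by (rule subsetD[OF N(3) rI[OF that]])
    show "lin KG W ?u l \<in> lspan KG W (q ` \<Phi>)"
      if "l \<in> rel KG (left_regular KG) N (\<lambda>m. total (?u m))" for l
      using that lin_congN relu by (auto simp: rel_def)
  qed simp_all
  moreover have "rel KG (left_regular KG) {..<n} (\<lambda>j. total (?t j)) = rel KG (left_regular KG) {..<n} r"
    using lin_cong by (auto simp: rel_def)
  ultimately have fgr: "fgen KG (free_module KG {..<n}) (rel KG (left_regular KG) {..<n} r)" by simp
  have "N \<subseteq> lspan KG (left_regular KG) (r ` {..<n})"
  proof
    fix m assume m: "m \<in> N"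
    have "total (?u m) \<in> total ` lspan KG W T0" by (rule imageI) (use T0(3) m in blast)
    also have "total ` lspan KG W T0 = lspan KG (left_regular KG) (total ` T0)"
      by (rule lmod_hom_lspan[OF total_hom W_module LKG_module]) (use T0(2) Tc in blast)
    also have "total ` T0 = r ` {..<n}"
      unfolding T0t[symmetric] image_image using total_t by (intro image_cong) auto
    finally show "m \<in> lspan KG (left_regular KG) (r ` {..<n})" unfolding total_u[OF m] .
  qed
  moreover have "r ` {..<n} \<subseteq> carrier (left_regular KG)" using rc by auto
  ultimately have gen: "I \<subseteq> lspan KG (left_regular KG) (r ` {..<n})"
    using N(3) L.lspan_subset_lspan by blast
  show ?thesis
  proof (rule relations_fp[OF L.left_module_restrict[OF I]])
    show "r j \<in> carrier ((left_regular KG)\<lparr>carrier := I\<rparr>)" if "j \<in> {..<n}" for j using rI[OF that] by simp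
    show "carrier ((left_regular KG)\<lparr>carrier := I\<rparr>) \<subseteq> lspan KG ((left_regular KG)\<lparr>carrier := I\<rparr>) (r ` {..<n})"
      using gen by (simp add: lspan_restrict)
    show "fgen KG (free_module KG {..<n}) (rel KG ((left_regular KG)\<lparr>carrier := I\<rparr>) {..<n} r)"
      using fgr rel_restrict[OF LKG_module I, of "{..<n}" r] rI by simp
  qed
qed

end

text \<open>A finite infimum of extended natural numbers is attained.\<close>
lemma short_projective_resolution:
  assumes "cohomological_dimension K G X \<phi> \<le> 2"
  shows "\<exists>n P d \<epsilon>. n \<le> 1 \<and> projective_resolution (group_ring K G) (augmentation_module K G X \<phi>) n P d \<epsilon>"
proof -
  let ?A = "{enat n | n. \<exists>P d \<epsilon>. projective_resolution (group_ring K G) (augmentation_module K G X \<phi>) n P d \<epsilon>}"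
  have "Inf ?A + 1 \<le> 1 + 1"
    using assms unfolding cohomological_dimension_def projective_dimension_def by (simp add: one_add_one)
  then have le: "Inf ?A \<le> 1" by (cases "Inf ?A") (auto simp: one_enat_def)
  have "?A \<noteq> {}"
  proof
    assume "?A = {}"
    then have "Inf ?A = \<infinity>" unfolding Inf_enat_def by (rule if_P)
    then show False using le by (simp only: one_enat_def) simp
  qed
  then have "Inf ?A \<in> ?A" unfolding Inf_enat_def by (metis (no_types, lifting) LeastI ex_in_conv)
  then obtain n where n: "Inf ?A = enat n"
    and ex: "\<exists>P d \<epsilon>. projective_resolution (group_ring K G) (augmentation_module K G X \<phi>) n P d \<epsilon>" by blast
  have "n \<le> 1" using le unfolding n by (simp add: one_enat_def)
  then show ?thesis using ex by blast
qed

theorem theorem7p6: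
  fixes K :: "('k, 'r) ring_scheme"
    and G :: "('g, 's) monoid_scheme"
    and X :: "'x set"
    and \<phi> :: "'g \<Rightarrow> 'x \<Rightarrow> 'x"
    and D :: "('d, 't) ring_scheme"
    and \<iota> :: "('g \<Rightarrow> 'k) \<Rightarrow> 'd"
  assumes "field K"
    and "group_pair G X \<phi>"
    and "cohomological_dimension K G X \<phi> \<le> 2"
    and "left_artinian_ring D"
    and "\<iota> \<in> ring_hom (group_ring K G) D"
    and "inj_on \<iota> (carrier (group_ring K G))"
    and "flat_right_module (group_ring K G)
           (diagonal_tensor K G
              (restrict_scalars \<iota> (right_regular D))
              (opposite_module K G (augmentation_module K G X \<phi>)))"
    and "\<And>x. x \<in> X \<Longrightarrow> coherent_ring (group_ring K (G\<lparr>carrier := stabilizer G \<phi> x\<rparr>))"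
  shows "coherent_ring (group_ring K G)"
proof -
  have right: "right_module (group_ring K G)
           (diagonal_tensor K G
              (restrict_scalars \<iota> (right_regular D))
              (opposite_module K G (augmentation_module K G X \<phi>)))"
    using assms(7) by (simp add: flat_right_module_def)
  have act: "group_action G X \<phi>" and ne: "X \<noteq> {}"
    using assms(2) by (auto simp: group_pair_def group_pair_axioms_def)
  interpret A: group_action G X \<phi> by (rule act)
  interpret diagonal_pair K G X \<phi> D \<iota>
    by (intro diagonal_pair.intro pair_algebra.intro group_algebra.intro diagonal_pair_axioms.intro
        assms(1,5) act A.group_hom[THEN group_hom.axioms(1)] right right_module.axioms(1)[OF right]
        left_artinian_ring.axioms(1)[OF assms(4)])
  obtain n P d \<epsilon> where n: "n \<le> 1" and res: "projective_resolution KG Om n P d \<epsilon>"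
    using short_projective_resolution[OF assms(3)] by (elim exE conjE)
  have proj: "projective_module KG (P i)" for i using res by (simp add: projective_resolution_def)
  have Pm: "left_module KG (P i)" for i using proj[of i] by (simp add: projective_module_def)
  have \<epsilon>: "\<epsilon> \<in> lmod_hom KG (P 0) Om" "\<epsilon> ` carrier (P 0) = carrier Om"
    using res by (simp_all add: projective_resolution_def)
  have dh: "d i \<in> lmod_hom KG (P (Suc i)) (P i)" for i using res by (simp add: projective_resolution_def)
  have d0: "d 0 ` carrier (P (Suc 0)) = {p \<in> carrier (P 0). \<epsilon> p = \<zero>\<^bsub>Om\<^esub>}"
    using res by (simp add: projective_resolution_def a_kernel_def')
  have d1: "d (Suc 0) ` carrier (P (Suc (Suc 0))) = {p \<in> carrier (P (Suc 0)). d 0 p = \<zero>\<^bsub>P 0\<^esub>}"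
    using res by (simp add: projective_resolution_def a_kernel_def')
  have P2: "carrier (P (Suc (Suc 0))) = {\<zero>\<^bsub>P (Suc (Suc 0))\<^esub>}"
    using res n by (simp add: projective_resolution_def)
  \<comment> \<open>As \<open>P\<^sub>2\<close> vanishes, \<open>P\<^sub>1\<close> embeds into \<open>P\<^sub>0\<close>.\<close>
  have ker: "p = \<zero>\<^bsub>P (Suc 0)\<^esub>" if p: "p \<in> carrier (P (Suc 0))" "d 0 p = \<zero>\<^bsub>P 0\<^esub>" for p
  proof -
    have "p \<in> d (Suc 0) ` {\<zero>\<^bsub>P (Suc (Suc 0))\<^esub>}" using p d1 unfolding P2 by blast
    then show ?thesis
      using addmap_zero[OF lmod_hom_addmap[OF dh[of "Suc 0"]] left_module.M_group[OF Pm] left_module.M_group[OF Pm]]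
      by simp
  qed
  have inj: "inj_on (d 0) (carrier (P (Suc 0)))"
  proof (rule inj_onI)
    fix p p' assume p: "p \<in> carrier (P (Suc 0))" "p' \<in> carrier (P (Suc 0))" and e: "d 0 p = d 0 p'"
    interpret P1: left_module KG "P (Suc 0)" by (rule Pm)
    interpret P0: left_module KG "P 0" by (rule Pm)
    have "d 0 (p \<ominus>\<^bsub>P (Suc 0)\<^esub> p') = d 0 p \<ominus>\<^bsub>P 0\<^esub> d 0 p'"
      by (rule addmap_minus[OF lmod_hom_addmap[OF dh] P1.M_group P0.M_group p])
    also have "\<dots> = \<zero>\<^bsub>P 0\<^esub>"
      unfolding e a_minus_def by (rule P0.M.r_neg[OF lmod_hom_closed[OF dh p(2)]])
    finally have "p \<ominus>\<^bsub>P (Suc 0)\<^esub> p' = \<zero>\<^bsub>P (Suc 0)\<^esub>" by (rule ker[OF P1.M.minus_closed[OF p]])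
    then show "p = p'" by (rule minus_eq_zeroD[OF P1.M_group p])
  qed
  obtain B0 :: "('g \<Rightarrow> 'k, 'x \<Rightarrow> 'k) ambient set" and s0 p0 where B0: "s0 \<in> lmod_hom KG (P 0) (free_module KG B0)"
      "p0 \<in> lmod_hom KG (free_module KG B0) (P 0)" "\<forall>p\<in>carrier (P 0). p0 (s0 p) = p"
    using proj[of 0] unfolding projective_module_def by (elim conjE exE bexE) (rule that)
  obtain B1 :: "('g \<Rightarrow> 'k, 'x \<Rightarrow> 'k) ambient set" and s1 p1 where B1: "s1 \<in> lmod_hom KG (P (Suc 0)) (free_module KG B1)"
      "p1 \<in> lmod_hom KG (free_module KG B1) (P (Suc 0))" "\<forall>p\<in>carrier (P (Suc 0)). p1 (s1 p) = p"
    using proj[of "Suc 0"] unfolding projective_module_def by (elim conjE exE bexE) (rule that)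
  interpret L: left_module KG "left_regular KG" by (rule LKG_module)
  show ?thesis
    unfolding coherent_ring_def L.submodule_iff_lsub
  proof (intro conjI allI impI)
    show "ring KG" by (rule KG_ring)
    fix I assume I: "lsub KG (left_regular KG) I" and fg: "finitely_generated KG ((left_regular KG)\<lparr>carrier := I\<rparr>)"
    show "finitely_presented KG ((left_regular KG)\<lparr>carrier := I\<rparr>)"
      by (rule left_ideal_presented[OF assms(7,4,6) ne assms(8) Pm Pm \<epsilon> dh inj d0 B0 B1 I
          fg[unfolded L.finitely_generated_restrict'[OF I]]])
  qed
qed

end
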